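(* Let $n\ge2$, let $k$ be a commutative ring containing a primitive $n$-th root of unity $q$, and let $\Lambda_n$ be the Taft algebra, with the Hopf algebra structure, the characters $\alpha_u$ ($u\in\mathbb{Z}/n\mathbb{Z}$) and the grouplike elements $\pi_i$ ($i\in\mathbb{Z}/n\mathbb{Z}$) described in the context; in particular $\alpha_0=\varepsilon$ and $\pi_0=1$. Consider the triples $(\pi,\alpha,\beta)=(\pi_i,\alpha_u,\alpha_v)$ satisfying condition (CM). Then: $$HC_p^{\pi_{n-1},\varepsilon,\varepsilon}(\Lambda_n)\cong\begin{cases}k^{p/2+1}&\text{if } p\ge 0\text{ is even},\\0&\text{if } p\text{ is odd};\end{cases}$$ for all $u\in\{0,\dots,n-1\}$, $$HC_p^{1,\alpha_u,\alpha_{u-1}}(\Lambda_n)\cong\begin{cases}0&\text{if } p\text{ is even},\\k^{(p+1)/2}&\text{if } p\ge 1\text{ is odd};\end{cases}$$ and $HC_*^{\pi,\alpha,\beta}(\Lambda_n)=0$ for every other such triple.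
   Context: The Taft algebra: let $\Delta$ be the $n$-crown, i.e. the quiver with vertices $e_0,\dots,e_{n-1}$ and edges $a_0,\dots,a_{n-1}$, $a_i$ going from $e_i$ to $e_{i+1}$, indices modulo $n$. $k\Delta$ is its path algebra, with paths composed so that $a_i=e_{i+1}a_ie_i$; $\mathfrak m$ is the ideal of $k\Delta$ generated by the edges; $\Lambda_n=k\Delta/\mathfrak m^n$. It is a Hopf algebra with (indices modulo $n$; $\delta$ the Kronecker symbol) $$\varepsilon(e_i)=\delta_{i,0},\quad \varepsilon(a_i)=0,\quad \Delta(e_i)=\sum_{j+k=i}e_j\otimes e_k,\quad \Delta(a_i)=\sum_{j+k=i}(e_j\otimes a_k+q^k a_j\otimes e_k),$$ $$S(e_i)=e_{-i},\quad S(a_i)=-q^{i+1}a_{-i-1}.$$ The character $\alpha_u:\Lambda_n\to k$ is $1$ on $e_u$ and $0$ on every other path. The grouplike elements are $\pi_i=\sum_{l=0}^{n-1}q^{il}e_l$. Condition (CM) for characters $\alpha,\beta$ and a grouplike $\pi$ of a Hopf algebra $H$, with $S_\pi(a)=\pi S(a)$: (i) $\alpha(\pi)=1=\beta(\pi)$; (ii) $(\alpha*S_\pi*\beta)^2=\mathrm{id}_H$ ($*$ convolution product, square for composition), i.e. in Sweedler notation $\alpha(a^{(1)})\alpha(S(a^{(4)}))\pi S^2(a^{(3)})\pi^{-1}\beta(S(a^{(2)}))\beta(a^{(5)})=a$ for all $a\in H$. Under (CM), $C_n^{(\pi,\alpha,\beta)}(H)=H^{\otimes n}$ ($n\ge0$)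 is a cyclic module with, on $a_1\otimes\cdots\otimes a_n$ ($n\ge 1$): $d_0=\alpha(a_1)a_2\otimes\cdots\otimes a_n$; $d_i=a_1\otimes\cdots\otimes a_ia_{i+1}\otimes\cdots\otimes a_n$ for $1\le i\le n-1$; $d_n=a_1\otimes\cdots\otimes a_{n-1}\beta(a_n)$ (for $n=1$, $d_0=\alpha$ and $d_1=\beta$); degeneracies $s_i$ ($0\le i\le n$) inserting $1$ after $a_i$ (at the front if $i=0$); and $t_n(a_1\otimes\cdots\otimes a_n)=\alpha(a_1^{(1)}\cdots a_n^{(1)})S_\pi(a_1^{(2)}\cdots a_n^{(2)})\otimes a_1^{(3)}\otimes\cdots\otimes a_{n-1}^{(3)}\beta(a_n^{(3)})$, $t_0=\mathrm{id}_k$. $HC_*^{\pi,\alpha,\beta}(H)$ is the cyclic homology of this cyclic module: the homology of the total complex of the first-quadrant bicomplex whose columns are alternately $(C_*,b)$ and $(C_*,-b')$, $b=\sum_{i=0}^n(-1)^id_i$, $b'=\sum_{i=0}^{n-1}(-1)^id_i$, with horizontal maps alternately $1-\tau_n$ and $\sum_{i=0}^n\tau_n^i$, where $\tau_n=(-1)^nt_n$. *)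

theory Defs
  imports Main "HOL-Library.Function_Algebras"
begin

section \<open>Free modules with a basis\<close>

text \<open>
  A free k-module with finite basis \<open>B\<close> is given by its coordinate vectors, that is by the
  functions to k vanishing outside \<open>B\<close>.  Linear, bilinear maps and functionals are given
  by their values on the basis.  The tensor product of the free modules on \<open>B\<close> and \<open>C\<close> is the
  free module on \<open>B \<times> C\<close>.
\<close>

definition vecs :: "'b set \<Rightarrow> ('b \<Rightarrow> 'k::comm_ring_1) set" where
  "vecs B = {x. \<forall>b. b \<notin> B \<longrightarrow> x b = 0}"

definition bvec :: "'b \<Rightarrow> 'b \<Rightarrow> 'k::comm_ring_1" where
  "bvec b = (\<lambda>c. of_bool (c = b))"

definition functional :: "'b set \<Rightarrow> ('b \<Rightarrow> 'k::comm_ring_1) \<Rightarrow> ('b \<Rightarrow> 'k) \<Rightarrow> 'k" where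
  "functional B f x = (\<Sum>b\<in>B. x b * f b)"

definition linear_ext :: "'b set \<Rightarrow> ('b \<Rightarrow> 'c \<Rightarrow> 'k::comm_ring_1) \<Rightarrow> ('b \<Rightarrow> 'k) \<Rightarrow> ('c \<Rightarrow> 'k)" where
  "linear_ext B f x = (\<lambda>c. \<Sum>b\<in>B. x b * f b c)"

definition bilinear_ext ::
    "'b set \<Rightarrow> ('b \<Rightarrow> 'b \<Rightarrow> 'c \<Rightarrow> 'k::comm_ring_1) \<Rightarrow> ('b \<Rightarrow> 'k) \<Rightarrow> ('b \<Rightarrow> 'k) \<Rightarrow> ('c \<Rightarrow> 'k)" where
  "bilinear_ext B f x y = (\<lambda>c. \<Sum>a\<in>B. \<Sum>b\<in>B. x a * y b * f a b c)"

definition tensor_vec :: "('b \<Rightarrow> 'k::comm_ring_1) \<Rightarrow> ('c \<Rightarrow> 'k) \<Rightarrow> 'b \<times> 'c \<Rightarrow> 'k" where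
  "tensor_vec x y = (\<lambda>(b, c). x b * y c)"

text \<open>Structure constants of \<open>A \<otimes> A\<close>, where \<open>A\<close> has structure constants \<open>m\<close>:
  \<open>(a \<otimes> b) (a' \<otimes> b') = a a' \<otimes> b b'\<close>.\<close>

definition tensor_mult ::
    "('b \<Rightarrow> 'b \<Rightarrow> 'b \<Rightarrow> 'k::comm_ring_1) \<Rightarrow> 'b \<times> 'b \<Rightarrow> 'b \<times> 'b \<Rightarrow> 'b \<times> 'b \<Rightarrow> 'k" where
  "tensor_mult m = (\<lambda>(a, b) (a', b'). tensor_vec (m a a') (m b b'))"


section \<open>Hopf algebras which are finitely generated free as modules\<close>

record ('b, 'k) hopf =
  Basis :: "'b set"
  Mult :: "'b \<Rightarrow> 'b \<Rightarrow> 'b \<Rightarrow> 'k"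
  Unit :: "'b \<Rightarrow> 'k"
  Comult :: "'b \<Rightarrow> 'b \<times> 'b \<Rightarrow> 'k"
  Counit :: "'b \<Rightarrow> 'k"
  Antipode :: "'b \<Rightarrow> 'b \<Rightarrow> 'k"

definition hmult :: "('b, 'k::comm_ring_1) hopf \<Rightarrow> ('b \<Rightarrow> 'k) \<Rightarrow> ('b \<Rightarrow> 'k) \<Rightarrow> ('b \<Rightarrow> 'k)" where
  "hmult H = bilinear_ext (Basis H) (Mult H)"

definition hmult2 ::
    "('b, 'k::comm_ring_1) hopf \<Rightarrow> ('b \<times> 'b \<Rightarrow> 'k) \<Rightarrow> ('b \<times> 'b \<Rightarrow> 'k) \<Rightarrow> ('b \<times> 'b \<Rightarrow> 'k)" where
  "hmult2 H = bilinear_ext (Basis H \<times> Basis H) (tensor_mult (Mult H))"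

definition hantipode :: "('b, 'k::comm_ring_1) hopf \<Rightarrow> ('b \<Rightarrow> 'k) \<Rightarrow> ('b \<Rightarrow> 'k)" where
  "hantipode H = linear_ext (Basis H) (Antipode H)"

definition is_hopf_algebra :: "('b, 'k::comm_ring_1) hopf \<Rightarrow> bool" where
  "is_hopf_algebra H \<longleftrightarrow> (let B = Basis H in
     finite B \<and>
     (\<forall>a\<in>B. \<forall>b\<in>B. Mult H a b \<in> vecs B) \<and>
     Unit H \<in> vecs B \<and>
     (\<forall>a\<in>B. Comult H a \<in> vecs (B \<times> B)) \<and>
     (\<forall>a\<in>B. Antipode H a \<in> vecs B) \<and>
     (\<forall>a\<in>B. \<forall>b\<in>B. \<forall>c\<in>B. hmult H (Mult H a b) (bvec c) = hmult H (bvec a) (Mult H b c)) \<and>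
     (\<forall>a\<in>B. hmult H (Unit H) (bvec a) = bvec a \<and> hmult H (bvec a) (Unit H) = bvec a) \<and>
     (\<forall>a\<in>B. \<forall>x\<in>B. \<forall>y\<in>B. \<forall>z\<in>B.
        (\<Sum>u\<in>B. Comult H a (u, z) * Comult H u (x, y)) =
        (\<Sum>u\<in>B. Comult H a (x, u) * Comult H u (y, z))) \<and>
     (\<forall>a\<in>B. \<forall>x\<in>B. (\<Sum>u\<in>B. Counit H u * Comult H a (u, x)) = bvec a x \<and>
                  (\<Sum>u\<in>B. Comult H a (x, u) * Counit H u) = bvec a x) \<and>
     (\<forall>a\<in>B. \<forall>b\<in>B. linear_ext B (Comult H) (Mult H a b) = hmult2 H (Comult H a) (Comult H b)) \<and>
     linear_ext B (Comult H) (Unit H) = tensor_vec (Unit H) (Unit H) \<and>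
     (\<forall>a\<in>B. \<forall>b\<in>B. functional B (Counit H) (Mult H a b) = Counit H a * Counit H b) \<and>
     functional B (Counit H) (Unit H) = 1 \<and>
     (\<forall>a\<in>B. linear_ext (B \<times> B) (\<lambda>(x, y). hmult H (Antipode H x) (bvec y)) (Comult H a)
               = (\<lambda>c. Counit H a * Unit H c)) \<and>
     (\<forall>a\<in>B. linear_ext (B \<times> B) (\<lambda>(x, y). hmult H (bvec x) (Antipode H y)) (Comult H a)
               = (\<lambda>c. Counit H a * Unit H c)))"

text \<open>The iterated comultiplication \<open>(id \<otimes> \<Delta>) \<Delta>\<close>: the coefficient of \<open>x \<otimes> y \<otimes> z\<close>
  in \<open>a\<^sup>(\<^sup>1\<^sup>) \<otimes> a\<^sup>(\<^sup>2\<^sup>) \<otimes> a\<^sup>(\<^sup>3\<^sup>)\<close>.\<close>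

definition comult3 :: "('b, 'k::comm_ring_1) hopf \<Rightarrow> 'b \<Rightarrow> 'b \<Rightarrow> 'b \<Rightarrow> 'b \<Rightarrow> 'k" where
  "comult3 H a x y z = (\<Sum>u\<in>Basis H. Comult H a (x, u) * Comult H u (y, z))"

definition twisted_antipode ::
    "('b, 'k::comm_ring_1) hopf \<Rightarrow> ('b \<Rightarrow> 'k) \<Rightarrow> ('b \<Rightarrow> 'k) \<Rightarrow> ('b \<Rightarrow> 'k)" where
  "twisted_antipode H \<pi> a = hmult H \<pi> (hantipode H a)"

definition twisted_conv ::
    "('b, 'k::comm_ring_1) hopf \<Rightarrow> ('b \<Rightarrow> 'k) \<Rightarrow> ('b \<Rightarrow> 'k) \<Rightarrow> ('b \<Rightarrow> 'k) \<Rightarrow> ('b \<Rightarrow> 'k) \<Rightarrow> ('b \<Rightarrow> 'k)" where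
  "twisted_conv H \<pi> \<alpha> \<beta> = linear_ext (Basis H) (\<lambda>a c.
     \<Sum>x\<in>Basis H. \<Sum>y\<in>Basis H. \<Sum>z\<in>Basis H.
       comult3 H a x y z * \<alpha> x * twisted_antipode H \<pi> (bvec y) c * \<beta> z)"

definition CM :: "('b, 'k::comm_ring_1) hopf \<Rightarrow> ('b \<Rightarrow> 'k) \<Rightarrow> ('b \<Rightarrow> 'k) \<Rightarrow> ('b \<Rightarrow> 'k) \<Rightarrow> bool" where
  "CM H \<pi> \<alpha> \<beta> \<longleftrightarrow>
     functional (Basis H) \<alpha> \<pi> = 1 \<and> functional (Basis H) \<beta> \<pi> = 1 \<and>
     (\<forall>a\<in>vecs (Basis H). twisted_conv H \<pi> \<alpha> \<beta> (twisted_conv H \<pi> \<alpha> \<beta> a) = a)"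


section \<open>The cyclic module of a triple\<close>

text \<open>\<open>H\<^sup>\<otimes>\<^sup>n\<close> is the free module on the words of length \<open>n\<close> in the basis of \<open>H\<close>.\<close>

definition words :: "('b, 'k) hopf \<Rightarrow> nat \<Rightarrow> 'b list set" where
  "words H n = {w. length w = n \<and> set w \<subseteq> Basis H}"

definition pure_tensor :: "('b \<Rightarrow> 'k::comm_ring_1) list \<Rightarrow> 'b list \<Rightarrow> 'k" where
  "pure_tensor xs = (\<lambda>w. if length w = length xs then (\<Prod>i<length xs. (xs ! i) (w ! i)) else 0)"

definition face ::
    "('b, 'k::comm_ring_1) hopf \<Rightarrow> ('b \<Rightarrow> 'k) \<Rightarrow> ('b \<Rightarrow> 'k) \<Rightarrow> nat \<Rightarrow> nat \<Rightarrow> ('b list \<Rightarrow> 'k) \<Rightarrow> ('b list \<Rightarrow> 'k)"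
where
  "face H \<alpha> \<beta> n i = linear_ext (words H n) (\<lambda>w v.
     if i = 0 then \<alpha> (hd w) * pure_tensor (map bvec (tl w)) v
     else if i < n then
       pure_tensor (map bvec (take (i - 1) w) @ [Mult H (w ! (i - 1)) (w ! i)]
                    @ map bvec (drop (i + 1) w)) v
     else pure_tensor (map bvec (butlast w)) v * \<beta> (last w))"

definition word_prod :: "('b, 'k::comm_ring_1) hopf \<Rightarrow> 'b list \<Rightarrow> ('b \<Rightarrow> 'k)" where
  "word_prod H w = foldr (\<lambda>b. hmult H (bvec b)) w (Unit H)"

text \<open>In the sum below, \<open>X\<close>, \<open>Y\<close>, \<open>Z\<close> run through the basis elements occurring in
  \<open>a\<^sub>i\<^sup>(\<^sup>1\<^sup>)\<close>, \<open>a\<^sub>i\<^sup>(\<^sup>2\<^sup>)\<close>, \<open>a\<^sub>i\<^sup>(\<^sup>3\<^sup>)\<close>, where \<open>w = a\<^sub>1 \<otimes> \<dots> \<otimes> a\<^sub>n\<close>.\<close>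

definition cyc ::
    "('b, 'k::comm_ring_1) hopf \<Rightarrow> ('b \<Rightarrow> 'k) \<Rightarrow> ('b \<Rightarrow> 'k) \<Rightarrow> ('b \<Rightarrow> 'k) \<Rightarrow> nat \<Rightarrow>
     ('b list \<Rightarrow> 'k) \<Rightarrow> ('b list \<Rightarrow> 'k)" where
  "cyc H \<pi> \<alpha> \<beta> n = (if n = 0 then id else linear_ext (words H n) (\<lambda>w v.
     \<Sum>X\<in>words H n. \<Sum>Y\<in>words H n. \<Sum>Z\<in>words H n.
       (\<Prod>i<n. comult3 H (w ! i) (X ! i) (Y ! i) (Z ! i)) *
       functional (Basis H) \<alpha> (word_prod H X) *
       pure_tensor (twisted_antipode H \<pi> (word_prod H Y) # map bvec (butlast Z)) v *
       \<beta> (last Z)))"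

definition b_op ::
    "('b, 'k::comm_ring_1) hopf \<Rightarrow> ('b \<Rightarrow> 'k) \<Rightarrow> ('b \<Rightarrow> 'k) \<Rightarrow> nat \<Rightarrow> ('b list \<Rightarrow> 'k) \<Rightarrow> ('b list \<Rightarrow> 'k)" where
  "b_op H \<alpha> \<beta> n x = (\<lambda>v. \<Sum>i\<le>n. (-1) ^ i * face H \<alpha> \<beta> n i x v)"

definition b'_op ::
    "('b, 'k::comm_ring_1) hopf \<Rightarrow> ('b \<Rightarrow> 'k) \<Rightarrow> ('b \<Rightarrow> 'k) \<Rightarrow> nat \<Rightarrow> ('b list \<Rightarrow> 'k) \<Rightarrow> ('b list \<Rightarrow> 'k)" where
  "b'_op H \<alpha> \<beta> n x = (\<lambda>v. \<Sum>i<n. (-1) ^ i * face H \<alpha> \<beta> n i x v)"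

definition tau ::
    "('b, 'k::comm_ring_1) hopf \<Rightarrow> ('b \<Rightarrow> 'k) \<Rightarrow> ('b \<Rightarrow> 'k) \<Rightarrow> ('b \<Rightarrow> 'k) \<Rightarrow> nat \<Rightarrow>
     ('b list \<Rightarrow> 'k) \<Rightarrow> ('b list \<Rightarrow> 'k)" where
  "tau H \<pi> \<alpha> \<beta> n x = (\<lambda>v. (-1) ^ n * cyc H \<pi> \<alpha> \<beta> n x v)"

definition norm_op ::
    "('b, 'k::comm_ring_1) hopf \<Rightarrow> ('b \<Rightarrow> 'k) \<Rightarrow> ('b \<Rightarrow> 'k) \<Rightarrow> ('b \<Rightarrow> 'k) \<Rightarrow> nat \<Rightarrow>
     ('b list \<Rightarrow> 'k) \<Rightarrow> ('b list \<Rightarrow> 'k)" where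
  "norm_op H \<pi> \<alpha> \<beta> n x = (\<Sum>i\<le>n. (tau H \<pi> \<alpha> \<beta> n ^^ i) x)"


section \<open>Cyclic homology\<close>

text \<open>A chain \<open>x\<close> of degree \<open>m\<close> of the total complex has component \<open>x c \<in> C\<^bsub>m - c\<^esub>\<close>
  in column \<open>c \<le> m\<close>.\<close>

definition tot_chains :: "('b, 'k::comm_ring_1) hopf \<Rightarrow> nat \<Rightarrow> (nat \<Rightarrow> 'b list \<Rightarrow> 'k) set" where
  "tot_chains H m = {x. (\<forall>c\<le>m. x c \<in> vecs (words H (m - c))) \<and> (\<forall>c>m. x c = 0)}"

definition vertical ::
    "('b, 'k::comm_ring_1) hopf \<Rightarrow> ('b \<Rightarrow> 'k) \<Rightarrow> ('b \<Rightarrow> 'k) \<Rightarrow> nat \<Rightarrow> nat \<Rightarrow> ('b list \<Rightarrow> 'k) \<Rightarrow> ('b list \<Rightarrow> 'k)"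
where
  "vertical H \<alpha> \<beta> c n x = (if even c then b_op H \<alpha> \<beta> n x else - b'_op H \<alpha> \<beta> n x)"

text \<open>The map from column \<open>c + 1\<close> to column \<open>c\<close> in row \<open>n\<close>.\<close>

definition horizontal ::
    "('b, 'k::comm_ring_1) hopf \<Rightarrow> ('b \<Rightarrow> 'k) \<Rightarrow> ('b \<Rightarrow> 'k) \<Rightarrow> ('b \<Rightarrow> 'k) \<Rightarrow> nat \<Rightarrow> nat \<Rightarrow>
     ('b list \<Rightarrow> 'k) \<Rightarrow> ('b list \<Rightarrow> 'k)" where
  "horizontal H \<pi> \<alpha> \<beta> c n x = (if even c then x - tau H \<pi> \<alpha> \<beta> n x else norm_op H \<pi> \<alpha> \<beta> n x)"

definition tot_diff ::
    "('b, 'k::comm_ring_1) hopf \<Rightarrow> ('b \<Rightarrow> 'k) \<Rightarrow> ('b \<Rightarrow> 'k) \<Rightarrow> ('b \<Rightarrow> 'k) \<Rightarrow> nat \<Rightarrow>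
     (nat \<Rightarrow> 'b list \<Rightarrow> 'k) \<Rightarrow> (nat \<Rightarrow> 'b list \<Rightarrow> 'k)" where
  "tot_diff H \<pi> \<alpha> \<beta> m x = (\<lambda>c. if c < m then
     vertical H \<alpha> \<beta> c (m - c) (x c) + horizontal H \<pi> \<alpha> \<beta> c (m - Suc c) (x (Suc c)) else 0)"

record ('k, 'm) kmodule =
  Mcarrier :: "'m set"
  Madd :: "'m \<Rightarrow> 'm \<Rightarrow> 'm"
  Msmult :: "'k \<Rightarrow> 'm \<Rightarrow> 'm"

text \<open>\<open>Z / B\<close>, for submodules \<open>B \<subseteq> Z\<close> of a module with scalar multiplication \<open>s\<close>.\<close>

definition quotient_module ::
    "('k \<Rightarrow> 'm \<Rightarrow> 'm) \<Rightarrow> 'm set \<Rightarrow> 'm set \<Rightarrow> ('k, ('m::ab_group_add) set) kmodule" where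
  "quotient_module s Z B = \<lparr>
     Mcarrier = (\<lambda>x. {x + y | y. y \<in> B}) ` Z,
     Madd = (\<lambda>X Y. {x + y | x y. x \<in> X \<and> y \<in> Y}),
     Msmult = (\<lambda>r X. {s r x + y | x y. x \<in> X \<and> y \<in> B})\<rparr>"

definition free_module :: "nat \<Rightarrow> ('k::comm_ring_1, nat \<Rightarrow> 'k) kmodule" where
  "free_module r = \<lparr>
     Mcarrier = vecs {..<r},
     Madd = (\<lambda>x y i. x i + y i),
     Msmult = (\<lambda>c x i. c * x i)\<rparr>"

definition kmodule_iso :: "('k, 'm) kmodule \<Rightarrow> ('k, 'l) kmodule \<Rightarrow> bool" (infix "\<cong>\<^sub>k" 50) where
  "M \<cong>\<^sub>k N \<longleftrightarrow> (\<exists>f. bij_betw f (Mcarrier M) (Mcarrier N) \<and>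
     (\<forall>x\<in>Mcarrier M. \<forall>y\<in>Mcarrier M. f (Madd M x y) = Madd N (f x) (f y)) \<and>
     (\<forall>r. \<forall>x\<in>Mcarrier M. f (Msmult M r x) = Msmult N r (f x)))"

definition HC ::
    "('b, 'k::comm_ring_1) hopf \<Rightarrow> ('b \<Rightarrow> 'k) \<Rightarrow> ('b \<Rightarrow> 'k) \<Rightarrow> ('b \<Rightarrow> 'k) \<Rightarrow> nat \<Rightarrow>
     ('k, (nat \<Rightarrow> 'b list \<Rightarrow> 'k) set) kmodule" where
  "HC H \<pi> \<alpha> \<beta> p = quotient_module (\<lambda>r x c w. r * x c w)
     {x \<in> tot_chains H p. tot_diff H \<pi> \<alpha> \<beta> p x = 0}
     (tot_diff H \<pi> \<alpha> \<beta> (Suc p) ` tot_chains H (Suc p))"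


section \<open>The Taft algebra\<close>

text \<open>
  The pair \<open>(i, l)\<close> is the path \<open>a\<^bsub>i+l-1\<^esub> \<dots> a\<^bsub>i+1\<^esub> a\<^sub>i\<close> of length \<open>l\<close> starting at the
  vertex \<open>i\<close> (so it is the vertex itself if \<open>l = 0\<close> and \<open>a\<^sub>i\<close> if \<open>l = 1\<close>).
  The ideal \<open>\<mm>\<^sup>n\<close> is spanned by the paths of length at least \<open>n\<close>, so that the paths of length
  less than \<open>n\<close> are a basis of the quotient, and a product of paths which has length \<open>\<ge> n\<close>
  vanishes.  Indices modulo \<open>n\<close> are represented by their residues in \<open>{..<n}\<close>.
\<close>

definition taft_paths :: "nat \<Rightarrow> (nat \<times> nat) set" where
  "taft_paths n = {..<n} \<times> {..<n}"

definition taft_mult :: "nat \<Rightarrow> nat \<times> nat \<Rightarrow> nat \<times> nat \<Rightarrow> nat \<times> nat \<Rightarrow> 'k::comm_ring_1" where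
  "taft_mult n = (\<lambda>(i, l) (j, m).
     if i = (j + m) mod n \<and> l + m < n then bvec (j, l + m) else (\<lambda>_. 0))"

text \<open>The values of \<open>\<Delta>\<close> on vertices and edges; \<open>\<Delta>\<close> is multiplicative, so its value on a longer
  path is the product in \<open>\<Lambda>\<^sub>n \<otimes> \<Lambda>\<^sub>n\<close> of its values on the edges.  Likewise \<open>S\<close> is antimultiplicative.\<close>

definition taft_comult_vertex :: "nat \<Rightarrow> nat \<Rightarrow> (nat \<times> nat) \<times> (nat \<times> nat) \<Rightarrow> 'k::comm_ring_1" where
  "taft_comult_vertex n i = (\<Sum>(j, k) \<in> {(j, k). j < n \<and> k < n \<and> (j + k) mod n = i}.
     tensor_vec (bvec (j, 0)) (bvec (k, 0)))"

definition taft_comult_edge ::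
    "nat \<Rightarrow> 'k \<Rightarrow> nat \<Rightarrow> (nat \<times> nat) \<times> (nat \<times> nat) \<Rightarrow> 'k::comm_ring_1" where
  "taft_comult_edge n q i = (\<Sum>(j, k) \<in> {(j, k). j < n \<and> k < n \<and> (j + k) mod n = i}.
     tensor_vec (bvec (j, 0)) (bvec (k, 1)) +
     (\<lambda>u. q ^ k * tensor_vec (bvec (j, 1)) (bvec (k, 0)) u))"

fun taft_comult :: "nat \<Rightarrow> 'k \<Rightarrow> nat \<times> nat \<Rightarrow> (nat \<times> nat) \<times> (nat \<times> nat) \<Rightarrow> 'k::comm_ring_1" where
  "taft_comult n q (i, 0) = taft_comult_vertex n i"
| "taft_comult n q (i, Suc 0) = taft_comult_edge n q i"
| "taft_comult n q (i, Suc (Suc l)) =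
     bilinear_ext (taft_paths n \<times> taft_paths n) (tensor_mult (taft_mult n))
       (taft_comult_edge n q ((i + Suc l) mod n)) (taft_comult n q (i, Suc l))"

definition taft_antipode_edge :: "nat \<Rightarrow> 'k \<Rightarrow> nat \<Rightarrow> nat \<times> nat \<Rightarrow> 'k::comm_ring_1" where
  "taft_antipode_edge n q i = (\<lambda>u. - (q ^ (i + 1)) * bvec ((2 * n - i - 1) mod n, 1) u)"

fun taft_antipode :: "nat \<Rightarrow> 'k \<Rightarrow> nat \<times> nat \<Rightarrow> nat \<times> nat \<Rightarrow> 'k::comm_ring_1" where
  "taft_antipode n q (i, 0) = bvec ((n - i) mod n, 0)"
| "taft_antipode n q (i, Suc 0) = taft_antipode_edge n q i"
| "taft_antipode n q (i, Suc (Suc l)) =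
     bilinear_ext (taft_paths n) (taft_mult n)
       (taft_antipode n q (i, Suc l)) (taft_antipode_edge n q ((i + Suc l) mod n))"

definition taft :: "nat \<Rightarrow> 'k \<Rightarrow> (nat \<times> nat, 'k::comm_ring_1) hopf" where
  "taft n q = \<lparr>
     Basis = taft_paths n,
     Mult = taft_mult n,
     Unit = (\<Sum>i<n. bvec (i, 0)),
     Comult = taft_comult n q,
     Counit = bvec (0, 0),
     Antipode = taft_antipode n q\<rparr>"

definition taft_char :: "nat \<Rightarrow> nat \<times> nat \<Rightarrow> 'k::comm_ring_1" where
  "taft_char u = bvec (u, 0)"

definition taft_grouplike :: "nat \<Rightarrow> 'k \<Rightarrow> nat \<Rightarrow> nat \<times> nat \<Rightarrow> 'k::comm_ring_1" where
  "taft_grouplike n q i = (\<Sum>l<n. (\<lambda>u. q ^ (i * l) * bvec (l, 0) u))"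


section \<open>The Taft algebra is a Hopf algebra\<close>

text \<open>
  If k has zero divisors, an element \<open>q\<close> of multiplicative order \<open>n\<close> need not satisfy
  \<open>1 + q + \<dots> + q\<^bsup>n-1\<^esup> = 0\<close>, and then \<open>\<Delta>\<close> does not pass to the quotient by \<open>\<mm>\<^sup>n\<close>
  (for instance \<open>n = 2\<close>, \<open>q = 3\<close> in \<open>\<int>/8\<close>).  So over a general commutative ring
  \<open>is_hopf_algebra (taft n q)\<close> is a condition on \<open>q\<close>.  It holds whenever the \<open>1 - q\<^sup>m\<close>,
  \<open>0 < m < n\<close>, are not zero divisors, in particular for every primitive \<open>n\<close>-th root of unity of
  an integral domain.
\<close>


fun gbin :: "'k::comm_ring_1 \<Rightarrow> nat \<Rightarrow> nat \<Rightarrow> 'k" where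
  "gbin q m 0 = 1"
| "gbin q 0 (Suc s) = 0"
| "gbin q (Suc m) (Suc s) = gbin q m (Suc s) + q ^ (m - s) * gbin q m s"

lemma gbin_eq_0: "m < s \<Longrightarrow> gbin q m s = 0"
  by (induction q m s rule: gbin.induct) auto

lemma gbin_self [simp]: "gbin q m m = 1"
  by (induction m) (auto simp: gbin_eq_0)

definition qfact :: "'k::comm_ring_1 \<Rightarrow> nat \<Rightarrow> 'k" where
  "qfact q m = (\<Prod>i<m. \<Sum>j\<le>i. q ^ j)"

lemma qfact_Suc: "qfact q (Suc m) = (\<Sum>j\<le>m. q ^ j) * qfact q m"
  by (simp add: qfact_def mult.commute)

lemma qnum_add: "(\<Sum>j<t. q ^ j) + q ^ t * (\<Sum>j\<le>s. q ^ j) = (\<Sum>j\<le>s + t. q ^ j :: 'k::comm_ring_1)"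
proof (induction s)
  case 0
  then show ?case by (simp add: lessThan_Suc_atMost [symmetric])
next
  case (Suc s)
  then show ?case by (simp add: algebra_simps power_add)
qed

lemma gbin_qfact: "gbin q (s + t) s * (qfact q s * qfact q t) = qfact q (s + t)"
proof (induction "s + t" arbitrary: s t)
  case 0
  then show ?case by (simp add: qfact_def)
next
  case (Suc m)
  show ?case
  proof (cases s)
    case 0
    then show ?thesis by (simp add: qfact_def)
  next
    case s: (Suc s')
    have m: "m = s' + t" using Suc.hyps s by simp
    have 1: "gbin q m s' * (qfact q s' * qfact q t) = qfact q m"
      using Suc.hyps(1)[OF m] m by simp
    have 2: "gbin q m s * (qfact q s * qfact q t) = (\<Sum>j<t. q ^ j) * qfact q m"
    proof (cases t)
      case 0
      then show ?thesis using m s by (simp add: gbin_eq_0)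
    next
      case t: (Suc t')
      have "m = s + t'" using m s t by simp
      from Suc.hyps(1)[OF this] this
      have "gbin q m s * (qfact q s * qfact q t') = qfact q m" by simp
      moreover have "qfact q t = (\<Sum>j<t. q ^ j) * qfact q t'"
        by (simp add: qfact_Suc t lessThan_Suc_atMost del: sum.lessThan_Suc)
      ultimately show ?thesis by (metis mult.left_commute)
    qed
    have 3: "qfact q s = (\<Sum>j\<le>s'. q ^ j) * qfact q s'"
      by (simp add: qfact_def s algebra_simps)
    have "gbin q (s + t) s = gbin q m s + q ^ t * gbin q m s'"
      using s m by simp
    then have "gbin q (s + t) s * (qfact q s * qfact q t) =
        gbin q m s * (qfact q s * qfact q t) + q ^ t * ((\<Sum>j\<le>s'. q ^ j) * (gbin q m s' * (qfact q s' * qfact q t)))"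
      unfolding 3 by (simp add: algebra_simps)
    also have "\<dots> = ((\<Sum>j<t. q ^ j) + q ^ t * (\<Sum>j\<le>s'. q ^ j)) * qfact q m"
      unfolding 1 2 by (simp add: algebra_simps)
    also have "\<dots> = qfact q (s + t)"
      unfolding qnum_add using s m by (simp add: qfact_def algebra_simps)
    finally show ?thesis .
  qed
qed

lemma gbin_vandermonde:
  "(\<Sum>r\<le>s. q ^ ((m - r) * (s - r)) * gbin q l (s - r) * gbin q m r) = gbin q (l + m) s"
proof (induction l arbitrary: s)
  case 0
  have "(\<Sum>r\<le>s. q ^ ((m - r) * (s - r)) * gbin q 0 (s - r) * gbin q m r) =
        (\<Sum>r\<in>{s}. q ^ ((m - r) * (s - r)) * gbin q 0 (s - r) * gbin q m r)"
  proof (rule sum.mono_neutral_right)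
    show "\<forall>r\<in>{..s} - {s}. q ^ ((m - r) * (s - r)) * gbin q 0 (s - r) * gbin q m r = 0"
      by (auto simp: gbin_eq_0)
  qed auto
  then show ?case by simp
next
  case (Suc l)
  show ?case
  proof (cases s)
    case 0
    then show ?thesis by simp
  next
    case s: (Suc s')
    have "(\<Sum>r\<le>s'. q ^ ((m - r) * (s - r)) * gbin q (Suc l) (s - r) * gbin q m r) =
      (\<Sum>r\<le>s'. q ^ ((m - r) * (s - r)) * gbin q l (s - r) * gbin q m r) +
      q ^ (l + m - s') * (\<Sum>r\<le>s'. q ^ ((m - r) * (s' - r)) * gbin q l (s' - r) * gbin q m r)"
      unfolding sum_distrib_left sum.distrib [symmetric]
    proof (rule sum.cong, goal_cases)
      case (2 r)
      then have sr: "s - r = Suc (s' - r)" using s by auto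
      show ?case
      proof (cases "r \<le> m \<and> s' - r \<le> l")
        case True
        then have "(m - r) * Suc (s' - r) + (l - (s' - r)) = (l + m - s') + (m - r) * (s' - r)"
          using 2 by auto
        then have "q ^ ((m - r) * Suc (s' - r)) * q ^ (l - (s' - r)) = q ^ (l + m - s') * q ^ ((m - r) * (s' - r))"
          by (metis power_add)
        then show ?thesis unfolding sr by (simp add: algebra_simps)
      next
        case False
        then have "gbin q m r = 0 \<or> gbin q l (s' - r) = 0" by (auto simp: gbin_eq_0 not_le)
        then show ?thesis unfolding sr by (auto simp: algebra_simps)
      qed
    qed auto
    then have "(\<Sum>r\<le>s. q ^ ((m - r) * (s - r)) * gbin q (Suc l) (s - r) * gbin q m r) =
      (\<Sum>r\<le>s. q ^ ((m - r) * (s - r)) * gbin q l (s - r) * gbin q m r) +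
      q ^ (l + m - s') * (\<Sum>r\<le>s'. q ^ ((m - r) * (s' - r)) * gbin q l (s' - r) * gbin q m r)"
      by (simp add: s algebra_simps)
    also have "\<dots> = gbin q (Suc l + m) s"
      unfolding Suc.IH by (simp add: s)
    finally show ?thesis .
  qed
qed

lemma gbin_alternating:
  "(\<Sum>s\<le>m. (-1) ^ s * gbin q m s * q ^ (\<Sum>{..<s}) * x ^ s) = (\<Prod>r<m. 1 - q ^ r * x)"
proof (induction m)
  case (Suc m)
  let ?f = "\<lambda>m s. (-1) ^ s * gbin q m s * q ^ (\<Sum>{..<s}) * x ^ s"
  have "(\<Sum>s\<le>Suc m. ?f (Suc m) s) = ?f (Suc m) 0 + (\<Sum>s\<le>m. ?f (Suc m) (Suc s))"
    by (subst sum.atMost_Suc_shift) simp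
  also have "(\<Sum>s\<le>m. ?f (Suc m) (Suc s)) = (\<Sum>s\<le>m. ?f m (Suc s)) - q ^ m * x * (\<Sum>s\<le>m. ?f m s)"
    unfolding sum_distrib_left sum_subtractf [symmetric]
  proof (rule sum.cong, goal_cases)
    case (2 s)
    have "q ^ (m - s) * q ^ s = q ^ m" using 2 by (simp add: power_add [symmetric])
    then have "q ^ (m - s) * q ^ (\<Sum>{..<Suc s}) = q ^ m * q ^ (\<Sum>{..<s})"
      by (simp only: sum.lessThan_Suc power_add) (metis mult.assoc mult.commute)
    then have "(-1) ^ Suc s * (q ^ (m - s) * gbin q m s) * q ^ (\<Sum>{..<Suc s}) * x ^ Suc s
        = - (q ^ m * x * ?f m s)"
      by (simp add: algebra_simps)
    then show ?case by (simp add: algebra_simps del: sum.lessThan_Suc)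
  qed auto
  also have "?f (Suc m) 0 + ((\<Sum>s\<le>m. ?f m (Suc s)) - q ^ m * x * (\<Sum>s\<le>m. ?f m s))
      = (\<Sum>s\<le>Suc m. ?f m s) - q ^ m * x * (\<Sum>s\<le>m. ?f m s)"
    using sum.atMost_Suc_shift[of "?f m" m] by simp
  also have "(\<Sum>s\<le>Suc m. ?f m s) = (\<Sum>s\<le>m. ?f m s)"
    by (simp add: gbin_eq_0)
  finally show ?case unfolding Suc.IH by (simp add: algebra_simps)
qed auto

context
  fixes n :: nat and q :: "'k::comm_ring_1"
  assumes n: "n \<ge> 2" and q1: "q ^ n = 1"
    and nzd: "\<And>m x. 0 < m \<Longrightarrow> m < n \<Longrightarrow> (1 - q ^ m) * x = 0 \<Longrightarrow> x = 0"
begin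

lemma qfact_nzd: "m < n \<Longrightarrow> qfact q m * x = 0 \<Longrightarrow> x = 0"
proof (induction m)
  case (Suc m)
  have "1 - q ^ Suc m = (1 - q) * (\<Sum>j\<le>m. q ^ j)"
    using one_diff_power_eq[of q "Suc m"] by (simp only: lessThan_Suc_atMost)
  then have "(1 - q ^ Suc m) * (qfact q m * x) = (1 - q) * (qfact q (Suc m) * x)"
    unfolding qfact_Suc by (simp only: mult.assoc)
  then have "qfact q m * x = 0" using nzd[of "Suc m"] Suc.prems by simp
  then show ?case using Suc by simp
qed (simp add: qfact_def)

lemma qfact_cancel: "m < n \<Longrightarrow> qfact q m * x = qfact q m * y \<Longrightarrow> x = y"
  using qfact_nzd[of m "x - y"] by (simp add: algebra_simps)

lemma qfact_n: "qfact q n = 0"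
proof -
  obtain n' where n': "n = Suc n'" using n by (cases n) auto
  have "(1 - q ^ 1) * (\<Sum>j\<le>n'. q ^ j) = 1 - q ^ n"
    by (simp add: one_diff_power_eq lessThan_Suc_atMost n' del: power_Suc)
  then have "(\<Sum>j\<le>n'. q ^ j) = 0" using nzd[of 1] n q1 by simp
  then show ?thesis by (simp add: qfact_def n')
qed

lemma gbin_sym: assumes "s + t < n" shows "gbin q (s + t) s = gbin q (s + t) t"
proof -
  have "qfact q s * (qfact q t * gbin q (s + t) s) = gbin q (s + t) s * (qfact q s * qfact q t)"
    by (simp add: algebra_simps)
  also have "\<dots> = gbin q (t + s) t * (qfact q t * qfact q s)"
    unfolding gbin_qfact by (simp add: add.commute)
  also have "\<dots> = qfact q s * (qfact q t * gbin q (s + t) t)"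
    by (simp add: algebra_simps)
  finally have "qfact q t * gbin q (s + t) s = qfact q t * gbin q (s + t) t"
    by (rule qfact_cancel[rotated]) (use assms in simp)
  then show ?thesis
    by (rule qfact_cancel[rotated]) (use assms in simp)
qed

lemma gbin_trinomial:
  assumes "x + y + z < n"
  shows "gbin q (x + y + z) (x + y) * gbin q (x + y) x = gbin q (x + y + z) x * gbin q (y + z) y"
proof -
  have "qfact q x * (qfact q y * (qfact q z * (gbin q (x + y + z) (x + y) * gbin q (x + y) x))) =
      gbin q (x + y + z) (x + y) * ((gbin q (x + y) x * (qfact q x * qfact q y)) * qfact q z)"
    by (simp add: algebra_simps)
  also have "\<dots> = gbin q (x + (y + z)) x * (qfact q x * (gbin q (y + z) y * (qfact q y * qfact q z)))"
    unfolding gbin_qfact by (simp add: add.assoc)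
  also have "\<dots> = qfact q x * (qfact q y * (qfact q z * (gbin q (x + y + z) x * gbin q (y + z) y)))"
    by (simp add: algebra_simps)
  finally have "qfact q y * (qfact q z * (gbin q (x + y + z) (x + y) * gbin q (x + y) x)) =
      qfact q y * (qfact q z * (gbin q (x + y + z) x * gbin q (y + z) y))"
    by (rule qfact_cancel[rotated]) (use assms in simp)
  then have "qfact q z * (gbin q (x + y + z) (x + y) * gbin q (x + y) x) =
      qfact q z * (gbin q (x + y + z) x * gbin q (y + z) y)"
    by (rule qfact_cancel[rotated]) (use assms in simp)
  then show ?thesis
    by (rule qfact_cancel[rotated]) (use assms in simp)
qed

lemma gbin_vanish: "n \<le> m \<Longrightarrow> s < n \<Longrightarrow> m - s < n \<Longrightarrow> gbin q m s = 0"
proof (induction m arbitrary: s)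
  case (Suc m)
  obtain s' where s: "s = Suc s'" using Suc.prems by (cases s) auto
  show ?case
  proof (cases "Suc m = n")
    case True
    have "gbin q (s + (n - s)) s * (qfact q s * qfact q (n - s)) = 0"
      unfolding gbin_qfact using Suc.prems qfact_n by simp
    then have "qfact q s * (qfact q (n - s) * gbin q n s) = 0" 
      using Suc.prems by (simp add: algebra_simps)
    then show ?thesis using qfact_nzd Suc.prems True s by (metis diff_less zero_less_Suc)
  next
    case False
    then show ?thesis using Suc s by auto
  qed
qed (use n in auto)

lemma q_mod: "q ^ (k mod n) = q ^ k"
proof -
  have "q ^ k = q ^ (n * (k div n) + k mod n)" by simp
  also have "\<dots> = q ^ (k mod n)" unfolding power_add power_mult q1 by simp
  finally show ?thesis by simp
qed

lemma q_cong: "k mod n = k' mod n \<Longrightarrow> q ^ k = q ^ k'"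
  by (metis q_mod)

lemma q_mod_mult: "q ^ ((k mod n) * m) = q ^ (k * m)"
  by (rule q_cong) (simp add: mod_simps)


lemma finite_taft [simp]: "finite (taft_paths n)"
  by (simp add: taft_paths_def)

lemma taft_mult_coeff:
  assumes "s < n"
  shows "taft_mult n p p' (a, s) =
    (of_bool (p = ((a + snd p') mod n, s - snd p') \<and> fst p' = a \<and> snd p' \<le> s) :: 'k)"
proof -
  obtain i l where p: "p = (i, l)" by (cases p)
  obtain j m where p': "p' = (j, m)" by (cases p')
  have "i = (j + m) mod n \<and> l + m < n \<and> a = j \<and> s = l + m \<longleftrightarrow>
        (i = (a + m) mod n \<and> l = s - m) \<and> j = a \<and> m \<le> s"
    using assms by (cases "m \<le> s"; cases "a = j") auto
  then show ?thesis unfolding p p' taft_mult_def bvec_def by (auto simp del: mod_less)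
qed

lemma taft_mult_sum:
  assumes "a < n" "s < n"
  shows "(\<Sum>p\<in>taft_paths n. \<Sum>p'\<in>taft_paths n. F p p' * taft_mult n p p' (a, s)) =
         (\<Sum>r\<le>s. F ((a + r) mod n, s - r) (a, r) :: 'k)"
proof -
  have "(\<Sum>p\<in>taft_paths n. \<Sum>p'\<in>taft_paths n. F p p' * taft_mult n p p' (a, s)) =
        (\<Sum>p'\<in>taft_paths n. \<Sum>p\<in>taft_paths n.
           if p = ((a + snd p') mod n, s - snd p') then
             (if fst p' = a \<and> snd p' \<le> s then F p p' else 0) else 0)"
    using assms
    by (subst sum.swap, intro sum.cong refl) (simp add: taft_mult_coeff)
  also have "\<dots> = (\<Sum>p'\<in>taft_paths n. if fst p' = a \<and> snd p' \<le> s then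
                      F ((a + snd p') mod n, s - snd p') p' else 0)"
    using assms by (intro sum.cong refl) (auto simp: sum.delta taft_paths_def)
  also have "\<dots> = (\<Sum>p'\<in>{a} \<times> {..s}. F ((a + snd p') mod n, s - snd p') p')"
    using assms by (intro sum.mono_neutral_cong_right) (auto simp: taft_paths_def)
  also have "\<dots> = (\<Sum>r\<le>s. F ((a + r) mod n, s - r) (a, r))"
    by (simp add: sum.cartesian_product')
  finally show ?thesis .
qed

lemma taft_bilinear:
  "bilinear_ext (taft_paths n) (taft_mult n) x y (a, s) =
     (if a < n \<and> s < n then \<Sum>r\<le>s. x ((a + r) mod n, s - r) * y (a, r) else (0::'k))"
proof (cases "a < n \<and> s < n")
  case True
  then show ?thesis using taft_mult_sum[of a s "\<lambda>p p'. x p * y p'"] by (simp add: bilinear_ext_def)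
next
  case False
  then show ?thesis unfolding bilinear_ext_def
    by (auto intro!: sum.neutral simp: taft_mult_def taft_paths_def bvec_def)
qed

lemma taft_bilinear2:
  "bilinear_ext (taft_paths n \<times> taft_paths n) (tensor_mult (taft_mult n)) x y ((a, s), (b, t)) =
     (if a < n \<and> s < n \<and> b < n \<and> t < n then
        \<Sum>r\<le>s. \<Sum>r'\<le>t. x (((a + r) mod n, s - r), ((b + r') mod n, t - r')) * y ((a, r), (b, r'))
      else (0::'k))"
proof (cases "a < n \<and> s < n \<and> b < n \<and> t < n")
  case True
  let ?X = "taft_paths n"
  have "bilinear_ext (?X \<times> ?X) (tensor_mult (taft_mult n)) x y ((a, s), (b, t)) =
    (\<Sum>p\<in>?X. \<Sum>u\<in>?X. \<Sum>p'\<in>?X. \<Sum>u'\<in>?X. x (p, u) * y (p', u') * taft_mult n u u' (b, t) * taft_mult n p p' (a, s))"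
    by (simp add: bilinear_ext_def tensor_mult_def tensor_vec_def sum.cartesian_product' algebra_simps)
  also have "\<dots> = (\<Sum>p\<in>?X. \<Sum>p'\<in>?X.
      (\<Sum>u\<in>?X. \<Sum>u'\<in>?X. x (p, u) * y (p', u') * taft_mult n u u' (b, t)) * taft_mult n p p' (a, s))"
    unfolding sum_distrib_right by (intro sum.cong refl sum.swap)
  also have "\<dots> = (\<Sum>r\<le>s. \<Sum>r'\<le>t. x (((a + r) mod n, s - r), ((b + r') mod n, t - r')) * y ((a, r), (b, r')))"
    using True by (simp add: taft_mult_sum[of a s "\<lambda>p p'. \<Sum>r\<le>t. x (p, (b + r) mod n, t - r) * y (p', b, r)"]
        taft_mult_sum[of b t "\<lambda>u u'. x (p, u) * y (p', u')" for p p'])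
  finally show ?thesis using True by simp
next
  case False
  then show ?thesis unfolding bilinear_ext_def
    by (auto intro!: sum.neutral simp: taft_mult_def taft_paths_def bvec_def tensor_mult_def tensor_vec_def)
qed

lemma sum_fun: "(\<Sum>i\<in>A. f i) x = (\<Sum>i\<in>A. f i x :: 'k)"
  by (induction A rule: infinite_finite_induct) auto

lemma pairs_sum:
  "(\<Sum>p\<in>{(j, k). j < n \<and> k < n \<and> (j + k) mod n = i}. of_bool (a = fst p \<and> b = snd p) * f p) =
     (of_bool (a < n \<and> b < n \<and> (a + b) mod n = i) * f (a, b) :: 'k)"
proof -
  let ?P = "{(j, k). j < n \<and> k < n \<and> (j + k) mod n = i}"
  have "?P \<subseteq> {..<n} \<times> {..<n}" by auto
  then have "finite ?P" by (rule finite_subset) auto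
  have "(\<Sum>p\<in>?P. of_bool (a = fst p \<and> b = snd p) * f p) = (\<Sum>p\<in>?P. if p = (a, b) then f p else 0)"
    by (intro sum.cong refl) (auto simp: prod_eq_iff)
  also have "\<dots> = of_bool (a < n \<and> b < n \<and> (a + b) mod n = i) * f (a, b)"
    using \<open>finite ?P\<close> by (auto simp: sum.delta)
  finally show ?thesis .
qed

lemma comult_vertex:
  "taft_comult_vertex n i ((a, s), (b, t)) =
     (of_bool (a < n \<and> b < n \<and> (a + b) mod n = i) * of_bool (s = 0 \<and> t = 0) :: 'k)"
proof -
  have "taft_comult_vertex n i ((a, s), (b, t)) =
    (\<Sum>p\<in>{(j, k). j < n \<and> k < n \<and> (j + k) mod n = i}.
      of_bool (a = fst p \<and> b = snd p) * of_bool (s = 0 \<and> t = 0) :: 'k)"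
    unfolding taft_comult_vertex_def sum_fun
    by (intro sum.cong refl) (auto simp: tensor_vec_def bvec_def)
  then show ?thesis using pairs_sum[where f = "\<lambda>_. of_bool (s = 0 \<and> t = 0)"] by (rule trans)
qed

lemma comult_edge:
  "taft_comult_edge n q i ((a, s), (b, t)) =
     (of_bool (a < n \<and> b < n \<and> (a + b) mod n = i) *
       (of_bool (s = 0 \<and> t = 1) + q ^ b * of_bool (s = 1 \<and> t = 0)) :: 'k)"
proof -
  have "taft_comult_edge n q i ((a, s), (b, t)) =
    (\<Sum>p\<in>{(j, k). j < n \<and> k < n \<and> (j + k) mod n = i}.
      of_bool (a = fst p \<and> b = snd p) *
      (of_bool (s = 0 \<and> t = 1) + q ^ snd p * of_bool (s = 1 \<and> t = 0)) :: 'k)"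
    unfolding taft_comult_edge_def sum_fun
    by (intro sum.cong refl) (auto simp: tensor_vec_def bvec_def)
  then show ?thesis 
    using pairs_sum[where f = "\<lambda>p. of_bool (s = 0 \<and> t = 1) + q ^ snd p * of_bool (s = 1 \<and> t = 0)"]
    by (auto intro: trans)
qed

lemma comult_edge_mult:
  assumes "a < n" "s < n" "b < n" "t < n"
  shows "bilinear_ext (taft_paths n \<times> taft_paths n) (tensor_mult (taft_mult n))
       (taft_comult_edge n q j) y ((a, s), (b, t)) =
     (if t > 0 \<and> (a + s + b + t - 1) mod n = j then y ((a, s), (b, t - 1)) else 0) +
     (if s > 0 \<and> (a + s + b + t - 1) mod n = j then q ^ (b + t) * y ((a, s - 1), (b, t)) else (0::'k))"
proof -
  define c where "c r r' = (of_bool (((a + r) mod n + (b + r') mod n) mod n = j) :: 'k)" for r r'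
  have "bilinear_ext (taft_paths n \<times> taft_paths n) (tensor_mult (taft_mult n))
       (taft_comult_edge n q j) y ((a, s), (b, t)) =
     (\<Sum>r\<le>s. \<Sum>r'\<le>t. c r r' * (of_bool (s - r = 0 \<and> t - r' = 1) + q ^ (b + r') * of_bool (s - r = 1 \<and> t - r' = 0))
         * y ((a, r), (b, r')))"
    using assms n by (simp add: taft_bilinear2 comult_edge c_def q_mod)
  also have "\<dots> = (\<Sum>r\<le>s. \<Sum>r'\<le>t. of_bool (r = s) * (if t > 0 \<and> r' = t - 1 then c s (t - 1) * y ((a, s), (b, t - 1)) else 0))
      + (\<Sum>r\<le>s. \<Sum>r'\<le>t. of_bool (r' = t) * (if s > 0 \<and> r = s - 1 then c (s - 1) t * q ^ (b + t) * y ((a, s - 1), (b, t)) else 0))"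
    unfolding sum.distrib [symmetric]
    by (intro sum.cong refl) (auto simp: algebra_simps)
  also have "(\<Sum>r\<le>s. \<Sum>r'\<le>t. of_bool (r = s) * (if t > 0 \<and> r' = t - 1 then c s (t - 1) * y ((a, s), (b, t - 1)) else 0)) =
      (if t > 0 then c s (t - 1) * y ((a, s), (b, t - 1)) else 0)"
    unfolding sum_distrib_left [symmetric]
    by (simp add: of_bool_def if_distrib [where f = "\<lambda>x. x * _"] sum.delta cong: if_cong)
  also have "(\<Sum>r\<le>s. \<Sum>r'\<le>t. of_bool (r' = t) * (if s > 0 \<and> r = s - 1 then c (s - 1) t * q ^ (b + t) * y ((a, s - 1), (b, t)) else 0)) =
      (if s > 0 then c (s - 1) t * q ^ (b + t) * y ((a, s - 1), (b, t)) else 0)"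
    by (simp add: of_bool_def if_distrib [where f = "\<lambda>x. x * _"] sum.delta cong: if_cong)
  also have "(if t > 0 then c s (t - 1) * y ((a, s), (b, t - 1)) else 0) =
      (if t > 0 \<and> (a + s + b + t - 1) mod n = j then y ((a, s), (b, t - 1)) else 0)"
    by (cases t) (simp_all add: c_def mod_simps add.assoc)
  also have "(if s > 0 then c (s - 1) t * q ^ (b + t) * y ((a, s - 1), (b, t)) else 0) =
      (if s > 0 \<and> (a + s + b + t - 1) mod n = j then q ^ (b + t) * y ((a, s - 1), (b, t)) else 0)"
    by (cases s) (simp_all add: c_def mod_simps add.assoc)
  finally show ?thesis .
qed

lemma comult_closed:
  "i < n \<Longrightarrow> taft_comult n q (i, l) ((a, s), (b, t)) =
     (if a < n \<and> b < n \<and> s < n \<and> t < n \<and> (a + b) mod n = i \<and> s + t = l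
      then q ^ (b * s) * gbin q l s else 0)"
proof (induction l arbitrary: a s b t)
  case 0
  then show ?case using n by (auto simp: comult_vertex)
next
  case (Suc l)
  show ?case
  proof (cases l)
    case 0
    have "s + t = 1 \<longleftrightarrow> s = 0 \<and> t = 1 \<or> s = 1 \<and> t = 0" by auto
    then show ?thesis using n 0 by (auto simp: comult_edge)
  next
    case l: (Suc l')
    show ?thesis
    proof (cases "a < n \<and> b < n \<and> s < n \<and> t < n")
      case False
      then show ?thesis unfolding l by (auto simp: taft_bilinear2)
    next
      case True
      let ?j = "(i + l) mod n"
      have eq: "taft_comult n q (i, Suc l) ((a, s), (b, t)) =
         (if t > 0 \<and> (a + s + b + t - 1) mod n = ?j then taft_comult n q (i, l) ((a, s), (b, t - 1)) else 0) +
         (if s > 0 \<and> (a + s + b + t - 1) mod n = ?j then q ^ (b + t) * taft_comult n q (i, l) ((a, s - 1), (b, t)) else 0)"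
        using True unfolding l by (simp add: comult_edge_mult)
      show ?thesis
      proof (cases "(a + b) mod n = i \<and> s + t = Suc l")
        case False
        then have *: "\<not> ((a + b) mod n = i \<and> s + t = Suc l)" .
        have 1: "t > 0 \<Longrightarrow> taft_comult n q (i, l) ((a, s), (b, t - 1)) = 0"
          unfolding Suc.IH[OF Suc.prems] by (rule if_not_P) (use * in linarith)
        have 2: "s > 0 \<Longrightarrow> taft_comult n q (i, l) ((a, s - 1), (b, t)) = 0"
          unfolding Suc.IH[OF Suc.prems] by (rule if_not_P) (use * in linarith)
        have "taft_comult n q (i, Suc l) ((a, s), (b, t)) = 0"
          unfolding eq using 1 2
          by (cases "t > 0"; cases "s > 0") (simp_all only: if_cancel simp_thms if_False mult_zero_right add_0)
        then show ?thesis using * by (simp only: if_False simp_thms)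
      next
        case c: True
        then have "a + s + b + t - 1 = (a + b) + l" by auto
        then have j: "(a + s + b + t - 1) mod n = ?j"
          using c by (metis mod_add_left_eq)
        show ?thesis
        proof (cases s)
          case 0
          then show ?thesis unfolding eq Suc.IH[OF Suc.prems] j using True c by (simp del: mod_less)
        next
          case s: (Suc s')
          then have t: "t = l - s'" using c by auto
          have "q ^ (b + t) * q ^ (b * s') = q ^ (b * s) * q ^ (l - s')"
            by (simp add: s t power_add algebra_simps)
          moreover have "t = 0 \<Longrightarrow> gbin q l s = 0" using c by (auto simp: gbin_eq_0)
          ultimately show ?thesis unfolding eq Suc.IH[OF Suc.prems] j using True c s
            by (auto simp: algebra_simps)
        qed
      qed
    qed
  qed
qed


lemma mod_cancel: "(a + k) mod n = (b + k) mod n \<longleftrightarrow> a mod n = b mod (n::nat)"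
  unfolding nat_mod_eq_iff by (simp add: algebra_simps)

lemma mod_neg:
  assumes "k \<le> N" "N mod n = 0"
  shows "a = (N - k) mod n \<longleftrightarrow> a < n \<and> (a + k) mod n = 0"
proof -
  have "(a + k) mod n = 0 \<longleftrightarrow> (a + k) mod n = ((N - k) + k) mod n"
    using assms by simp
  also have "\<dots> \<longleftrightarrow> a mod n = (N - k) mod n" by (rule mod_cancel)
  finally show ?thesis using n by auto
qed

lemma antipode_edge:
  "i < n \<Longrightarrow> taft_antipode_edge n q i (a, s) =
     (if a < n \<and> s = 1 \<and> (a + i + 1) mod n = 0 then - (q ^ (i + 1)) else 0)"
  using mod_neg[of "i + 1" "2 * n" a] by (simp add: taft_antipode_edge_def bvec_def)

lemma antipode_closed:
  "i < n \<Longrightarrow> l < n \<Longrightarrow> taft_antipode n q (i, l) (a, s) =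
     (if a < n \<and> s = l \<and> (a + i + l) mod n = 0 then (-1) ^ l * q ^ (i * l + \<Sum>{..l}) else 0)"
proof (induction l arbitrary: a s)
  case 0
  then show ?case using mod_neg[of i n a] by (auto simp: bvec_def)
next
  case (Suc l)
  show ?case
  proof (cases l)
    case 0
    then show ?thesis using Suc.prems by (simp add: antipode_edge)
  next
    case l: (Suc l')
    let ?j = "(i + l) mod n"
    have jn: "?j < n" using n by simp
    have "(a + ?j + 1) mod n = ((a + 1) + ?j) mod n" by (simp add: ac_simps)
    then have ec: "(a + ?j + 1) mod n = (a + i + Suc l) mod n" unfolding mod_add_right_eq by (simp add: ac_simps)
    have "((a + 1) mod n + i + l) mod n = ((a + 1) mod n + (i + l)) mod n" by (simp add: ac_simps)
    then have e2: "((a + 1) mod n + i + l) mod n = (a + i + Suc l) mod n"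
      unfolding mod_add_left_eq by (simp add: ac_simps)
    have qj: "q ^ (?j + 1) = q ^ (i + l + 1)" by (simp add: q_mod)
    show ?thesis
    proof (cases "a < n \<and> s < n")
      case False
      then show ?thesis unfolding l using Suc.prems l by (auto simp: taft_bilinear)
    next
      case True
      have "taft_antipode n q (i, Suc l) (a, s) =
          (\<Sum>r\<le>s. taft_antipode n q (i, l) ((a + r) mod n, s - r) * taft_antipode_edge n q ?j (a, r))"
        using True by (simp add: l taft_bilinear)
      also have "\<dots> = (\<Sum>r\<le>s. if r = 1 then
          taft_antipode n q (i, l) ((a + 1) mod n, s - 1) * taft_antipode_edge n q ?j (a, 1) else 0)"
        using n by (intro sum.cong refl) (simp add: antipode_edge)
      also have "\<dots> = (if s > 0 then taft_antipode n q (i, l) ((a + 1) mod n, s - 1) * taft_antipode_edge n q ?j (a, 1) else 0)"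
        by (simp add: sum.delta Suc_le_eq)
      also have "taft_antipode_edge n q ?j (a, 1) = (if (a + i + Suc l) mod n = 0 then - (q ^ (i + l + 1)) else 0)"
        unfolding antipode_edge[OF jn] ec qj using True by simp
      also have "taft_antipode n q (i, l) ((a + 1) mod n, s - 1) =
          (if s - 1 = l \<and> (a + i + Suc l) mod n = 0 then (-1) ^ l * q ^ (i * l + \<Sum>{..l}) else 0)"
        unfolding Suc.IH[OF Suc.prems(1) Suc_lessD[OF Suc.prems(2)]] e2 using n by simp
      finally show ?thesis using True
        by (cases s) (auto simp: power_add algebra_simps)
    qed
  qed
qed

lemma unit_closed: "(\<Sum>i<n. bvec (i, 0)) (a, s) = (of_bool (a < n \<and> s = 0) :: 'k)"
proof -
  have "(\<Sum>i<n. bvec (i, 0)) (a, s) = (\<Sum>i<n. if i = a then of_bool (s = 0) else 0 :: 'k)"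
    unfolding sum_fun by (intro sum.cong refl) (auto simp: bvec_def)
  then show ?thesis by (simp add: sum.delta)
qed

lemma bilinear_bvec:
  assumes "finite B" "a \<in> B" "b \<in> B"
  shows "bilinear_ext B f (bvec a) (bvec b) = (f a b :: _ \<Rightarrow> 'k)"
proof
  fix c
  have "bilinear_ext B f (bvec a) (bvec b) c = (\<Sum>x\<in>B. \<Sum>y\<in>B. if y = b then (if x = a then f a b c else 0) else 0)"
    unfolding bilinear_ext_def by (intro sum.cong refl) (auto simp: bvec_def)
  also have "\<dots> = f a b c" using assms by (simp add: sum.delta)
  finally show "bilinear_ext B f (bvec a) (bvec b) c = f a b c" .
qed

lemma bilinear_zero:
  "bilinear_ext B f (\<lambda>_. 0) y = (\<lambda>_. 0 :: 'k)" "bilinear_ext B f y (\<lambda>_. 0) = (\<lambda>_. 0 :: 'k)"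
  by (simp_all add: bilinear_ext_def)

lemma taft_assoc:
  assumes "a \<in> taft_paths n" "b \<in> taft_paths n" "c \<in> taft_paths n"
  shows "bilinear_ext (taft_paths n) (taft_mult n) (taft_mult n a b) (bvec c) =
    (bilinear_ext (taft_paths n) (taft_mult n) (bvec a) (taft_mult n b c) :: _ \<Rightarrow> 'k)"
proof -
  obtain i l j m k r where abc: "a = (i, l)" "b = (j, m)" "c = (k, r)" by (metis prod.exhaust)
  have "(if i = (j + m) mod n \<and> l + m < n then
           if j = (k + r) mod n \<and> l + m + r < n then bvec (k, l + m + r) else (\<lambda>_. 0) else (\<lambda>_. 0)) =
        (if j = (k + r) mod n \<and> m + r < n then
           if i = (k + (m + r)) mod n \<and> l + (m + r) < n then bvec (k, l + m + r) else (\<lambda>_. 0) else (\<lambda>_. 0) :: _ \<Rightarrow> 'k)"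
  proof (cases "j = (k + r) mod n")
    case True
    then have "(j + m) mod n = (k + (m + r)) mod n" by (simp add: mod_simps ac_simps)
    then show ?thesis using True by auto
  qed simp
  moreover have "bilinear_ext (taft_paths n) (taft_mult n) (taft_mult n a b) (bvec c) =
    (if i = (j + m) mod n \<and> l + m < n then
           if j = (k + r) mod n \<and> l + m + r < n then bvec (k, l + m + r) else (\<lambda>_. 0) else (\<lambda>_. 0) :: _ \<Rightarrow> 'k)"
  proof (cases "i = (j + m) mod n \<and> l + m < n")
    case True
    then have "taft_mult n a b = (bvec (j, l + m) :: _ \<Rightarrow> 'k)" "(j, l + m) \<in> taft_paths n"
      using assms by (auto simp: abc taft_mult_def taft_paths_def)
    then show ?thesis using assms True by (simp add: bilinear_bvec) (auto simp: abc taft_mult_def ac_simps)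
  next
    case False
    then have "taft_mult n a b = (\<lambda>_. 0 :: 'k)" by (auto simp: abc taft_mult_def)
    then show ?thesis using False by (simp only: bilinear_zero if_False)
  qed
  moreover have "bilinear_ext (taft_paths n) (taft_mult n) (bvec a) (taft_mult n b c) =
    (if j = (k + r) mod n \<and> m + r < n then
           if i = (k + (m + r)) mod n \<and> l + (m + r) < n then bvec (k, l + m + r) else (\<lambda>_. 0) else (\<lambda>_. 0) :: _ \<Rightarrow> 'k)"
  proof (cases "j = (k + r) mod n \<and> m + r < n")
    case True
    then have "taft_mult n b c = (bvec (k, m + r) :: _ \<Rightarrow> 'k)" "(k, m + r) \<in> taft_paths n"
      using assms by (auto simp: abc taft_mult_def taft_paths_def ac_simps)
    then show ?thesis using assms True by (simp add: bilinear_bvec) (auto simp: abc taft_mult_def ac_simps)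
  next
    case False
    then have "taft_mult n b c = (\<lambda>_. 0 :: 'k)" by (auto simp: abc taft_mult_def)
    then show ?thesis using False by (simp only: bilinear_zero if_False)
  qed
  ultimately show ?thesis by (simp only:)
qed

lemma taft_unit:
  assumes "x \<in> vecs (taft_paths n)"
  shows "bilinear_ext (taft_paths n) (taft_mult n) (\<Sum>i<n. bvec (i, 0)) x = (x :: _ \<Rightarrow> 'k)"
    and "bilinear_ext (taft_paths n) (taft_mult n) x (\<Sum>i<n. bvec (i, 0)) = x"
proof -
  have zero: "x (a, s) = 0" if "\<not> (a < n \<and> s < n)" for a s
    using assms that by (auto simp: vecs_def taft_paths_def)
  have "(\<Sum>r\<le>s. (\<Sum>i<n. bvec (i, 0)) ((a + r) mod n, s - r) * x (a, r)) = (\<Sum>r\<le>s. if r = s then x (a, r) else 0)" for a s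
    using n by (intro sum.cong refl) (auto simp: unit_closed)
  then show "bilinear_ext (taft_paths n) (taft_mult n) (\<Sum>i<n. bvec (i, 0)) x = x"
    using zero by (auto simp: taft_bilinear sum.delta fun_eq_iff)
  have "(\<Sum>r\<le>s. x ((a + r) mod n, s - r) * (\<Sum>i<n. bvec (i, 0)) (a, r)) = (\<Sum>r\<le>s. if r = 0 then x (a, s) else 0)" if "a < n" for a s
    using n that by (intro sum.cong refl) (auto simp: unit_closed)
  then show "bilinear_ext (taft_paths n) (taft_mult n) x (\<Sum>i<n. bvec (i, 0)) = x"
    using zero by (auto simp: taft_bilinear sum.delta fun_eq_iff)
qed

lemma comult_zero: "i < n \<Longrightarrow> u \<notin> taft_paths n \<times> taft_paths n \<Longrightarrow> taft_comult n q (i, l) u = 0"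
  by (cases u; cases "fst u"; cases "snd u") (auto simp: comult_closed taft_paths_def)

lemma taft_coassoc:
  assumes "a \<in> taft_paths n" "x \<in> taft_paths n" "y \<in> taft_paths n" "z \<in> taft_paths n"
  shows "(\<Sum>u\<in>taft_paths n. taft_comult n q a (u, z) * taft_comult n q u (x, y)) =
         (\<Sum>u\<in>taft_paths n. taft_comult n q a (x, u) * taft_comult n q u (y, z))"
proof -
  obtain i l x1 x2 y1 y2 z1 z2 where ax: "a = (i, l)" "x = (x1, x2)" "y = (y1, y2)" "z = (z1, z2)"
    by (metis prod.exhaust)
  have lt: "i < n" "l < n" "x1 < n" "x2 < n" "y1 < n" "y2 < n" "z1 < n" "z2 < n"
    using assms by (auto simp: ax taft_paths_def)
  define P where "P \<longleftrightarrow> (x1 + y1 + z1) mod n = i \<and> x2 + y2 + z2 = l"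
  have 1: "(\<Sum>u\<in>taft_paths n. taft_comult n q a (u, z) * taft_comult n q u (x, y)) =
    (\<Sum>u\<in>taft_paths n. if u = ((x1 + y1) mod n, x2 + y2) then
       (if P then q ^ (z1 * (x2 + y2) + y1 * x2) * (gbin q l (x2 + y2) * gbin q (x2 + y2) x2) else 0) else 0)"
  proof (intro sum.cong refl)
    fix u assume "u \<in> taft_paths n"
    then obtain c s where u: "u = (c, s)" "c < n" "s < n" by (auto simp: taft_paths_def)
    show "taft_comult n q a (u, z) * taft_comult n q u (x, y) =
      (if u = ((x1 + y1) mod n, x2 + y2) then
       (if P then q ^ (z1 * (x2 + y2) + y1 * x2) * (gbin q l (x2 + y2) * gbin q (x2 + y2) x2) else 0) else 0)"
    proof (cases "u = ((x1 + y1) mod n, x2 + y2)")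
      case False
      then have "taft_comult n q u (x, y) = 0" using u ax by (auto simp: comult_closed)
      then show ?thesis using False by simp
    next
      case True
      then have c: "c = (x1 + y1) mod n" "s = x2 + y2" using u by auto
      have "(c + z1) mod n = i \<and> s + z2 = l \<longleftrightarrow> P"
        unfolding P_def c by (simp add: mod_simps)
      then show ?thesis using lt u c True unfolding ax
        by (simp add: comult_closed power_add del: mod_less)
    qed
  qed
  have 2: "(\<Sum>u\<in>taft_paths n. taft_comult n q a (x, u) * taft_comult n q u (y, z)) =
    (\<Sum>u\<in>taft_paths n. if u = ((y1 + z1) mod n, y2 + z2) then
       (if P then q ^ (z1 * (x2 + y2) + y1 * x2) * (gbin q l x2 * gbin q (y2 + z2) y2) else 0) else 0)"
  proof (intro sum.cong refl)
    fix u assume "u \<in> taft_paths n"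
    then obtain c s where u: "u = (c, s)" "c < n" "s < n" by (auto simp: taft_paths_def)
    show "taft_comult n q a (x, u) * taft_comult n q u (y, z) =
      (if u = ((y1 + z1) mod n, y2 + z2) then
       (if P then q ^ (z1 * (x2 + y2) + y1 * x2) * (gbin q l x2 * gbin q (y2 + z2) y2) else 0) else 0)"
    proof (cases "u = ((y1 + z1) mod n, y2 + z2)")
      case False
      then have "taft_comult n q u (y, z) = 0" using u ax by (auto simp: comult_closed)
      then show ?thesis using False by simp
    next
      case True
      then have c: "c = (y1 + z1) mod n" "s = y2 + z2" using u by auto
      have "(x1 + c) mod n = i \<and> x2 + s = l \<longleftrightarrow> P"
        unfolding P_def c by (simp add: mod_simps ac_simps)
      moreover have "q ^ (c * x2) * g1 * (q ^ (z1 * y2) * g2) = q ^ (z1 * (x2 + y2) + y1 * x2) * (g1 * g2)" for g1 g2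
        unfolding c q_mod_mult by (simp add: power_add algebra_simps)
      ultimately show ?thesis using lt u c(2) True unfolding ax
        by (simp add: comult_closed del: mod_less)
    qed
  qed
  have "gbin q l (x2 + y2) * gbin q (x2 + y2) x2 = gbin q l x2 * gbin q (y2 + z2) y2" if P
    using that lt gbin_trinomial[of x2 y2 z2] by (simp add: P_def)
  moreover have "x2 + y2 < n" "y2 + z2 < n" if P
    using that lt by (auto simp: P_def)
  ultimately show ?thesis
    unfolding 1 2 using n by (auto simp: sum.delta taft_paths_def)
qed

lemma comult_mult:
  assumes "i < n" "l < n" "j < n" "m < n"
  shows "bilinear_ext (taft_paths n \<times> taft_paths n) (tensor_mult (taft_mult n))
           (taft_comult n q (i, l)) (taft_comult n q (j, m)) =
         (if i = (j + m) mod n \<and> l + m < n then taft_comult n q (j, l + m) else (\<lambda>_. 0))"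
proof
  fix u :: "(nat \<times> nat) \<times> (nat \<times> nat)"
  obtain a s b t where u: "u = ((a, s), (b, t))" by (metis prod.exhaust)
  let ?lhs = "bilinear_ext (taft_paths n \<times> taft_paths n) (tensor_mult (taft_mult n))
           (taft_comult n q (i, l)) (taft_comult n q (j, m)) u"
  let ?rhs = "(if i = (j + m) mod n \<and> l + m < n then taft_comult n q (j, l + m) else (\<lambda>_. 0)) u"
  show "?lhs = ?rhs"
  proof (cases "a < n \<and> s < n \<and> b < n \<and> t < n")
    case False
    then have "a < n \<and> b < n \<and> s < n \<and> t < n \<longleftrightarrow> False" by auto
    then show ?thesis using assms unfolding u taft_bilinear2 if_not_P[OF False] by (simp add: comult_closed, blast)
  next
    case True
    define P where "P \<longleftrightarrow> (a + b) mod n = j \<and> (j + m) mod n = i \<and> s + t = l + m"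
    have trm: "taft_comult n q (i, l) (((a + r) mod n, s - r), ((b + r') mod n, t - r')) * taft_comult n q (j, m) ((a, r), (b, r'))
        = (if r' = m - r then
            (if P then q ^ (b * s) * (q ^ ((m - r) * (s - r)) * gbin q l (s - r) * gbin q m r) else 0) * of_bool (r \<le> m) else 0)"
      if "r \<le> s" "r' \<le> t" for r r'
    proof (cases "(a + b) mod n = j \<and> r + r' = m")
      case False
      then have "taft_comult n q (j, m) ((a, r), (b, r')) = 0"
        using assms by (simp add: comult_closed, blast)
      then show ?thesis using False by (auto simp: P_def)
    next
      case c: True
      have "((a + r) mod n + (b + r') mod n) mod n = ((a + b) + (r + r')) mod n"
        unfolding mod_add_eq by (simp add: ac_simps)
      also have "\<dots> = (j + m) mod n" using c by (metis mod_add_left_eq)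
      finally have "((a + r) mod n + (b + r') mod n) mod n = i \<and> s - r + (t - r') = l \<longleftrightarrow> P"
        using c that unfolding P_def by auto
      moreover have "q ^ ((b + r') mod n * (s - r)) * q ^ (b * r) = q ^ (b * s) * q ^ (r' * (s - r))"
      proof -
        have "(b + r') * (s - r) + b * r = b * s + r' * (s - r)"
          using le_Suc_ex[OF that(1)] by (auto simp: algebra_simps)
        then show ?thesis unfolding q_mod_mult by (metis power_add)
      qed
      ultimately have e: "q ^ ((b + r') mod n * (s - r)) * q ^ (b * r) = q ^ (b * s) * q ^ (r' * (s - r))"
        and fin: "((a + r) mod n + (b + r') mod n) mod n = i \<and> s - r + (t - r') = l \<longleftrightarrow> P" by blast+
      have f: "(a + r) mod n < n" "(b + r') mod n < n" "s - r < n" "t - r' < n"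
        using True n by auto
      have e1: "taft_comult n q (i, l) (((a + r) mod n, s - r), ((b + r') mod n, t - r')) =
          (if P then q ^ ((b + r') mod n * (s - r)) * gbin q l (s - r) else 0)"
        unfolding comult_closed[OF assms(1)] by (simp only: f simp_thms fin)
      have f': "r < n" "r' < n" using True that by auto
      have e2: "taft_comult n q (j, m) ((a, r), (b, r')) = q ^ (b * r) * gbin q m r"
        unfolding comult_closed[OF assms(3)] by (simp only: True f' c simp_thms if_True)
      have r': "r' = m - r" "r \<le> m" using c by auto
      have "q ^ ((b + r') mod n * (s - r)) * gbin q l (s - r) * (q ^ (b * r) * gbin q m r) =
          (q ^ ((b + r') mod n * (s - r)) * q ^ (b * r)) * (gbin q l (s - r) * gbin q m r)"
        by (simp only: ac_simps)
      also have "\<dots> = q ^ (b * s) * (q ^ (r' * (s - r)) * gbin q l (s - r) * gbin q m r)"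
        unfolding e by (simp only: ac_simps)
      finally show ?thesis unfolding e1 e2 using r' by simp
    qed
    have "?lhs = (\<Sum>r\<le>s. \<Sum>r'\<le>t. if r' = m - r then
            (if P then q ^ (b * s) * (q ^ ((m - r) * (s - r)) * gbin q l (s - r) * gbin q m r) else 0) * of_bool (r \<le> m) else 0)"
    proof -
      have "?lhs = (\<Sum>r\<le>s. \<Sum>r'\<le>t. taft_comult n q (i, l) (((a + r) mod n, s - r), ((b + r') mod n, t - r'))
              * taft_comult n q (j, m) ((a, r), (b, r')))"
        using True unfolding u taft_bilinear2 by simp
      also have "\<dots> = (\<Sum>r\<le>s. \<Sum>r'\<le>t. if r' = m - r then
            (if P then q ^ (b * s) * (q ^ ((m - r) * (s - r)) * gbin q l (s - r) * gbin q m r) else 0) * of_bool (r \<le> m) else 0)"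
        by (intro sum.cong refl trm) auto
      finally show ?thesis .
    qed
    also have "\<dots> = (\<Sum>r\<le>s. if P then q ^ (b * s) * (q ^ ((m - r) * (s - r)) * gbin q l (s - r) * gbin q m r) else 0)"
    proof (intro sum.cong refl)
      fix r assume "r \<in> {..s}"
      then have rs: "r \<le> s" by simp
      have "r > m \<Longrightarrow> gbin q m r = 0" by (simp add: gbin_eq_0)
      moreover have "P \<Longrightarrow> \<not> m - r \<le> t \<Longrightarrow> gbin q l (s - r) = 0"
        using rs by (auto simp: P_def intro!: gbin_eq_0)
      ultimately show "(\<Sum>r'\<le>t. if r' = m - r then
            (if P then q ^ (b * s) * (q ^ ((m - r) * (s - r)) * gbin q l (s - r) * gbin q m r) else 0) * of_bool (r \<le> m) else 0)
          = (if P then q ^ (b * s) * (q ^ ((m - r) * (s - r)) * gbin q l (s - r) * gbin q m r) else 0)"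
        by (auto simp: sum.delta not_le)
    qed
    also have "\<dots> = (if P then q ^ (b * s) * gbin q (l + m) s else 0)"
      by (simp add: gbin_vandermonde[symmetric] sum_distrib_left)
    also have "\<dots> = ?rhs"
    proof (cases "l + m < n")
      case lm: True
      then show ?thesis using True assms unfolding u P_def by (simp add: comult_closed)
    next
      case False
      then have "P \<Longrightarrow> gbin q (l + m) s = 0" using True by (intro gbin_vanish) (auto simp: P_def)
      then show ?thesis using False by simp
    qed
    finally show ?thesis .
  qed
qed


lemma antipode_left:
  assumes "i < n" "l < n"
  shows "linear_ext (taft_paths n \<times> taft_paths n)
      (\<lambda>(x, y). bilinear_ext (taft_paths n) (taft_mult n) (taft_antipode n q x) (bvec y)) (taft_comult n q (i, l)) (c, r)
     = of_bool (i = 0 \<and> l = 0) * of_bool (c < n \<and> r = 0)" (is "?lhs = _")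
proof -
  let ?X = "taft_paths n"
  define g where "g = (\<lambda>((a, s), (b, t)). (if a < n \<and> b < n \<and> s < n \<and> t < n \<and> (a + b) mod n = i \<and> s + t = l
      then q ^ (b * s) * gbin q l s else 0) *
     (if c < n \<and> r < n \<and> b = c \<and> r = s + t \<and> (c + t + a + s) mod n = 0 then (-1) ^ s * q ^ (a * s + \<Sum>{..s}) else 0))"
  have hm: "bilinear_ext ?X (taft_mult n) (taft_antipode n q (a, s)) (bvec (b, t)) (c, r) =
     (if c < n \<and> r < n \<and> b = c \<and> r = s + t \<and> (c + t + a + s) mod n = 0 then (-1) ^ s * q ^ (a * s + \<Sum>{..s}) else 0)"
    if "a < n" "s < n" "b < n" "t < n" for a s b t
  proof (cases "c < n \<and> r < n")
    case True
    have "bilinear_ext ?X (taft_mult n) (taft_antipode n q (a, s)) (bvec (b, t)) (c, r) =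
      (\<Sum>r'\<le>r. if r' = t then taft_antipode n q (a, s) ((c + t) mod n, r - t) * of_bool (b = c) else 0)"
    proof -
      have "bilinear_ext ?X (taft_mult n) (taft_antipode n q (a, s)) (bvec (b, t)) (c, r) =
        (\<Sum>r'\<le>r. taft_antipode n q (a, s) ((c + r') mod n, r - r') * bvec (b, t) (c, r'))"
        using True by (simp add: taft_bilinear)
      also have "\<dots> = (\<Sum>r'\<le>r. if r' = t then taft_antipode n q (a, s) ((c + t) mod n, r - t) * of_bool (b = c) else 0)"
        by (intro sum.cong refl) (auto simp: bvec_def)
      finally show ?thesis .
    qed
    also have "\<dots> = (if t \<le> r then taft_antipode n q (a, s) ((c + t) mod n, r - t) * of_bool (b = c) else 0)"
      by (simp add: sum.delta)
    also have "\<dots> = (if c < n \<and> r < n \<and> b = c \<and> r = s + t \<and> (c + t + a + s) mod n = 0 then (-1) ^ s * q ^ (a * s + \<Sum>{..s}) else 0)"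
    proof -
      have "((c + t) mod n + a + s) mod n = (c + t + a + s) mod n" by (simp add: mod_simps add.assoc)
      moreover have "t \<le> r \<Longrightarrow> r - t = s \<longleftrightarrow> r = s + t" by auto
      ultimately show ?thesis using that True by (simp add: antipode_closed)
    qed
    finally show ?thesis .
  next
    case False
    then show ?thesis unfolding taft_bilinear if_not_P[OF False] by (simp, blast)
  qed
  have lhs: "?lhs = sum g (?X \<times> ?X)"
    unfolding linear_ext_def
  proof (intro sum.cong refl)
    fix u assume "u \<in> ?X \<times> ?X"
    then obtain a s b t where u: "u = ((a, s), (b, t))" and lt: "a < n" "s < n" "b < n" "t < n"
      by (auto simp: taft_paths_def)
    show "taft_comult n q (i, l) u * (case u of (x, y) \<Rightarrow> bilinear_ext ?X (taft_mult n) (taft_antipode n q x) (bvec y)) (c, r) = g u"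
      unfolding u g_def prod.case hm[OF lt] comult_closed[OF assms(1)] by (rule refl)
  qed
  show ?thesis
  proof (cases "c < n \<and> r = l \<and> (i + l) mod n = 0")
    case False
    have "g u = 0" if "u \<in> ?X \<times> ?X" for u
    proof -
      obtain a s b t where u: "u = ((a, s), (b, t))" by (metis prod.exhaust)
      have "\<not> (((a + b) mod n = i \<and> s + t = l) \<and> (c < n \<and> b = c \<and> r = s + t \<and> (c + t + a + s) mod n = 0))"
      proof (rule notI, elim conjE)
        assume h: "(a + b) mod n = i" "s + t = l" "c < n" "b = c" "r = s + t" "(c + t + a + s) mod n = 0"
        have "(i + l) mod n = (c + t + a + s) mod n"
          unfolding h(1,2) [symmetric] mod_add_left_eq by (simp add: h(4) ac_simps)
        then show False using False h by simp
      qed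
      then show ?thesis unfolding u g_def by auto
    qed
    then have "?lhs = 0" unfolding lhs by (simp add: sum.neutral)
    then show ?thesis using False n assms by auto
  next
    case True
    then have T: "c < n" "r = l" "(i + l) mod n = 0" by auto
    define a0 where "a0 = (i + (n - c)) mod n"
    have a0: "a = a0 \<longleftrightarrow> (a + c) mod n = i" if "a < n" for a
    proof -
      have "(a + c) mod n = i \<longleftrightarrow> (a + c) mod n = (i + (n - c) + c) mod n" using T assms by simp
      also have "\<dots> \<longleftrightarrow> a mod n = (i + (n - c)) mod n" by (rule mod_cancel)
      finally show ?thesis using that by (simp add: a0_def)
    qed
    have a0n: "a0 < n" "(a0 + c) mod n = i" using a0[of a0] n by (auto simp: a0_def)
    have "sum g (?X \<times> ?X) = sum g ((\<lambda>s. ((a0, s), (c, l - s))) ` {..l})"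
    proof (rule sum.mono_neutral_right)
      show "(\<lambda>s. ((a0, s), (c, l - s))) ` {..l} \<subseteq> ?X \<times> ?X"
        using a0n T assms by (auto simp: taft_paths_def)
      show "\<forall>u\<in>?X \<times> ?X - (\<lambda>s. ((a0, s), (c, l - s))) ` {..l}. g u = 0"
      proof safe
        fix a s b t
        assume *: "((a, s), (b, t)) \<notin> (\<lambda>s. ((a0, s), (c, l - s))) ` {..l}" and "(a, s) \<in> ?X"
        then have "a < n" by (simp add: taft_paths_def)
        have "\<not> (a = a0 \<and> b = c \<and> s + t = l)" using * by force
        then show "g ((a, s), (b, t)) = 0" using a0[OF \<open>a < n\<close>] by (auto simp: g_def)
      qed
    qed simp
    also have "\<dots> = (\<Sum>s\<le>l. g ((a0, s), (c, l - s)))"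
      by (subst sum.reindex) (auto simp: inj_on_def)
    also have "\<dots> = (\<Sum>s\<le>l. (-1) ^ s * gbin q l s * q ^ (\<Sum>{..<s}) * (q ^ (i + 1)) ^ s)"
    proof (intro sum.cong refl)
      fix s assume s: "s \<in> {..l}"
      have "c + (l - s) + a0 + s = (a0 + c) + l" using s by auto
      then have "(c + (l - s) + a0 + s) mod n = 0" using a0n T by (metis mod_add_left_eq)
      then have "g ((a0, s), (c, l - s)) = q ^ (c * s) * gbin q l s * ((-1) ^ s * q ^ (a0 * s + \<Sum>{..s}))"
        using a0n T assms s by (auto simp: g_def)
      also have "\<dots> = (-1) ^ s * gbin q l s * q ^ (\<Sum>{..<s}) * (q ^ ((a0 + c) * s) * q ^ s)"
        by (simp add: ivl_disj_un_singleton(2)[symmetric] power_add algebra_simps)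
      also have "q ^ ((a0 + c) * s) = q ^ (i * s)"
        using a0n(2) q_mod_mult[of "a0 + c" s] by simp
      finally show "g ((a0, s), (c, l - s)) = (-1) ^ s * gbin q l s * q ^ (\<Sum>{..<s}) * (q ^ (i + 1)) ^ s"
        by (simp add: power_mult power_mult_distrib algebra_simps)
    qed
    also have "\<dots> = (\<Prod>r<l. 1 - q ^ r * q ^ (i + 1))" by (rule gbin_alternating)
    also have "\<dots> = of_bool (i = 0 \<and> l = 0) * of_bool (c < n \<and> r = 0)"
    proof (cases l)
      case 0
      then show ?thesis using T assms by simp
    next
      case (Suc l')
      then have "q ^ l' * q ^ (i + 1) = q ^ (i + l)" by (simp add: power_add algebra_simps)
      also have "\<dots> = 1" using q_cong[of "i + l" 0] T by simp
      finally show ?thesis using Suc by (auto intro!: prod_zero)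
    qed
    finally show ?thesis unfolding lhs .
  qed
qed

lemma antipode_right:
  assumes "i < n" "l < n"
  shows "linear_ext (taft_paths n \<times> taft_paths n)
      (\<lambda>(x, y). bilinear_ext (taft_paths n) (taft_mult n) (bvec x) (taft_antipode n q y)) (taft_comult n q (i, l)) (c, r)
     = of_bool (i = 0 \<and> l = 0) * of_bool (c < n \<and> r = 0)" (is "?lhs = _")
proof -
  let ?X = "taft_paths n"
  define g where "g = (\<lambda>((a, s), (b, t)). (if a < n \<and> b < n \<and> s < n \<and> t < n \<and> (a + b) mod n = i \<and> s + t = l
      then q ^ (b * s) * gbin q l s else 0) *
     (if c < n \<and> r < n \<and> a = (c + t) mod n \<and> r = s + t \<and> (c + b + t) mod n = 0 then (-1) ^ t * q ^ (b * t + \<Sum>{..t}) else 0))"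
  have hm: "bilinear_ext ?X (taft_mult n) (bvec (a, s)) (taft_antipode n q (b, t)) (c, r) =
     (if c < n \<and> r < n \<and> a = (c + t) mod n \<and> r = s + t \<and> (c + b + t) mod n = 0 then (-1) ^ t * q ^ (b * t + \<Sum>{..t}) else 0)"
    if "a < n" "s < n" "b < n" "t < n" for a s b t
  proof (cases "c < n \<and> r < n")
    case True
    have "bilinear_ext ?X (taft_mult n) (bvec (a, s)) (taft_antipode n q (b, t)) (c, r) =
      (\<Sum>r'\<le>r. if r' = t then (if (c + t) mod n = a \<and> r - t = s then taft_antipode n q (b, t) (c, t) else 0) else 0)"
    proof -
      have "bilinear_ext ?X (taft_mult n) (bvec (a, s)) (taft_antipode n q (b, t)) (c, r) =
        (\<Sum>r'\<le>r. bvec (a, s) ((c + r') mod n, r - r') * taft_antipode n q (b, t) (c, r'))"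
        using True by (simp add: taft_bilinear)
      also have "\<dots> = (\<Sum>r'\<le>r. if r' = t then (if (c + t) mod n = a \<and> r - t = s then taft_antipode n q (b, t) (c, t) else 0) else 0)"
        using that by (intro sum.cong refl) (auto simp: bvec_def antipode_closed)
      finally show ?thesis .
    qed
    also have "\<dots> = (if t \<le> r then (if (c + t) mod n = a \<and> r - t = s then taft_antipode n q (b, t) (c, t) else 0) else 0)"
      by (simp add: sum.delta)
    also have "\<dots> = (if c < n \<and> r < n \<and> a = (c + t) mod n \<and> r = s + t \<and> (c + b + t) mod n = 0 then (-1) ^ t * q ^ (b * t + \<Sum>{..t}) else 0)"
      using that True by (auto simp: antipode_closed)
    finally show ?thesis .
  next
    case False
    then show ?thesis unfolding taft_bilinear if_not_P[OF False] by (simp, blast)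
  qed
  have lhs: "?lhs = sum g (?X \<times> ?X)"
    unfolding linear_ext_def
  proof (intro sum.cong refl)
    fix u assume "u \<in> ?X \<times> ?X"
    then obtain a s b t where u: "u = ((a, s), (b, t))" and lt: "a < n" "s < n" "b < n" "t < n"
      by (auto simp: taft_paths_def)
    show "taft_comult n q (i, l) u * (case u of (x, y) \<Rightarrow> bilinear_ext ?X (taft_mult n) (bvec x) (taft_antipode n q y)) (c, r) = g u"
      unfolding u g_def prod.case hm[OF lt] comult_closed[OF assms(1)] by (rule refl)
  qed
  show ?thesis
  proof (cases "c < n \<and> r = l \<and> i = 0")
    case False
    have "g u = 0" if "u \<in> ?X \<times> ?X" for u
    proof -
      obtain a s b t where u: "u = ((a, s), (b, t))" by (metis prod.exhaust)
      have "\<not> (((a + b) mod n = i \<and> s + t = l) \<and> (c < n \<and> a = (c + t) mod n \<and> r = s + t \<and> (c + b + t) mod n = 0))"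
      proof (rule notI, elim conjE)
        assume h: "(a + b) mod n = i" "s + t = l" "c < n" "a = (c + t) mod n" "r = s + t" "(c + b + t) mod n = 0"
        have "((c + t) mod n + b) mod n = (c + b + t) mod n"
          unfolding mod_add_left_eq by (simp add: ac_simps)
        then show False using False h by simp
      qed
      then show ?thesis unfolding u g_def by auto
    qed
    then have "?lhs = 0" unfolding lhs by (simp add: sum.neutral)
    then show ?thesis using False n assms by auto
  next
    case True
    then have T: "c < n" "r = l" "i = 0" by auto
    define b0 where "b0 t = ((n - c) + (n - 1) * t) mod n" for t
    have bz: "(c + (n - c + (n - 1) * t) + t) mod n = 0" for t
    proof -
      have "c + (n - c + (n - 1) * t) + t = n * (1 + t)" using T n
        by (cases n) (auto simp: algebra_simps)
      then show ?thesis by (metis mod_mult_self1_is_0)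
    qed
    have b0z: "(b0 t + (c + t)) mod n = 0" for t
      unfolding b0_def mod_add_left_eq using bz[of t] by (simp only: ac_simps)
    have b0: "b = b0 t \<longleftrightarrow> (b + (c + t)) mod n = 0" if "b < n" for b t
    proof -
      have "(b + (c + t)) mod n = 0 \<longleftrightarrow> (b + (c + t)) mod n = (b0 t + (c + t)) mod n" using b0z by simp
      also have "\<dots> \<longleftrightarrow> b mod n = b0 t mod n" by (rule mod_cancel)
      finally show ?thesis using that by (simp add: b0_def)
    qed
    have b0n: "b0 t < n" for t using n by (simp add: b0_def)
    let ?h = "\<lambda>t. (((c + t) mod n, l - t), (b0 t, t))"
    have "sum g (?X \<times> ?X) = sum g (?h ` {..l})"
    proof (rule sum.mono_neutral_right)
      show "?h ` {..l} \<subseteq> ?X \<times> ?X"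
        using b0n T assms by (auto simp: taft_paths_def)
      show "\<forall>u\<in>?X \<times> ?X - ?h ` {..l}. g u = 0"
      proof safe
        fix a s b t
        assume *: "((a, s), (b, t)) \<notin> ?h ` {..l}" and "(b, t) \<in> ?X"
        then have "b < n" by (simp add: taft_paths_def)
        have "\<not> (a = (c + t) mod n \<and> b = b0 t \<and> s + t = l)" using * by force
        then show "g ((a, s), (b, t)) = 0" using b0[OF \<open>b < n\<close>, of t] by (auto simp: g_def ac_simps)
      qed
    qed simp
    also have "\<dots> = (\<Sum>t\<le>l. g (?h t))"
      by (subst sum.reindex) (auto simp: inj_on_def)
    also have "\<dots> = q ^ ((n - c) * l) * (\<Sum>t\<le>l. (-1) ^ t * gbin q l t * q ^ (\<Sum>{..<t}) * (q ^ (1 + (n - 1) * l)) ^ t)"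
      unfolding sum_distrib_left
    proof (intro sum.cong refl)
      fix t assume t: "t \<in> {..l}"
      have "((c + t) mod n + b0 t) mod n = 0" using b0z[of t] by (simp add: mod_simps ac_simps)
      moreover have "(c + b0 t + t) mod n = 0" using b0z[of t] by (simp add: ac_simps)
      ultimately have "g (?h t) = q ^ (b0 t * (l - t)) * gbin q l (l - t) * ((-1) ^ t * q ^ (b0 t * t + \<Sum>{..t}))"
        using b0n[of t] T assms t n less_imp_diff_less[OF assms(2), of t] by (simp add: g_def)
      also have "gbin q l (l - t) = gbin q l t"
        using gbin_sym[of "l - t" t] assms t by simp
      also have "q ^ (b0 t * (l - t)) * gbin q l t * ((-1) ^ t * q ^ (b0 t * t + \<Sum>{..t}))
          = (-1) ^ t * gbin q l t * (q ^ (b0 t * (l - t)) * q ^ (b0 t * t)) * q ^ (\<Sum>{..<t}) * q ^ t"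
        by (simp add: ivl_disj_un_singleton(2)[symmetric] power_add algebra_simps)
      also have "q ^ (b0 t * (l - t)) * q ^ (b0 t * t) = q ^ (b0 t * l)"
        using t by (simp add: power_add[symmetric] add_mult_distrib2[symmetric])
      also have "\<dots> = q ^ ((n - c) * l) * q ^ ((n - 1) * l * t)"
        unfolding b0_def q_mod_mult by (simp add: power_add[symmetric] algebra_simps)
      finally have "g (?h t) = (-1) ^ t * gbin q l t * (q ^ ((n - c) * l) * q ^ ((n - 1) * l * t)) * q ^ (\<Sum>{..<t}) * q ^ t" .
      moreover have "(q ^ (1 + (n - 1) * l)) ^ t = q ^ t * q ^ ((n - 1) * l * t)"
        by (simp only: power_add power_mult power_mult_distrib power_one_right)
      ultimately show "g (?h t) = q ^ ((n - c) * l) * ((-1) ^ t * gbin q l t * q ^ (\<Sum>{..<t}) * (q ^ (1 + (n - 1) * l)) ^ t)"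
        by (simp only: ac_simps)
    qed
    also have "(\<Sum>t\<le>l. (-1) ^ t * gbin q l t * q ^ (\<Sum>{..<t}) * (q ^ (1 + (n - 1) * l)) ^ t) =
        (\<Prod>r<l. 1 - q ^ r * q ^ (1 + (n - 1) * l))" by (rule gbin_alternating)
    also have "q ^ ((n - c) * l) * \<dots> = of_bool (i = 0 \<and> l = 0) * of_bool (c < n \<and> r = 0)"
    proof (cases l)
      case 0
      then show ?thesis using T assms by simp
    next
      case (Suc l')
      have "l' + (1 + (n - 1) * l) = n * l" using n Suc by (cases n) (auto simp: algebra_simps)
      then have "q ^ l' * q ^ (1 + (n - 1) * l) = q ^ (n * l)" by (metis power_add)
      also have "\<dots> = 1" by (simp add: power_mult q1)
      finally have "(\<Prod>r<l. 1 - q ^ r * q ^ (1 + (n - 1) * l)) = 0"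
        using Suc by (intro prod_zero) (auto intro!: bexI[of _ l'])
      then show ?thesis using Suc by simp
    qed
    finally show ?thesis unfolding lhs .
  qed
qed

lemma functional_counit: "functional (taft_paths n) (bvec (0, 0)) x = (x (0, 0) :: 'k)"
proof -
  have "functional (taft_paths n) (bvec (0, 0)) x = (\<Sum>b\<in>taft_paths n. if b = (0, 0) then x b else 0)"
    unfolding functional_def by (intro sum.cong refl) (auto simp: bvec_def)
  then show ?thesis using n by (simp add: sum.delta taft_paths_def)
qed

lemma linear_ext_bvec: "finite B \<Longrightarrow> b \<in> B \<Longrightarrow> linear_ext B f (bvec b) = (f b :: _ \<Rightarrow> 'k)"
proof
  fix c assume "finite B" "b \<in> B"
  have "linear_ext B f (bvec b) c = (\<Sum>x\<in>B. if x = b then f b c else 0)"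
    unfolding linear_ext_def by (intro sum.cong refl) (auto simp: bvec_def)
  then show "linear_ext B f (bvec b) c = f b c" using \<open>finite B\<close> \<open>b \<in> B\<close> by (simp add: sum.delta)
qed

lemma taft_hopf: "is_hopf_algebra (taft n q)"
proof -
  let ?X = "taft_paths n"
  have bv: "bvec p \<in> vecs ?X" if "p \<in> ?X" for p :: "nat \<times> nat"
    using that by (auto simp: bvec_def vecs_def)
  have 1: "taft_mult n a b \<in> (vecs ?X :: (_ \<Rightarrow> 'k) set)" if "a \<in> ?X" "b \<in> ?X" for a b
    using that by (auto simp: taft_mult_def vecs_def bvec_def taft_paths_def split: prod.splits)
  have 2: "(\<Sum>i<n. bvec (i, 0)) \<in> (vecs ?X :: (_ \<Rightarrow> 'k) set)"
    using n by (auto simp: vecs_def unit_closed taft_paths_def)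
  have 3: "taft_comult n q a \<in> vecs (?X \<times> ?X)" if aX: "a \<in> ?X" for a
  proof -
    obtain i l where a: "a = (i, l)" "i < n" using aX by (auto simp: taft_paths_def)
    show ?thesis unfolding vecs_def a(1) using comult_zero[OF a(2)] by blast
  qed
  have 4: "taft_antipode n q a \<in> vecs ?X" if "a \<in> ?X" for a
    using that by (cases a) (auto simp: vecs_def antipode_closed taft_paths_def)
  have 5: "(\<Sum>u\<in>?X. bvec (0, 0) u * taft_comult n q a (u, x)) = bvec a x"
          "(\<Sum>u\<in>?X. taft_comult n q a (x, u) * bvec (0, 0) u) = bvec a x" if "a \<in> ?X" "x \<in> ?X" for a x
  proof -
    obtain i l c s where ax: "a = (i, l)" "x = (c, s)" by (metis prod.exhaust)
    have "(\<Sum>u\<in>?X. bvec (0, 0) u * taft_comult n q a (u, x)) = (\<Sum>u\<in>?X. if u = (0, 0) then taft_comult n q a ((0, 0), x) else 0)"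
      by (intro sum.cong refl) (auto simp: bvec_def)
    also have "\<dots> = bvec a x" using that n by (auto simp: ax taft_paths_def sum.delta comult_closed bvec_def)
    finally show "(\<Sum>u\<in>?X. bvec (0, 0) u * taft_comult n q a (u, x)) = bvec a x" .
    have "(\<Sum>u\<in>?X. taft_comult n q a (x, u) * bvec (0, 0) u) = (\<Sum>u\<in>?X. if u = (0, 0) then taft_comult n q a (x, (0, 0)) else 0)"
      by (intro sum.cong refl) (auto simp: bvec_def)
    also have "\<dots> = bvec a x" using that n by (auto simp: ax taft_paths_def sum.delta comult_closed bvec_def)
    finally show "(\<Sum>u\<in>?X. taft_comult n q a (x, u) * bvec (0, 0) u) = bvec a x" .
  qed
  have 6: "linear_ext ?X (taft_comult n q) (taft_mult n a b) =
      bilinear_ext (?X \<times> ?X) (tensor_mult (taft_mult n)) (taft_comult n q a) (taft_comult n q b)"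
    if "a \<in> ?X" "b \<in> ?X" for a b
  proof -
    obtain i l j m where ab: "a = (i, l)" "b = (j, m)" by (metis prod.exhaust)
    have lt: "i < n" "l < n" "j < n" "m < n" using that by (auto simp: ab taft_paths_def)
    show ?thesis
    proof (cases "i = (j + m) mod n \<and> l + m < n")
      case True
      then have "linear_ext ?X (taft_comult n q) (taft_mult n a b) = linear_ext ?X (taft_comult n q) (bvec (j, l + m))"
        by (simp add: ab taft_mult_def)
      also have "\<dots> = taft_comult n q (j, l + m)"
        using True lt by (intro linear_ext_bvec) (auto simp: taft_paths_def)
      finally show ?thesis unfolding ab comult_mult[OF lt] using True by simp
    next
      case False
      then have "taft_mult n a b = (\<lambda>_. 0 :: 'k)" by (auto simp: ab taft_mult_def)
      then show ?thesis unfolding ab comult_mult[OF lt] using False by (simp only: if_False) (simp add: linear_ext_def)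
    qed
  qed
  have 7: "linear_ext ?X (taft_comult n q) (\<Sum>i<n. bvec (i, 0)) = tensor_vec (\<Sum>i<n. bvec (i, 0)) (\<Sum>i<n. bvec (i, 0))"
  proof
    fix u :: "(nat \<times> nat) \<times> (nat \<times> nat)"
    obtain a s b t where u: "u = ((a, s), (b, t))" by (metis prod.exhaust)
    have "linear_ext ?X (taft_comult n q) (\<Sum>i<n. bvec (i, 0)) u =
       (\<Sum>p\<in>?X. if p = ((a + b) mod n, 0) then of_bool (a < n \<and> b < n \<and> s = 0 \<and> t = 0) else 0)"
      unfolding linear_ext_def
    proof (intro sum.cong refl)
      fix p assume "p \<in> ?X"
      then obtain c l where p: "p = (c, l)" "c < n" by (auto simp: taft_paths_def)
      show "(\<Sum>i<n. bvec (i, 0)) p * taft_comult n q p u =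
        (if p = ((a + b) mod n, 0) then of_bool (a < n \<and> b < n \<and> s = 0 \<and> t = 0) else 0)"
      proof (cases l)
        case 0
        then show ?thesis using p(2) unfolding p(1) u unit_closed by (auto simp: comult_vertex)
      next
        case (Suc l')
        then show ?thesis unfolding p(1) u unit_closed by simp
      qed
    qed
    also have "\<dots> = tensor_vec (\<Sum>i<n. bvec (i, 0)) (\<Sum>i<n. bvec (i, 0)) u"
      using n by (auto simp: u tensor_vec_def unit_closed sum.delta taft_paths_def)
    finally show "linear_ext ?X (taft_comult n q) (\<Sum>i<n. bvec (i, 0)) u = tensor_vec (\<Sum>i<n. bvec (i, 0)) (\<Sum>i<n. bvec (i, 0)) u" .
  qed
  have 8: "functional ?X (bvec (0, 0)) (taft_mult n a b) = (bvec (0, 0) a * bvec (0, 0) b :: 'k)" if "a \<in> ?X" "b \<in> ?X" for a b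
    using that unfolding functional_counit
    by (auto simp: taft_mult_def taft_paths_def bvec_def split: prod.splits)
  have 9: "functional ?X (bvec (0, 0)) (\<Sum>i<n. bvec (i, 0)) = (1 :: 'k)"
    using n by (simp add: functional_counit unit_closed)
  have 10: "linear_ext (?X \<times> ?X) (\<lambda>(x, y). bilinear_ext ?X (taft_mult n) (taft_antipode n q x) (bvec y)) (taft_comult n q a)
      = (\<lambda>c. bvec (0, 0) a * (\<Sum>i<n. bvec (i, 0)) c)"
    "linear_ext (?X \<times> ?X) (\<lambda>(x, y). bilinear_ext ?X (taft_mult n) (bvec x) (taft_antipode n q y)) (taft_comult n q a)
      = (\<lambda>c. bvec (0, 0) a * (\<Sum>i<n. bvec (i, 0)) c)"
    if aX: "a \<in> ?X" for a
  proof -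
    obtain i l where a: "a = (i, l)" "i < n" "l < n" using aX by (auto simp: taft_paths_def)
    have *: "bvec (0, 0) a = (of_bool (i = 0 \<and> l = 0) :: 'k)" by (simp add: a bvec_def)
    show "linear_ext (?X \<times> ?X) (\<lambda>(x, y). bilinear_ext ?X (taft_mult n) (taft_antipode n q x) (bvec y)) (taft_comult n q a)
      = (\<lambda>c. bvec (0, 0) a * (\<Sum>i<n. bvec (i, 0)) c)"
      unfolding * fun_eq_iff split_paired_All unfolding a(1) antipode_left[OF a(2,3)] unit_closed by simp
    show "linear_ext (?X \<times> ?X) (\<lambda>(x, y). bilinear_ext ?X (taft_mult n) (bvec x) (taft_antipode n q y)) (taft_comult n q a)
      = (\<lambda>c. bvec (0, 0) a * (\<Sum>i<n. bvec (i, 0)) c)"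
      unfolding * fun_eq_iff split_paired_All unfolding a(1) antipode_right[OF a(2,3)] unit_closed by simp
  qed
  show ?thesis
    unfolding is_hopf_algebra_def Let_def hmult_def hmult2_def taft_def hopf.simps
    by (intro conjI ballI) (fact finite_taft | erule (1) 1 | rule 2 | erule 3 | erule 4
        | erule (2) taft_assoc | rule taft_unit, erule bv | erule (3) taft_coassoc | erule (1) 5 | erule (1) 6
        | rule 7 | erule (1) 8 | rule 9 | erule 10)+
qed

end

corollary taft_hopf_idom:
  fixes q :: "'k::idom"
  assumes "n \<ge> 2" "q ^ n = 1" "\<And>m. 0 < m \<Longrightarrow> m < n \<Longrightarrow> q ^ m \<noteq> 1"
  shows "is_hopf_algebra (taft n q)"
  using assms by (intro taft_hopf) auto

end

theory Submission imports Defs "HOL.Modules" begin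



text \<open>
  The cyclic homology follows from the Hochschild homology of the complex \<open>(C, b)\<close>, which is computed here by
  showing that it repeats with period two.

  \<^bold>\<open>Which triples satisfy the condition.\<close>  Let \<open>(i, l)\<close> be the path of length \<open>l\<close> that starts at \<open>e\<^sub>i\<close>.
  Convolution with a vertex character translates indices and multiplies by a power of \<open>q\<close>, and the antipode sends a
  path to a multiple of a path.  So \<open>\<alpha>\<^sub>u * S\<^sub>\<pi> * \<alpha>\<^sub>v\<close> with \<open>\<pi> = \<pi>\<^sub>j\<close> permutes the paths up to scalars, and its square
  multiplies \<open>(i, l)\<close> by \<open>q\<close> to the power \<open>l (v - u + 1 + j) + j (u + v)\<close>.  As \<open>q\<close> is primitive, this and \<open>\<alpha>\<^sub>u(\<pi>) = \<alpha>\<^sub>v(\<pi>) = 1\<close> say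
  \<open>j u = j v = 0\<close> and \<open>u - v = j + 1\<close> modulo \<open>n\<close> (\<open>CM_iff\<close>).  In particular \<open>u = v\<close> forces \<open>j = n - 1\<close> and then
  \<open>u = v = 0\<close>, and \<open>u = v + 1\<close> forces \<open>j = 0\<close>: these are the two families with nonzero homology.

  \<^bold>\<open>The cyclic operator is periodic.\<close>  Let \<open>\<gamma>\<close> send a tensor \<open>w\<close> to
  \<open>\<alpha>(w\<^sup>(\<^sup>1\<^sup>)) S\<^sub>\<pi>(w\<^sup>(\<^sup>2\<^sup>)) \<otimes> w\<^sup>(\<^sup>3\<^sup>)\<close>, where the coproduct is taken in every factor and the first two parts are
  multiplied together.  Then \<open>t = (1 \<otimes> \<beta>) \<gamma>\<close>, the map \<open>\<alpha> \<otimes> 1\<close> is a left inverse of \<open>\<gamma>\<close>, and \<open>\<gamma>\<close>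
  intertwines the faces with a shift of their index.  In the untwisted case applying \<open>\<gamma>\<close> twice only inserts a unit (\<open>xdegen_xdegen\<close>), and this gives
  \<open>\<gamma> t = \<rho> \<gamma>\<close> for the rotation \<open>\<rho>\<close> of the tensor factors, up to an automorphism \<open>\<sigma>\<close> of the factor that is moved.
  Since \<open>\<gamma>\<close> is injective and absorbs \<open>\<sigma>\<close>, the power \<open>n + 1\<close> of \<open>t\<close> in degree \<open>n\<close> is the identity (\<open>tdual_pow\<close>), and the identities of
  the bicomplex follow.

  \<^bold>\<open>From Hochschild to cyclic homology.\<close>  The columns with \<open>b'\<close> are exact, so dropping the first two columns of
  the bicomplex gives the periodicity operator from cyclic homology in degree \<open>p\<close> to degree \<open>p - 2\<close>, with kernel and
  cokernel controlled by Hochschild homology.  If the latter is free of rank \<open>\<rho>\<close> in the degrees of one parity and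
  zero in the others, the operator is onto with kernel the Hochschild homology of degree \<open>p\<close>, and bases are extended by
  induction (\<open>cyclic_homology_free\<close>).

  \<^bold>\<open>Hochschild homology.\<close>  Look at the last tensor factor.  Appending \<open>e\<^sub>v\<close> shows that a cycle \<open>z\<close> is homologous to
  its part \<open>z\<^sup>+\<close> whose last factor is a path of positive length starting at \<open>e\<^sub>v\<close>.  Write \<open>z\<^sup>+ = y a\<^sub>v\<close> by removing the first
  arrow of that path.  From \<open>b z\<^sup>+ = 0\<close> one gets \<open>(b' y) a\<^sub>v = 0\<close>, and among the paths
  starting at the end point of \<open>a\<^sub>v\<close> only the longest one, of length \<open>n - 1\<close>, is killed by \<open>a\<^sub>v\<close>; so \<open>b' y\<close> is some
  \<open>w\<close> tensored with that path.  Because \<open>b'\<close> is exact, \<open>z \<mapsto> w\<close> induces an isomorphism from degree \<open>N + 2\<close> to degree \<open>N\<close>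
  (\<open>hochschild_periodic\<close>).  In degrees 0 and 1 the homology is free of rank one if \<open>u = v\<close>, respectively
  \<open>u = v + 1\<close>, and zero otherwise.
\<close>

section \<open>Pairing a vector with a function on the basis\<close>

lemma sum_fun_apply: "(\<Sum>i\<in>I. f i) v = (\<Sum>i\<in>I. f i v :: 'k::comm_ring_1)"
  by (induction I rule: infinite_finite_induct) auto

lemma functional_swap:
  "functional X (\<lambda>x. functional Y (\<lambda>y. G x y) g) f = functional Y (\<lambda>y. functional X (\<lambda>x. G x y) f) g"
  unfolding functional_def sum_distrib_left by (subst sum.swap) (simp add: mult.left_commute)

lemma functional_add: "functional X (\<lambda>x. g x + h x) f = functional X g f + functional X h f"
  by (simp add: functional_def algebra_simps sum.distrib)

lemma functional_scale: "functional X (\<lambda>x. c * g x) f = c * functional X g f"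
  by (simp add: functional_def sum_distrib_left mult.left_commute)

lemma functional_cong: "(\<And>x. x \<in> X \<Longrightarrow> g x = h x) \<Longrightarrow> functional X g f = functional X h f"
  by (simp add: functional_def cong: sum.cong)

lemma functional_bvec: "finite X \<Longrightarrow> b \<in> X \<Longrightarrow> functional X g (bvec b) = g b"
  by (simp add: functional_def bvec_def of_bool_def if_distrib[of "\<lambda>x. x * _"] cong: if_cong)

lemma functional_at: "finite X \<Longrightarrow> x \<in> vecs X \<Longrightarrow> functional X (bvec b) x = x b"
  by (auto simp: functional_def bvec_def of_bool_def vecs_def if_distrib[of "\<lambda>y. _ * y"] cong: if_cong)

lemma functional_of_scaled: "functional X g (\<lambda>x. c * f x) = c * functional X g f"
  by (simp add: functional_def sum_distrib_left mult.assoc)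

lemma functional_Times:
  "functional (X \<times> Y) (\<lambda>(x, y). g x y) f = (\<Sum>x\<in>X. \<Sum>y\<in>Y. f (x, y) * g x y)"
  by (simp add: functional_def sum.cartesian_product case_prod_unfold)

lemma functional_linear_ext:
  "functional Y g (linear_ext X f x) = functional X (\<lambda>a. functional Y g (f a)) x"
  unfolding functional_def linear_ext_def sum_distrib_left sum_distrib_right
  by (subst sum.swap) (simp add: mult.assoc)

lemma functional_bilinear_ext:
  "functional Y g (bilinear_ext X f x y) = functional X (\<lambda>a. functional X (\<lambda>b. functional Y g (f a b)) y) x"
proof -
  have "bilinear_ext X f x y = linear_ext X (\<lambda>a. linear_ext X (f a) y) x"
    by (simp add: bilinear_ext_def linear_ext_def sum_distrib_left mult.assoc)
  then show ?thesis by (simp add: functional_linear_ext)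
qed

lemma functional_tensor_vec:
  "functional (X \<times> Y) (\<lambda>(a, b). g a b) (tensor_vec x y) = functional X (\<lambda>a. functional Y (g a) y) x"
  by (simp add: functional_Times tensor_vec_def) (simp add: functional_def sum_distrib_left mult.assoc)

lemma bvec_vecs: "b \<in> X \<Longrightarrow> bvec b \<in> vecs X"
  by (auto simp: bvec_def vecs_def)


section \<open>Hopf algebras through their pairings\<close>

locale hopf_algebra =
  fixes H :: "('b, 'k::comm_ring_1) hopf"
  assumes hopf: "is_hopf_algebra H"
begin

text \<open>Sweedler notation becomes continuation passing: for a basis element \<open>a\<close> and a function \<open>g\<close> on the basis, the
  four constants below evaluate the linear extension of \<open>g\<close> at \<open>a b\<close>, at \<open>S(a)\<close>, at \<open>\<Delta>(a)\<close> and at \<open>1\<close>.  For instance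
  \<open>comul a (\<lambda>x y. anti x (\<lambda>p. mul p y g))\<close> is \<open>g(S(a\<^sup>(\<^sup>1\<^sup>)) a\<^sup>(\<^sup>2\<^sup>))\<close>.  The operations in independent variables then
  commute, because they are finite sums.\<close>

abbreviation B where "B \<equiv> Basis H"
abbreviation eps where "eps \<equiv> Counit H"

definition mul where "mul a b g = functional B g (Mult H a b)"
definition anti where "anti a g = functional B g (Antipode H a)"
definition comul where "comul a g = functional (B \<times> B) (\<lambda>(x, y). g x y) (Comult H a)"
definition one where "one g = functional B g (Unit H)"

lemma finite_B: "finite B"
  using hopf by (simp add: is_hopf_algebra_def Let_def)

lemma mul_cong [cong]: "(\<And>c. c \<in> B \<Longrightarrow> g c = h c) \<Longrightarrow> mul a b g = mul a b h"
  unfolding mul_def by (rule functional_cong)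

lemma anti_cong [cong]: "(\<And>c. c \<in> B \<Longrightarrow> g c = h c) \<Longrightarrow> anti a g = anti a h"
  unfolding anti_def by (rule functional_cong)

lemma one_cong [cong]: "(\<And>c. c \<in> B \<Longrightarrow> g c = h c) \<Longrightarrow> one g = one h"
  unfolding one_def by (rule functional_cong)

lemma comul_cong [cong]: "(\<And>x y. x \<in> B \<Longrightarrow> y \<in> B \<Longrightarrow> g x y = h x y) \<Longrightarrow> comul a g = comul a h"
  unfolding comul_def by (rule functional_cong) auto

lemma functional_prod_swap:
  "functional X (\<lambda>(x, y). functional Y (\<lambda>z. G x y z) g) f = functional Y (\<lambda>z. functional X (\<lambda>(x, y). G x y z) f) g"
  using functional_swap[of X Y "\<lambda>p z. G (fst p) (snd p) z" g f] by (simp add: case_prod_unfold)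

lemma comul_mul: "comul a (\<lambda>x y. mul b c (\<lambda>z. G x y z)) = mul b c (\<lambda>z. comul a (\<lambda>x y. G x y z))"
  and comul_anti: "comul a (\<lambda>x y. anti b (\<lambda>z. G x y z)) = anti b (\<lambda>z. comul a (\<lambda>x y. G x y z))"
  and comul_one: "comul a (\<lambda>x y. one (\<lambda>z. G x y z)) = one (\<lambda>z. comul a (\<lambda>x y. G x y z))"
  unfolding comul_def mul_def anti_def one_def by (rule functional_prod_swap)+

lemma comul_comul: "comul a (\<lambda>x y. comul b (\<lambda>z w. F x y z w)) = comul b (\<lambda>z w. comul a (\<lambda>x y. F x y z w))"
  using functional_swap[of "B \<times> B" "B \<times> B" "\<lambda>p r. F (fst p) (snd p) (fst r) (snd r)" "Comult H b" "Comult H a"]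
  by (simp add: comul_def case_prod_unfold)

lemma mul_mul: "mul a b (\<lambda>x. mul c d (\<lambda>z. G' x z)) = mul c d (\<lambda>z. mul a b (\<lambda>x. G' x z))"
  and anti_anti: "anti a (\<lambda>x. anti c (\<lambda>z. G' x z)) = anti c (\<lambda>z. anti a (\<lambda>x. G' x z))"
  and anti_mul: "anti a (\<lambda>x. mul c d (\<lambda>z. G' x z)) = mul c d (\<lambda>z. anti a (\<lambda>x. G' x z))"
  and one_mul: "one (\<lambda>x. mul c d (\<lambda>z. G' x z)) = mul c d (\<lambda>z. one (\<lambda>x. G' x z))"
  and one_anti: "one (\<lambda>x. anti c (\<lambda>z. G' x z)) = anti c (\<lambda>z. one (\<lambda>x. G' x z))"
  unfolding mul_def anti_def one_def by (rule functional_swap)+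

lemma comul_scale: "comul a (\<lambda>x y. c * g x y) = c * comul a g"
  using functional_scale[of "B \<times> B" c "\<lambda>p. g (fst p) (snd p)"] by (simp add: comul_def case_prod_unfold)

lemma mul_scale: "mul a b (\<lambda>x. c * g x) = c * mul a b g"
  and anti_scale: "anti a (\<lambda>x. c * g x) = c * anti a g"
  and one_scale: "one (\<lambda>x. c * g x) = c * one g"
  unfolding mul_def anti_def one_def by (rule functional_scale)+

lemmas scales = comul_scale mul_scale anti_scale one_scale

lemma functional_hmult:
  "functional B g (hmult H x y) = functional B (\<lambda>a. functional B (\<lambda>b. mul a b g) y) x"
  by (simp add: hmult_def functional_bilinear_ext mul_def)

lemma functional_hantipode: "functional B g (hantipode H x) = functional B (\<lambda>a. anti a g) x"
  by (simp add: hantipode_def functional_linear_ext anti_def)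

lemma coassoc:
  assumes "a \<in> B"
  shows "comul a (\<lambda>x z. comul x (\<lambda>p r. g p r z)) = comul a (\<lambda>p y. comul y (\<lambda>r z. g p r z))"
proof -
  have ax: "(\<Sum>u\<in>B. Comult H a (u, z) * Comult H u (x, y)) = (\<Sum>u\<in>B. Comult H a (x, u) * Comult H u (y, z))"
    if "x \<in> B" "y \<in> B" "z \<in> B" for x y z
    using hopf assms that by (simp add: is_hopf_algebra_def Let_def)
  have "comul a (\<lambda>x z. comul x (\<lambda>p r. g p r z)) =
      (\<Sum>p\<in>B. \<Sum>r\<in>B. \<Sum>z\<in>B. (\<Sum>u\<in>B. Comult H a (u, z) * Comult H u (p, r)) * g p r z)"
    unfolding comul_def functional_Times sum_distrib_left sum_distrib_right
    by (subst sum.swap, subst (2) sum.swap, subst sum.swap, subst (3) sum.swap, subst (2) sum.swap) (simp add: mult.assoc)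
  also have "\<dots> = (\<Sum>p\<in>B. \<Sum>r\<in>B. \<Sum>z\<in>B. (\<Sum>u\<in>B. Comult H a (p, u) * Comult H u (r, z)) * g p r z)"
    by (intro sum.cong refl) (simp add: ax)
  also have "\<dots> = comul a (\<lambda>p y. comul y (\<lambda>r z. g p r z))"
    unfolding comul_def functional_Times sum_distrib_left sum_distrib_right
    by (rule sum.cong[OF refl], subst (2) sum.swap, subst sum.swap) (simp add: mult.assoc)
  finally show ?thesis .
qed

lemma counit_left: "comul a (\<lambda>x y. eps x * g y) = g a" if "a \<in> B"
proof -
  have ax: "(\<Sum>u\<in>B. eps u * Comult H a (u, x)) = bvec a x" if "x \<in> B" for x
    using hopf \<open>a \<in> B\<close> that by (simp add: is_hopf_algebra_def Let_def)
  have "comul a (\<lambda>x y. eps x * g y) = (\<Sum>y\<in>B. (\<Sum>u\<in>B. eps u * Comult H a (u, y)) * g y)"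
    unfolding comul_def functional_Times sum_distrib_right by (subst sum.swap) (simp add: algebra_simps)
  also have "\<dots> = functional B g (bvec a)" by (simp add: ax functional_def)
  finally show ?thesis using that finite_B by (simp add: functional_bvec)
qed

lemma counit_right: "comul a (\<lambda>x y. eps y * g x) = g a" if "a \<in> B"
proof -
  have ax: "(\<Sum>u\<in>B. Comult H a (x, u) * eps u) = bvec a x" if "x \<in> B" for x
    using hopf \<open>a \<in> B\<close> that by (simp add: is_hopf_algebra_def Let_def)
  have "comul a (\<lambda>x y. eps y * g x) = (\<Sum>x\<in>B. (\<Sum>u\<in>B. Comult H a (x, u) * eps u) * g x)"
    unfolding comul_def functional_Times sum_distrib_right by (simp add: algebra_simps)
  also have "\<dots> = functional B g (bvec a)" by (simp add: ax functional_def)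
  finally show ?thesis using that finite_B by (simp add: functional_bvec)
qed

lemma mul_assoc: "mul a b (\<lambda>p. mul p c g) = mul b c (\<lambda>p. mul a p g)" if "a \<in> B" "b \<in> B" "c \<in> B"
proof -
  have "hmult H (Mult H a b) (bvec c) = hmult H (bvec a) (Mult H b c)"
    using hopf that by (simp add: is_hopf_algebra_def Let_def)
  then have "functional B g (hmult H (Mult H a b) (bvec c)) = functional B g (hmult H (bvec a) (Mult H b c))" by simp
  then show ?thesis using that finite_B by (simp add: functional_hmult functional_bvec mul_def)
qed

lemma one_mul_left: "one (\<lambda>p. mul p a g) = g a" if "a \<in> B"
proof -
  have "hmult H (Unit H) (bvec a) = bvec a" using hopf that by (simp add: is_hopf_algebra_def Let_def)
  then have "functional B g (hmult H (Unit H) (bvec a)) = functional B g (bvec a)" by simp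
  then show ?thesis using that finite_B by (simp add: functional_hmult functional_bvec one_def)
qed

lemma one_mul_right: "one (\<lambda>p. mul a p g) = g a" if "a \<in> B"
proof -
  have "hmult H (bvec a) (Unit H) = bvec a" using hopf that by (simp add: is_hopf_algebra_def Let_def)
  then have "functional B g (hmult H (bvec a) (Unit H)) = functional B g (bvec a)" by simp
  then show ?thesis using that finite_B by (simp add: functional_hmult functional_bvec one_def)
qed

lemma comul_mul_hom:
  assumes "a \<in> B" "b \<in> B"
  shows "mul a b (\<lambda>c. comul c g) = comul a (\<lambda>x y. comul b (\<lambda>x' y'. mul x x' (\<lambda>p. mul y y' (\<lambda>r. g p r))))"
proof -
  let ?g = "\<lambda>(x, y). g x y"
  have "linear_ext B (Comult H) (Mult H a b) = hmult2 H (Comult H a) (Comult H b)"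
    using hopf assms by (simp add: is_hopf_algebra_def Let_def)
  then have "functional (B \<times> B) ?g (linear_ext B (Comult H) (Mult H a b)) = functional (B \<times> B) ?g (hmult2 H (Comult H a) (Comult H b))"
    by simp
  then show ?thesis
    by (simp add: functional_linear_ext hmult2_def functional_bilinear_ext comul_def mul_def
        tensor_mult_def case_prod_unfold functional_tensor_vec[unfolded case_prod_unfold])
qed

lemma eps_mul: "mul a b eps = eps a * eps b" if "a \<in> B" "b \<in> B"
  using hopf that by (simp add: is_hopf_algebra_def Let_def mul_def)

lemma eps_one: "one eps = 1"
  using hopf by (simp add: is_hopf_algebra_def Let_def one_def)

lemma comul_one_hom: "one (\<lambda>p. comul p g) = one (\<lambda>x. one (\<lambda>y. g x y))"
proof -
  have "linear_ext B (Comult H) (Unit H) = tensor_vec (Unit H) (Unit H)"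
    using hopf by (simp add: is_hopf_algebra_def Let_def)
  then have "functional (B \<times> B) (\<lambda>(x, y). g x y) (linear_ext B (Comult H) (Unit H)) = functional (B \<times> B) (\<lambda>(x, y). g x y) (tensor_vec (Unit H) (Unit H))"
    by simp
  then show ?thesis by (simp add: functional_linear_ext functional_tensor_vec comul_def one_def)
qed

lemma antipode_l: "comul a (\<lambda>x y. anti x (\<lambda>p. mul p y g)) = eps a * one g"
  and antipode_r: "comul a (\<lambda>x y. anti y (\<lambda>p. mul x p g)) = eps a * one g" if "a \<in> B"
proof -
  have "linear_ext (B \<times> B) (\<lambda>(x, y). hmult H (Antipode H x) (bvec y)) (Comult H a) = (\<lambda>c. eps a * Unit H c)"
    using hopf that by (simp add: is_hopf_algebra_def Let_def)
  then have "functional B g (linear_ext (B \<times> B) (\<lambda>(x, y). hmult H (Antipode H x) (bvec y)) (Comult H a)) = functional B g (\<lambda>c. eps a * Unit H c)"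
    by simp
  moreover have "functional (B \<times> B) (\<lambda>p. functional B g (hmult H (Antipode H (fst p)) (bvec (snd p)))) (Comult H a)
     = comul a (\<lambda>x y. anti x (\<lambda>p. mul p y g))"
    unfolding comul_def
    by (rule functional_cong) (auto simp: functional_hmult functional_bvec finite_B anti_def)
  ultimately show "comul a (\<lambda>x y. anti x (\<lambda>p. mul p y g)) = eps a * one g"
    by (simp add: functional_linear_ext case_prod_unfold functional_of_scaled one_def)
  have "linear_ext (B \<times> B) (\<lambda>(x, y). hmult H (bvec x) (Antipode H y)) (Comult H a) = (\<lambda>c. eps a * Unit H c)"
    using hopf that by (simp add: is_hopf_algebra_def Let_def)
  then have "functional B g (linear_ext (B \<times> B) (\<lambda>(x, y). hmult H (bvec x) (Antipode H y)) (Comult H a)) = functional B g (\<lambda>c. eps a * Unit H c)"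
    by simp
  moreover have "functional (B \<times> B) (\<lambda>p. functional B g (hmult H (bvec (fst p)) (Antipode H (snd p)))) (Comult H a)
     = comul a (\<lambda>x y. anti y (\<lambda>p. mul x p g))"
    unfolding comul_def
    by (rule functional_cong) (auto simp: functional_hmult functional_bvec finite_B anti_def)
  ultimately show "comul a (\<lambda>x y. anti y (\<lambda>p. mul x p g)) = eps a * one g"
    by (simp add: functional_linear_ext case_prod_unfold functional_of_scaled one_def)
qed



lemma eps_anti: "anti a eps = eps a" if "a \<in> B"
proof -
  have "anti a eps = comul a (\<lambda>x y. eps y * anti x eps)" using that by (simp add: counit_right)
  also have "\<dots> = comul a (\<lambda>x y. anti x (\<lambda>p. mul p y eps))"
  proof (intro comul_cong)
    fix x y assume "x \<in> B" "y \<in> B"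
    then have "anti x (\<lambda>p. mul p y eps) = anti x (\<lambda>p. eps y * eps p)"
      by (intro anti_cong) (simp add: eps_mul mult.commute)
    then show "eps y * anti x eps = anti x (\<lambda>p. mul p y eps)" by (simp add: anti_scale)
  qed
  also have "\<dots> = eps a" using that by (simp add: antipode_l eps_one)
  finally show ?thesis .
qed

lemma anti_one: "one (\<lambda>p. anti p g) = one g"
proof -
  have "one (\<lambda>p. anti p g) = one (\<lambda>p. anti p (\<lambda>r. one (\<lambda>y. mul r y g)))"
    by (intro one_cong anti_cong) (simp add: one_mul_right)
  also have "\<dots> = one (\<lambda>a. comul a (\<lambda>x y. anti x (\<lambda>p. mul p y g)))"
    by (simp add: comul_one_hom one_anti)
  also have "\<dots> = one (\<lambda>a. one g * eps a)"
    by (intro one_cong) (simp add: antipode_l mult.commute)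
  also have "\<dots> = one g" by (simp add: one_scale eps_one)
  finally show ?thesis .
qed

lemma anti_rotate: "anti a (\<lambda>x. anti b (\<lambda>y. anti c (\<lambda>z. G x y z))) = anti b (\<lambda>y. anti c (\<lambda>z. anti a (\<lambda>x. G x y z)))"
  by (subst anti_anti) (rule anti_cong, rule anti_anti)

lemma anti_out:
  "mul a b (\<lambda>c. anti c (\<lambda>s. mul a' b' (\<lambda>p. anti d (\<lambda>r. anti e (\<lambda>v. K v r s p))))) =
   anti d (\<lambda>r. anti e (\<lambda>v. mul a b (\<lambda>c. mul a' b' (\<lambda>p. anti c (\<lambda>s. K v r s p)))))"
  by (simp only: anti_mul) (intro mul_cong, rule anti_rotate)

lemma coassoc_pair:
  assumes "a \<in> B" "b \<in> B"
  shows "comul a (\<lambda>a1 x. comul b (\<lambda>b1 y. comul x (\<lambda>a2 a3. comul y (\<lambda>b2 b3. G a1 a2 a3 b1 b2 b3)))) =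
    comul a (\<lambda>x a3. comul b (\<lambda>y b3. comul x (\<lambda>a1 a2. comul y (\<lambda>b1 b2. G a1 a2 a3 b1 b2 b3))))"
proof -
  have "comul a (\<lambda>a1 x. comul b (\<lambda>b1 y. comul x (\<lambda>a2 a3. comul y (\<lambda>b2 b3. G a1 a2 a3 b1 b2 b3)))) =
      comul a (\<lambda>a1 x. comul x (\<lambda>a2 a3. comul b (\<lambda>b1 y. comul y (\<lambda>b2 b3. G a1 a2 a3 b1 b2 b3))))"
    by (rule comul_cong) (rule comul_comul)
  also have "\<dots> = comul a (\<lambda>x a3. comul x (\<lambda>a1 a2. comul b (\<lambda>b1 y. comul y (\<lambda>b2 b3. G a1 a2 a3 b1 b2 b3))))"
    by (rule coassoc[OF assms(1), symmetric])
  also have "\<dots> = comul a (\<lambda>x a3. comul x (\<lambda>a1 a2. comul b (\<lambda>y b3. comul y (\<lambda>b1 b2. G a1 a2 a3 b1 b2 b3))))"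
    by (rule comul_cong, rule comul_cong) (rule coassoc[OF assms(2), symmetric])
  also have "\<dots> = comul a (\<lambda>x a3. comul b (\<lambda>y b3. comul x (\<lambda>a1 a2. comul y (\<lambda>b1 b2. G a1 a2 a3 b1 b2 b3))))"
    by (rule comul_cong) (rule comul_comul)
  finally show ?thesis .
qed

lemma antipode_r_pair:
  assumes "a \<in> B" "b \<in> B"
  shows "comul a (\<lambda>a2 a3. comul b (\<lambda>b2 b3. mul a2 b2 (\<lambda>p. anti b3 (\<lambda>r. mul p r (\<lambda>t. anti a3 (\<lambda>v. mul t v h)))))) =
    eps a * eps b * one h"
proof -
  have in1: "comul b (\<lambda>b2 b3. mul c b2 (\<lambda>p. anti b3 (\<lambda>r. mul p r k))) = eps b * k c" if "c \<in> B" for c k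
  proof -
    have "comul b (\<lambda>b2 b3. mul c b2 (\<lambda>p. anti b3 (\<lambda>r. mul p r k))) =
      comul b (\<lambda>b2 b3. anti b3 (\<lambda>r. mul b2 r (\<lambda>p. mul c p k)))"
      using that by (intro comul_cong) (simp add: anti_mul[symmetric] mul_assoc)
    also have "\<dots> = eps b * k c" using that assms by (simp add: antipode_r one_mul_right)
    finally show ?thesis .
  qed
  have "comul a (\<lambda>a2 a3. comul b (\<lambda>b2 b3. mul a2 b2 (\<lambda>p. anti b3 (\<lambda>r. mul p r (\<lambda>t. anti a3 (\<lambda>v. mul t v h)))))) =
    comul a (\<lambda>a2 a3. eps b * anti a3 (\<lambda>v. mul a2 v h))"
    by (intro comul_cong in1)
  then show ?thesis using assms by (simp add: comul_scale antipode_r)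
qed

text \<open>The antipode reverses products because both sides are convolution inverses of the multiplication
  \<open>H \<otimes> H \<rightarrow> H\<close>: insert \<open>a\<^sup>(\<^sup>2\<^sup>) b\<^sup>(\<^sup>2\<^sup>) S(b\<^sup>(\<^sup>3\<^sup>)) S(a\<^sup>(\<^sup>3\<^sup>))\<close> to the right of \<open>S(a\<^sup>(\<^sup>1\<^sup>) b\<^sup>(\<^sup>1\<^sup>))\<close>.\<close>

lemma anti_mul_rev:
  assumes "a \<in> B" "b \<in> B"
  shows "mul a b (\<lambda>c. anti c g) = anti a (\<lambda>p. anti b (\<lambda>r. mul r p g))"
proof -
  have "mul a b (\<lambda>c. anti c g) = comul a (\<lambda>a1 a2. eps a2 * comul b (\<lambda>b1 b2. eps b2 * mul a1 b1 (\<lambda>c. anti c g)))"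
    using assms by (simp add: counit_right)
  also have "\<dots> = comul a (\<lambda>a1 x. comul b (\<lambda>b1 y. mul a1 b1 (\<lambda>c. anti c (\<lambda>s. eps x * eps y * one (\<lambda>t. mul s t g)))))"
    by (intro comul_cong) (simp add: scales one_mul_right mult.assoc)
  also have "\<dots> = comul a (\<lambda>a1 x. comul b (\<lambda>b1 y. mul a1 b1 (\<lambda>c. anti c (\<lambda>s.
      comul x (\<lambda>a2 a3. comul y (\<lambda>b2 b3. mul a2 b2 (\<lambda>p. anti b3 (\<lambda>r. mul p r (\<lambda>t. anti a3 (\<lambda>v. mul t v (\<lambda>w. mul s w g)))))))))))"
    by (intro comul_cong mul_cong anti_cong) (simp add: antipode_r_pair)
  also have "\<dots> = comul a (\<lambda>a1 x. comul b (\<lambda>b1 y. mul a1 b1 (\<lambda>c. anti c (\<lambda>s.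
      comul x (\<lambda>a2 a3. comul y (\<lambda>b2 b3. mul a2 b2 (\<lambda>p. anti b3 (\<lambda>r. anti a3 (\<lambda>v. mul s p (\<lambda>z. mul z r (\<lambda>t. mul t v g)))))))))))"
  proof (intro comul_cong mul_cong anti_cong)
    fix s p b3 r a3 assume B: "s \<in> B" "p \<in> B" "r \<in> B"
    have "mul p r (\<lambda>t. anti a3 (\<lambda>v. mul t v (\<lambda>w. mul s w g))) = anti a3 (\<lambda>v. mul p r (\<lambda>t. mul s t (\<lambda>y. mul y v g)))"
      using B by (simp only: anti_mul[symmetric]) (intro anti_cong mul_cong mul_assoc[symmetric])
    also have "\<dots> = anti a3 (\<lambda>v. mul s p (\<lambda>z. mul z r (\<lambda>t. mul t v g)))"
      using B by (intro anti_cong) (rule mul_assoc[symmetric])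
    finally show "mul p r (\<lambda>t. anti a3 (\<lambda>v. mul t v (\<lambda>w. mul s w g))) = anti a3 (\<lambda>v. mul s p (\<lambda>z. mul z r (\<lambda>t. mul t v g)))" .
  qed
  also have "\<dots> = comul a (\<lambda>a1 x. comul b (\<lambda>b1 y. comul x (\<lambda>a2 a3. comul y (\<lambda>b2 b3. anti b3 (\<lambda>r. anti a3 (\<lambda>v.
      mul a1 b1 (\<lambda>c. mul a2 b2 (\<lambda>p. anti c (\<lambda>s. mul s p (\<lambda>z. mul z r (\<lambda>t. mul t v g)))))))))))"
  proof (rule comul_cong, rule comul_cong)
    fix a1 x b1 y
    let ?K = "\<lambda>v r s p. mul s p (\<lambda>z. mul z r (\<lambda>t. mul t v g))"
    have "mul a1 b1 (\<lambda>c. anti c (\<lambda>s. mul a2 b2 (\<lambda>p. anti b3 (\<lambda>r. anti a3 (\<lambda>v. ?K v r s p))))) =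
        anti b3 (\<lambda>r. anti a3 (\<lambda>v. mul a1 b1 (\<lambda>c. mul a2 b2 (\<lambda>p. anti c (\<lambda>s. ?K v r s p)))))" for a2 a3 b2 b3
      by (rule anti_out)
    then show "mul a1 b1 (\<lambda>c. anti c (\<lambda>s. comul x (\<lambda>a2 a3. comul y (\<lambda>b2 b3. mul a2 b2 (\<lambda>p. anti b3 (\<lambda>r. anti a3 (\<lambda>v. ?K v r s p))))))) =
        comul x (\<lambda>a2 a3. comul y (\<lambda>b2 b3. anti b3 (\<lambda>r. anti a3 (\<lambda>v. mul a1 b1 (\<lambda>c. mul a2 b2 (\<lambda>p. anti c (\<lambda>s. ?K v r s p)))))))"
      by (simp only: comul_mul[symmetric] comul_anti[symmetric])
  qed
  also have "\<dots> = comul a (\<lambda>x a3. comul b (\<lambda>y b3. comul x (\<lambda>a1 a2. comul y (\<lambda>b1 b2. anti b3 (\<lambda>r. anti a3 (\<lambda>v.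
      mul a1 b1 (\<lambda>c. mul a2 b2 (\<lambda>p. anti c (\<lambda>s. mul s p (\<lambda>z. mul z r (\<lambda>t. mul t v g)))))))))))"
    by (rule coassoc_pair[OF assms])
  also have "\<dots> = comul a (\<lambda>x a3. comul b (\<lambda>y b3. anti b3 (\<lambda>r. anti a3 (\<lambda>v.
      mul x y (\<lambda>c. comul c (\<lambda>c1 c2. anti c1 (\<lambda>s. mul s c2 (\<lambda>z. mul z r (\<lambda>t. mul t v g)))))))))"
    by (intro comul_cong) (simp add: comul_anti comul_mul_hom)
  also have "\<dots> = comul a (\<lambda>x a3. comul b (\<lambda>y b3. anti b3 (\<lambda>r. anti a3 (\<lambda>v. eps x * (eps y * mul r v g)))))"
  proof (intro comul_cong anti_cong)
    fix x y r v assume "x \<in> B" "y \<in> B" "r \<in> B" "v \<in> B"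
    then have "mul x y (\<lambda>c. comul c (\<lambda>c1 c2. anti c1 (\<lambda>s. mul s c2 (\<lambda>z. mul z r (\<lambda>t. mul t v g))))) = mul x y (\<lambda>c. mul r v g * eps c)"
      by (intro mul_cong) (simp add: antipode_l one_mul_left mult.commute)
    also have "\<dots> = eps x * (eps y * mul r v g)"
      using \<open>x \<in> B\<close> \<open>y \<in> B\<close> by (simp only: mul_scale eps_mul) (simp add: ac_simps)
    finally show "mul x y (\<lambda>c. comul c (\<lambda>c1 c2. anti c1 (\<lambda>s. mul s c2 (\<lambda>z. mul z r (\<lambda>t. mul t v g))))) = eps x * (eps y * mul r v g)" .
  qed
  also have "\<dots> = anti a (\<lambda>p. anti b (\<lambda>r. mul r p g))"
    using assms by (simp add: scales counit_left) (rule anti_anti)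
  finally show ?thesis .
qed

lemma antipode_r_twice:
  assumes "a \<in> B"
  shows "comul a (\<lambda>a2 z. comul z (\<lambda>a3 z'. comul z' (\<lambda>a4 a5. anti a4 (\<lambda>r. anti a5 (\<lambda>p. mul a2 p (\<lambda>x. mul a3 r (\<lambda>y. h x y))))))) =
    eps a * one (\<lambda>x. one (\<lambda>y. h x y))"
proof -
  have in1: "comul z (\<lambda>a3 z'. comul z' (\<lambda>a4 a5. anti a4 (\<lambda>r. anti a5 (\<lambda>p. mul a2 p (\<lambda>x. mul a3 r (\<lambda>y. h x y)))))) =
     anti z (\<lambda>p. mul a2 p (\<lambda>x. one (\<lambda>y. h x y)))" if "a2 \<in> B" "z \<in> B" for a2 z
  proof -
    have "comul z (\<lambda>a3 z'. comul z' (\<lambda>a4 a5. anti a4 (\<lambda>r. anti a5 (\<lambda>p. mul a2 p (\<lambda>x. mul a3 r (\<lambda>y. h x y)))))) =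
      comul z (\<lambda>w a5. comul w (\<lambda>a3 a4. anti a4 (\<lambda>r. anti a5 (\<lambda>p. mul a2 p (\<lambda>x. mul a3 r (\<lambda>y. h x y))))))"
      using that by (rule_tac coassoc[symmetric])
    also have "\<dots> = comul z (\<lambda>w a5. comul w (\<lambda>a3 a4. anti a5 (\<lambda>p. mul a2 p (\<lambda>x. anti a4 (\<lambda>r. mul a3 r (\<lambda>y. h x y))))))"
      by (intro comul_cong) (subst anti_anti, simp only: anti_mul)
    also have "\<dots> = comul z (\<lambda>w a5. eps w * anti a5 (\<lambda>p. mul a2 p (\<lambda>x. one (\<lambda>y. h x y))))"
      by (intro comul_cong) (simp add: comul_anti comul_mul antipode_r scales)
    finally show ?thesis using that by (simp add: counit_left)
  qed
  then show ?thesis using assms by (simp add: antipode_r)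
qed

text \<open>Dually, the antipode reverses coproducts: \<open>\<Delta>(S(a\<^sup>(\<^sup>1\<^sup>)))\<close> is multiplied by
  \<open>a\<^sup>(\<^sup>2\<^sup>) S(a\<^sup>(\<^sup>5\<^sup>)) \<otimes> a\<^sup>(\<^sup>3\<^sup>) S(a\<^sup>(\<^sup>4\<^sup>))\<close>.\<close>

lemma comul_anti_rev:
  assumes "a \<in> B"
  shows "anti a (\<lambda>s. comul s g) = comul a (\<lambda>x y. anti x (\<lambda>p. anti y (\<lambda>r. g r p)))"
proof -
  have "anti a (\<lambda>s. comul s g) = comul a (\<lambda>a1 z. eps z * anti a1 (\<lambda>s. comul s g))"
    using assms by (simp add: counit_right)
  also have "\<dots> = comul a (\<lambda>a1 z. anti a1 (\<lambda>s. comul s (\<lambda>u w. eps z * one (\<lambda>x. one (\<lambda>y. mul u x (\<lambda>u'. mul w y (\<lambda>w'. g u' w')))))))"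
    by (intro comul_cong) (simp add: scales one_mul one_mul_right)
  also have "\<dots> = comul a (\<lambda>a1 z. anti a1 (\<lambda>s. comul s (\<lambda>u w.
      comul z (\<lambda>a2 z2. comul z2 (\<lambda>a3 z3. comul z3 (\<lambda>a4 a5. anti a4 (\<lambda>r. anti a5 (\<lambda>p. 
        mul a2 p (\<lambda>x. mul a3 r (\<lambda>y. mul u x (\<lambda>u'. mul w y (\<lambda>w'. g u' w'))))))))))))"
    by (intro comul_cong anti_cong) (simp add: antipode_r_twice)
  also have "\<dots> = comul a (\<lambda>a1 z. anti a1 (\<lambda>s. comul s (\<lambda>u w.
      comul z (\<lambda>a2 z2. comul z2 (\<lambda>a3 z3. comul z3 (\<lambda>a4 a5. anti a4 (\<lambda>r. anti a5 (\<lambda>p. 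
        mul u a2 (\<lambda>t. mul w a3 (\<lambda>t'. mul t p (\<lambda>u'. mul t' r (\<lambda>w'. g u' w'))))))))))))"
  proof (intro comul_cong anti_cong)
    fix u w a2 a3 p r assume B: "u \<in> B" "w \<in> B" "a2 \<in> B" "a3 \<in> B" "p \<in> B" "r \<in> B"
    have "mul a2 p (\<lambda>x. mul a3 r (\<lambda>y. mul u x (\<lambda>u'. mul w y (\<lambda>w'. g u' w')))) =
        mul a2 p (\<lambda>x. mul u x (\<lambda>u'. mul a3 r (\<lambda>y. mul w y (\<lambda>w'. g u' w'))))"
      by (intro mul_cong) (rule mul_mul)
    also have "\<dots> = mul u a2 (\<lambda>t. mul t p (\<lambda>u'. mul w a3 (\<lambda>t'. mul t' r (\<lambda>w'. g u' w'))))"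
      using B by (simp add: mul_assoc)
    also have "\<dots> = mul u a2 (\<lambda>t. mul w a3 (\<lambda>t'. mul t p (\<lambda>u'. mul t' r (\<lambda>w'. g u' w'))))"
      by (intro mul_cong) (rule mul_mul)
    finally show "mul a2 p (\<lambda>x. mul a3 r (\<lambda>y. mul u x (\<lambda>u'. mul w y (\<lambda>w'. g u' w')))) = \<dots>" .
  qed
  also have "\<dots> = comul a (\<lambda>a1 z. comul z (\<lambda>a2 z2. comul z2 (\<lambda>a3 z3. anti a1 (\<lambda>s. comul z3 (\<lambda>a4 a5. comul s (\<lambda>u w.
      anti a4 (\<lambda>r. anti a5 (\<lambda>p. mul u a2 (\<lambda>t. mul w a3 (\<lambda>t'. mul t p (\<lambda>u'. mul t' r (\<lambda>w'. g u' w'))))))))))))"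
  proof (intro comul_cong)
    fix a1 z
    let ?F = "\<lambda>a2 a3 a4 a5 u w. anti a4 (\<lambda>r. anti a5 (\<lambda>p. mul u a2 (\<lambda>t. mul w a3 (\<lambda>t'. mul t p (\<lambda>u'. mul t' r (\<lambda>w'. g u' w'))))))"
    have "comul s (\<lambda>u w. comul z (\<lambda>a2 z2. comul z2 (\<lambda>a3 z3. comul z3 (\<lambda>a4 a5. ?F a2 a3 a4 a5 u w)))) =
        comul z (\<lambda>a2 z2. comul z2 (\<lambda>a3 z3. comul z3 (\<lambda>a4 a5. comul s (\<lambda>u w. ?F a2 a3 a4 a5 u w))))" for s
      apply (subst comul_comul[of s z])
      apply (rule comul_cong)
      apply (subst comul_comul[of s])
      apply (rule comul_cong)
      apply (rule comul_comul)
      done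
    then show "anti a1 (\<lambda>s. comul s (\<lambda>u w. comul z (\<lambda>a2 z2. comul z2 (\<lambda>a3 z3. comul z3 (\<lambda>a4 a5. ?F a2 a3 a4 a5 u w))))) =
        comul z (\<lambda>a2 z2. comul z2 (\<lambda>a3 z3. anti a1 (\<lambda>s. comul z3 (\<lambda>a4 a5. comul s (\<lambda>u w. ?F a2 a3 a4 a5 u w)))))"
      by (simp only: comul_anti)
  qed
  also have "\<dots> = comul a (\<lambda>a1 z. comul z (\<lambda>b z3. comul b (\<lambda>a2 a3. anti a1 (\<lambda>s. comul z3 (\<lambda>a4 a5. comul s (\<lambda>u w.
      anti a4 (\<lambda>r. anti a5 (\<lambda>p. mul u a2 (\<lambda>t. mul w a3 (\<lambda>t'. mul t p (\<lambda>u'. mul t' r (\<lambda>w'. g u' w'))))))))))))"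
    by (rule comul_cong) (rule coassoc[symmetric])
  also have "\<dots> = comul a (\<lambda>x z3. comul x (\<lambda>a1 b. comul b (\<lambda>a2 a3. anti a1 (\<lambda>s. comul z3 (\<lambda>a4 a5. comul s (\<lambda>u w.
      anti a4 (\<lambda>r. anti a5 (\<lambda>p. mul u a2 (\<lambda>t. mul w a3 (\<lambda>t'. mul t p (\<lambda>u'. mul t' r (\<lambda>w'. g u' w'))))))))))))"
    by (rule coassoc[symmetric, OF assms])
  also have "\<dots> = comul a (\<lambda>x z3. eps x * comul z3 (\<lambda>a4 a5. anti a4 (\<lambda>r. anti a5 (\<lambda>p. g p r))))"
  proof (intro comul_cong)
    fix x z3 assume x: "x \<in> B" and z3: "z3 \<in> B"
    let ?K = "\<lambda>p r t t'. mul t p (\<lambda>u'. mul t' r (\<lambda>w'. g u' w'))"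
    have "comul x (\<lambda>a1 b. comul b (\<lambda>a2 a3. anti a1 (\<lambda>s. comul z3 (\<lambda>a4 a5. comul s (\<lambda>u w.
        anti a4 (\<lambda>r. anti a5 (\<lambda>p. mul u a2 (\<lambda>t. mul w a3 (\<lambda>t'. ?K p r t t')))))))))
      = comul z3 (\<lambda>a4 a5. comul x (\<lambda>a1 b. comul b (\<lambda>a2 a3. anti a1 (\<lambda>s. comul s (\<lambda>u w.
        anti a4 (\<lambda>r. anti a5 (\<lambda>p. mul u a2 (\<lambda>t. mul w a3 (\<lambda>t'. ?K p r t t')))))))))"
      by (simp only: comul_anti[symmetric]) (subst comul_comul[of z3 x], intro comul_cong, rule comul_comul)
    also have "\<dots> = comul z3 (\<lambda>a4 a5. anti a4 (\<lambda>r. anti a5 (\<lambda>p. comul x (\<lambda>a1 b. anti a1 (\<lambda>s. comul b (\<lambda>a2 a3. comul s (\<lambda>u w.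
        mul u a2 (\<lambda>t. mul w a3 (\<lambda>t'. ?K p r t t')))))))))"
    proof (intro comul_cong)
      fix a4 a5
      let ?G = "\<lambda>p r a2 a3 u w. mul u a2 (\<lambda>t. mul w a3 (\<lambda>t'. ?K p r t t'))"
      have "comul x (\<lambda>a1 b. comul b (\<lambda>a2 a3. anti a1 (\<lambda>s. comul s (\<lambda>u w. anti a4 (\<lambda>r. anti a5 (\<lambda>p. ?G p r a2 a3 u w))))))
          = comul x (\<lambda>a1 b. comul b (\<lambda>a2 a3. anti a4 (\<lambda>r. anti a5 (\<lambda>p. anti a1 (\<lambda>s. comul s (\<lambda>u w. ?G p r a2 a3 u w))))))"
        by (rule comul_cong, rule comul_cong) (simp only: comul_anti, rule anti_rotate)
      then show "comul x (\<lambda>a1 b. comul b (\<lambda>a2 a3. anti a1 (\<lambda>s. comul s (\<lambda>u w. anti a4 (\<lambda>r. anti a5 (\<lambda>p. ?G p r a2 a3 u w))))))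
          = anti a4 (\<lambda>r. anti a5 (\<lambda>p. comul x (\<lambda>a1 b. anti a1 (\<lambda>s. comul b (\<lambda>a2 a3. comul s (\<lambda>u w. ?G p r a2 a3 u w))))))"
        by (simp only: comul_anti)
    qed
    also have "\<dots> = comul z3 (\<lambda>a4 a5. anti a4 (\<lambda>r. anti a5 (\<lambda>p. comul x (\<lambda>a1 b. anti a1 (\<lambda>s. mul s b (\<lambda>c. comul c (\<lambda>t t'. ?K p r t t')))))))"
      by (intro comul_cong anti_cong) (simp add: comul_mul_hom, rule comul_comul)
    also have "\<dots> = comul z3 (\<lambda>a4 a5. anti a4 (\<lambda>r. anti a5 (\<lambda>p. eps x * g p r)))"
      using x by (intro comul_cong anti_cong) (simp add: antipode_l comul_one_hom one_mul one_mul_left)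
    finally show "comul x (\<lambda>a1 b. comul b (\<lambda>a2 a3. anti a1 (\<lambda>s. comul z3 (\<lambda>a4 a5. comul s (\<lambda>u w.
        anti a4 (\<lambda>r. anti a5 (\<lambda>p. mul u a2 (\<lambda>t. mul w a3 (\<lambda>t'. ?K p r t t'))))))))) =
        eps x * comul z3 (\<lambda>a4 a5. anti a4 (\<lambda>r. anti a5 (\<lambda>p. g p r)))"
      by (simp add: scales)
  qed
  also have "\<dots> = comul a (\<lambda>x y. anti x (\<lambda>p. anti y (\<lambda>r. g r p)))"
    using assms by (simp add: counit_left)
  finally show ?thesis .
qed




section \<open>The extra degeneracy\<close>

lemma functional_zero: "functional X (\<lambda>x. 0) f = 0"
  by (simp add: functional_def)

lemma comul_functional: "comul a (\<lambda>x y. functional X (\<lambda>z. F z x y) f) = functional X (\<lambda>z. comul a (F z)) f"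
  using functional_swap[of "B \<times> B" X "\<lambda>p z. F z (fst p) (snd p)" f "Comult H a"]
  by (simp add: comul_def case_prod_unfold)

lemma mul_functional: "mul a b (\<lambda>x. functional X (\<lambda>z. F' z x) f) = functional X (\<lambda>z. mul a b (F' z)) f"
  and anti_functional: "anti a (\<lambda>x. functional X (\<lambda>z. F' z x) f) = functional X (\<lambda>z. anti a (F' z)) f"
  and one_functional: "one (\<lambda>x. functional X (\<lambda>z. F' z x) f) = functional X (\<lambda>z. one (F' z)) f"
  unfolding mul_def anti_def one_def by (rule functional_swap)+

text \<open>Coefficient form of \<open>b \<otimes> v \<mapsto> b S(a\<^sup>(\<^sup>1\<^sup>)) \<otimes> a\<^sup>(\<^sup>2\<^sup>) \<otimes> v\<close>.  Since the antipode reverses products, the tensor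
  \<open>\<pi> S(w\<^sup>(\<^sup>1\<^sup>)) \<otimes> w\<^sup>(\<^sup>2\<^sup>)\<close> arises from \<open>\<pi>\<close> by absorbing the letters of \<open>w\<close> in this way, the last one first.  The
  construction of the cyclic operator by such steps makes every identity below an induction over the word.\<close>

definition absorb where
  "absorb a \<phi> u = (case u of [] \<Rightarrow> 0 | b # v \<Rightarrow> comul a (\<lambda>x c. anti x (\<lambda>p. mul b p (\<lambda>r. \<phi> (r # c # v)))))"

lemma absorb_Cons: "absorb a \<phi> (b # v) = comul a (\<lambda>x c. anti x (\<lambda>p. mul b p (\<lambda>r. \<phi> (r # c # v))))"
  by (simp add: absorb_def)

lemma absorb_cong:
  assumes "\<And>u. length u = Suc (length v) \<Longrightarrow> set u \<subseteq> B \<Longrightarrow> \<phi> u = \<psi> u" "set v \<subseteq> B"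
  shows "absorb a \<phi> v = absorb a \<psi> v"
  using assms by (cases v) (auto simp: absorb_def intro!: comul_cong anti_cong mul_cong)

lemma absorb_functional: "absorb a (\<lambda>u. functional X (\<lambda>x. F x u) f) v = functional X (\<lambda>x. absorb a (F x) v) f"
  by (cases v) (simp_all add: absorb_def functional_zero comul_functional anti_functional mul_functional)

text \<open>The inner face: \<open>\<phi>\<close> evaluated after the letters at positions \<open>i\<close> and \<open>i + 1\<close> have been multiplied.\<close>

primrec merge :: "nat \<Rightarrow> ('b list \<Rightarrow> 'k) \<Rightarrow> 'b list \<Rightarrow> 'k" where
  "merge 0 \<phi> w = (case w of a # b # v \<Rightarrow> mul a b (\<lambda>c. \<phi> (c # v)) | _ \<Rightarrow> 0)"
| "merge (Suc i) \<phi> w = (case w of a # v \<Rightarrow> merge i (\<lambda>u. \<phi> (a # u)) v | _ \<Rightarrow> 0)"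

lemma merge_functional: "merge i (\<lambda>u. functional X (\<lambda>x. F x u) f) v = functional X (\<lambda>x. merge i (F x) v) f"
  by (induction i arbitrary: F v) (auto simp: functional_zero mul_functional split: list.split)

lemma merge_cong:
  assumes "\<And>u. Suc (length u) = length w \<Longrightarrow> set u \<subseteq> B \<Longrightarrow> \<phi> u = \<psi> u" "set w \<subseteq> B"
  shows "merge i \<phi> w = merge i \<psi> w"
  using assms
proof (induction i arbitrary: \<phi> \<psi> w)
  case 0
  show ?case
  proof (cases "\<exists>a b v. w = a # b # v")
    case True
    then obtain a b v where w: "w = a # b # v" by blast
    have "mul a b (\<lambda>c. \<phi> (c # v)) = mul a b (\<lambda>c. \<psi> (c # v))"
      using 0 w by (intro mul_cong) simp
    then show ?thesis by (simp only: w merge.simps list.case)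
  next
    case False
    then show ?thesis by (auto split: list.split)
  qed
next
  case (Suc i)
  show ?case
  proof (cases w)
    case (Cons a v)
    have "merge i (\<lambda>u. \<phi> (a # u)) v = merge i (\<lambda>u. \<psi> (a # u)) v"
      using Suc.prems Cons by (intro Suc.IH) auto
    then show ?thesis by (simp only: Cons merge.simps list.case)
  qed simp
qed

end

locale hopf_grouplike = hopf_algebra H for H :: "('b, 'k::comm_ring_1) hopf" +
  fixes \<pi> :: "'b \<Rightarrow> 'k"
  assumes grouplike: "functional (Basis H) (\<lambda>p. comul p g) \<pi> = functional (Basis H) (\<lambda>x. functional (Basis H) (\<lambda>y. g x y) \<pi>) \<pi>"
    and grouplike_eps: "functional (Basis H) (Counit H) \<pi> = 1"
begin

text \<open>The map \<open>w \<mapsto> \<pi> S(w\<^sup>(\<^sup>1\<^sup>)) \<otimes> w\<^sup>(\<^sup>2\<^sup>)\<close>, composed with \<open>\<phi>\<close>.\<close>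

definition xdegen :: "('b list \<Rightarrow> 'k) \<Rightarrow> 'b list \<Rightarrow> 'k" where
  "xdegen \<phi> w = functional B (\<lambda>p. fold absorb w \<phi> [p]) \<pi>"

lemma xdegen_Nil: "xdegen \<phi> [] = functional B (\<lambda>p. \<phi> [p]) \<pi>"
  and xdegen_Cons: "xdegen \<phi> (a # w) = xdegen (absorb a \<phi>) w"
  by (simp_all add: xdegen_def)

lemma xdegen_cong:
  assumes "\<And>u. length u = Suc (length w) \<Longrightarrow> set u \<subseteq> B \<Longrightarrow> \<phi> u = \<psi> u" "set w \<subseteq> B"
  shows "xdegen \<phi> w = xdegen \<psi> w"
  using assms
proof (induction w arbitrary: \<phi> \<psi>)
  case Nil
  then show ?case by (auto simp: xdegen_Nil intro!: functional_cong)
next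
  case (Cons a w)
  show ?case unfolding xdegen_Cons using Cons.prems by (intro Cons.IH absorb_cong) auto
qed

lemma xdegen_functional: "xdegen (\<lambda>u. functional X (\<lambda>x. F x u) f) w = functional X (\<lambda>x. xdegen (F x) w) f"
  by (induction w arbitrary: F) (simp_all add: xdegen_Nil xdegen_Cons absorb_functional[abs_def] functional_swap[of B])

lemma xdegen_comul: "xdegen (\<lambda>u. comul a (\<lambda>x y. F2 x y u)) w = comul a (\<lambda>x y. xdegen (F2 x y) w)"
  using xdegen_functional[of "B \<times> B" "\<lambda>p. F2 (fst p) (snd p)" "Comult H a" w] by (simp add: comul_def case_prod_unfold)

lemma xdegen_mul: "xdegen (\<lambda>u. mul a b (\<lambda>x. F x u)) w = mul a b (\<lambda>x. xdegen (F x) w)"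
  and xdegen_anti: "xdegen (\<lambda>u. anti a (\<lambda>x. F x u)) w = anti a (\<lambda>x. xdegen (F x) w)"
  and xdegen_one: "xdegen (\<lambda>u. one (\<lambda>x. F x u)) w = one (\<lambda>x. xdegen (F x) w)"
  unfolding mul_def anti_def one_def by (rule xdegen_functional)+

lemma xdegen_scale: "xdegen (\<lambda>u. c * \<phi> u) w = c * xdegen \<phi> w"
  using xdegen_functional[of "{()}" "\<lambda>_. \<phi>" "\<lambda>_. c"] by (simp add: functional_def)

text \<open>The counit of the new tensor factor is \<open>\<epsilon>(\<pi>) \<epsilon>(S(w\<^sup>(\<^sup>1\<^sup>))) = \<epsilon>(w\<^sup>(\<^sup>1\<^sup>))\<close>.\<close>

lemma xdegen_counit:
  "set w \<subseteq> B \<Longrightarrow> xdegen (\<lambda>u. eps (hd u) * \<phi> (tl u)) w = \<phi> w"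
proof (induction w arbitrary: \<phi>)
  case Nil
  then show ?case using grouplike_eps functional_scale[of B "\<phi> []" eps \<pi>] by (simp add: xdegen_Nil mult.commute)
next
  case (Cons a w)
  have "xdegen (\<lambda>u. eps (hd u) * \<phi> (tl u)) (a # w) = xdegen (\<lambda>u. eps (hd u) * \<phi> (a # tl u)) w"
    unfolding xdegen_Cons
  proof (rule xdegen_cong)
    fix u assume u: "length u = Suc (length w)" "set u \<subseteq> B"
    then obtain b v where bv: "u = b # v" "b \<in> B" by (cases u) auto
    have "absorb a (\<lambda>u. eps (hd u) * \<phi> (tl u)) u = comul a (\<lambda>x c. anti x (\<lambda>p. \<phi> (c # v) * eps b * eps p))"
      unfolding bv absorb_Cons
    proof (intro comul_cong anti_cong)
      fix c p assume "p \<in> B"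
      have "mul b p (\<lambda>r. eps (hd (r # c # v)) * \<phi> (tl (r # c # v))) = mul b p (\<lambda>r. \<phi> (c # v) * eps r)"
        by (simp add: mult.commute)
      then show "mul b p (\<lambda>r. eps (hd (r # c # v)) * \<phi> (tl (r # c # v))) = \<phi> (c # v) * eps b * eps p"
        using bv \<open>p \<in> B\<close> by (simp add: mul_scale eps_mul)
    qed
    also have "\<dots> = comul a (\<lambda>x c. eps b * (eps x * \<phi> (c # v)))"
      by (intro comul_cong) (subst anti_scale, simp add: eps_anti ac_simps)
    also have "\<dots> = eps (hd u) * \<phi> (a # tl u)"
      using Cons.prems by (simp add: comul_scale counit_left[of a "\<lambda>c. \<phi> (c # v)"] bv)
    finally show "absorb a (\<lambda>u. eps (hd u) * \<phi> (tl u)) u = eps (hd u) * \<phi> (a # tl u)" .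
  qed (use Cons.prems in auto)
  then show ?case using Cons.IH[of "\<lambda>v. \<phi> (a # v)"] Cons.prems by simp
qed

text \<open>Multiplying the new factor with the first old one gives \<open>S(a\<^sup>(\<^sup>1\<^sup>)) a\<^sup>(\<^sup>2\<^sup>) = \<epsilon>(a)\<close>.\<close>

lemma xdegen_merge_0:
  assumes "set (a # w) \<subseteq> B"
  shows "xdegen (merge 0 \<phi>) (a # w) = eps a * xdegen \<phi> w"
proof -
  have "xdegen (absorb a (merge 0 \<phi>)) w = xdegen (\<lambda>u. eps a * \<phi> u) w"
  proof (rule xdegen_cong)
    fix u assume u: "length u = Suc (length w)" "set u \<subseteq> B"
    then obtain b v where bv: "u = b # v" "b \<in> B" by (cases u) auto
    have "absorb a (merge 0 \<phi>) u = comul a (\<lambda>x c. anti x (\<lambda>p. mul p c (\<lambda>m. mul b m (\<lambda>z. \<phi> (z # v)))))"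
      unfolding bv absorb_Cons using bv by (intro comul_cong anti_cong) (simp add: mul_assoc)
    also have "\<dots> = eps a * \<phi> u" using assms bv by (simp add: antipode_l one_mul_right)
    finally show "absorb a (merge 0 \<phi>) u = eps a * \<phi> u" .
  qed (use assms in auto)
  then show ?thesis by (simp add: xdegen_Cons xdegen_scale)
qed

text \<open>Absorbing a product amounts to absorbing both factors and multiplying them, as \<open>\<Delta>\<close> is multiplicative and
  \<open>S\<close> antimultiplicative.\<close>

lemma absorb_mul:
  assumes "a \<in> B" "b \<in> B" "y \<in> B"
  shows "mul a b (\<lambda>c. absorb c \<phi> (y # u)) = absorb b (absorb a (merge (Suc 0) \<phi>)) (y # u)"
proof -
  have "mul a b (\<lambda>c. absorb c \<phi> (y # u)) = comul a (\<lambda>a1 a2. comul b (\<lambda>b1 b2. mul a1 b1 (\<lambda>x. mul a2 b2 (\<lambda>z. anti x (\<lambda>p. mul y p (\<lambda>t. \<phi> (t # z # u)))))))"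
    using assms by (simp add: absorb_Cons comul_mul_hom)
  also have "\<dots> = comul a (\<lambda>a1 a2. comul b (\<lambda>b1 b2. mul a1 b1 (\<lambda>x. anti x (\<lambda>p. mul y p (\<lambda>t. mul a2 b2 (\<lambda>z. \<phi> (t # z # u)))))))"
    by (intro comul_cong mul_cong) (simp only: anti_mul[symmetric] mul_mul[of _ _ y])
  also have "\<dots> = comul a (\<lambda>a1 a2. comul b (\<lambda>b1 b2. anti a1 (\<lambda>p. anti b1 (\<lambda>r. mul y r (\<lambda>s. mul s p (\<lambda>t. mul a2 b2 (\<lambda>z. \<phi> (t # z # u))))))))"
    using assms by (intro comul_cong) (simp add: anti_mul_rev mul_assoc)
  also have "\<dots> = comul b (\<lambda>b1 b2. comul a (\<lambda>a1 a2. anti a1 (\<lambda>p. anti b1 (\<lambda>r. mul y r (\<lambda>s. mul s p (\<lambda>t. mul a2 b2 (\<lambda>z. \<phi> (t # z # u))))))))"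
    by (rule comul_comul)
  also have "\<dots> = comul b (\<lambda>b1 b2. comul a (\<lambda>a1 a2. anti b1 (\<lambda>r. anti a1 (\<lambda>p. mul y r (\<lambda>s. mul s p (\<lambda>t. mul a2 b2 (\<lambda>z. \<phi> (t # z # u))))))))"
    by (rule comul_cong, rule comul_cong) (rule anti_anti)
  also have "\<dots> = absorb b (absorb a (merge (Suc 0) \<phi>)) (y # u)"
    unfolding absorb_Cons by (simp add: comul_anti comul_mul anti_mul)
  finally show ?thesis .
qed

lemma xdegen_merge_Suc:
  assumes "set w \<subseteq> B" "Suc i < length w"
  shows "xdegen (merge (Suc i) \<phi>) w = merge i (xdegen \<phi>) w"
  using assms
proof (induction i arbitrary: \<phi> w)
  case 0
  then obtain a b v where w: "w = a # b # v" by (cases w; cases "tl w") auto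
  have "merge 0 (xdegen \<phi>) w = xdegen (\<lambda>u. mul a b (\<lambda>c. absorb c \<phi> u)) v"
    by (simp add: w xdegen_Cons xdegen_mul)
  also have "\<dots> = xdegen (absorb b (absorb a (merge (Suc 0) \<phi>))) v"
  proof (rule xdegen_cong)
    fix u assume "length u = Suc (length v)" "set u \<subseteq> B"
    then show "mul a b (\<lambda>c. absorb c \<phi> u) = absorb b (absorb a (merge (Suc 0) \<phi>)) u"
      using 0 w by (cases u) (auto intro!: absorb_mul)
  qed (use 0 w in auto)
  finally show ?case unfolding w xdegen_Cons by (rule sym)
next
  case (Suc i)
  then obtain a v where w: "w = a # v" by (cases w) auto
  have "merge (Suc i) (xdegen \<phi>) w = xdegen (merge (Suc i) (absorb a \<phi>)) v"
    using Suc by (simp add: w xdegen_Cons Suc.IH)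
  also have "\<dots> = xdegen (absorb a (merge (Suc (Suc i)) \<phi>)) v"
  proof (rule xdegen_cong)
    fix u assume "length u = Suc (length v)" "set u \<subseteq> B"
    then obtain b u' where u: "u = b # u'" by (cases u) auto
    have "merge i (\<lambda>u'. absorb a \<phi> (b # u')) u' = comul a (\<lambda>x c. anti x (\<lambda>p. mul b p (\<lambda>r. merge i (\<lambda>u'. \<phi> (r # c # u')) u')))"
      unfolding absorb_Cons comul_def anti_def mul_def case_prod_unfold by (simp only: merge_functional)
    then show "merge (Suc i) (absorb a \<phi>) u = absorb a (merge (Suc (Suc i)) \<phi>) u" by (simp add: u absorb_Cons)
  qed (use Suc w in auto)
  finally show ?case unfolding w xdegen_Cons by (rule sym)
qed


text \<open>The letterwise form of the next lemma.  On the left, the letter \<open>b S(a\<^sup>(\<^sup>1\<^sup>))\<close> is itself comultiplied and its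
  antipode \<open>S(b\<^sup>(\<^sup>1\<^sup>) S(a\<^sup>(\<^sup>2\<^sup>))) = S\<^sup>2(a\<^sup>(\<^sup>2\<^sup>)) S(b\<^sup>(\<^sup>1\<^sup>))\<close> is multiplied from the left by the \<open>S(a\<^sup>(\<^sup>3\<^sup>))\<close> that comes from
  absorbing the rest of \<open>a\<close>.  Together they form the antipode of \<open>S(a\<^sup>(\<^sup>2\<^sup>)) a\<^sup>(\<^sup>3\<^sup>)\<close>, which is a counit.\<close>

lemma absorb_absorb:
  assumes "a \<in> B" "b \<in> B" "y \<in> B"
  shows "comul a (\<lambda>x c. anti x (\<lambda>p. mul b p (\<lambda>r. absorb c (absorb r \<phi>) (y # u)))) =
    absorb b (\<lambda>w. absorb a (\<lambda>u. \<phi> (hd w # u)) (tl w)) (y # u)"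
proof -
  let ?\<psi> = "\<lambda>t r c. \<phi> (t # r # c # u)"
  have step1: "anti x (\<lambda>p. mul b p (\<lambda>r. comul r (\<lambda>r1 r2. anti r1 (\<lambda>s'. G s' r2)))) =
      comul b (\<lambda>b1 b2. comul x (\<lambda>x1 x2. anti x1 (\<lambda>p2. anti x2 (\<lambda>p1. anti b1 (\<lambda>e. anti p1 (\<lambda>f. mul f e (\<lambda>s'. mul b2 p2 (\<lambda>r2. G s' r2))))))))"
    if "x \<in> B" for x and G :: "'b \<Rightarrow> 'b \<Rightarrow> 'k"
  proof -
    have "anti x (\<lambda>p. mul b p (\<lambda>r. comul r (\<lambda>r1 r2. anti r1 (\<lambda>s'. G s' r2)))) =
      anti x (\<lambda>p. comul b (\<lambda>b1 b2. comul p (\<lambda>p1 p2. mul b1 p1 (\<lambda>r1. anti r1 (\<lambda>s'. mul b2 p2 (\<lambda>r2. G s' r2))))))"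
      using assms by (simp add: comul_mul_hom anti_mul)
    also have "\<dots> = anti x (\<lambda>p. comul b (\<lambda>b1 b2. comul p (\<lambda>p1 p2. anti b1 (\<lambda>e. anti p1 (\<lambda>f. mul f e (\<lambda>s'. mul b2 p2 (\<lambda>r2. G s' r2)))))))"
      by (intro anti_cong comul_cong) (simp add: anti_mul_rev)
    also have "\<dots> = comul b (\<lambda>b1 b2. anti x (\<lambda>p. comul p (\<lambda>p1 p2. anti b1 (\<lambda>e. anti p1 (\<lambda>f. mul f e (\<lambda>s'. mul b2 p2 (\<lambda>r2. G s' r2)))))))"
      by (rule comul_anti[symmetric])
    finally show ?thesis using that by (simp add: comul_anti_rev)
  qed
  have "comul a (\<lambda>x c. anti x (\<lambda>p. mul b p (\<lambda>r. absorb c (absorb r \<phi>) (y # u)))) =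
    comul a (\<lambda>x c. anti x (\<lambda>p. mul b p (\<lambda>r. comul c (\<lambda>c1 c2. anti c1 (\<lambda>s. mul y s (\<lambda>t. comul r (\<lambda>r1 r2. anti r1 (\<lambda>s'. mul t s' (\<lambda>t'. ?\<psi> t' r2 c2)))))))))"
    by (simp only: absorb_Cons)
  also have "\<dots> = comul a (\<lambda>x c. comul c (\<lambda>c1 c2. anti c1 (\<lambda>s. mul y s (\<lambda>t. anti x (\<lambda>p. mul b p (\<lambda>r. comul r (\<lambda>r1 r2. anti r1 (\<lambda>s'. mul t s' (\<lambda>t'. ?\<psi> t' r2 c2)))))))))"
  proof (rule comul_cong)
    fix x c
    have sw: "anti x (\<lambda>p. mul b p (\<lambda>r. comul c (\<lambda>c1 c2. anti c1 (\<lambda>s. mul y s (\<lambda>t. G r c2 t))))) =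
       comul c (\<lambda>c1 c2. anti c1 (\<lambda>s. mul y s (\<lambda>t. anti x (\<lambda>p. mul b p (\<lambda>r. G r c2 t)))))" for G :: "'b \<Rightarrow> 'b \<Rightarrow> 'b \<Rightarrow> 'k"
    proof -
      have "anti x (\<lambda>p. mul b p (\<lambda>r. comul c (\<lambda>c1 c2. anti c1 (\<lambda>s. mul y s (\<lambda>t. G r c2 t))))) =
        comul c (\<lambda>c1 c2. anti x (\<lambda>p. anti c1 (\<lambda>s. mul b p (\<lambda>r. mul y s (\<lambda>t. G r c2 t)))))"
        by (simp only: comul_mul[symmetric] comul_anti[symmetric] anti_mul[symmetric])
      also have "\<dots> = comul c (\<lambda>c1 c2. anti c1 (\<lambda>s. anti x (\<lambda>p. mul y s (\<lambda>t. mul b p (\<lambda>r. G r c2 t)))))"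
        by (rule comul_cong, subst anti_anti, rule anti_cong, rule anti_cong) (rule mul_mul)
      finally show ?thesis by (simp only: anti_mul)
    qed
    show "anti x (\<lambda>p. mul b p (\<lambda>r. comul c (\<lambda>c1 c2. anti c1 (\<lambda>s. mul y s (\<lambda>t. comul r (\<lambda>r1 r2. anti r1 (\<lambda>s'. mul t s' (\<lambda>t'. ?\<psi> t' r2 c2)))))))) =
       comul c (\<lambda>c1 c2. anti c1 (\<lambda>s. mul y s (\<lambda>t. anti x (\<lambda>p. mul b p (\<lambda>r. comul r (\<lambda>r1 r2. anti r1 (\<lambda>s'. mul t s' (\<lambda>t'. ?\<psi> t' r2 c2))))))))"
      by (rule sw)
  qed
  also have "\<dots> = comul a (\<lambda>x c. comul c (\<lambda>c1 c2. anti c1 (\<lambda>s. mul y s (\<lambda>t. 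
      comul b (\<lambda>b1 b2. comul x (\<lambda>x1 x2. anti x1 (\<lambda>p2. anti x2 (\<lambda>p1. anti b1 (\<lambda>e. anti p1 (\<lambda>f. mul f e (\<lambda>s'. mul b2 p2 (\<lambda>r2. mul t s' (\<lambda>t'. ?\<psi> t' r2 c2)))))))))))))"
    by (rule comul_cong, rule comul_cong, rule anti_cong, rule mul_cong) (erule step1)
  also have "\<dots> = comul a (\<lambda>x c. comul c (\<lambda>c1 c2. 
      comul b (\<lambda>b1 b2. comul x (\<lambda>x1 x2. anti c1 (\<lambda>s. mul y s (\<lambda>t. anti x1 (\<lambda>p2. anti x2 (\<lambda>p1. anti b1 (\<lambda>e. anti p1 (\<lambda>f. mul f e (\<lambda>s'. mul b2 p2 (\<lambda>r2. mul t s' (\<lambda>t'. ?\<psi> t' r2 c2)))))))))))))"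
    by (rule comul_cong, rule comul_cong) (simp only: comul_anti comul_mul)
  also have "\<dots> = comul a (\<lambda>x c. comul c (\<lambda>c1 c2. 
      comul b (\<lambda>b1 b2. comul x (\<lambda>x1 x2. anti x1 (\<lambda>p2. anti b1 (\<lambda>e. anti x2 (\<lambda>p1. anti p1 (\<lambda>f. anti c1 (\<lambda>s. mul s f (\<lambda>l. mul y l (\<lambda>k. mul k e (\<lambda>t'. mul b2 p2 (\<lambda>r2. ?\<psi> t' r2 c2)))))))))))))"
  proof (rule comul_cong, rule comul_cong, rule comul_cong, rule comul_cong)
    fix c1 c2 b1 b2 x1 x2
    let ?K = "\<lambda>p2 t'. mul b2 p2 (\<lambda>r2. ?\<psi> t' r2 c2)"
    have "anti c1 (\<lambda>s. mul y s (\<lambda>t. anti x1 (\<lambda>p2. anti x2 (\<lambda>p1. anti b1 (\<lambda>e. anti p1 (\<lambda>f. mul f e (\<lambda>s'. mul b2 p2 (\<lambda>r2. mul t s' (\<lambda>t'. ?\<psi> t' r2 c2)))))))))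
      = anti c1 (\<lambda>s. mul y s (\<lambda>t. anti x1 (\<lambda>p2. anti x2 (\<lambda>p1. anti b1 (\<lambda>e. anti p1 (\<lambda>f. mul t f (\<lambda>k. mul k e (\<lambda>t'. ?K p2 t'))))))))"
    proof (intro anti_cong mul_cong)
      fix t p2 e f assume "t \<in> B" "e \<in> B" "f \<in> B"
      have "mul f e (\<lambda>s'. mul b2 p2 (\<lambda>r2. mul t s' (\<lambda>t'. ?\<psi> t' r2 c2))) = mul f e (\<lambda>s'. mul t s' (\<lambda>t'. ?K p2 t'))"
        by (rule mul_cong) (rule mul_mul)
      then show "mul f e (\<lambda>s'. mul b2 p2 (\<lambda>r2. mul t s' (\<lambda>t'. ?\<psi> t' r2 c2))) = mul t f (\<lambda>k. mul k e (\<lambda>t'. ?K p2 t'))"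
        using \<open>t \<in> B\<close> \<open>e \<in> B\<close> \<open>f \<in> B\<close> by (simp only: mul_assoc)
    qed
    also have "\<dots> = anti c1 (\<lambda>s. anti x1 (\<lambda>p2. anti x2 (\<lambda>p1. anti b1 (\<lambda>e. anti p1 (\<lambda>f. mul y s (\<lambda>t. mul t f (\<lambda>k. mul k e (\<lambda>t'. ?K p2 t'))))))))"
      by (simp only: anti_mul[symmetric])
    also have "\<dots> = anti c1 (\<lambda>s. anti x1 (\<lambda>p2. anti b1 (\<lambda>e. anti x2 (\<lambda>p1. anti p1 (\<lambda>f. mul s f (\<lambda>l. mul y l (\<lambda>k. mul k e (\<lambda>t'. ?K p2 t'))))))))"
    proof (rule anti_cong, rule anti_cong)
      fix s p2 assume "s \<in> B"
      have "anti x2 (\<lambda>p1. anti b1 (\<lambda>e. anti p1 (\<lambda>f. mul y s (\<lambda>t. mul t f (\<lambda>k. mul k e (\<lambda>t'. ?K p2 t')))))) =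
         anti b1 (\<lambda>e. anti x2 (\<lambda>p1. anti p1 (\<lambda>f. mul y s (\<lambda>t. mul t f (\<lambda>k. mul k e (\<lambda>t'. ?K p2 t'))))))"
        by (rule anti_anti)
      also have "\<dots> = anti b1 (\<lambda>e. anti x2 (\<lambda>p1. anti p1 (\<lambda>f. mul s f (\<lambda>l. mul y l (\<lambda>k. mul k e (\<lambda>t'. ?K p2 t'))))))"
        using \<open>s \<in> B\<close> assms by (intro anti_cong mul_assoc)
      finally show "anti x2 (\<lambda>p1. anti b1 (\<lambda>e. anti p1 (\<lambda>f. mul y s (\<lambda>t. mul t f (\<lambda>k. mul k e (\<lambda>t'. ?K p2 t')))))) = \<dots>" .
    qed
    also have "\<dots> = anti x1 (\<lambda>p2. anti b1 (\<lambda>e. anti x2 (\<lambda>p1. anti p1 (\<lambda>f. anti c1 (\<lambda>s. mul s f (\<lambda>l. mul y l (\<lambda>k. mul k e (\<lambda>t'. ?K p2 t'))))))))"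
      by (subst anti_anti, rule anti_cong, subst anti_anti, rule anti_cong, subst anti_anti, rule anti_cong, rule anti_anti)
    finally show "anti c1 (\<lambda>s. mul y s (\<lambda>t. anti x1 (\<lambda>p2. anti x2 (\<lambda>p1. anti b1 (\<lambda>e. anti p1 (\<lambda>f. mul f e (\<lambda>s'. mul b2 p2 (\<lambda>r2. mul t s' (\<lambda>t'. ?\<psi> t' r2 c2))))))))) = \<dots>" .
  qed
  also have "\<dots> = comul a (\<lambda>x c. comul x (\<lambda>x1 x2. comul c (\<lambda>c1 c2. 
      comul b (\<lambda>b1 b2. anti x1 (\<lambda>p2. anti b1 (\<lambda>e. anti x2 (\<lambda>p1. mul p1 c1 (\<lambda>m. anti m (\<lambda>l. mul y l (\<lambda>k. mul k e (\<lambda>t'. mul b2 p2 (\<lambda>r2. ?\<psi> t' r2 c2))))))))))))"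
  proof (rule comul_cong)
    fix x c
    let ?F = "\<lambda>c1 c2 b1 b2 x1 x2. anti x1 (\<lambda>p2. anti b1 (\<lambda>e. anti x2 (\<lambda>p1. anti p1 (\<lambda>f. anti c1 (\<lambda>s. mul s f (\<lambda>l. mul y l (\<lambda>k. mul k e (\<lambda>t'. mul b2 p2 (\<lambda>r2. ?\<psi> t' r2 c2)))))))))"
    have "comul c (\<lambda>c1 c2. comul b (\<lambda>b1 b2. comul x (\<lambda>x1 x2. ?F c1 c2 b1 b2 x1 x2))) =
      comul c (\<lambda>c1 c2. comul x (\<lambda>x1 x2. comul b (\<lambda>b1 b2. ?F c1 c2 b1 b2 x1 x2)))"
      by (rule comul_cong) (rule comul_comul)
    also have "\<dots> = comul x (\<lambda>x1 x2. comul c (\<lambda>c1 c2. comul b (\<lambda>b1 b2. ?F c1 c2 b1 b2 x1 x2)))"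
      by (rule comul_comul)
    also have "\<dots> = comul x (\<lambda>x1 x2. comul c (\<lambda>c1 c2. 
      comul b (\<lambda>b1 b2. anti x1 (\<lambda>p2. anti b1 (\<lambda>e. anti x2 (\<lambda>p1. mul p1 c1 (\<lambda>m. anti m (\<lambda>l. mul y l (\<lambda>k. mul k e (\<lambda>t'. mul b2 p2 (\<lambda>r2. ?\<psi> t' r2 c2)))))))))))"
      by (intro comul_cong anti_cong) (simp only: anti_mul_rev)
    finally show "comul c (\<lambda>c1 c2. comul b (\<lambda>b1 b2. comul x (\<lambda>x1 x2. ?F c1 c2 b1 b2 x1 x2))) = \<dots>" .
  qed
  also have "\<dots> = comul a (\<lambda>x1 z. comul z (\<lambda>x2 c. comul c (\<lambda>c1 c2. 
      comul b (\<lambda>b1 b2. anti x1 (\<lambda>p2. anti b1 (\<lambda>e. anti x2 (\<lambda>p1. mul p1 c1 (\<lambda>m. anti m (\<lambda>l. mul y l (\<lambda>k. mul k e (\<lambda>t'. mul b2 p2 (\<lambda>r2. ?\<psi> t' r2 c2))))))))))))"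
    by (rule coassoc[OF assms(1)])
  also have "\<dots> = comul a (\<lambda>x1 z. comul z (\<lambda>d c2. comul d (\<lambda>x2 c1. 
      comul b (\<lambda>b1 b2. anti x1 (\<lambda>p2. anti b1 (\<lambda>e. anti x2 (\<lambda>p1. mul p1 c1 (\<lambda>m. anti m (\<lambda>l. mul y l (\<lambda>k. mul k e (\<lambda>t'. mul b2 p2 (\<lambda>r2. ?\<psi> t' r2 c2))))))))))))"
    by (rule comul_cong) (rule coassoc[symmetric])
  also have "\<dots> = comul a (\<lambda>x1 z. comul z (\<lambda>d c2. eps d * 
      comul b (\<lambda>b1 b2. anti x1 (\<lambda>p2. anti b1 (\<lambda>e. mul y e (\<lambda>t'. mul b2 p2 (\<lambda>r2. ?\<psi> t' r2 c2)))))))"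
  proof (rule comul_cong, rule comul_cong)
    fix x1 z d c2 assume d: "d \<in> B"
    have "comul d (\<lambda>x2 c1. comul b (\<lambda>b1 b2. anti x1 (\<lambda>p2. anti b1 (\<lambda>e. anti x2 (\<lambda>p1. mul p1 c1 (\<lambda>m. G b2 p2 e m)))))) =
       eps d * comul b (\<lambda>b1 b2. anti x1 (\<lambda>p2. anti b1 (\<lambda>e. one (\<lambda>m. G b2 p2 e m))))" for G :: "'b \<Rightarrow> 'b \<Rightarrow> 'b \<Rightarrow> 'b \<Rightarrow> 'k"
      by (subst comul_comul) (simp only: comul_anti antipode_l[OF d] scales)
    then show "comul d (\<lambda>x2 c1. 
      comul b (\<lambda>b1 b2. anti x1 (\<lambda>p2. anti b1 (\<lambda>e. anti x2 (\<lambda>p1. mul p1 c1 (\<lambda>m. anti m (\<lambda>l. mul y l (\<lambda>k. mul k e (\<lambda>t'. mul b2 p2 (\<lambda>r2. ?\<psi> t' r2 c2)))))))))) =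
       eps d * comul b (\<lambda>b1 b2. anti x1 (\<lambda>p2. anti b1 (\<lambda>e. mul y e (\<lambda>t'. mul b2 p2 (\<lambda>r2. ?\<psi> t' r2 c2)))))"
      using assms by (simp only: anti_one one_mul_right)
  qed
  also have "\<dots> = comul a (\<lambda>x1 z. comul b (\<lambda>b1 b2. anti x1 (\<lambda>p2. anti b1 (\<lambda>e. mul y e (\<lambda>t'. mul b2 p2 (\<lambda>r2. ?\<psi> t' r2 z))))))"
    by (rule comul_cong) (rule counit_left)
  also have "\<dots> = comul b (\<lambda>b1 b2. comul a (\<lambda>x1 z. anti x1 (\<lambda>p2. anti b1 (\<lambda>e. mul y e (\<lambda>t'. mul b2 p2 (\<lambda>r2. ?\<psi> t' r2 z))))))"
    by (rule comul_comul)
  also have "\<dots> = comul b (\<lambda>b1 b2. comul a (\<lambda>x1 z. anti b1 (\<lambda>e. anti x1 (\<lambda>p2. mul y e (\<lambda>t'. mul b2 p2 (\<lambda>r2. ?\<psi> t' r2 z))))))"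
    by (rule comul_cong, rule comul_cong) (rule anti_anti)
  also have "\<dots> = absorb b (\<lambda>w. absorb a (\<lambda>u. \<phi> (hd w # u)) (tl w)) (y # u)"
    unfolding absorb_Cons list.sel by (simp only: comul_anti comul_mul anti_mul)
  finally show ?thesis .
qed

text \<open>Applying the extra degeneracy twice inserts a unit in front of the result of applying it once.  For the empty word
  this is \<open>\<pi> S(\<pi>) = 1\<close>; the letters of a word are moved past both applications by the lemma above.\<close>

lemma xdegen_xdegen:
  "set w \<subseteq> B \<Longrightarrow> xdegen (xdegen \<phi>) w = xdegen (\<lambda>v. one (\<lambda>p. \<phi> (p # v))) w"
proof (induction w arbitrary: \<phi>)
  case Nil
  have "xdegen (xdegen \<phi>) [] = functional B (\<lambda>p. comul p (\<lambda>x y. functional B (\<lambda>b. anti x (\<lambda>s. mul b s (\<lambda>r. \<phi> [r, y]))) \<pi>)) \<pi>"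
    by (simp add: xdegen_Nil xdegen_Cons absorb_Cons comul_functional)
  also have "\<dots> = functional B (\<lambda>x. functional B (\<lambda>y. functional B (\<lambda>b. anti x (\<lambda>s. mul b s (\<lambda>r. \<phi> [r, y]))) \<pi>) \<pi>) \<pi>"
    by (rule grouplike)
  also have "\<dots> = functional B (\<lambda>y. functional B (\<lambda>b. functional B (\<lambda>x. anti x (\<lambda>s. mul b s (\<lambda>r. \<phi> [r, y]))) \<pi>) \<pi>) \<pi>"
    by (subst functional_swap) (rule functional_cong, rule functional_swap)
  also have "\<dots> = functional B (\<lambda>y. one (\<lambda>r. \<phi> [r, y])) \<pi>"
  proof (rule functional_cong)
    fix y
    let ?h = "\<lambda>r. \<phi> [r, y]"
    have "functional B (\<lambda>b. functional B (\<lambda>x. anti x (\<lambda>s. mul b s ?h)) \<pi>) \<pi> =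
      functional B (\<lambda>p. comul p (\<lambda>b x. anti x (\<lambda>s. mul b s ?h))) \<pi>"
      by (rule grouplike[symmetric])
    also have "\<dots> = functional B (\<lambda>p. one ?h * eps p) \<pi>"
      by (rule functional_cong) (simp add: antipode_r mult.commute)
    also have "\<dots> = one ?h" by (simp add: functional_scale grouplike_eps)
    finally show "functional B (\<lambda>b. functional B (\<lambda>x. anti x (\<lambda>s. mul b s ?h)) \<pi>) \<pi> = one ?h" .
  qed
  finally show ?case by (simp add: xdegen_Nil)
next
  case (Cons a w)
  let ?\<psi> = "\<lambda>w. absorb a (\<lambda>u. \<phi> (hd w # u)) (tl w)"
  have "xdegen (xdegen \<phi>) (a # w) = xdegen (xdegen ?\<psi>) w"
    unfolding xdegen_Cons
  proof (rule xdegen_cong)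
    fix u assume u: "length u = Suc (length w)" "set u \<subseteq> B"
    then obtain b v where bv: "u = b # v" "b \<in> B" "set v \<subseteq> B" by (cases u) auto
    have "absorb a (xdegen \<phi>) u = xdegen (\<lambda>u. comul a (\<lambda>x c. anti x (\<lambda>p. mul b p (\<lambda>r. absorb c (absorb r \<phi>) u)))) v"
      by (simp add: bv absorb_Cons xdegen_Cons xdegen_comul xdegen_anti xdegen_mul)
    also have "\<dots> = xdegen (absorb b ?\<psi>) v"
    proof (rule xdegen_cong)
      fix u assume "length u = Suc (length v)" "set u \<subseteq> B"
      then obtain y u' where u: "u = y # u'" "y \<in> B" by (cases u) auto
      have "a \<in> B" using Cons.prems by simp
      then show "comul a (\<lambda>x c. anti x (\<lambda>p. mul b p (\<lambda>r. absorb c (absorb r \<phi>) u))) = absorb b ?\<psi> u"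
        unfolding u using bv u by (intro absorb_absorb)
    qed (use bv in auto)
    finally show "absorb a (xdegen \<phi>) u = xdegen ?\<psi> u" by (simp add: bv xdegen_Cons)
  qed (use Cons.prems in auto)
  also have "\<dots> = xdegen (\<lambda>v. one (\<lambda>p. ?\<psi> (p # v))) w" using Cons by simp
  also have "\<dots> = xdegen (\<lambda>v. one (\<lambda>p. \<phi> (p # v))) (a # w)"
    unfolding xdegen_Cons one_def by (simp only: list.sel absorb_functional[abs_def])
  finally show ?case .
qed

end


section \<open>Linear maps between tensor powers\<close>

context hopf_algebra
begin

abbreviation W where "W n \<equiv> words H n"

lemma W_iff: "w \<in> W n \<longleftrightarrow> length w = n \<and> set w \<subseteq> B"
  by (simp add: words_def)

lemma finite_W: "finite (W n)"
  using finite_lists_length_eq[OF finite_B, of n] by (simp add: words_def conj_commute)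

text \<open>Linear maps of tensor powers are written through their transpose: \<open>P\<close> acts on functions of words, and \<open>tmap\<close>
  is the map whose composition with \<open>\<phi>\<close> is \<open>P \<phi>\<close>.  This is legitimate if \<open>P \<phi>\<close> depends linearly on the values of \<open>\<phi>\<close> on
  words of the right length, which is what \<open>local_map\<close> says.  Composition of maps becomes reversed composition of
  transposes.\<close>

definition tmap :: "nat \<Rightarrow> (('b list \<Rightarrow> 'k) \<Rightarrow> 'b list \<Rightarrow> 'k) \<Rightarrow> ('b list \<Rightarrow> 'k) \<Rightarrow> 'b list \<Rightarrow> 'k" where
  "tmap n P x = linear_ext (W n) (\<lambda>w v. P (bvec v) w) x"

definition local_map :: "nat \<Rightarrow> nat \<Rightarrow> (('b list \<Rightarrow> 'k) \<Rightarrow> 'b list \<Rightarrow> 'k) \<Rightarrow> bool" where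
  "local_map n m P \<longleftrightarrow> (\<forall>\<phi>. \<forall>w\<in>W n. P \<phi> w = functional (W m) (\<lambda>u. P (bvec u) w) \<phi>)"

lemma local_mapI:
  assumes "\<And>\<phi> \<psi> w. w \<in> W n \<Longrightarrow> (\<And>u. u \<in> W m \<Longrightarrow> \<phi> u = \<psi> u) \<Longrightarrow> P \<phi> w = P \<psi> w"
    and "\<And>F (f :: 'b list \<Rightarrow> 'k) w. w \<in> W n \<Longrightarrow> P (\<lambda>u. functional (W m) (\<lambda>x. F x u) f) w = functional (W m) (\<lambda>x. P (F x) w) f"
  shows "local_map n m P"
  unfolding local_map_def
proof (intro allI ballI)
  fix \<phi> :: "'b list \<Rightarrow> 'k" and w assume w: "w \<in> W n"
  have "functional (W m) (\<lambda>u. bvec u v) \<phi> = \<phi> v" if "v \<in> W m" for v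
  proof -
    have "functional (W m) (\<lambda>u. bvec u v) \<phi> = functional (W m) (bvec v) \<phi>"
      by (rule functional_cong) (auto simp: bvec_def)
    also have "\<dots> = \<phi> v" using that finite_W by (auto simp: functional_def bvec_def of_bool_def if_distrib[of "\<lambda>y. _ * y"] cong: if_cong)
    finally show ?thesis .
  qed
  then have "P \<phi> w = P (\<lambda>v. functional (W m) (\<lambda>u. bvec u v) \<phi>) w" by (intro assms(1) w) simp
  also have "\<dots> = functional (W m) (\<lambda>u. P (bvec u) w) \<phi>" by (rule assms(2)[OF w])
  finally show "P \<phi> w = functional (W m) (\<lambda>u. P (bvec u) w) \<phi>" .
qed

lemma local_mapD: "local_map n m P \<Longrightarrow> w \<in> W n \<Longrightarrow> P \<phi> w = functional (W m) (\<lambda>u. P (bvec u) w) \<phi>"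
  unfolding local_map_def by blast

lemma tmap_tmap:
  assumes "local_map n m Q"
  shows "tmap m P (tmap n Q x) = tmap n (\<lambda>\<phi>. Q (P \<phi>)) x"
proof
  fix v
  have "tmap m P (tmap n Q x) v = functional (W m) (P (bvec v)) (linear_ext (W n) (\<lambda>w v. Q (bvec v) w) x)"
    by (simp add: tmap_def linear_ext_def functional_def)
  also have "\<dots> = functional (W n) (\<lambda>w. functional (W m) (P (bvec v)) (\<lambda>u. Q (bvec u) w)) x"
    by (rule functional_linear_ext)
  also have "\<dots> = functional (W n) (Q (P (bvec v))) x"
  proof (rule functional_cong)
    fix w assume "w \<in> W n"
    then have "Q (P (bvec v)) w = functional (W m) (\<lambda>u. Q (bvec u) w) (P (bvec v))"
      by (rule local_mapD[OF assms])
    then show "functional (W m) (P (bvec v)) (\<lambda>u. Q (bvec u) w) = Q (P (bvec v)) w"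
      by (simp add: functional_def mult.commute)
  qed
  finally show "tmap m P (tmap n Q x) v = tmap n (\<lambda>\<phi>. Q (P \<phi>)) x v"
    by (simp add: tmap_def linear_ext_def functional_def)
qed

lemma tmap_cong: "(\<And>\<phi> w. w \<in> W n \<Longrightarrow> P \<phi> w = Q \<phi> w) \<Longrightarrow> tmap n P x = tmap n Q x"
  by (simp add: tmap_def linear_ext_def fun_eq_iff)

lemma tmap_vecs: "local_map n m P \<Longrightarrow> tmap n P x \<in> vecs (W m)"
unfolding vecs_def tmap_def linear_ext_def
proof (rule CollectI, intro allI impI)
  fix v assume P: "local_map n m P" and v: "v \<notin> W m"
  have "P (bvec v) w = 0" if "w \<in> W n" for w
  proof -
    have "P (bvec v) w = functional (W m) (\<lambda>u. P (bvec u) w) (bvec v)" using P that by (rule local_mapD)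
    also have "\<dots> = 0" unfolding functional_def using v by (intro sum.neutral) (auto simp: bvec_def)
    finally show ?thesis .
  qed
  then show "(\<Sum>w\<in>W n. x w * P (bvec v) w) = 0" by simp
qed

lemma tmap_id: "x \<in> vecs (W n) \<Longrightarrow> tmap n (\<lambda>\<phi>. \<phi>) x = x"
proof
  fix v assume "x \<in> vecs (W n)"
  then have "functional (W n) (bvec v) x = x v" by (rule functional_at[OF finite_W])
  then show "tmap n (\<lambda>\<phi>. \<phi>) x v = x v" by (simp add: tmap_def linear_ext_def functional_def)
qed


subsection \<open>Faces\<close>

lemma Mult_vecs: "a \<in> B \<Longrightarrow> b \<in> B \<Longrightarrow> Mult H a b \<in> vecs B"
  and Unit_vecs: "Unit H \<in> vecs B"
  and Antipode_vecs: "a \<in> B \<Longrightarrow> Antipode H a \<in> vecs B"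
  using hopf by (simp_all add: is_hopf_algebra_def Let_def)

lemma twisted_antipode_vecs: "twisted_antipode H \<pi> x \<in> vecs B"
  using Mult_vecs by (auto simp: twisted_antipode_def hmult_def bilinear_ext_def vecs_def intro!: sum.neutral)

definition dface where
  "dface \<alpha> \<beta> n i \<phi> w = (if i = 0 then \<alpha> (hd w) * \<phi> (tl w)
     else if i < n then merge (i - 1) \<phi> w else \<phi> (butlast w) * \<beta> (last w))"

lemma pure_tensor_Nil: "pure_tensor [] v = of_bool (v = [])"
  by (simp add: pure_tensor_def)

lemma pure_tensor_Cons: "pure_tensor (x # xs) (c # v) = x c * pure_tensor xs v"
  and pure_tensor_Cons_Nil: "pure_tensor (x # xs) [] = 0"
  by (simp_all add: pure_tensor_def prod.lessThan_Suc_shift del: prod.lessThan_Suc)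

lemma pure_tensor_map_bvec: "pure_tensor (map bvec ys) v = of_bool (v = ys)"
proof (induction ys arbitrary: v)
  case (Cons y ys)
  then show ?case by (cases v) (auto simp: pure_tensor_Cons pure_tensor_Cons_Nil bvec_def)
qed (simp add: pure_tensor_Nil)

lemma pure_tensor_insert:
  assumes "h \<in> vecs B"
  shows "pure_tensor (map bvec xs @ [h] @ map bvec ys) v = functional B (\<lambda>c. bvec v (xs @ c # ys)) h"
proof (induction xs arbitrary: v)
  case Nil
  show ?case
  proof (cases v)
    case (Cons c v')
    have "functional B (\<lambda>d. bvec v (d # ys)) h = functional B (\<lambda>d. of_bool (v' = ys) * bvec c d) h"
      by (rule functional_cong) (auto simp: bvec_def Cons)
    also have "\<dots> = of_bool (v' = ys) * h c"
      using assms finite_B by (simp add: functional_scale functional_at)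
    finally show ?thesis by (simp add: Cons pure_tensor_Cons pure_tensor_map_bvec)
  qed (simp add: pure_tensor_Cons_Nil bvec_def functional_zero)
next
  case (Cons x xs)
  show ?case
  proof (cases v)
    case v: (Cons c v')
    have "functional B (\<lambda>d. bvec v ((x # xs) @ d # ys)) h = functional B (\<lambda>d. of_bool (c = x) * bvec v' (xs @ d # ys)) h"
      by (rule functional_cong) (auto simp: bvec_def v)
    then show ?thesis using Cons by (simp add: v pure_tensor_Cons functional_scale bvec_def)
  qed (simp add: pure_tensor_Cons_Nil bvec_def functional_zero)
qed

lemma merge_eq:
  "Suc j < length w \<Longrightarrow> merge j \<phi> w = functional B (\<lambda>c. \<phi> (take j w @ c # drop (j + 2) w)) (Mult H (w ! j) (w ! Suc j))"
proof (induction j arbitrary: \<phi> w)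
  case 0
  then obtain a b v where "w = a # b # v" by (cases w; cases "tl w") auto
  then show ?case by (simp add: mul_def)
next
  case (Suc j)
  then obtain a v where "w = a # v" by (cases w) auto
  then show ?case using Suc by simp
qed

lemma face_dface:
  assumes "0 < n"
  shows "face H \<alpha> \<beta> n i x = tmap n (dface \<alpha> \<beta> n i) x"
  unfolding face_def tmap_def linear_ext_def
proof (rule ext, rule sum.cong[OF refl], rule arg_cong[of _ _ "(*) _"])
  fix v w :: "'b list" assume "w \<in> W n"
  then have w: "length w = n" "set w \<subseteq> B" by (auto simp: W_iff)
  have bv: "pure_tensor (map bvec ys) v = bvec v ys" for ys
    by (simp add: pure_tensor_map_bvec bvec_def eq_commute)
  have "pure_tensor (map bvec (take (i - 1) w) @ [Mult H (w ! (i - 1)) (w ! i)] @ map bvec (drop (i + 1) w)) v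
      = merge (i - 1) (bvec v) w" if "i \<noteq> 0" "i < n"
  proof -
    have "Mult H (w ! (i - 1)) (w ! i) \<in> vecs B"
      using w that by (intro Mult_vecs subsetD[OF w(2)] nth_mem) auto
    moreover have "Suc (i - 1) = i" "i - 1 + 2 = i + 1" using that by auto
    ultimately show ?thesis using that w by (simp only: pure_tensor_insert merge_eq)
  qed
  then show "(if i = 0 then \<alpha> (hd w) * pure_tensor (map bvec (tl w)) v
     else if i < n then pure_tensor (map bvec (take (i - 1) w) @ [Mult H (w ! (i - 1)) (w ! i)] @ map bvec (drop (i + 1) w)) v
     else pure_tensor (map bvec (butlast w)) v * \<beta> (last w)) = dface \<alpha> \<beta> n i (bvec v) w"
    unfolding dface_def bv by simp
qed

section \<open>The cyclic module of a triple\<close>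

lemma merge_snoc:
  "Suc j < length v \<Longrightarrow> merge j \<phi> (v @ [a]) = merge j (\<lambda>u. \<phi> (u @ [a])) v"
proof (induction j arbitrary: \<phi> v)
  case 0
  then obtain c d v' where "v = c # d # v'" by (cases v; cases "tl v") auto
  then show ?case by simp
next
  case (Suc j)
  then obtain c v' where "v = c # v'" by (cases v) auto
  then show ?case using Suc by simp
qed

lemma merge_snoc_last: "merge (length v) \<phi> (v @ [c, a]) = mul c a (\<lambda>z. \<phi> (v @ [z]))"
  by (induction v arbitrary: \<phi>) simp_all

lemma merge_map:
  assumes "\<And>a b g. a \<in> B \<Longrightarrow> b \<in> B \<Longrightarrow> mul (f a) (f b) g = mul a b (\<lambda>c. g (f c))"
    and "set w \<subseteq> B" "Suc j < length w"
  shows "merge j \<phi> (map f w) = merge j (\<lambda>u. \<phi> (map f u)) w"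
  using assms(2,3)
proof (induction j arbitrary: \<phi> w)
  case 0
  then obtain c d v' where "w = c # d # v'" by (cases w; cases "tl w") auto
  then show ?case using 0 assms(1) by simp
next
  case (Suc j)
  then obtain c v' where "w = c # v'" by (cases w) auto
  then show ?case using Suc by simp
qed

end

text \<open>The extra degeneracy depends on the coproduct only through \<open>S(a\<^sup>(\<^sup>1\<^sup>)) \<otimes> a\<^sup>(\<^sup>2\<^sup>)\<close>.  For translations of the
  paths of the Taft algebra this tensor is invariant although the coproduct is not.\<close>

lemma (in hopf_grouplike) xdegen_map:
  assumes f: "\<And>a. a \<in> B \<Longrightarrow> f a \<in> B"
    and mul: "\<And>a b g. a \<in> B \<Longrightarrow> b \<in> B \<Longrightarrow> mul (f a) (f b) g = mul a b (\<lambda>c. g (f c))"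
    and anti: "\<And>a g. a \<in> B \<Longrightarrow> comul a (\<lambda>x c. anti x (\<lambda>p. g (f p) (f c))) = comul a (\<lambda>x c. anti x (\<lambda>p. g p c))"
    and pi: "\<And>g. functional B (\<lambda>p. g (f p)) \<pi> = functional B g \<pi>"
  shows "set w \<subseteq> B \<Longrightarrow> xdegen (\<lambda>u. \<phi> (map f u)) w = xdegen \<phi> w"
proof (induction w arbitrary: \<phi>)
  case Nil
  show ?case using pi[of "\<lambda>p. \<phi> [p]"] by (simp add: xdegen_Nil)
next
  case (Cons a w)
  have "xdegen (absorb a (\<lambda>u. \<phi> (map f u))) w = xdegen (\<lambda>u. absorb a \<phi> (map f u)) w"
  proof (rule xdegen_cong)
    fix u assume "length u = Suc (length w)" "set u \<subseteq> B"
    then obtain b v where u: "u = b # v" "b \<in> B" by (cases u) auto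
    let ?g = "\<lambda>p c. mul (f b) p (\<lambda>r. \<phi> (r # c # map f v))"
    have "absorb a (\<lambda>u. \<phi> (map f u)) u = comul a (\<lambda>x c. anti x (\<lambda>p. ?g (f p) (f c)))"
      unfolding u absorb_Cons by (intro comul_cong anti_cong) (simp add: mul u)
    also have "\<dots> = comul a (\<lambda>x c. anti x (\<lambda>p. ?g p c))"
      using Cons.prems by (intro anti) simp
    also have "\<dots> = absorb a \<phi> (map f u)" by (simp add: u absorb_Cons)
    finally show "absorb a (\<lambda>u. \<phi> (map f u)) u = absorb a \<phi> (map f u)" .
  qed (use Cons.prems in auto)
  then show ?case using Cons by (simp add: xdegen_Cons)
qed

text \<open>The map \<open>sh\<close> is left translation by \<open>\<alpha>\<close>.  The assumption \<open>twist\<close> replaces the involution condition on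
  \<open>\<alpha> * S\<^sub>\<pi> * \<beta>\<close>: it says that \<open>\<sigma>\<close>, put on the last factor \<open>c\<close> of \<open>\<pi> S(z\<^sup>(\<^sup>1\<^sup>)) \<otimes> z\<^sup>(\<^sup>2\<^sup>)\<close>, makes the wrapped product
  \<open>\<sigma>(z\<^sup>(\<^sup>2\<^sup>)) \<pi> S(z\<^sup>(\<^sup>1\<^sup>))\<close> equal to \<open>\<beta>(z) \<pi>\<close>, after translation of \<open>z\<close>.\<close>

locale modular_triple = hopf_grouplike H \<pi>
  for H :: "('b, 'k::comm_ring_1) hopf" and \<pi> +
  fixes \<alpha> \<beta> :: "'b \<Rightarrow> 'k" and sh \<sigma> :: "'b \<Rightarrow> 'b"
  assumes alpha_mul: "\<And>a b. a \<in> B \<Longrightarrow> b \<in> B \<Longrightarrow> mul a b \<alpha> = \<alpha> a * \<alpha> b"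
    and beta_mul: "\<And>a b. a \<in> B \<Longrightarrow> b \<in> B \<Longrightarrow> mul a b \<beta> = \<beta> a * \<beta> b"
    and alpha_one: "one \<alpha> = 1"
    and beta_pi: "functional B \<beta> \<pi> = 1"
    and sh_bij: "bij_betw sh B B"
    and translate: "\<And>a g. a \<in> B \<Longrightarrow> comul a (\<lambda>x y. \<alpha> x * g y) = g (sh a)"
    and sh_anti: "\<And>a g. a \<in> B \<Longrightarrow> comul a (\<lambda>x c. anti x (\<lambda>p. g (sh p) (sh c))) = comul a (\<lambda>x c. anti x (\<lambda>p. g p c))"
    and sh_pi: "\<And>g. functional B (\<lambda>p. g (sh p)) \<pi> = functional B g \<pi>"
    and sg_B: "\<And>a. a \<in> B \<Longrightarrow> \<sigma> a \<in> B"
    and sg_mul: "\<And>a b g. a \<in> B \<Longrightarrow> b \<in> B \<Longrightarrow> mul (\<sigma> a) (\<sigma> b) g = mul a b (\<lambda>c. g (\<sigma> c))"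
    and sg_anti: "\<And>a g. a \<in> B \<Longrightarrow> comul a (\<lambda>x c. anti x (\<lambda>p. g (\<sigma> p) (\<sigma> c))) = comul a (\<lambda>x c. anti x (\<lambda>p. g p c))"
    and sg_pi: "\<And>g. functional B (\<lambda>p. g (\<sigma> p)) \<pi> = functional B g \<pi>"
    and twist: "\<And>z g. z \<in> B \<Longrightarrow>
      functional B (\<lambda>p. comul (sh z) (\<lambda>x c. anti x (\<lambda>s. mul p s (\<lambda>t. mul (\<sigma> c) t g)))) \<pi> = \<beta> z * functional B g \<pi>"
begin

lemma sh_B: "a \<in> B \<Longrightarrow> sh a \<in> B"
  using sh_bij by (auto simp: bij_betw_def)

lemma set_map_sh: "set w \<subseteq> B \<Longrightarrow> set (map sh w) \<subseteq> B"
  using sh_B by auto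

lemma sh_mul: "mul (sh a) (sh b) g = mul a b (\<lambda>c. g (sh c))" if "a \<in> B" "b \<in> B"
proof -
  have "mul a b (\<lambda>c. g (sh c)) = mul a b (\<lambda>c. comul c (\<lambda>x y. \<alpha> x * g y))"
    by (intro mul_cong) (simp add: translate)
  also have "\<dots> = comul a (\<lambda>x y. comul b (\<lambda>x' y'. mul x x' (\<lambda>p. mul y y' (\<lambda>r. \<alpha> p * g r))))"
    using that by (rule comul_mul_hom)
  also have "\<dots> = comul a (\<lambda>x y. comul b (\<lambda>x' y'. \<alpha> x * (\<alpha> x' * mul y y' g)))"
  proof (intro comul_cong)
    fix x y x' y' assume "x \<in> B" "x' \<in> B"
    have "mul x x' (\<lambda>p. mul y y' (\<lambda>r. \<alpha> p * g r)) = mul x x' (\<lambda>p. mul y y' g * \<alpha> p)"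
      by (intro mul_cong) (simp add: mul_scale mult.commute)
    also have "\<dots> = mul y y' g * (\<alpha> x * \<alpha> x')"
      using \<open>x \<in> B\<close> \<open>x' \<in> B\<close> by (simp only: mul_scale alpha_mul)
    finally show "mul x x' (\<lambda>p. mul y y' (\<lambda>r. \<alpha> p * g r)) = \<alpha> x * (\<alpha> x' * mul y y' g)"
      by (simp add: ac_simps)
  qed
  also have "\<dots> = comul a (\<lambda>x y. \<alpha> x * mul y (sh b) g)"
    using that by (intro comul_cong) (simp add: comul_scale translate)
  also have "\<dots> = mul (sh a) (sh b) g" using that by (simp add: translate)
  finally show ?thesis by simp
qed

lemma alpha_sh: "a \<in> B \<Longrightarrow> \<alpha> a = eps (sh a)"
  using translate[of a eps] counit_right[of a \<alpha>] by (simp add: mult.commute)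

text \<open>With \<open>\<gamma>\<close> the twisted extra degeneracy, \<open>degen \<phi> = \<phi> \<circ> \<gamma>\<close>, and \<open>tdual \<phi> = \<phi> \<circ> t\<close> for \<open>t = (1 \<otimes> \<beta>) \<gamma>\<close>.\<close>

definition last_face :: "('b list \<Rightarrow> 'k) \<Rightarrow> 'b list \<Rightarrow> 'k" where
  "last_face \<phi> w = \<phi> (butlast w) * \<beta> (last w)"

definition degen :: "('b list \<Rightarrow> 'k) \<Rightarrow> 'b list \<Rightarrow> 'k" where
  "degen \<phi> w = xdegen \<phi> (map sh w)"

definition tdual :: "('b list \<Rightarrow> 'k) \<Rightarrow> 'b list \<Rightarrow> 'k" where
  "tdual \<phi> w = degen (last_face \<phi>) w"

lemma degen_cong:
  assumes "\<And>u. length u = Suc (length w) \<Longrightarrow> set u \<subseteq> B \<Longrightarrow> \<phi> u = \<psi> u" "set w \<subseteq> B"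
  shows "degen \<phi> w = degen \<psi> w"
  unfolding degen_def using assms set_map_sh by (intro xdegen_cong) auto

text \<open>Left translation turns \<open>\<alpha>\<close> into the counit, so this is the counit property of the untwisted degeneracy; the inverse
  of the translation restores the remaining letters.\<close>

lemma degen_alpha:
  assumes "set w \<subseteq> B"
  shows "degen (\<lambda>u. \<alpha> (hd u) * \<phi> (tl u)) w = \<phi> w"
proof -
  let ?i = "inv_into B sh"
  have i: "?i (sh a) = a" if "a \<in> B" for a
    using sh_bij that by (auto simp: bij_betw_def inv_into_f_f)
  have mi: "map ?i (map sh v) = v" if "set v \<subseteq> B" for v
    using that i by (auto intro!: map_idI)
  have "degen (\<lambda>u. \<alpha> (hd u) * \<phi> (tl u)) w = degen (\<lambda>u. eps (hd (map sh u)) * \<phi> (map ?i (tl (map sh u)))) w"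
  proof (rule degen_cong)
    fix u assume "length u = Suc (length w)" "set u \<subseteq> B"
    then show "\<alpha> (hd u) * \<phi> (tl u) = eps (hd (map sh u)) * \<phi> (map ?i (tl (map sh u)))"
      using mi by (cases u) (simp_all add: alpha_sh del: map_map)
  qed (rule assms)
  also have "\<dots> = xdegen (\<lambda>u. eps (hd u) * \<phi> (map ?i (tl u))) (map sh w)"
    unfolding degen_def
    by (rule xdegen_map[of sh _ "\<lambda>u. eps (hd u) * \<phi> (map ?i (tl u))", OF sh_B sh_mul sh_anti sh_pi set_map_sh[OF assms]])
  also have "\<dots> = \<phi> (map ?i (map sh w))"
    by (rule xdegen_counit) (rule set_map_sh[OF assms])
  finally show ?thesis using assms by (simp only: mi)
qed

lemma degen_merge_0: "set (a # w) \<subseteq> B \<Longrightarrow> degen (merge 0 \<phi>) (a # w) = \<alpha> a * degen \<phi> w"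
  using set_map_sh[of "a # w"] xdegen_merge_0[of "sh a" "map sh w" \<phi>]
  by (simp add: degen_def alpha_sh del: merge.simps)

lemma degen_merge_Suc:
  assumes "set w \<subseteq> B" "Suc i < length w"
  shows "degen (merge (Suc i) \<phi>) w = merge i (degen \<phi>) w"
proof -
  have "degen (merge (Suc i) \<phi>) w = merge i (xdegen \<phi>) (map sh w)"
    unfolding degen_def using assms set_map_sh by (intro xdegen_merge_Suc) auto
  also have "\<dots> = merge i (degen \<phi>) w"
    unfolding degen_def[abs_def] using assms by (intro merge_map sh_mul)
  finally show ?thesis .
qed

lemma last_face_merge:
  assumes "j + 2 < length u"
  shows "last_face (merge j \<phi>) u = merge j (last_face \<phi>) u"
proof -
  obtain v a where u: "u = v @ [a]" using assms by (cases u rule: rev_cases) auto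
  have "merge j (last_face \<phi>) u = merge j (\<lambda>u. functional {()} (\<lambda>_. \<phi> u) (\<lambda>_. \<beta> a)) v"
    using assms unfolding u by (subst merge_snoc) (auto simp: last_face_def functional_def mult.commute)
  also have "\<dots> = last_face (merge j \<phi>) u" unfolding merge_functional by (simp add: u last_face_def functional_def mult.commute)
  finally show ?thesis by simp
qed

lemma last_face_last_face:
  assumes "length u = j + 2" "set u \<subseteq> B"
  shows "last_face (last_face \<phi>) u = merge j (last_face \<phi>) u"
proof -
  obtain v c a where u: "u = v @ [c, a]"
    using assms by (cases u rule: rev_cases; cases "butlast u" rule: rev_cases) auto
  have j: "j = length v" using assms u by simp
  have "merge j (last_face \<phi>) u = \<phi> v * (\<beta> c * \<beta> a)"
    using assms unfolding j u merge_snoc_last by (simp add: last_face_def mul_scale beta_mul)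
  then show ?thesis by (simp add: u last_face_def butlast_append mult.assoc)
qed

lemma last_face_dface:
  assumes "length u = Suc n" "set u \<subseteq> B" "0 < i" "i \<le> n"
  shows "last_face (dface \<alpha> \<beta> n i \<phi>) u = merge (i - 1) (last_face \<phi>) u"
proof (cases "i < n")
  case True
  have "last_face (dface \<alpha> \<beta> n i \<phi>) u = last_face (merge (i - 1) \<phi>) u"
    using assms True by (simp add: last_face_def dface_def)
  then show ?thesis using assms True by (simp add: last_face_merge)
next
  case False
  then have "last_face (dface \<alpha> \<beta> n i \<phi>) u = last_face (last_face \<phi>) u"
    using assms by (simp add: last_face_def dface_def)
  then show ?thesis using assms False by (simp add: last_face_last_face)
qed

lemma tdual_dface_Suc:
  assumes "w \<in> W n" "0 < i" "i \<le> n"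
  shows "tdual (dface \<alpha> \<beta> n i \<phi>) w = dface \<alpha> \<beta> n (i - 1) (tdual \<phi>) w"
proof -
  have w: "length w = n" "set w \<subseteq> B" using assms(1) by (auto simp: W_iff)
  obtain a v where av: "w = a # v" using w assms by (cases w) auto
  have "tdual (dface \<alpha> \<beta> n i \<phi>) w = degen (merge (i - 1) (last_face \<phi>)) w"
    unfolding tdual_def using w assms by (intro degen_cong last_face_dface) auto
  also have "\<dots> = dface \<alpha> \<beta> n (i - 1) (tdual \<phi>) w"
  proof (cases "i - 1")
    case 0
    then show ?thesis using w unfolding av tdual_def[abs_def] by (simp add: degen_merge_0 dface_def del: merge.simps)
  next
    case (Suc j)
    then have "degen (merge (i - 1) (last_face \<phi>)) w = merge j (degen (last_face \<phi>)) w"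
      using w assms by (simp add: degen_merge_Suc del: merge.simps)
    moreover have "Suc j < n" using Suc assms by simp
    ultimately show ?thesis using Suc by (simp add: dface_def tdual_def[abs_def])
  qed
  finally show ?thesis .
qed

lemma tdual_dface_0:
  assumes "w \<in> W n" "0 < n"
  shows "tdual (dface \<alpha> \<beta> n 0 \<phi>) w = dface \<alpha> \<beta> n n \<phi> w"
proof -
  have w: "length w = n" "set w \<subseteq> B" using assms(1) by (auto simp: W_iff)
  have "tdual (dface \<alpha> \<beta> n 0 \<phi>) w = degen (\<lambda>u. \<alpha> (hd u) * last_face \<phi> (tl u)) w"
    unfolding tdual_def
  proof (rule degen_cong)
    fix u :: "'b list" assume "length u = Suc (length w)"
    then obtain b v z where "u = b # v @ [z]" using w assms
      by (cases u; cases "tl u" rule: rev_cases) auto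
    then show "last_face (dface \<alpha> \<beta> n 0 \<phi>) u = \<alpha> (hd u) * last_face \<phi> (tl u)"
      by (simp add: last_face_def dface_def)
  qed (rule w)
  also have "\<dots> = last_face \<phi> w" using w by (intro degen_alpha)
  finally show ?thesis using assms by (simp add: dface_def last_face_def)
qed

definition wrap :: "('b list \<Rightarrow> 'k) \<Rightarrow> 'b list \<Rightarrow> 'k" where
  "wrap \<phi> u = mul (\<sigma> (last u)) (hd u) (\<lambda>r. \<phi> (r # butlast (tl u)))"

text \<open>Multiplying the twisted last factor of \<open>\<gamma>(w)\<close> with its first factor removes the last letter of \<open>w\<close> at the cost of
  \<open>\<beta>\<close>.  For one letter this is the assumption \<open>twist\<close>, and by associativity the letters in front of it do not interfere.\<close>

lemma xdegen_wrap:
  "w \<noteq> [] \<Longrightarrow> set w \<subseteq> B \<Longrightarrow> degen (wrap \<phi>) w = last_face (degen \<phi>) w"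
proof (induction w arbitrary: \<phi> rule: list_nonempty_induct)
  case (single z)
  have "degen (wrap \<phi>) [z] = \<beta> z * functional B (\<lambda>t. \<phi> [t]) \<pi>"
    using single twist[of z "\<lambda>t. \<phi> [t]"] by (simp add: degen_def xdegen_Cons xdegen_Nil absorb_Cons wrap_def cong del: mul_cong)
  then show ?case by (simp add: last_face_def degen_def xdegen_Nil mult.commute)
next
  case (cons a w)
  have "degen (wrap \<phi>) (a # w) = xdegen (absorb (sh a) (wrap \<phi>)) (map sh w)" by (simp add: degen_def xdegen_Cons)
  also have "\<dots> = xdegen (wrap (absorb (sh a) \<phi>)) (map sh w)"
  proof (rule xdegen_cong)
    fix u assume "length u = Suc (length (map sh w))" "set u \<subseteq> B"
    then obtain b v z where u: "u = b # v @ [z]" "b \<in> B" "z \<in> B" using cons(1)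
      by (cases u; cases "tl u" rule: rev_cases) auto
    let ?F = "\<lambda>c r. \<phi> (r # c # v)"
    have "absorb (sh a) (wrap \<phi>) u = comul (sh a) (\<lambda>x c. anti x (\<lambda>p. mul b p (\<lambda>r. mul (\<sigma> z) r (?F c))))"
      by (simp add: u absorb_Cons wrap_def cong del: mul_cong)
    also have "\<dots> = comul (sh a) (\<lambda>x c. anti x (\<lambda>p. mul (\<sigma> z) b (\<lambda>r. mul r p (?F c))))"
      using u sg_B by (intro comul_cong anti_cong) (simp add: mul_assoc)
    also have "\<dots> = wrap (absorb (sh a) \<phi>) u"
      by (simp add: u absorb_Cons wrap_def comul_mul anti_mul cong del: mul_cong)
    finally show "absorb (sh a) (wrap \<phi>) u = wrap (absorb (sh a) \<phi>) u" .
  qed (use cons set_map_sh in auto)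
  also have "\<dots> = last_face (degen (absorb (sh a) \<phi>)) w"
    using cons by (simp add: degen_def[symmetric])
  finally show ?case using cons(1) by (simp add: last_face_def degen_def xdegen_Cons)
qed

definition rot :: "('b list \<Rightarrow> 'k) \<Rightarrow> 'b list \<Rightarrow> 'k" where
  "rot \<phi> u = \<phi> (\<sigma> (last u) # butlast u)"

text \<open>\<open>\<gamma> t = \<rho> \<gamma>\<close> for the rotation \<open>\<rho>\<close>: by the preceding lemma \<open>\<gamma> t = \<gamma> (1 \<otimes> \<beta>) \<gamma>\<close> is the wrapped product of
  \<open>\<gamma> \<gamma>\<close>, whose first factor is a unit.\<close>

lemma tdual_degen:
  assumes "set w \<subseteq> B"
  shows "tdual (degen \<phi>) w = degen (rot \<phi>) w"
proof -
  have "tdual (degen \<phi>) w = degen (\<lambda>u. xdegen (wrap \<phi>) (map sh u)) w"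
    unfolding tdual_def
  proof (rule degen_cong)
    fix u assume "length u = Suc (length w)" "set u \<subseteq> B"
    then have "u \<noteq> []" by auto
    then show "last_face (degen \<phi>) u = xdegen (wrap \<phi>) (map sh u)"
      using xdegen_wrap[OF _ \<open>set u \<subseteq> B\<close>, of \<phi>] by (simp add: degen_def)
  qed (rule assms)
  also have "\<dots> = xdegen (xdegen (wrap \<phi>)) (map sh w)"
    unfolding degen_def
    by (rule xdegen_map[of sh _ "xdegen (wrap \<phi>)", OF sh_B sh_mul sh_anti sh_pi set_map_sh[OF assms]])
  also have "\<dots> = xdegen (\<lambda>v. one (\<lambda>p. wrap \<phi> (p # v))) (map sh w)"
    by (rule xdegen_xdegen) (rule set_map_sh[OF assms])
  also have "\<dots> = degen (rot \<phi>) w"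
    unfolding degen_def
  proof (rule xdegen_cong)
    fix u assume u: "length u = Suc (length (map sh w))" "set u \<subseteq> B"
    then have "u \<noteq> []" by auto
    then have "last u \<in> B" using u last_in_set by blast
    then show "one (\<lambda>p. wrap \<phi> (p # u)) = rot \<phi> u"
      using \<open>u \<noteq> []\<close> sg_B[of "last u"] by (simp add: wrap_def rot_def one_mul_right cong del: mul_cong)
  qed (rule set_map_sh[OF assms])
  finally show ?thesis .
qed

lemma tdual_cong:
  assumes "\<And>u. length u = length w \<Longrightarrow> set u \<subseteq> B \<Longrightarrow> \<phi> u = \<psi> u" "set w \<subseteq> B"
  shows "tdual \<phi> w = tdual \<psi> w"
  unfolding tdual_def
proof (rule degen_cong)
  fix u assume u: "length u = Suc (length w)" "set u \<subseteq> B"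
  then have "set (butlast u) \<subseteq> B" by (auto dest: in_set_butlastD)
  then show "last_face \<phi> u = last_face \<psi> u" using assms(1)[of "butlast u"] u by (simp add: last_face_def)
qed (rule assms)

lemma tdual_pow_degen:
  "set w \<subseteq> B \<Longrightarrow> (tdual ^^ k) (degen \<phi>) w = degen ((rot ^^ k) \<phi>) w"
proof (induction k arbitrary: w)
  case (Suc k)
  have "(tdual ^^ Suc k) (degen \<phi>) w = tdual (degen ((rot ^^ k) \<phi>)) w"
    using Suc by (auto intro: tdual_cong)
  then show ?case using Suc.prems by (simp add: tdual_degen)
qed simp

lemma rot_pow: "(rot ^^ length z) \<phi> (v @ z) = \<phi> (map \<sigma> z @ v)"
proof (induction z arbitrary: \<phi> v)
  case (Cons y z)
  have "(rot ^^ length (y # z)) \<phi> (v @ y # z) = (rot ^^ length z) (rot \<phi>) ((v @ [y]) @ z)"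
    by (simp only: length_Cons funpow_Suc_right o_apply append.simps append_assoc)
  also have "\<dots> = rot \<phi> (map \<sigma> z @ v @ [y])" by (rule Cons)
  also have "\<dots> = \<phi> (map \<sigma> (y # z) @ v)" by (simp add: rot_def butlast_append)
  finally show ?case .
qed simp

text \<open>\<open>\<gamma> t\<^sup>(\<^sup>n\<^sup>+\<^sup>1\<^sup>) = \<rho>\<^sup>(\<^sup>n\<^sup>+\<^sup>1\<^sup>) \<gamma>\<close>, where \<open>\<rho>\<^sup>(\<^sup>n\<^sup>+\<^sup>1\<^sup>)\<close> applies \<open>\<sigma>\<close> to each of the \<open>n + 1\<close> factors.  The degeneracy absorbs
  this, and \<open>\<gamma>\<close> cancels by its left inverse \<open>\<alpha> \<otimes> 1\<close>.\<close>

theorem tdual_pow: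
  assumes "w \<in> W n"
  shows "(tdual ^^ Suc n) \<phi> w = \<phi> w"
proof -
  have w: "length w = n" "set w \<subseteq> B" using assms by (auto simp: W_iff)
  let ?\<psi> = "\<lambda>u. \<alpha> (hd u) * \<phi> (tl u)"
  have *: "(tdual ^^ k) \<phi> v = (tdual ^^ k) (degen ?\<psi>) v" if "set v \<subseteq> B" for k v
    using that
  proof (induction k arbitrary: v)
    case 0
    then show ?case by (simp add: degen_alpha)
  next
    case (Suc k)
    then show ?case by (auto intro: tdual_cong)
  qed
  have "(tdual ^^ Suc n) \<phi> w = degen ((rot ^^ Suc n) ?\<psi>) w"
    using w by (simp only: * tdual_pow_degen)
  also have "\<dots> = degen (\<lambda>u. ?\<psi> (map \<sigma> u)) w"
  proof (rule degen_cong)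
    fix u :: "'b list" assume "length u = Suc (length w)"
    then show "(rot ^^ Suc n) ?\<psi> u = ?\<psi> (map \<sigma> u)" using rot_pow[of u ?\<psi> "[]"] w by simp
  qed (rule w)
  also have "\<dots> = degen ?\<psi> w"
    unfolding degen_def by (rule xdegen_map[of \<sigma> _ ?\<psi>, OF sg_B sg_mul sg_anti sg_pi set_map_sh[OF w(2)]])
  also have "\<dots> = \<phi> w" using w by (simp add: degen_alpha)
  finally show ?thesis .
qed




section \<open>The bicomplex identities\<close>

lemma finite_sum_W_Suc: "(\<Sum>w\<in>W (Suc n). f w) = (\<Sum>a\<in>B. \<Sum>w\<in>W n. f (a # w))"
proof -
  have "W (Suc n) = (\<lambda>(a, w). a # w) ` (B \<times> W n)"
    by (auto simp: W_iff length_Suc_conv image_iff)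
  moreover have "inj_on (\<lambda>(a, w). a # w) (B \<times> W n)" by (auto simp: inj_on_def)
  ultimately show ?thesis by (simp add: sum.reindex sum.cartesian_product case_prod_unfold)
qed

lemma functional_twisted_antipode_Cons:
  assumes "y \<in> B"
  shows "functional B g (twisted_antipode H \<pi> (word_prod H (y # w))) =
    functional B (\<lambda>b. anti y (\<lambda>p. mul b p g)) (twisted_antipode H \<pi> (word_prod H w))"
  unfolding twisted_antipode_def functional_hmult functional_hantipode
proof (rule functional_cong)
  fix c assume c: "c \<in> B"
  have "functional B (\<lambda>a. anti a (\<lambda>e. mul c e g)) (word_prod H (y # w)) =
     functional B (\<lambda>b. mul y b (\<lambda>a. anti a (\<lambda>e. mul c e g))) (word_prod H w)"
    using assms finite_B by (simp add: word_prod_def functional_hmult functional_bvec)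
  also have "\<dots> = functional B (\<lambda>a. anti a (\<lambda>e. mul c e (\<lambda>b. anti y (\<lambda>p. mul b p g)))) (word_prod H w)"
  proof (rule functional_cong)
    fix b assume b: "b \<in> B"
    have "mul y b (\<lambda>a. anti a (\<lambda>e. mul c e g)) = anti y (\<lambda>p. anti b (\<lambda>r. mul c r (\<lambda>b. mul b p g)))"
      using assms b c by (simp add: anti_mul_rev mul_assoc)
    also have "\<dots> = anti b (\<lambda>r. anti y (\<lambda>p. mul c r (\<lambda>b. mul b p g)))" by (rule anti_anti)
    finally show "mul y b (\<lambda>a. anti a (\<lambda>e. mul c e g)) = anti b (\<lambda>e. mul c e (\<lambda>b. anti y (\<lambda>p. mul b p g)))"
      by (simp only: anti_mul)
  qed
  finally show "functional B (\<lambda>a. anti a (\<lambda>e. mul c e g)) (word_prod H (y # w)) =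
    functional B (\<lambda>a. anti a (\<lambda>e. mul c e (\<lambda>b. anti y (\<lambda>p. mul b p g)))) (word_prod H w)" .
qed

lemma functional_alpha_word_prod_Cons:
  assumes "x \<in> B"
  shows "functional B \<alpha> (word_prod H (x # w)) = \<alpha> x * functional B \<alpha> (word_prod H w)"
proof -
  have "functional B \<alpha> (word_prod H (x # w)) = functional B (\<lambda>b. mul x b \<alpha>) (word_prod H w)"
    using assms finite_B by (simp add: word_prod_def functional_hmult functional_bvec)
  also have "\<dots> = functional B (\<lambda>b. \<alpha> x * \<alpha> b) (word_prod H w)"
    using assms by (intro functional_cong) (simp add: alpha_mul)
  finally show ?thesis by (simp add: functional_scale)
qed

lemma comult3_translate:
  assumes "a \<in> B"
  shows "(\<Sum>x\<in>B. \<Sum>y\<in>B. \<Sum>z\<in>B. comult3 H a x y z * \<alpha> x * h y z) = comul (sh a) h"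
proof -
  have "comul (sh a) h = comul a (\<lambda>x u. \<alpha> x * comul u h)"
    using assms by (simp add: translate)
  also have "\<dots> = (\<Sum>x\<in>B. \<Sum>u\<in>B. \<Sum>y\<in>B. \<Sum>z\<in>B. Comult H a (x, u) * Comult H u (y, z) * \<alpha> x * h y z)"
    by (simp add: comul_def functional_Times sum_distrib_left ac_simps)
  also have "\<dots> = (\<Sum>x\<in>B. \<Sum>y\<in>B. \<Sum>z\<in>B. comult3 H a x y z * \<alpha> x * h y z)"
    unfolding comult3_def sum_distrib_right
    by (rule sum.cong[OF refl], subst sum.swap, rule sum.cong[OF refl], rule sum.swap)
  finally show ?thesis by simp
qed

text \<open>The sum over threefold coproducts that defines the cyclic operator, evaluated one letter at a time: the first parts
  combine to a translation, the second ones to the product under the antipode.\<close>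

lemma cyc_sum:
  "set w \<subseteq> B \<Longrightarrow>
   (\<Sum>X\<in>W (length w). \<Sum>Y\<in>W (length w). \<Sum>Z\<in>W (length w).
      (\<Prod>i<length w. comult3 H (w ! i) (X ! i) (Y ! i) (Z ! i)) * functional B \<alpha> (word_prod H X) *
      functional B (\<lambda>c. \<psi> (c # Z)) (twisted_antipode H \<pi> (word_prod H Y))) = degen \<psi> w"
proof (induction w arbitrary: \<psi>)
  case Nil
  have W0: "W 0 = {[]}" by (auto simp: W_iff)
  have "functional B (\<lambda>c. \<psi> [c]) (twisted_antipode H \<pi> (word_prod H [])) = functional B (\<lambda>b. one (\<lambda>a. anti a (\<lambda>e. mul b e (\<lambda>c. \<psi> [c])))) \<pi>"
    by (simp add: twisted_antipode_def functional_hmult functional_hantipode word_prod_def one_def)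
  also have "\<dots> = functional B (\<lambda>c. \<psi> [c]) \<pi>"
    by (rule functional_cong) (simp add: anti_one one_mul_right)
  finally show ?case using alpha_one by (simp add: W0 word_prod_def one_def degen_def xdegen_Nil)
next
  case (Cons a w)
  let ?n = "length w"
  define P where "P X Y Z = (\<Prod>i<?n. comult3 H (w ! i) (X ! i) (Y ! i) (Z ! i)) * functional B \<alpha> (word_prod H X)" for X Y Z
  define T where "T Y g = functional B g (twisted_antipode H \<pi> (word_prod H Y))" for Y g
  have "(\<Sum>X\<in>W (length (a # w)). \<Sum>Y\<in>W (length (a # w)). \<Sum>Z\<in>W (length (a # w)).
      (\<Prod>i<length (a # w). comult3 H ((a # w) ! i) (X ! i) (Y ! i) (Z ! i)) * functional B \<alpha> (word_prod H X) * T Y (\<lambda>c. \<psi> (c # Z)))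
    = (\<Sum>x\<in>B. \<Sum>X\<in>W ?n. \<Sum>y\<in>B. \<Sum>Y\<in>W ?n. \<Sum>z\<in>B. \<Sum>Z\<in>W ?n.
        P X Y Z * (comult3 H a x y z * \<alpha> x * T Y (\<lambda>b. anti y (\<lambda>p. mul b p (\<lambda>r. \<psi> (r # z # Z))))))"
    unfolding length_Cons finite_sum_W_Suc T_def
  proof (intro sum.cong refl)
    fix x X y Y z Z assume "x \<in> B" "y \<in> B"
    then show "(\<Prod>i<Suc ?n. comult3 H ((a # w) ! i) ((x # X) ! i) ((y # Y) ! i) ((z # Z) ! i)) * functional B \<alpha> (word_prod H (x # X)) *
        functional B (\<lambda>c. \<psi> (c # z # Z)) (twisted_antipode H \<pi> (word_prod H (y # Y))) =
      P X Y Z * (comult3 H a x y z * \<alpha> x * functional B (\<lambda>b. anti y (\<lambda>p. mul b p (\<lambda>r. \<psi> (r # z # Z)))) (twisted_antipode H \<pi> (word_prod H Y)))"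
      by (simp add: functional_alpha_word_prod_Cons functional_twisted_antipode_Cons P_def prod.lessThan_Suc_shift ac_simps del: prod.lessThan_Suc)
  qed
  also have "\<dots> = (\<Sum>X\<in>W ?n. \<Sum>Y\<in>W ?n. \<Sum>Z\<in>W ?n. \<Sum>x\<in>B. \<Sum>y\<in>B. \<Sum>z\<in>B.
        P X Y Z * (comult3 H a x y z * \<alpha> x * T Y (\<lambda>b. anti y (\<lambda>p. mul b p (\<lambda>r. \<psi> (r # z # Z))))))"
  proof -
    have sw: "(\<Sum>x\<in>B. \<Sum>X\<in>W ?n. \<Sum>y\<in>B. \<Sum>Y\<in>W ?n. \<Sum>z\<in>B. \<Sum>Z\<in>W ?n. F x X y Y z Z) =
       (\<Sum>X\<in>W ?n. \<Sum>Y\<in>W ?n. \<Sum>Z\<in>W ?n. \<Sum>x\<in>B. \<Sum>y\<in>B. \<Sum>z\<in>B. F x X y Y z Z)" for F :: "'b \<Rightarrow> 'b list \<Rightarrow> 'b \<Rightarrow> 'b list \<Rightarrow> 'b \<Rightarrow> 'b list \<Rightarrow> 'k"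
    proof -
      have "(\<Sum>x\<in>B. \<Sum>X\<in>W ?n. \<Sum>y\<in>B. \<Sum>Y\<in>W ?n. \<Sum>z\<in>B. \<Sum>Z\<in>W ?n. F x X y Y z Z) =
        (\<Sum>X\<in>W ?n. \<Sum>x\<in>B. \<Sum>Y\<in>W ?n. \<Sum>y\<in>B. \<Sum>Z\<in>W ?n. \<Sum>z\<in>B. F x X y Y z Z)"
        by (subst sum.swap[of _ "W ?n" B], (rule sum.cong[OF refl])+, subst sum.swap[of _ "W ?n" B], (rule sum.cong[OF refl])+, rule sum.swap)
      also have "\<dots> = (\<Sum>X\<in>W ?n. \<Sum>Y\<in>W ?n. \<Sum>x\<in>B. \<Sum>Z\<in>W ?n. \<Sum>y\<in>B. \<Sum>z\<in>B. F x X y Y z Z)"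
        by (rule sum.cong[OF refl], subst sum.swap[of _ "W ?n" B], (rule sum.cong[OF refl])+, rule sum.swap)
      also have "\<dots> = (\<Sum>X\<in>W ?n. \<Sum>Y\<in>W ?n. \<Sum>Z\<in>W ?n. \<Sum>x\<in>B. \<Sum>y\<in>B. \<Sum>z\<in>B. F x X y Y z Z)"
        by ((rule sum.cong[OF refl])+, rule sum.swap)
      finally show ?thesis .
    qed
    show ?thesis by (rule sw)
  qed
  also have "\<dots> = (\<Sum>X\<in>W ?n. \<Sum>Y\<in>W ?n. \<Sum>Z\<in>W ?n. P X Y Z * T Y (\<lambda>b. absorb (sh a) \<psi> (b # Z)))"
  proof (intro sum.cong refl)
    fix X Y Z
    have "(\<Sum>x\<in>B. \<Sum>y\<in>B. \<Sum>z\<in>B. comult3 H a x y z * \<alpha> x * T Y (\<lambda>b. anti y (\<lambda>p. mul b p (\<lambda>r. \<psi> (r # z # Z))))) =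
       T Y (\<lambda>b. absorb (sh a) \<psi> (b # Z))"
      using Cons.prems by (simp add: comult3_translate absorb_Cons T_def comul_functional[symmetric])
    then show "(\<Sum>x\<in>B. \<Sum>y\<in>B. \<Sum>z\<in>B. P X Y Z * (comult3 H a x y z * \<alpha> x * T Y (\<lambda>b. anti y (\<lambda>p. mul b p (\<lambda>r. \<psi> (r # z # Z)))))) =
       P X Y Z * T Y (\<lambda>b. absorb (sh a) \<psi> (b # Z))"
      by (simp only: sum_distrib_left[symmetric])
  qed
  also have "\<dots> = degen (absorb (sh a) \<psi>) w"
    unfolding P_def T_def using Cons by simp
  finally show ?case unfolding T_def by (simp add: degen_def xdegen_Cons)
qed

lemma tdual_Nil: "tdual \<phi> [] = \<phi> []"
  using tdual_pow[of "[]" 0 \<phi>] by (simp add: W_iff)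

lemma tau_eq:
  assumes "x \<in> vecs (W n)"
  shows "tau H \<pi> \<alpha> \<beta> n x = tmap n (\<lambda>\<phi> w. (-1) ^ n * tdual \<phi> w) x"
proof -
  have "cyc H \<pi> \<alpha> \<beta> n x = tmap n tdual x"
  proof (cases "n = 0")
    case True
    have "tmap n tdual x = tmap n (\<lambda>\<phi>. \<phi>) x"
      by (rule tmap_cong) (auto simp: True W_iff tdual_Nil)
    then show ?thesis using True assms by (simp add: cyc_def tmap_id)
  next
    case False
    have "(\<Sum>X\<in>W n. \<Sum>Y\<in>W n. \<Sum>Z\<in>W n. (\<Prod>i<n. comult3 H (w ! i) (X ! i) (Y ! i) (Z ! i)) * functional B \<alpha> (word_prod H X) *
         pure_tensor (twisted_antipode H \<pi> (word_prod H Y) # map bvec (butlast Z)) v * \<beta> (last Z)) = tdual (bvec v) w"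
      if "w \<in> W n" for v w
    proof -
      have w: "length w = n" "set w \<subseteq> B" using that by (auto simp: W_iff)
      have "pure_tensor (twisted_antipode H \<pi> (word_prod H Y) # map bvec (butlast Z)) v * \<beta> (last Z) =
         functional B (\<lambda>c. last_face (bvec v) (c # Z)) (twisted_antipode H \<pi> (word_prod H Y))" if "Z \<in> W n" for Y Z
      proof -
        have "Z \<noteq> []" using that False by (auto simp: W_iff)
        then have "functional B (\<lambda>c. last_face (bvec v) (c # Z)) (twisted_antipode H \<pi> (word_prod H Y)) =
          functional B (\<lambda>c. \<beta> (last Z) * bvec v (c # butlast Z)) (twisted_antipode H \<pi> (word_prod H Y))"
          by (simp add: last_face_def mult.commute)
        then show ?thesis
          using pure_tensor_insert[OF twisted_antipode_vecs, of "[]" \<pi> "word_prod H Y" "butlast Z" v]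
          by (simp add: functional_scale mult.commute)
      qed
      then show ?thesis unfolding tdual_def cyc_sum[OF w(2), symmetric] w(1)
        by (simp add: mult.assoc)
    qed
    then show ?thesis using False
      by (simp add: cyc_def tmap_def linear_ext_def)
  qed
  then show ?thesis by (simp add: tau_def tmap_def linear_ext_def sum_distrib_left ac_simps)
qed

end


text \<open>The relation \<open>b' N = N b\<close> of cyclic objects.  With signed faces and cyclic operators the relations
  \<open>D\<^sub>i\<^sub>+\<^sub>1 t = t' D\<^sub>i\<close> give \<open>D\<^sub>i t\<^sup>i = t'\<^sup>i D\<^sub>0\<close>; as \<open>N\<close> absorbs powers of \<open>t\<close>, both sides are \<open>N' D\<^sub>0 N\<close>.\<close>

lemma norm_commute:
  fixes D :: "nat \<Rightarrow> 'v::ab_group_add \<Rightarrow> 'v"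
  assumes V: "\<And>x. x \<in> V \<Longrightarrow> t x \<in> V" and D_V: "\<And>x i. x \<in> V \<Longrightarrow> i \<le> n \<Longrightarrow> D i x \<in> V'"
    and V': "\<And>y. y \<in> V' \<Longrightarrow> t' y \<in> V'"
    and t_add: "\<And>x y. t (x + y) = t x + t y" and t'_add: "\<And>x y. t' (x + y) = t' x + t' y"
    and D_add: "\<And>i x y. D i (x + y) = D i x + D i y"
    and step: "\<And>x i. x \<in> V \<Longrightarrow> i < n \<Longrightarrow> D (Suc i) (t x) = t' (D i x)"
    and period: "\<And>x. x \<in> V \<Longrightarrow> (t ^^ Suc n) x = x" and per': "\<And>y. y \<in> V' \<Longrightarrow> (t' ^^ n) y = y"
    and V_add: "\<And>x y. x \<in> V \<Longrightarrow> y \<in> V \<Longrightarrow> x + y \<in> V" and V_0: "0 \<in> V"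
    and x: "x \<in> V"
  shows "(\<Sum>i<n. D i (\<Sum>j\<le>n. (t ^^ j) x)) = (\<Sum>j<n. (t' ^^ j) (\<Sum>i\<le>n. D i x))"
proof -
  have sum_t: "f (\<Sum>i\<in>I. g i) = (\<Sum>i\<in>I. f (g i))" if "finite I" "\<And>x y. f (x + y) = f x + f y"
    for f :: "'v \<Rightarrow> 'v" and I :: "nat set" and g
  proof -
    have "f 0 + f 0 = f 0" using that(2)[of 0 0] by simp
    then have f0: "f 0 = 0" by simp
    show ?thesis using that(1) by (induction I rule: finite_induct) (simp_all add: f0 that(2))
  qed
  have pow_V: "(t ^^ j) y \<in> V" if "y \<in> V" for j y using that V by (induction j) auto
  have pow_add: "(t' ^^ j) (y + z) = (t' ^^ j) y + (t' ^^ j) z" for j y z using t'_add by (induction j) auto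
  define Nx where "Nx = (\<Sum>j\<le>n. (t ^^ j) x)"
  have sum_V: "finite I \<Longrightarrow> (\<Sum>j\<in>I. (t ^^ j) x) \<in> V" for I
    by (induction I rule: finite_induct) (auto simp: V_add V_0 pow_V x)
  have Nx: "Nx \<in> V" unfolding Nx_def by (rule sum_V) simp
  have "t Nx = (\<Sum>j\<le>n. (t ^^ Suc j) x)"
    unfolding Nx_def by (subst sum_t) (auto simp: t_add)
  also have "\<dots> = Nx"
  proof -
    have "(\<Sum>j\<le>n. (t ^^ Suc j) x) + x = (\<Sum>j\<le>Suc n. (t ^^ j) x)"
      by (subst sum.atMost_Suc_shift) simp
    also have "\<dots> = Nx + x" using period[OF x] by (simp add: Nx_def)
    finally show ?thesis by simp
  qed
  finally have tNx: "t Nx = Nx" .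
  have D_pow: "D i ((t ^^ i) y) = (t' ^^ i) (D 0 y)" if "y \<in> V" "i \<le> n" for i y
    using that
  proof (induction i)
    case (Suc i)
    then show ?case using step[of "(t ^^ i) y" i] pow_V by simp
  qed simp
  have tN_pow: "(t ^^ i) Nx = Nx" for i by (induction i) (auto simp: tNx)
  have "(\<Sum>i<n. D i Nx) = (\<Sum>i<n. (t' ^^ i) (D 0 Nx))"
  proof (rule sum.cong[OF refl])
    fix i assume "i \<in> {..<n}"
    then have "D i ((t ^^ i) Nx) = (t' ^^ i) (D 0 Nx)" by (intro D_pow Nx) simp
    then show "D i Nx = (t' ^^ i) (D 0 Nx)" by (simp only: tN_pow)
  qed
  also have "\<dots> = (\<Sum>j<n. (t' ^^ j) (\<Sum>i\<le>n. D i x))"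
  proof -
    let ?N = "\<lambda>y. \<Sum>j<n. (t' ^^ j) y"
    have N_add: "?N (y + z) = ?N y + ?N z" for y z by (simp add: pow_add sum.distrib)
    have N_t: "?N (t' y) = ?N y" if "y \<in> V'" for y
    proof -
      have "?N (t' y) + y = (\<Sum>j<Suc n. (t' ^^ j) y)"
        by (subst sum.lessThan_Suc_shift) (simp add: funpow_swap1)
      also have "\<dots> = ?N y + y" using per'[OF that] by simp
      finally show ?thesis by simp
    qed
    have N_pow: "?N ((t' ^^ i) y) = ?N y" if "y \<in> V'" for i y
    proof -
      have "(t' ^^ i) y \<in> V'" for i using V' that by (induction i) auto
      then show ?thesis by (induction i) (auto simp: N_t)
    qed
    have "?N (D i x) = ?N (D 0 ((t ^^ (Suc n - i)) x))" if "i \<le> n" for i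
    proof -
      have "(t ^^ i) ((t ^^ (Suc n - i)) x) = (t ^^ (i + (Suc n - i))) x"
        by (simp only: funpow_add o_apply)
      also have "\<dots> = x" using that period[OF x] by simp
      finally have "D i x = (t' ^^ i) (D 0 ((t ^^ (Suc n - i)) x))"
        using D_pow[of "(t ^^ (Suc n - i)) x" i] pow_V[OF x] that by metis
      then have "?N (D i x) = ?N ((t' ^^ i) (D 0 ((t ^^ (Suc n - i)) x)))" by (simp only:)
      also have "\<dots> = ?N (D 0 ((t ^^ (Suc n - i)) x))" by (rule N_pow) (intro D_V pow_V x le0)
      finally show ?thesis .
    qed
    then have "(\<Sum>i\<le>n. ?N (D i x)) = (\<Sum>i\<le>n. ?N (D 0 ((t ^^ (Suc n - i)) x)))" by simp
    also have "\<dots> = (\<Sum>i\<le>n. ?N (D 0 ((t ^^ Suc i) x)))"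
      by (rule sum.reindex_bij_witness[of _ "\<lambda>i. n - i" "\<lambda>i. n - i"]) (auto simp: Suc_diff_le)
    also have "\<dots> = ?N (D 0 (\<Sum>i\<le>n. (t ^^ Suc i) x))"
      by (subst sum_t, simp, rule D_add, subst sum_t[where f = ?N], simp, rule N_add, rule refl)
    also have "(\<Sum>i\<le>n. (t ^^ Suc i) x) = Nx"
      using \<open>(\<Sum>j\<le>n. (t ^^ Suc j) x) = Nx\<close> .
    finally have "(\<Sum>i\<le>n. ?N (D i x)) = ?N (D 0 Nx)" .
    moreover have "?N (\<Sum>i\<le>n. D i x) = (\<Sum>i\<le>n. ?N (D i x))"
      by (subst sum_t[where f = ?N]) (auto simp: N_add)
    ultimately show ?thesis by simp
  qed
  finally show ?thesis unfolding Nx_def .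
qed

context modular_triple
begin

lemma dface_functional:
  "dface \<alpha> \<beta> n i (\<lambda>u. functional X (\<lambda>x. F x u) f) w = functional X (\<lambda>x. dface \<alpha> \<beta> n i (F x) w) f"
  by (simp add: dface_def merge_functional functional_scale mult.commute[of _ "\<beta> _"])

lemma dface_cong:
  assumes "\<And>u. Suc (length u) = length w \<Longrightarrow> set u \<subseteq> B \<Longrightarrow> \<phi> u = \<psi> u" "set w \<subseteq> B" "w \<noteq> []"
  shows "dface \<alpha> \<beta> n i \<phi> w = dface \<alpha> \<beta> n i \<psi> w"
proof -
  have "set (tl w) \<subseteq> B" "set (butlast w) \<subseteq> B"
    using assms(2) by (cases w; auto dest: in_set_butlastD)+
  then have "\<phi> (tl w) = \<psi> (tl w)" "\<phi> (butlast w) = \<psi> (butlast w)" using assms(3) by (auto intro!: assms(1))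
  then show ?thesis using merge_cong[OF assms(1,2), where i = "i - 1"] by (simp add: dface_def)
qed

definition dbp where "dbp n \<phi> w = (\<Sum>i<n. (-1) ^ i * dface \<alpha> \<beta> n i \<phi> w)"
definition db where "db n \<phi> w = (\<Sum>i\<le>n. (-1) ^ i * dface \<alpha> \<beta> n i \<phi> w)"

lemma db_dbp: "0 < n \<Longrightarrow> db n \<phi> w = dbp n \<phi> w + (-1) ^ n * last_face \<phi> w"
  by (simp add: db_def dbp_def lessThan_Suc_atMost[symmetric] dface_def last_face_def)

lemma db_Suc: "db (Suc n) \<phi> = (\<lambda>w. dbp (Suc n) \<phi> w + (-1) ^ Suc n * last_face \<phi> w)"
  by (rule ext) (simp add: db_dbp)

lemma dbp_functional: "dbp n (\<lambda>u. functional X (\<lambda>x. F x u) f) w = functional X (\<lambda>x. dbp n (F x) w) f"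
proof -
  have "dbp n (\<lambda>u. functional X (\<lambda>x. F x u) f) w = (\<Sum>i<n. \<Sum>x\<in>X. f x * ((-1) ^ i * dface \<alpha> \<beta> n i (F x) w))"
    unfolding dbp_def dface_functional unfolding functional_def sum_distrib_left by (simp add: mult.left_commute)
  then show ?thesis unfolding functional_def dbp_def sum_distrib_left by (subst sum.swap)
qed

lemma dbp_mul: "dbp n (\<lambda>u. mul a b (\<lambda>x. F x u)) w = mul a b (\<lambda>x. dbp n (F x) w)"
  and dbp_one: "dbp n (\<lambda>u. one (\<lambda>x. F x u)) w = one (\<lambda>x. dbp n (F x) w)"
  unfolding mul_def one_def by (rule dbp_functional)+

lemma dbp_lin: "dbp n (\<lambda>u. \<phi> u + c * \<psi> u) w = dbp n \<phi> w + c * dbp n \<psi> w"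
  using dbp_functional[of n UNIV "\<lambda>x. if x then \<phi> else \<psi>" "\<lambda>x. if x then 1 else c" w]
  by (simp add: functional_def UNIV_bool add.commute)

lemma dbp_scale: "dbp n (\<lambda>u. \<phi> u * c) w = dbp n \<phi> w * c"
  using dbp_functional[of n "{()}" "\<lambda>_. \<phi>" "\<lambda>_. c" w] by (simp add: functional_def mult.commute)

lemma dbp_cong:
  assumes "\<And>u. Suc (length u) = length w \<Longrightarrow> set u \<subseteq> B \<Longrightarrow> \<phi> u = \<psi> u" "set w \<subseteq> B" "w \<noteq> []"
  shows "dbp n \<phi> w = dbp n \<psi> w"
  unfolding dbp_def by (intro sum.cong refl arg_cong[of _ _ "(*) _"] dface_cong assms)

lemma dbp_1: "dbp (Suc 0) \<phi> [a] = \<alpha> a * \<phi> []"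
  by (simp add: dbp_def dface_def)

lemma dbp_snoc:
  assumes "length v = n" "0 < n"
  shows "dbp (Suc n) \<phi> (v @ [a]) = dbp n (\<lambda>u. \<phi> (u @ [a])) v + (-1) ^ n * mul (last v) a (\<lambda>z. \<phi> (butlast v @ [z]))"
proof -
  obtain v' c where v: "v = v' @ [c]" using assms by (cases v rule: rev_cases) auto
  have "dface \<alpha> \<beta> (Suc n) i \<phi> (v @ [a]) = dface \<alpha> \<beta> n i (\<lambda>u. \<phi> (u @ [a])) v" if "i < n" for i
  proof (cases "i = 0")
    case True
    then show ?thesis by (cases v') (simp_all add: dface_def v)
  next
    case False
    then show ?thesis using that assms(1) by (simp add: dface_def merge_snoc)
  qed
  moreover have "dface \<alpha> \<beta> (Suc n) n \<phi> (v @ [a]) = mul (last v) a (\<lambda>z. \<phi> (butlast v @ [z]))"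
    using assms merge_snoc_last[of v' \<phi> c a] by (auto simp: dface_def v cong del: mul_cong)
  ultimately show ?thesis by (simp add: dbp_def)
qed

lemma dbp_mul_last:
  assumes "length v = n" "0 < n" "set v \<subseteq> B" "c \<in> B" "a \<in> B"
  shows "dbp (Suc n) (\<lambda>u. mul (last u) a (\<lambda>z. \<phi> (butlast u @ [z]))) (v @ [c]) = mul c a (\<lambda>z. dbp (Suc n) \<phi> (v @ [z]))"
proof -
  have "last v \<in> B" using assms last_in_set[of v] by auto
  then show ?thesis
    unfolding dbp_snoc[OF assms(1,2)]
    using assms by (simp add: dbp_mul butlast_append mul_assoc cong del: mul_cong)
      (simp add: mul_def functional_add functional_scale)
qed

lemma dbp_dbp:
  "length w = Suc (Suc n) \<Longrightarrow> set w \<subseteq> B \<Longrightarrow> dbp (Suc (Suc n)) (dbp (Suc n) \<phi>) w = 0"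
proof (induction n arbitrary: \<phi> w)
  case 0
  then obtain c a where w: "w = [c, a]" "c \<in> B" "a \<in> B" by (auto simp: length_Suc_conv)
  have "dbp (Suc (Suc 0)) (dbp (Suc 0) \<phi>) ([c] @ [a]) = \<alpha> c * (\<alpha> a * \<phi> []) - mul c a (\<lambda>z. \<phi> [] * \<alpha> z)"
    by (subst dbp_snoc) (simp_all add: dbp_1 mult.commute cong del: mul_cong)
  also have "\<dots> = 0" using w by (simp only: mul_scale alpha_mul) (simp add: ac_simps)
  finally show ?case by (simp add: w)
next
  case (Suc n)
  then obtain v' c a where w: "w = (v' @ [c]) @ [a]" by (cases w rule: rev_cases; cases "butlast w" rule: rev_cases) auto
  let ?v = "v' @ [c]" and ?N = "Suc (Suc n)"
  have l: "length v' = Suc n" "set v' \<subseteq> B" "c \<in> B" "a \<in> B" using Suc.prems by (auto simp: w)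
  have "dbp ?N (\<lambda>u. dbp ?N \<phi> (u @ [a])) ?v =
      dbp ?N (\<lambda>u. dbp (Suc n) (\<lambda>x. \<phi> (x @ [a])) u + (-1) ^ Suc n * mul (last u) a (\<lambda>z. \<phi> (butlast u @ [z]))) ?v"
    using l by (intro dbp_cong dbp_snoc) auto
  also have "\<dots> = (-1) ^ Suc n * mul c a (\<lambda>z. dbp ?N \<phi> (v' @ [z]))"
    unfolding dbp_lin using l by (simp add: Suc.IH dbp_mul_last cong del: mul_cong)
  finally show ?case using l unfolding w by (subst dbp_snoc) (simp_all add: butlast_append cong del: mul_cong)
qed

lemma db_db:
  assumes "length w = Suc (Suc n)" "set w \<subseteq> B"
  shows "db (Suc (Suc n)) (db (Suc n) \<phi>) w = 0"
proof -
  let ?N = "Suc (Suc n)"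
  obtain v a where w: "w = v @ [a]" using assms by (cases w rule: rev_cases) auto
  have l: "length v = Suc n" "set v \<subseteq> B" "a \<in> B" "v \<noteq> []" using assms by (auto simp: w)
  then have lv: "last v \<in> B" using last_in_set by blast
  have 1: "dbp ?N (last_face \<phi>) w = dbp (Suc n) \<phi> v * \<beta> a + (-1) ^ Suc n * (\<phi> (butlast v) * (\<beta> (last v) * \<beta> a))"
    unfolding w using l lv by (subst dbp_snoc) (simp_all add: last_face_def dbp_scale mul_scale beta_mul cong del: mul_cong)
  have "db ?N (db (Suc n) \<phi>) w = dbp ?N (\<lambda>u. dbp (Suc n) \<phi> u + (-1) ^ Suc n * last_face \<phi> u) w
      + (-1) ^ ?N * last_face (\<lambda>u. dbp (Suc n) \<phi> u + (-1) ^ Suc n * last_face \<phi> u) w"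
    by (simp only: db_Suc)
  also have "\<dots> = (-1) ^ Suc n * dbp ?N (last_face \<phi>) w + (-1) ^ ?N * last_face (\<lambda>u. dbp (Suc n) \<phi> u + (-1) ^ Suc n * last_face \<phi> u) w"
    unfolding dbp_lin using assms by (simp add: dbp_dbp)
  also have "\<dots> = 0" unfolding 1 by (simp add: last_face_def w algebra_simps)
  finally show ?thesis .
qed

lemma b_op_eq: "0 < n \<Longrightarrow> b_op H \<alpha> \<beta> n x = tmap n (db n) x"
  unfolding b_op_def db_def
  by (rule ext) (simp add: face_dface tmap_def linear_ext_def sum_distrib_left mult.left_commute, rule sum.swap)

lemma b'_op_eq: "0 < n \<Longrightarrow> b'_op H \<alpha> \<beta> n x = tmap n (dbp n) x"
  unfolding b'_op_def dbp_def
  by (rule ext) (simp add: face_dface tmap_def linear_ext_def sum_distrib_left mult.left_commute, rule sum.swap)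

lemma dbp_local: "local_map (Suc n) n (dbp (Suc n))"
  by (rule local_mapI) (auto simp: dbp_functional W_iff intro!: dbp_cong)

lemma last_face_functional: "last_face (\<lambda>u. functional X (\<lambda>x. F x u) f) w = functional X (\<lambda>x. last_face (F x) w) f"
  unfolding last_face_def mult.commute[of _ "\<beta> _"] functional_scale ..

lemma db_local: "local_map (Suc n) n (db (Suc n))"
proof (rule local_mapI)
  fix \<phi> \<psi> :: "'b list \<Rightarrow> 'k" and w assume w: "w \<in> W (Suc n)" "\<And>u. u \<in> W n \<Longrightarrow> \<phi> u = \<psi> u"
  show "db (Suc n) \<phi> w = db (Suc n) \<psi> w"
    unfolding db_def using w by (intro sum.cong refl arg_cong[of _ _ "(*) _"] dface_cong) (auto simp: W_iff)
next
  fix F :: "'b list \<Rightarrow> 'b list \<Rightarrow> 'k" and f w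
  show "db (Suc n) (\<lambda>u. functional (W n) (\<lambda>x. F x u) f) w = functional (W n) (\<lambda>x. db (Suc n) (F x) w) f"
    by (simp only: db_Suc dbp_functional last_face_functional functional_add functional_scale)
qed

lemma degen_functional: "degen (\<lambda>u. functional X (\<lambda>x. F x u) f) w = functional X (\<lambda>x. degen (F x) w) f"
  unfolding degen_def by (rule xdegen_functional)

lemma tdual_functional: "tdual (\<lambda>u. functional X (\<lambda>x. F x u) f) w = functional X (\<lambda>x. tdual (F x) w) f"
  unfolding tdual_def last_face_functional[abs_def] by (rule degen_functional)

definition dtau where "dtau n \<phi> w = (-1) ^ n * tdual \<phi> w"

lemma dtau_local: "local_map n n (dtau n)"
  by (rule local_mapI) (auto simp: dtau_def tdual_functional functional_scale W_iff intro!: arg_cong[of _ _ "(*) _"] tdual_cong)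

lemma tau_dtau: "x \<in> vecs (W n) \<Longrightarrow> tau H \<pi> \<alpha> \<beta> n x = tmap n (dtau n) x"
  by (simp add: tau_eq dtau_def[abs_def])

lemma tdual_scale: "tdual (\<lambda>u. c * \<phi> u) w = c * tdual \<phi> w"
  using tdual_functional[of "{()}" "\<lambda>_. \<phi>" "\<lambda>_. c" w] by (simp add: functional_def)

lemma dtau_pow: "(dtau n ^^ k) \<phi> w = (-1) ^ (n * k) * (tdual ^^ k) \<phi> w"
proof (induction k arbitrary: w)
  case (Suc k)
  have IH: "(dtau n ^^ k) \<phi> = (\<lambda>w. (-1) ^ (n * k) * (tdual ^^ k) \<phi> w)" by (rule ext) (rule Suc)
  have "(dtau n ^^ Suc k) \<phi> w = (-1) ^ n * tdual ((dtau n ^^ k) \<phi>) w" by (simp add: dtau_def[of n "(dtau n ^^ k) \<phi>"])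
  also have "\<dots> = (-1) ^ n * ((-1) ^ (n * k) * tdual ((tdual ^^ k) \<phi>) w)" by (simp only: IH tdual_scale)
  finally show ?case by (simp add: power_add mult.assoc)
qed simp


lemma dface_scale: "dface \<alpha> \<beta> n i (\<lambda>u. c * \<phi> u) w = c * dface \<alpha> \<beta> n i \<phi> w"
  using dface_functional[of n i "{()}" "\<lambda>_. \<phi>" "\<lambda>_. c" w] by (simp add: functional_def)

lemma local_map_comp: "local_map n m P \<Longrightarrow> local_map m l Q \<Longrightarrow> local_map n l (\<lambda>\<phi>. P (Q \<phi>))"
proof (unfold local_map_def, intro allI ballI)
  fix \<phi> :: "'b list \<Rightarrow> 'k" and w
  assume P: "\<forall>\<phi>. \<forall>w\<in>W n. P \<phi> w = functional (W m) (\<lambda>u. P (bvec u) w) \<phi>"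
    and Q: "\<forall>\<phi>. \<forall>w\<in>W m. Q \<phi> w = functional (W l) (\<lambda>u. Q (bvec u) w) \<phi>" and w: "w \<in> W n"
  have swap: "functional X f g = functional X g f" for X f and g :: "'b list \<Rightarrow> 'k"
    by (simp add: functional_def mult.commute)
  have "P (Q \<phi>) w = functional (W m) (Q \<phi>) (\<lambda>u. P (bvec u) w)"
    using P w swap by metis
  also have "\<dots> = functional (W m) (\<lambda>v. functional (W l) (\<lambda>u. Q (bvec u) v) \<phi>) (\<lambda>u. P (bvec u) w)"
    by (rule functional_cong) (use Q in blast)
  also have "\<dots> = functional (W l) (\<lambda>u. functional (W m) (Q (bvec u)) (\<lambda>v. P (bvec v) w)) \<phi>"
    by (rule functional_swap)
  also have "\<dots> = functional (W l) (\<lambda>u. P (Q (bvec u)) w) \<phi>"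
    by (rule functional_cong) (use P w swap in metis)
  finally show "P (Q \<phi>) w = functional (W l) (\<lambda>u. P (Q (bvec u)) w) \<phi>" .
qed

lemma tmap_zero: "(\<And>\<phi> w. w \<in> W n \<Longrightarrow> P \<phi> w = 0) \<Longrightarrow> tmap n P x = 0"
  by (simp add: tmap_def linear_ext_def zero_fun_def)

abbreviation C where "C n \<equiv> vecs (W n) :: ('b list \<Rightarrow> 'k) set"
abbreviation b where "b \<equiv> b_op H \<alpha> \<beta>"
abbreviation b' where "b' \<equiv> b'_op H \<alpha> \<beta>"
abbreviation \<tau> where "\<tau> \<equiv> tau H \<pi> \<alpha> \<beta>"

lemma b_C: "b (Suc n) x \<in> C n" and b'_C: "b' (Suc n) x \<in> C n"
  by (simp_all add: b_op_eq b'_op_eq tmap_vecs[OF db_local] tmap_vecs[OF dbp_local])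

lemma tau_C: "x \<in> C n \<Longrightarrow> \<tau> n x \<in> C n"
  by (simp add: tau_dtau tmap_vecs[OF dtau_local])

lemma b_b: "b (Suc n) (b (Suc (Suc n)) x) = 0"
  by (simp add: b_op_eq tmap_tmap[OF db_local]) (rule tmap_zero, simp add: W_iff db_db)

lemma b'_b': "b' (Suc n) (b' (Suc (Suc n)) x) = 0"
  by (simp add: b'_op_eq tmap_tmap[OF dbp_local]) (rule tmap_zero, simp add: W_iff dbp_dbp)

lemma tau_add: "\<tau> n (x + y) = \<tau> n x + \<tau> n y"
  by (rule ext) (simp add: tau_def cyc_def linear_ext_def plus_fun_def algebra_simps sum.distrib)

lemma tau_pow_tmap: "x \<in> C n \<Longrightarrow> (\<tau> n ^^ k) x = tmap n (dtau n ^^ k) x \<and> local_map n n (dtau n ^^ k)"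
proof (induction k)
  case 0
  have "local_map n n (\<lambda>\<phi>. \<phi>)" by (rule local_mapI) auto
  then show ?case using 0 tmap_id[of x n] by (simp add: id_def)
next
  case (Suc k)
  then have IH: "(\<tau> n ^^ k) x = tmap n (dtau n ^^ k) x" "local_map n n (dtau n ^^ k)" by auto
  have "(\<tau> n ^^ Suc k) x = tmap n (dtau n) (tmap n (dtau n ^^ k) x)"
    using tmap_vecs[OF IH(2)] by (simp add: IH tau_dtau)
  also have "\<dots> = tmap n (dtau n ^^ Suc k) x"
    by (simp add: tmap_tmap[OF IH(2)] funpow_Suc_right o_def del: funpow.simps)
  finally show ?case using local_map_comp[OF IH(2) dtau_local] by (simp add: funpow_Suc_right o_def del: funpow.simps)
qed

lemma tau_period:
  assumes "x \<in> C n" shows "(\<tau> n ^^ Suc n) x = x"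
proof -
  have "(\<tau> n ^^ Suc n) x = tmap n (dtau n ^^ Suc n) x" using tau_pow_tmap[OF assms] by blast
  also have "\<dots> = tmap n (\<lambda>\<phi>. \<phi>) x"
    by (rule tmap_cong) (simp only: dtau_pow tdual_pow, simp)
  finally show ?thesis using assms by (simp add: tmap_id)
qed

definition signed_face :: "nat \<Rightarrow> nat \<Rightarrow> ('b list \<Rightarrow> 'k) \<Rightarrow> 'b list \<Rightarrow> 'k" where
  "signed_face n i x = (\<lambda>v. (-1) ^ i * face H \<alpha> \<beta> n i x v)"

lemma signed_face_tmap: "0 < n \<Longrightarrow> signed_face n i x = tmap n (\<lambda>\<phi> w. (-1) ^ i * dface \<alpha> \<beta> n i \<phi> w) x"
  by (simp add: signed_face_def face_dface tmap_def linear_ext_def sum_distrib_left mult.left_commute)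

lemma signed_face_local: "i \<le> Suc n \<Longrightarrow> local_map (Suc n) n (\<lambda>\<phi> w. (-1) ^ i * dface \<alpha> \<beta> (Suc n) i \<phi> w)"
  by (rule local_mapI) (auto simp: dface_functional functional_scale W_iff intro!: arg_cong[of _ _ "(*) _"] dface_cong)

lemma signed_face_C: "i \<le> Suc n \<Longrightarrow> signed_face (Suc n) i x \<in> C n"
  by (simp add: signed_face_tmap tmap_vecs[OF signed_face_local])

lemma signed_face_add: "signed_face n i (x + y) = signed_face n i x + signed_face n i y"
  by (rule ext) (simp add: signed_face_def face_def linear_ext_def plus_fun_def algebra_simps sum.distrib)

lemma signed_face_Suc_tau:
  assumes "x \<in> C (Suc n)" "i < Suc n"
  shows "signed_face (Suc n) (Suc i) (\<tau> (Suc n) x) = \<tau> n (signed_face (Suc n) i x)"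
proof -
  have "signed_face (Suc n) (Suc i) (\<tau> (Suc n) x) =
      tmap (Suc n) (\<lambda>\<phi>. dtau (Suc n) (\<lambda>w. (-1) ^ Suc i * dface \<alpha> \<beta> (Suc n) (Suc i) \<phi> w)) x"
    using assms by (simp only: tau_dtau signed_face_tmap tmap_tmap[OF dtau_local] zero_less_Suc)
  also have "\<dots> = tmap (Suc n) (\<lambda>\<phi> w. (-1) ^ i * dface \<alpha> \<beta> (Suc n) i (dtau n \<phi>) w) x"
  proof (rule tmap_cong)
    fix \<phi> w assume "w \<in> W (Suc n)"
    then show "dtau (Suc n) (\<lambda>w. (-1) ^ Suc i * dface \<alpha> \<beta> (Suc n) (Suc i) \<phi> w) w = (-1) ^ i * dface \<alpha> \<beta> (Suc n) i (dtau n \<phi>) w"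
      unfolding dtau_def[abs_def] tdual_scale dface_scale using assms tdual_dface_Suc[of w "Suc n" "Suc i" \<phi>] by simp
  qed
  also have "\<dots> = tmap n (dtau n) (tmap (Suc n) (\<lambda>\<phi> w. (-1) ^ i * dface \<alpha> \<beta> (Suc n) i \<phi> w) x)"
    using assms by (simp add: tmap_tmap[OF signed_face_local])
  also have "\<dots> = \<tau> n (signed_face (Suc n) i x)"
    using assms signed_face_C[of i n x] by (simp add: tau_dtau) (simp add: signed_face_tmap)
  finally show ?thesis .
qed

lemma signed_face_0_tau:
  assumes "x \<in> C (Suc n)"
  shows "signed_face (Suc n) 0 (\<tau> (Suc n) x) = signed_face (Suc n) (Suc n) x"
proof -
  have "signed_face (Suc n) 0 (\<tau> (Suc n) x) = tmap (Suc n) (\<lambda>\<phi>. dtau (Suc n) (\<lambda>w. (-1) ^ 0 * dface \<alpha> \<beta> (Suc n) 0 \<phi> w)) x"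
    using assms by (simp only: tau_dtau signed_face_tmap tmap_tmap[OF dtau_local] zero_less_Suc)
  also have "\<dots> = tmap (Suc n) (\<lambda>\<phi> w. (-1) ^ Suc n * dface \<alpha> \<beta> (Suc n) (Suc n) \<phi> w) x"
    by (rule tmap_cong) (simp add: dtau_def tdual_dface_0)
  also have "\<dots> = signed_face (Suc n) (Suc n) x" by (simp add: signed_face_tmap)
  finally show ?thesis .
qed

lemma b_sum: "b n x = (\<Sum>i\<le>n. signed_face n i x)" and b'_sum: "b' n x = (\<Sum>i<n. signed_face n i x)"
  by (auto simp: b_op_def b'_op_def signed_face_def sum_fun_apply fun_eq_iff)

lemma C_add: "x \<in> C n \<Longrightarrow> y \<in> C n \<Longrightarrow> x + y \<in> C n" and C_0: "0 \<in> C n"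
  by (auto simp: vecs_def)

lemma tau_sum: "finite I \<Longrightarrow> \<tau> n (\<Sum>i\<in>I. f i) = (\<Sum>i\<in>I. \<tau> n (f i))"
proof (induction I rule: finite_induct)
  case empty
  have "\<tau> n 0 + \<tau> n 0 = \<tau> n 0" using tau_add[of n 0 0] by (simp only: add_0)
  then have "\<tau> n 0 = 0" by (simp only: add_cancel_left_left)
  then show ?case by (simp only: sum.empty)
next
  case (insert i I)
  show ?case unfolding sum.insert[OF insert(1,2)] tau_add insert(3) ..
qed

lemma b_tau:
  assumes "x \<in> C (Suc n)"
  shows "b (Suc n) (\<tau> (Suc n) x) = b (Suc n) x - b' (Suc n) x + \<tau> n (b' (Suc n) x)"
proof -
  have "b (Suc n) (\<tau> (Suc n) x) = signed_face (Suc n) 0 (\<tau> (Suc n) x) + (\<Sum>i<Suc n. signed_face (Suc n) (Suc i) (\<tau> (Suc n) x))"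
    unfolding b_sum lessThan_Suc_atMost[symmetric] by (rule sum.lessThan_Suc_shift)
  also have "\<dots> = signed_face (Suc n) (Suc n) x + (\<Sum>i<Suc n. \<tau> n (signed_face (Suc n) i x))"
    using assms by (simp only: signed_face_0_tau) (intro arg_cong2[of _ _ _ _ "(+)"] refl sum.cong signed_face_Suc_tau, auto)
  also have "\<dots> = signed_face (Suc n) (Suc n) x + \<tau> n (b' (Suc n) x)"
    by (simp only: b'_sum tau_sum finite_lessThan)
  also have "signed_face (Suc n) (Suc n) x = b (Suc n) x - b' (Suc n) x"
    unfolding b_sum b'_sum lessThan_Suc_atMost[symmetric] by simp
  finally show ?thesis .
qed

lemma b'_norm:
  assumes "x \<in> C (Suc n)"
  shows "b' (Suc n) (norm_op H \<pi> \<alpha> \<beta> (Suc n) x) = norm_op H \<pi> \<alpha> \<beta> n (b (Suc n) x)"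
  unfolding b'_sum b_sum norm_op_def lessThan_Suc_atMost[symmetric, of n]
  by (rule norm_commute[where V = "C (Suc n)" and V' = "C n" and D = "signed_face (Suc n)" and t = "\<tau> (Suc n)" and t' = "\<tau> n"])
    (rule tau_C signed_face_C tau_add signed_face_add signed_face_Suc_tau tau_period C_add C_0 assms | assumption)+

lemma norm_tau:
  assumes "x \<in> C n"
  shows "\<tau> n (norm_op H \<pi> \<alpha> \<beta> n x) = norm_op H \<pi> \<alpha> \<beta> n x"
    and "norm_op H \<pi> \<alpha> \<beta> n (\<tau> n x) = norm_op H \<pi> \<alpha> \<beta> n x"
proof -
  have "(\<Sum>i\<le>n. (\<tau> n ^^ Suc i) x) + x = (\<Sum>i\<le>Suc n. (\<tau> n ^^ i) x)"
    by (subst sum.atMost_Suc_shift) simp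
  also have "\<dots> = (\<Sum>i\<le>n. (\<tau> n ^^ i) x) + (\<tau> n ^^ Suc n) x" by (rule sum.atMost_Suc)
  finally have *: "(\<Sum>i\<le>n. (\<tau> n ^^ Suc i) x) = norm_op H \<pi> \<alpha> \<beta> n x"
    unfolding tau_period[OF assms] by (simp add: norm_op_def)
  then show "\<tau> n (norm_op H \<pi> \<alpha> \<beta> n x) = norm_op H \<pi> \<alpha> \<beta> n x"
    by (simp add: norm_op_def tau_sum)
  show "norm_op H \<pi> \<alpha> \<beta> n (\<tau> n x) = norm_op H \<pi> \<alpha> \<beta> n x"
    using * by (simp add: norm_op_def funpow_swap1)
qed

text \<open>Appending a unit is, up to sign, a contracting homotopy of the \<open>b'\<close>-complex.\<close>

definition append_one :: "nat \<Rightarrow> ('b list \<Rightarrow> 'k) \<Rightarrow> 'b list \<Rightarrow> 'k" where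
  "append_one n = tmap n (\<lambda>\<phi> w. one (\<lambda>p. \<phi> (w @ [p])))"

lemma append_one_local: "local_map n (Suc n) (\<lambda>\<phi> w. one (\<lambda>p. \<phi> (w @ [p])))"
  by (rule local_mapI) (auto simp: one_functional W_iff intro!: one_cong)

lemma append_one_C: "append_one n x \<in> C (Suc n)"
  unfolding append_one_def by (rule tmap_vecs[OF append_one_local])

lemma b'_append_one_0: "x \<in> C 0 \<Longrightarrow> b' (Suc 0) (append_one 0 x) = x"
proof -
  assume x: "x \<in> C 0"
  have "b' (Suc 0) (append_one 0 x) = tmap 0 (\<lambda>\<phi> w. one (\<lambda>p. dbp (Suc 0) \<phi> (w @ [p]))) x"
    by (simp add: b'_op_eq append_one_def tmap_tmap[OF append_one_local])
  also have "\<dots> = tmap 0 (\<lambda>\<phi>. \<phi>) x"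
    by (rule tmap_cong) (simp add: W_iff dbp_1 mult.commute[of "\<alpha> _"] one_scale alpha_one)
  finally show ?thesis using x by (simp add: tmap_id)
qed

lemma b'_append_one_Suc:
  assumes "x \<in> C (Suc n)"
  shows "b' (Suc (Suc n)) (append_one (Suc n) x) = append_one n (b' (Suc n) x) + (\<lambda>v. (-1) ^ Suc n * x v)"
proof -
  have "b' (Suc (Suc n)) (append_one (Suc n) x) = tmap (Suc n) (\<lambda>\<phi> w. one (\<lambda>p. dbp (Suc (Suc n)) \<phi> (w @ [p]))) x"
    by (simp add: b'_op_eq append_one_def tmap_tmap[OF append_one_local])
  also have "\<dots> = tmap (Suc n) (\<lambda>\<phi> w. dbp (Suc n) (\<lambda>w. one (\<lambda>p. \<phi> (w @ [p]))) w + (-1) ^ Suc n * \<phi> w) x"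
  proof (rule tmap_cong)
    fix \<phi> w assume "w \<in> W (Suc n)"
    then have w: "length w = Suc n" "set w \<subseteq> B" "w \<noteq> []" by (auto simp: W_iff)
    then have "last w \<in> B" using last_in_set by blast
    have "one (\<lambda>p. dbp (Suc (Suc n)) \<phi> (w @ [p])) =
      one (\<lambda>p. dbp (Suc n) (\<lambda>u. \<phi> (u @ [p])) w + (-1) ^ Suc n * mul (last w) p (\<lambda>z. \<phi> (butlast w @ [z])))"
      using w by (intro one_cong dbp_snoc) auto
    also have "\<dots> = one (\<lambda>p. dbp (Suc n) (\<lambda>u. \<phi> (u @ [p])) w) + (-1) ^ Suc n * one (\<lambda>p. mul (last w) p (\<lambda>z. \<phi> (butlast w @ [z])))"
      unfolding one_def functional_add functional_scale ..
    also have "one (\<lambda>p. mul (last w) p (\<lambda>z. \<phi> (butlast w @ [z]))) = \<phi> w"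
      using \<open>last w \<in> B\<close> w by (simp add: one_mul_right)
    finally show "one (\<lambda>p. dbp (Suc (Suc n)) \<phi> (w @ [p])) = dbp (Suc n) (\<lambda>w. one (\<lambda>p. \<phi> (w @ [p]))) w + (-1) ^ Suc n * \<phi> w"
      by (simp only: dbp_one)
  qed
  also have "\<dots> = tmap (Suc n) (\<lambda>\<phi>. dbp (Suc n) (\<lambda>w. one (\<lambda>p. \<phi> (w @ [p])))) x + (\<lambda>v. (-1) ^ Suc n * tmap (Suc n) (\<lambda>\<phi>. \<phi>) x v)"
    by (rule ext) (simp add: tmap_def linear_ext_def plus_fun_def algebra_simps sum.distrib sum_distrib_left sum_subtractf sum_negf)
  also have "\<dots> = append_one n (b' (Suc n) x) + (\<lambda>v. (-1) ^ Suc n * x v)"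
    using assms by (simp add: tmap_id b'_op_eq append_one_def tmap_tmap[OF dbp_local])
  finally show ?thesis .
qed

end


section \<open>Bases of homology modules\<close>

text \<open>The classes of the \<open>\<omega> i\<close> form a basis of \<open>Z / Bd\<close>.\<close>

definition homology_basis ::
    "('k::comm_ring_1 \<Rightarrow> 'm \<Rightarrow> 'm::ab_group_add) \<Rightarrow> 'm set \<Rightarrow> 'm set \<Rightarrow> nat \<Rightarrow> (nat \<Rightarrow> 'm) \<Rightarrow> bool" where
  "homology_basis s Z Bd r \<omega> \<longleftrightarrow> (\<forall>i<r. \<omega> i \<in> Z) \<and>
     (\<forall>x\<in>Z. \<exists>c. x - (\<Sum>i<r. s (c i) (\<omega> i)) \<in> Bd) \<and>
     (\<forall>c. (\<Sum>i<r. s (c i) (\<omega> i)) \<in> Bd \<longrightarrow> (\<forall>i<r. c i = 0))"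

definition free_homology ::
    "('k::comm_ring_1 \<Rightarrow> 'm \<Rightarrow> 'm::ab_group_add) \<Rightarrow> 'm set \<Rightarrow> 'm set \<Rightarrow> nat \<Rightarrow> bool" where
  "free_homology s Z Bd r \<longleftrightarrow> (\<exists>\<omega>. homology_basis s Z Bd r \<omega>)"

lemma free_homology_0: "free_homology s Z Bd 0 \<longleftrightarrow> Z \<subseteq> Bd"
  by (auto simp: free_homology_def homology_basis_def)

lemma quotient_module_iso:
  fixes s :: "'k::comm_ring_1 \<Rightarrow> 'm::ab_group_add \<Rightarrow> 'm"
  assumes g: "\<And>x. x \<in> Z \<Longrightarrow> g x \<in> vecs {..<r}" "\<And>c. c \<in> vecs {..<r} \<Longrightarrow> \<exists>x\<in>Z. g x = c"
    and g_add: "\<And>x y. x \<in> Z \<Longrightarrow> y \<in> Z \<Longrightarrow> g (x + y) = (\<lambda>i. g x i + g y i)"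
    and g_scale: "\<And>a x. x \<in> Z \<Longrightarrow> g (s a x) = (\<lambda>i. a * g x i)"
    and ker: "\<And>x. x \<in> Z \<Longrightarrow> g x = (\<lambda>_. 0) \<longleftrightarrow> x \<in> Bd"
    and Z: "\<And>x y. x \<in> Z \<Longrightarrow> y \<in> Z \<Longrightarrow> x + y \<in> Z" "\<And>a x. x \<in> Z \<Longrightarrow> s a x \<in> Z" "\<And>x. x \<in> Z \<Longrightarrow> - x \<in> Z"
    and Bd: "Bd \<subseteq> Z" "\<And>x y. x \<in> Bd \<Longrightarrow> y \<in> Bd \<Longrightarrow> x + y \<in> Bd" "\<And>a x. x \<in> Bd \<Longrightarrow> s a x \<in> Bd"
      "\<And>x. x \<in> Bd \<Longrightarrow> - x \<in> Bd" "0 \<in> Bd"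
    and s_add: "\<And>a x y. s a (x + y) = s a x + s a y"
  shows "quotient_module s Z Bd \<cong>\<^sub>k free_module r"
proof -
  define co where "co x = {x + y | y. y \<in> Bd}" for x
  have mem: "x' \<in> co x \<longleftrightarrow> x' - x \<in> Bd" for x x'
    unfolding co_def by (auto intro!: exI[of _ "x' - x"])
  have refl: "x \<in> co x" for x using Bd by (simp add: mem)
  define f where "f X = g (SOME x. x \<in> X)" for X
  have f: "f (co x) = g x" if x: "x \<in> Z" for x
  proof -
    define x' where "x' = (SOME x'. x' \<in> co x)"
    have "x' \<in> co x" unfolding x'_def by (rule someI) (rule refl)
    then have d: "x' - x \<in> Bd" by (simp add: mem)
    have "g (x + (x' - x)) = (\<lambda>i. g x i + g (x' - x) i)" using d x Bd(1) by (intro g_add) auto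
    also have "g (x' - x) = (\<lambda>_. 0)" using d Bd(1) ker by blast
    finally show ?thesis by (simp add: f_def x'_def[symmetric])
  qed
  have co_eq: "co x = co y \<longleftrightarrow> x - y \<in> Bd" for x y
  proof
    assume "co x = co y"
    then have "x \<in> co y" using refl by blast
    then show "x - y \<in> Bd" by (simp add: mem)
  next
    assume d: "x - y \<in> Bd"
    have "z - x \<in> Bd \<longleftrightarrow> z - y \<in> Bd" for z
    proof
      assume "z - x \<in> Bd" then have "(z - x) + (x - y) \<in> Bd" using d by (rule Bd(2)) then show "z - y \<in> Bd" by simp
    next
      assume "z - y \<in> Bd" then have "(z - y) + - (x - y) \<in> Bd" using d by (intro Bd) then show "z - x \<in> Bd" by simp
    qed
    then show "co x = co y" by (auto simp: mem)
  qed
  have g_diff: "x - y \<in> Bd" if "x \<in> Z" "y \<in> Z" "g x = g y" for x y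
  proof -
    have "g ((x - y) + y) = (\<lambda>i. g (x - y) i + g y i)"
      using that Z(1)[of x "- y"] Z(3)[of y] by (intro g_add) auto
    then have "g (x - y) = (\<lambda>_. 0)" using that by (simp add: fun_eq_iff)
    then show ?thesis using ker[of "x - y"] that Z(1)[of x "- y"] Z(3)[of y] by simp
  qed
  have add: "{a + c |a c. a \<in> co x \<and> c \<in> co y} = co (x + y)" for x y
  proof (intro set_eqI iffI)
    fix z assume "z \<in> {a + c |a c. a \<in> co x \<and> c \<in> co y}"
    then obtain a c where "z = a + c" "a - x \<in> Bd" "c - y \<in> Bd" by (auto simp: mem)
    then show "z \<in> co (x + y)" using Bd(2)[of "a - x" "c - y"] by (simp add: mem algebra_simps)
  next
    fix z assume "z \<in> co (x + y)"
    then have "z - y \<in> co x" by (simp add: mem algebra_simps)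
    moreover have "z = (z - y) + y" by simp
    ultimately show "z \<in> {a + c |a c. a \<in> co x \<and> c \<in> co y}" using refl[of y] by blast
  qed
  have scale: "{s a z + y | z y. z \<in> co x \<and> y \<in> Bd} = co (s a x)" for a x
  proof (intro set_eqI iffI)
    fix z assume "z \<in> {s a z + y | z y. z \<in> co x \<and> y \<in> Bd}"
    then obtain u y where z: "z = s a u + y" "u - x \<in> Bd" "y \<in> Bd" by (auto simp: mem)
    have "s a u = s a (u - x) + s a x" using s_add[of a "u - x" x] by simp
    then have "z - s a x = s a (u - x) + y" by (simp add: z)
    moreover have "s a (u - x) + y \<in> Bd" using z by (intro Bd(2,3))
    ultimately show "z \<in> co (s a x)" by (simp only: mem)
  next
    fix z assume "z \<in> co (s a x)"
    then have "z - s a x \<in> Bd" by (simp add: mem)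
    moreover have "z = s a x + (z - s a x)" by simp
    ultimately show "z \<in> {s a z + y | z y. z \<in> co x \<and> y \<in> Bd}" using refl[of x] by blast
  qed
  have "bij_betw f (co ` Z) (vecs {..<r})"
    unfolding bij_betw_def
  proof
    show "inj_on f (co ` Z)"
    proof (rule inj_onI)
      fix X Y assume "X \<in> co ` Z" "Y \<in> co ` Z" "f X = f Y"
      then obtain x y where "x \<in> Z" "y \<in> Z" "X = co x" "Y = co y" "g x = g y" by (auto simp: f)
      then show "X = Y" using g_diff by (simp only: co_eq)
    qed
    show "f ` co ` Z = vecs {..<r}" using g by (force simp: f image_image)
  qed
  then show ?thesis
    unfolding kmodule_iso_def quotient_module_def free_module_def co_def[symmetric] kmodule.simps
    using add scale by (intro exI[of _ f]) (auto simp: f g_add g_scale Z)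
qed

text \<open>The coordinates with respect to a basis of the homology are unique, hence additive and homogeneous.\<close>

lemma free_homology_iso:
  fixes s :: "'k::comm_ring_1 \<Rightarrow> 'm::ab_group_add \<Rightarrow> 'm"
  assumes "free_homology s Z Bd r" and s: "module s"
    and Z: "\<And>x y. x \<in> Z \<Longrightarrow> y \<in> Z \<Longrightarrow> x + y \<in> Z" "\<And>a x. x \<in> Z \<Longrightarrow> s a x \<in> Z"
    and Bd: "Bd \<subseteq> Z" "\<And>x y. x \<in> Bd \<Longrightarrow> y \<in> Bd \<Longrightarrow> x + y \<in> Bd" "\<And>a x. x \<in> Bd \<Longrightarrow> s a x \<in> Bd" "0 \<in> Bd"
  shows "quotient_module s Z Bd \<cong>\<^sub>k free_module r"
proof -
  interpret module s by (rule s)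
  obtain \<omega> where \<omega>: "\<And>i. i < r \<Longrightarrow> \<omega> i \<in> Z" "\<And>x. x \<in> Z \<Longrightarrow> \<exists>c. x - (\<Sum>i<r. s (c i) (\<omega> i)) \<in> Bd"
     "\<And>c. (\<Sum>i<r. s (c i) (\<omega> i)) \<in> Bd \<Longrightarrow> \<forall>i<r. c i = 0"
    using assms(1) unfolding free_homology_def homology_basis_def by blast
  have neg: "- x = s (- 1) x" for x by simp
  have Bd_neg: "x \<in> Bd \<Longrightarrow> - x \<in> Bd" for x unfolding neg by (rule Bd)
  define L where "L c = (\<Sum>i<r. s (c i) (\<omega> i))" for c
  have L_add: "L (\<lambda>i. c i + d i) = L c + L d" for c d
    by (simp add: L_def scale_left_distrib sum.distrib)
  have L_scale: "L (\<lambda>i. a * c i) = s a (L c)" for a c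
    by (simp add: L_def scale_sum_right)
  have L_diff: "L (\<lambda>i. c i - d i) = L c - L d" for c d
    using L_add[of "\<lambda>i. c i - d i" d] by simp
  have L_Z: "c \<in> vecs {..<r} \<Longrightarrow> L c \<in> Z" for c
  proof -
    have 0: "0 \<in> Z" using Bd by auto
    have "finite I \<Longrightarrow> I \<subseteq> {..<r} \<Longrightarrow> (\<Sum>i\<in>I. s (c i) (\<omega> i)) \<in> Z" for I
      by (induction I rule: finite_induct) (auto intro!: Z \<omega> 0)
    then show "L c \<in> Z" by (simp add: L_def)
  qed
  have ex: "\<exists>c\<in>vecs {..<r}. x - L c \<in> Bd" if x: "x \<in> Z" for x
  proof -
    obtain c where "x - L c \<in> Bd" using \<omega>(2)[OF x] by (auto simp: L_def)
    moreover have "L (\<lambda>i. if i < r then c i else 0) = L c" unfolding L_def by (rule sum.cong) auto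
    ultimately show ?thesis by (intro bexI[of _ "\<lambda>i. if i < r then c i else 0"]) (auto simp: vecs_def)
  qed
  have uniq: "c = d" if "c \<in> vecs {..<r}" "d \<in> vecs {..<r}" "x - L c \<in> Bd" "x - L d \<in> Bd" for x c d
  proof -
    have "(x - L d) + - (x - L c) \<in> Bd" using that by (intro Bd Bd_neg)
    then have "L (\<lambda>i. c i - d i) \<in> Bd" by (simp add: L_diff)
    then have eq: "\<forall>i<r. c i - d i = 0" unfolding L_def by (rule \<omega>(3))
    show ?thesis
    proof
      fix i show "c i = d i" using eq that(1,2) by (cases "i < r") (auto simp: vecs_def)
    qed
  qed
  define g where "g x = (SOME c. c \<in> vecs {..<r} \<and> x - L c \<in> Bd)" for x
  have g: "g x \<in> vecs {..<r}" "x - L (g x) \<in> Bd" if "x \<in> Z" for x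
    using someI_ex[of "\<lambda>c. c \<in> vecs {..<r} \<and> x - L c \<in> Bd"] ex[OF that] by (auto simp: g_def)
  have g_eq: "g x = c" if "x \<in> Z" "c \<in> vecs {..<r}" "x - L c \<in> Bd" for x c
    using uniq[OF g(1)[OF that(1)] that(2) g(2)[OF that(1)] that(3)] .
  show ?thesis
  proof (rule quotient_module_iso[where g = g])
    show "\<exists>x\<in>Z. g x = c" if c: "c \<in> vecs {..<r}" for c
    proof (rule bexI)
      show "g (L c) = c" using Bd by (intro g_eq[OF L_Z[OF c] c]) simp
    qed (rule L_Z[OF c])
    show "g (x + y) = (\<lambda>i. g x i + g y i)" if "x \<in> Z" "y \<in> Z" for x y
    proof (rule g_eq)
      have "(x - L (g x)) + (y - L (g y)) \<in> Bd" using that by (intro Bd g)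
      then show "x + y - L (\<lambda>i. g x i + g y i) \<in> Bd" by (simp add: L_add algebra_simps)
    qed (use that Z g(1)[of x] g(1)[of y] in \<open>auto simp: vecs_def\<close>)
    show "g (s a x) = (\<lambda>i. a * g x i)" if "x \<in> Z" for a x
    proof (rule g_eq)
      have "s a (x - L (g x)) \<in> Bd" using that by (intro Bd g)
      then show "s a x - L (\<lambda>i. a * g x i) \<in> Bd" by (simp add: L_scale scale_right_diff_distrib)
    qed (use that Z g(1)[of x] in \<open>auto simp: vecs_def\<close>)
    show "g x = (\<lambda>_. 0) \<longleftrightarrow> x \<in> Bd" if "x \<in> Z" for x
    proof
      assume "g x = (\<lambda>_. 0)"
      then show "x \<in> Bd" using g(2)[OF that] by (simp add: L_def)
    next
      assume "x \<in> Bd"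
      then show "g x = (\<lambda>_. 0)" using that by (intro g_eq) (auto simp: L_def vecs_def)
    qed
    show "- x \<in> Z" if "x \<in> Z" for x unfolding neg by (rule Z(2)[OF that])
  qed (use Z Bd Bd_neg g scale_right_distrib in auto)
qed



section \<open>Cyclic homology from Hochschild homology\<close>

text \<open>The identities of Connes' bicomplex, with exactness of \<open>b'\<close> in place of degeneracies.\<close>

locale connes_bicomplex = module s
  for s :: "'k::comm_ring_1 \<Rightarrow> 'v::ab_group_add \<Rightarrow> 'v" +
  fixes C :: "nat \<Rightarrow> 'v set" and b b' \<tau> N :: "nat \<Rightarrow> 'v \<Rightarrow> 'v"
  assumes C_0: "0 \<in> C n" and C_add: "x \<in> C n \<Longrightarrow> y \<in> C n \<Longrightarrow> x + y \<in> C n" and C_scale: "x \<in> C n \<Longrightarrow> s r x \<in> C n"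
    and b_hom: "module_hom s s (b n)" and b'_hom: "module_hom s s (b' n)"
    and tau_hom: "module_hom s s (\<tau> n)" and N_hom: "module_hom s s (N n)"
    and b_C: "x \<in> C (Suc n) \<Longrightarrow> b (Suc n) x \<in> C n" and b'_C: "x \<in> C (Suc n) \<Longrightarrow> b' (Suc n) x \<in> C n"
    and tau_C: "x \<in> C n \<Longrightarrow> \<tau> n x \<in> C n" and N_C: "x \<in> C n \<Longrightarrow> N n x \<in> C n"
    and b_b: "x \<in> C (Suc (Suc n)) \<Longrightarrow> b (Suc n) (b (Suc (Suc n)) x) = 0"
    and b'_b': "x \<in> C (Suc (Suc n)) \<Longrightarrow> b' (Suc n) (b' (Suc (Suc n)) x) = 0"
    and b_tau: "x \<in> C (Suc n) \<Longrightarrow> b (Suc n) (\<tau> (Suc n) x) = b (Suc n) x - b' (Suc n) x + \<tau> n (b' (Suc n) x)"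
    and b'_N: "x \<in> C (Suc n) \<Longrightarrow> b' (Suc n) (N (Suc n) x) = N n (b (Suc n) x)"
    and tau_N: "x \<in> C n \<Longrightarrow> \<tau> n (N n x) = N n x" and N_tau: "x \<in> C n \<Longrightarrow> N n (\<tau> n x) = N n x"
    and b'_exact: "x \<in> C n \<Longrightarrow> n = 0 \<or> b' n x = 0 \<Longrightarrow> \<exists>y\<in>C (Suc n). b' (Suc n) y = x"
begin

definition chains :: "nat \<Rightarrow> (nat \<Rightarrow> 'v) set" where
  "chains m = {x. (\<forall>c\<le>m. x c \<in> C (m - c)) \<and> (\<forall>c>m. x c = 0)}"

definition total :: "nat \<Rightarrow> (nat \<Rightarrow> 'v) \<Rightarrow> nat \<Rightarrow> 'v" where
  "total m x = (\<lambda>c. if c < m then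
     (if even c then b (m - c) (x c) else - b' (m - c) (x c)) +
     (if even c then x (Suc c) - \<tau> (m - Suc c) (x (Suc c)) else N (m - Suc c) (x (Suc c))) else 0)"

definition scalec :: "'k \<Rightarrow> (nat \<Rightarrow> 'v) \<Rightarrow> nat \<Rightarrow> 'v" where "scalec r x = (\<lambda>c. s r (x c))"

definition cyc_cycles where "cyc_cycles p = {x \<in> chains p. total p x = 0}"
definition cyc_bounds where "cyc_bounds p = total (Suc p) ` chains (Suc p)"
definition cycles where "cycles p = {x \<in> C p. p = 0 \<or> b p x = 0}"
definition bounds where "bounds p = b (Suc p) ` C (Suc p)"

lemmas b_lin [simp] = module_hom.add[OF b_hom] module_hom.zero[OF b_hom] module_hom.neg[OF b_hom] module_hom.diff[OF b_hom] module_hom.scale[OF b_hom]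
lemmas b'_lin [simp] = module_hom.add[OF b'_hom] module_hom.zero[OF b'_hom] module_hom.neg[OF b'_hom] module_hom.diff[OF b'_hom] module_hom.scale[OF b'_hom]
lemmas tau_lin [simp] = module_hom.add[OF tau_hom] module_hom.zero[OF tau_hom] module_hom.neg[OF tau_hom] module_hom.diff[OF tau_hom] module_hom.scale[OF tau_hom]
lemmas N_lin [simp] = module_hom.add[OF N_hom] module_hom.zero[OF N_hom] module_hom.neg[OF N_hom] module_hom.diff[OF N_hom] module_hom.scale[OF N_hom]

lemma C_neg: "x \<in> C n \<Longrightarrow> - x \<in> C n"
  using C_scale[of x n "- 1"] by simp

lemma C_diff: "x \<in> C n \<Longrightarrow> y \<in> C n \<Longrightarrow> x - y \<in> C n"
  using C_add[of x n "- y"] C_neg by simp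

lemmas C_intros = C_0 C_add C_scale C_neg C_diff tau_C N_C

lemma total_add: "total m (x + y) = total m x + total m y"
  by (rule ext) (simp add: total_def)

lemma total_diff: "total m (x - y) = total m x - total m y"
  by (rule ext) (simp add: total_def)

lemma total_scale: "total m (scalec r x) = scalec r (total m x)"
  by (rule ext) (simp add: total_def scalec_def scale_right_distrib scale_right_diff_distrib)

lemma total_zero: "total m 0 = 0"
  by (rule ext) (simp add: total_def)

lemma chains_add: "x \<in> chains m \<Longrightarrow> y \<in> chains m \<Longrightarrow> x + y \<in> chains m"
  and chains_diff: "x \<in> chains m \<Longrightarrow> y \<in> chains m \<Longrightarrow> x - y \<in> chains m"
  and chains_scale: "x \<in> chains m \<Longrightarrow> scalec r x \<in> chains m"
  and chains_0: "0 \<in> chains m"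
  by (auto simp: chains_def scalec_def intro: C_intros)

lemma total_chains:
  assumes "x \<in> chains (Suc m)" shows "total (Suc m) x \<in> chains m"
  unfolding chains_def
proof (rule CollectI, intro conjI allI impI)
  fix c assume c: "c \<le> m"
  then have "x c \<in> C (Suc (m - c))" "x (Suc c) \<in> C (m - c)"
    using assms unfolding chains_def by (auto simp: Suc_diff_le[symmetric] dest: spec[of _ c] spec[of _ "Suc c"])
  then show "total (Suc m) x c \<in> C (m - c)"
    using c by (auto simp: total_def Suc_diff_le intro!: C_intros b_C b'_C)
qed (simp add: total_def)

lemma total_total:
  assumes "x \<in> chains (Suc m)" shows "total m (total (Suc m) x) = 0"
proof
  fix c
  show "total m (total (Suc m) x) c = 0 c"
  proof (cases "c < m")
    case True
    then obtain n where m: "m = Suc (c + n)" by (auto simp: less_iff_Suc_add)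
    have x: "x c \<in> C (Suc (Suc n))" "x (Suc c) \<in> C (Suc n)" "x (Suc (Suc c)) \<in> C n"
      using assms unfolding m chains_def
      by (auto dest: spec[of _ c] spec[of _ "Suc c"] spec[of _ "Suc (Suc c)"] simp: Suc_diff_le)
    show ?thesis
      using x by (simp add: total_def m Suc_diff_le b_b b'_b' b_tau b'_N tau_N N_tau)
  qed (simp add: total_def)
qed

lemma cyc_bounds_cycles: "cyc_bounds p \<subseteq> cyc_cycles p"
  by (auto simp: cyc_bounds_def cyc_cycles_def total_chains total_total)

subsection \<open>The periodicity operator\<close>

definition shift where "shift x = (\<lambda>c. x (c + 2))" for x :: "nat \<Rightarrow> 'v"
definition up where "up x = (\<lambda>c. if c < 2 then 0 else x (c - 2))" for x :: "nat \<Rightarrow> 'v"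
definition incl :: "'v \<Rightarrow> nat \<Rightarrow> 'v" where "incl z = (\<lambda>c. if c = 0 then z else 0)"

lemma shift_up: "shift (up x) = x"
  by (simp add: shift_def up_def)

lemma shift_lin: "shift (x + y) = shift x + shift y" "shift (x - y) = shift x - shift y"
    "shift (scalec r x) = scalec r (shift x)" "shift 0 = 0"
  by (auto simp: shift_def scalec_def fun_eq_iff)

lemma shift_incl: "shift (incl z) = 0"
  by (auto simp: shift_def incl_def fun_eq_iff)

lemma shift_eq_0: "shift x = 0 \<longleftrightarrow> (\<forall>c\<ge>2. x c = 0)"
proof
  assume *: "shift x = 0"
  show "\<forall>c\<ge>2. x c = 0"
  proof (intro allI impI)
    fix c :: nat assume "c \<ge> 2"
    then obtain d where "c = d + 2" by (metis le_add_diff_inverse2)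
    then show "x c = 0" using fun_cong[OF *, of d] by (simp add: shift_def)
  qed
qed (auto simp: shift_def fun_eq_iff)

lemma shift_chains: "x \<in> chains (m + 2) \<Longrightarrow> shift x \<in> chains m"
  by (auto simp: chains_def shift_def dest!: spec[of _ "_ + 2"])

lemma up_chains: "x \<in> chains m \<Longrightarrow> up x \<in> chains (m + 2)"
  unfolding chains_def up_def
proof (rule CollectI, intro conjI allI impI)
  assume x: "x \<in> {x. (\<forall>c\<le>m. x c \<in> C (m - c)) \<and> (\<forall>c>m. x c = 0)}"
  fix c assume "c \<le> m + 2"
  then have "m + 2 - c = m - (c - 2)" "c - 2 \<le> m" if "\<not> c < 2" using that by auto
  then show "(if c < 2 then 0 else x (c - 2)) \<in> C (m + 2 - c)" using x by (auto simp: C_0)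
qed auto

lemma incl_chains: "z \<in> C m \<Longrightarrow> incl z \<in> chains m"
  by (auto simp: chains_def incl_def C_0)

lemma shift_total: "shift (total (m + 2) x) = total m (shift x)"
  by (rule ext) (simp add: total_def shift_def)

lemma total_incl: "total (Suc m) (incl z) = incl (b (Suc m) z)"
  by (rule ext) (simp add: total_def incl_def)

text \<open>A cycle in the first two columns is homologous to one in the first column: the component in the second column is a
  \<open>b'\<close>-cycle, hence a \<open>b'\<close>-boundary, by exactness.\<close>

lemma cycle_columns01:
  assumes x: "x \<in> cyc_cycles p" and S: "shift x = 0"
  shows "\<exists>w\<in>chains (Suc p). \<exists>z\<in>cycles p. x = total (Suc p) w + incl z"
proof (cases p)
  case 0
  have "x = incl (x 0)" "x 0 \<in> C 0"
    using x by (auto simp: 0 cyc_cycles_def chains_def incl_def fun_eq_iff)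
  then show ?thesis
    by (intro bexI[of _ 0] bexI[of _ "x 0"]) (auto simp: 0 total_zero cycles_def chains_0)
next
  case (Suc n)
  have xc: "x c = 0" if "c \<ge> 2" for c using S that by (simp add: shift_eq_0)
  have x01: "x 0 \<in> C (Suc n)" "x 1 \<in> C n"
    using x by (auto simp: Suc cyc_cycles_def chains_def dest: spec[of _ 0] spec[of _ 1])
  have "n = 0 \<or> b' n (x 1) = 0"
  proof -
    have "total p x 1 = 0" using x by (simp add: cyc_cycles_def)
    then show ?thesis using xc[of "Suc (Suc 0)"] by (cases n) (auto simp: total_def Suc)
  qed
  then obtain y where y: "y \<in> C (Suc n)" "b' (Suc n) y = x 1" using b'_exact[OF x01(2)] by blast
  define w where "w = (\<lambda>c :: nat. if c = 1 then - y else 0)"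
  have w: "w \<in> chains (Suc p)" using y by (auto simp: w_def chains_def Suc C_intros)
  define z where "z = x 0 + (y - \<tau> (Suc n) y)"
  have x_eq: "x = total (Suc p) w + incl z"
  proof
    fix c :: nat
    consider "c = 0" | "c = 1" | "c \<ge> 2" by linarith
    then show "x c = (total (Suc p) w + incl z) c"
      by cases (auto simp: xc total_def w_def incl_def z_def Suc y)
  qed
  have "incl (b p z) = total p (incl z)" using total_incl[of n z] by (simp only: Suc)
  also have "incl z = x - total (Suc p) w" unfolding x_eq[symmetric] by (subst x_eq) simp
  also have "total p \<dots> = total p x - total p (total (Suc p) w)" by (rule total_diff)
  also have "\<dots> = 0 - 0" using x total_total[OF w] by (intro arg_cong2[of _ _ _ _ "(-)"]) (simp_all add: cyc_cycles_def)
  finally have "incl (b p z) = 0" by (simp only: diff_self)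
  then have "b p z = 0" by (auto simp: incl_def fun_eq_iff dest: spec[of _ 0])
  moreover have "z \<in> C p" using x01 y by (simp add: z_def Suc C_intros)
  ultimately show ?thesis using w x_eq by (auto simp: cycles_def)
qed

text \<open>Conversely, if an element of the first column bounds in the first two columns, it is a \<open>b\<close>-boundary: the component
  in the second column can again be removed by exactness of \<open>b'\<close>.\<close>

lemma bound_columns01:
  assumes w: "w \<in> chains (Suc p)" and S: "shift w = 0" and eq: "total (Suc p) w = incl z"
  shows "z \<in> bounds p"
proof -
  have wc: "w c = 0" if "c \<ge> 2" for c using S that by (simp add: shift_eq_0)
  have w01: "w 0 \<in> C (Suc p)" "w 1 \<in> C p"
    using w by (auto simp: chains_def dest: spec[of _ 0] spec[of _ 1])
  have "p = 0 \<or> b' p (w 1) = 0"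
    using fun_cong[OF eq, of 1] wc[of "Suc (Suc 0)"] by (cases p) (auto simp: total_def incl_def)
  then obtain u where u: "u \<in> C (Suc p)" "b' (Suc p) u = w 1" using b'_exact[OF w01(2)] by blast
  have "z = b (Suc p) (w 0) + (w 1 - \<tau> p (w 1))"
    using fun_cong[OF eq, of 0] by (simp add: total_def incl_def)
  also have "\<dots> = b (Suc p) (w 0 + (u - \<tau> (Suc p) u))"
    using u by (simp add: b_tau)
  finally show ?thesis unfolding bounds_def by (rule image_eqI) (intro C_intros w01 u)
qed

text \<open>Surjectivity of the periodicity operator when the Hochschild homology of degree \<open>p + 1\<close> vanishes: a lift is chosen
  in the second column by exactness of \<open>b'\<close>, and its defect in the first column is a Hochschild cycle of degree \<open>p + 1\<close>.\<close>

lemma cycle_lift: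
  assumes y: "y \<in> cyc_cycles p" and HH: "cycles (Suc p) \<subseteq> bounds (Suc p)"
  shows "\<exists>x\<in>cyc_cycles (p + 2). shift x = y"
proof -
  have yC: "y \<in> chains p" "total p y = 0" using y by (auto simp: cyc_cycles_def)
  have y0: "y 0 \<in> C p" using yC by (auto simp: chains_def)
  have "p = 0 \<or> b' p (N p (y 0)) = 0"
  proof (cases p)
    case (Suc n)
    have y1: "y 1 \<in> C n" using yC by (auto simp: chains_def Suc dest: spec[of _ 1])
    have "b p (y 0) = - (y 1 - \<tau> n (y 1))"
      using fun_cong[OF yC(2), of 0] by (simp add: total_def Suc add_eq_0_iff2)
    then show ?thesis using y0 y1 by (simp add: Suc b'_N N_tau)
  qed simp
  then obtain x1 where x1: "x1 \<in> C (Suc p)" "b' (Suc p) x1 = N p (y 0)"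
    using b'_exact[of "N p (y 0)" p] y0 N_C by blast
  have "x1 - \<tau> (Suc p) x1 \<in> cycles (Suc p)"
    using x1 y0 by (simp add: cycles_def C_intros b_tau tau_N)
  then obtain x0 where x0: "x0 \<in> C (Suc (Suc p))" "b (Suc (Suc p)) x0 = x1 - \<tau> (Suc p) x1"
    using HH by (auto simp: bounds_def)
  define x where "x c = (if c = 0 then - x0 else if c = 1 then x1 else y (c - 2))" for c
  have "shift x = y" by (auto simp: shift_def x_def)
  moreover have "x \<in> chains (p + 2)"
    unfolding chains_def
  proof (rule CollectI, intro conjI allI impI)
    fix c assume "c \<le> p + 2"
    moreover have "y (c - 2) \<in> C (p + 2 - c)" if "c \<ge> 2" "c \<le> p + 2"
      using yC(1) that by (auto simp: chains_def dest!: spec[of _ "c - 2"])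
    ultimately show "x c \<in> C (p + 2 - c)" using x0 x1 by (auto simp: x_def C_intros)
  next
    fix c assume "c > p + 2"
    then show "x c = 0" using yC(1) by (auto simp: chains_def x_def)
  qed
  moreover have "total (p + 2) x = 0"
  proof
    fix c :: nat
    consider "c = 0" | "c = 1" | "c \<ge> 2" by linarith
    then show "total (p + 2) x c = 0 c"
    proof cases
      case 3
      then obtain d where "c = d + 2" by (metis le_add_diff_inverse2)
      then have "total (p + 2) x c = shift (total (p + 2) x) d" by (simp only: shift_def)
      also have "\<dots> = 0" unfolding shift_total \<open>shift x = y\<close> yC(2) by simp
      finally show ?thesis by simp
    qed (simp_all add: total_def x_def x0 x1)
  qed
  ultimately show ?thesis by (auto simp: cyc_cycles_def)
qed


lemma module_scalec: "module scalec"
  by unfold_locales (auto simp: scalec_def fun_eq_iff scale_right_distrib scale_left_distrib)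

lemma cyc_cycles_add: "x \<in> cyc_cycles p \<Longrightarrow> y \<in> cyc_cycles p \<Longrightarrow> x + y \<in> cyc_cycles p"
  unfolding cyc_cycles_def by (simp only: mem_Collect_eq chains_add total_add, simp)

lemma cyc_cycles_diff: "x \<in> cyc_cycles p \<Longrightarrow> y \<in> cyc_cycles p \<Longrightarrow> x - y \<in> cyc_cycles p"
  unfolding cyc_cycles_def by (simp only: mem_Collect_eq chains_diff total_diff, simp)

lemma cyc_cycles_scale: "x \<in> cyc_cycles p \<Longrightarrow> scalec r x \<in> cyc_cycles p"
  by (simp add: cyc_cycles_def chains_scale total_scale) (simp add: scalec_def fun_eq_iff)

lemma cyc_cycles_0: "0 \<in> cyc_cycles p"
  by (simp add: cyc_cycles_def chains_0 total_zero)

lemma cyc_cycles_sum: "(\<And>i. i < r \<Longrightarrow> \<Omega> i \<in> cyc_cycles p) \<Longrightarrow> (\<Sum>i<r. scalec (c i) (\<Omega> i)) \<in> cyc_cycles p" for r :: nat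
proof (induction r)
  case (Suc r)
  then show ?case unfolding sum.lessThan_Suc by (intro cyc_cycles_add cyc_cycles_scale) auto
qed (simp only: lessThan_0 sum.empty cyc_cycles_0)

lemma cyc_boundsI: "w \<in> chains (Suc p) \<Longrightarrow> total (Suc p) w \<in> cyc_bounds p"
  by (auto simp: cyc_bounds_def)

lemma cyc_bounds_add: "x \<in> cyc_bounds p \<Longrightarrow> y \<in> cyc_bounds p \<Longrightarrow> x + y \<in> cyc_bounds p"
  unfolding cyc_bounds_def by (auto simp only: total_add[symmetric] intro!: imageI chains_add elim!: imageE)

lemma cyc_bounds_scale: "x \<in> cyc_bounds p \<Longrightarrow> scalec r x \<in> cyc_bounds p"
  unfolding cyc_bounds_def by (auto simp only: total_scale[symmetric] intro!: imageI chains_scale elim!: imageE)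

lemma cyc_bounds_0: "0 \<in> cyc_bounds p"
  using cyc_boundsI[OF chains_0, of p] by (simp only: total_zero)

lemma incl_lin: "incl (x + y) = incl x + incl y" "scalec r (incl x) = incl (s r x)" "incl 0 = 0"
  by (auto simp: incl_def scalec_def fun_eq_iff)

lemma incl_cycles: "z \<in> cycles p \<Longrightarrow> incl z \<in> cyc_cycles p"
proof (cases p)
  case 0
  then show "z \<in> cycles p \<Longrightarrow> incl z \<in> cyc_cycles p"
    by (simp add: cycles_def cyc_cycles_def incl_chains) (simp add: total_def fun_eq_iff)
next
  case (Suc n)
  then show "z \<in> cycles p \<Longrightarrow> incl z \<in> cyc_cycles p"
    by (simp add: cycles_def cyc_cycles_def incl_chains total_incl incl_lin)
qed

lemma incl_bounds: "z \<in> bounds p \<Longrightarrow> incl z \<in> cyc_bounds p"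
  by (auto simp: bounds_def total_incl[symmetric] intro!: cyc_boundsI incl_chains)

lemma incl_sum: "(\<Sum>j<r. scalec (e j) (incl (\<omega> j))) = incl (\<Sum>j<r. s (e j) (\<omega> j))" for r :: nat
proof (induction r)
  case (Suc r)
  then show ?case by (simp only: sum.lessThan_Suc incl_lin)
qed (simp only: lessThan_0 sum.empty incl_lin)

lemma shift_sum: "shift (\<Sum>i<r. scalec (c i) (\<Omega> i)) = (\<Sum>i<r. scalec (c i) (shift (\<Omega> i)))" for r :: nat
proof (induction r)
  case (Suc r)
  then show ?case by (simp only: sum.lessThan_Suc shift_lin)
qed (simp only: lessThan_0 sum.empty shift_lin)

lemma shift_cycles: "x \<in> cyc_cycles (p + 2) \<Longrightarrow> shift x \<in> cyc_cycles p"
  unfolding cyc_cycles_def using shift_total[of p x] shift_chains[of x p] by (simp add: shift_lin)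

lemma shift_small: "x \<in> chains p \<Longrightarrow> p < 2 \<Longrightarrow> shift x = 0"
  by (auto simp: shift_eq_0 chains_def)

lemma cycle_reduce:
  assumes x: "x \<in> cyc_cycles p" and w: "w \<in> chains (Suc p)" and S: "shift (x - total (Suc p) w) = 0"
  shows "\<exists>z\<in>cycles p. x - incl z \<in> cyc_bounds p"
proof -
  have "x - total (Suc p) w \<in> cyc_cycles p"
    using x cyc_bounds_cycles cyc_boundsI[OF w] by (intro cyc_cycles_diff) auto
  then obtain w' z where w': "w' \<in> chains (Suc p)" "z \<in> cycles p" "x - total (Suc p) w = total (Suc p) w' + incl z"
    using cycle_columns01[OF _ S] by blast
  have "x - incl z = (x - total (Suc p) w) + total (Suc p) w - incl z" by simp
  also have "\<dots> = total (Suc p) w' + total (Suc p) w" unfolding w'(3) by (simp only: algebra_simps)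
  finally have "x - incl z \<in> cyc_bounds p" using w w' by (simp only: cyc_bounds_add cyc_boundsI)
  then show ?thesis using w' by blast
qed

lemma cyclic_homology_0:
  assumes zero: "\<And>n. n mod 2 \<noteq> d \<Longrightarrow> cycles n \<subseteq> bounds n"
  shows "p mod 2 \<noteq> d \<Longrightarrow> cyc_cycles p \<subseteq> cyc_bounds p"
proof (induction p rule: less_induct)
  case (less p)
  show ?case
  proof
    fix x assume x: "x \<in> cyc_cycles p"
    have "\<exists>w\<in>chains (Suc p). shift (x - total (Suc p) w) = 0"
    proof (cases "p < 2")
      case True
      then have "shift (x - total (Suc p) 0) = 0" using x shift_small[of x p] by (simp only: total_zero diff_zero cyc_cycles_def mem_Collect_eq)
      then show ?thesis using chains_0 by blast
    next
      case False
      then obtain m where p: "p = m + 2" by (metis add.commute le_Suc_ex not_less)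
      have "shift x \<in> cyc_cycles m" using x by (auto simp only: p intro: shift_cycles)
      then have "shift x \<in> cyc_bounds m" using less.IH[of m] less.prems by (auto simp: p)
      then obtain w where w: "w \<in> chains (Suc m)" "shift x = total (Suc m) w" by (auto simp: cyc_bounds_def)
      have "shift (total (Suc p) (up w)) = total (Suc m) w"
        using shift_total[of "Suc m" "up w"] by (simp add: p shift_up)
      then show ?thesis using w up_chains[OF w(1)] by (intro bexI[of _ "up w"]) (simp_all add: p shift_lin)
    qed
    then obtain z where z: "z \<in> cycles p" "x - incl z \<in> cyc_bounds p" using cycle_reduce[OF x] by blast
    then have "incl z \<in> cyc_bounds p" using zero[of p] less.prems by (auto intro: incl_bounds)
    then have "(x - incl z) + incl z \<in> cyc_bounds p" using z by (intro cyc_bounds_add)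
    then show "x \<in> cyc_bounds p" by simp
  qed
qed

lemma sum_split: "(\<Sum>i<r + k. f i) = (\<Sum>i<r. f i) + (\<Sum>j<k. f (r + j))" for f :: "nat \<Rightarrow> nat \<Rightarrow> 'v"
  by (induction k) (simp_all add: add.assoc)

text \<open>Lifts of a basis in degree \<open>p - 2\<close> together with a basis of the Hochschild homology form a basis in degree \<open>p\<close>.
  The assumption \<open>red\<close> makes the Hochschild homology of degree \<open>p\<close> inject into the cyclic homology.\<close>

lemma extend_basis:
  assumes HH: "homology_basis s (cycles p) (bounds p) \<rho> \<omega>"
    and \<Omega>: "\<And>i. i < r \<Longrightarrow> \<Omega> i \<in> cyc_cycles p"
    and span: "\<And>x. x \<in> cyc_cycles p \<Longrightarrow> \<exists>c. \<exists>w\<in>chains (Suc p). shift (x - (\<Sum>i<r. scalec (c i) (\<Omega> i)) - total (Suc p) w) = 0"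
    and indep: "\<And>c w i. w \<in> chains (Suc p) \<Longrightarrow> shift (\<Sum>i<r. scalec (c i) (\<Omega> i)) = shift (total (Suc p) w) \<Longrightarrow> i < r \<Longrightarrow> c i = 0"
    and red: "\<And>w. w \<in> chains (Suc p) \<Longrightarrow> shift (total (Suc p) w) = 0 \<Longrightarrow>
      \<exists>w'\<in>chains (Suc p). shift w' = 0 \<and> total (Suc p) w' = total (Suc p) w"
  shows "homology_basis scalec (cyc_cycles p) (cyc_bounds p) (r + \<rho>) (\<lambda>i. if i < r then \<Omega> i else incl (\<omega> (i - r)))"
proof -
  let ?\<Omega> = "\<lambda>i. if i < r then \<Omega> i else incl (\<omega> (i - r))"
  have L: "(\<Sum>i<r + \<rho>. scalec (c i) (?\<Omega> i)) = (\<Sum>i<r. scalec (c i) (\<Omega> i)) + incl (\<Sum>j<\<rho>. s (c (r + j)) (\<omega> j))" for c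
    unfolding sum_split incl_sum[symmetric] by (intro arg_cong2[of _ _ _ _ "(+)"] sum.cong) auto
  have \<omega>: "\<And>j. j < \<rho> \<Longrightarrow> \<omega> j \<in> cycles p" "\<And>z. z \<in> cycles p \<Longrightarrow> \<exists>e. z - (\<Sum>j<\<rho>. s (e j) (\<omega> j)) \<in> bounds p"
    "\<And>e. (\<Sum>j<\<rho>. s (e j) (\<omega> j)) \<in> bounds p \<Longrightarrow> \<forall>j<\<rho>. e j = 0"
    using HH unfolding homology_basis_def by blast+
  show ?thesis
    unfolding homology_basis_def
  proof (intro conjI allI impI ballI)
    fix i assume "i < r + \<rho>"
    then show "?\<Omega> i \<in> cyc_cycles p" using \<Omega>[of i] \<omega>(1)[of "i - r"] by (auto intro: incl_cycles)
  next
    fix x assume x: "x \<in> cyc_cycles p"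
    obtain c w where w: "w \<in> chains (Suc p)" "shift (x - (\<Sum>i<r. scalec (c i) (\<Omega> i)) - total (Suc p) w) = 0"
      using span[OF x] by blast
    let ?x = "x - (\<Sum>i<r. scalec (c i) (\<Omega> i))"
    have "?x \<in> cyc_cycles p" using x \<Omega> by (intro cyc_cycles_diff cyc_cycles_sum)
    then obtain z where z: "z \<in> cycles p" "?x - incl z \<in> cyc_bounds p" using cycle_reduce w by blast
    obtain e where e: "z - (\<Sum>j<\<rho>. s (e j) (\<omega> j)) \<in> bounds p" using \<omega>(2)[OF z(1)] by blast
    let ?z = "\<Sum>j<\<rho>. s (e j) (\<omega> j)"
    define c' where "c' i = (if i < r then c i else e (i - r))" for i
    have "(\<Sum>i<r + \<rho>. scalec (c' i) (?\<Omega> i)) = (\<Sum>i<r. scalec (c i) (\<Omega> i)) + incl ?z"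
      unfolding L by (simp add: c'_def)
    moreover have "incl z = incl (z - ?z) + incl ?z" unfolding incl_lin(1)[symmetric] by simp
    ultimately have "x - (\<Sum>i<r + \<rho>. scalec (c' i) (?\<Omega> i)) = (?x - incl z) + incl (z - ?z)" by (simp only: algebra_simps)
    also have "\<dots> \<in> cyc_bounds p" using z e by (intro cyc_bounds_add incl_bounds)
    finally show "\<exists>c. x - (\<Sum>i<r + \<rho>. scalec (c i) (?\<Omega> i)) \<in> cyc_bounds p" by blast
  next
    fix c i assume "(\<Sum>i<r + \<rho>. scalec (c i) (?\<Omega> i)) \<in> cyc_bounds p" and i: "i < r + \<rho>"
    then obtain w where w: "w \<in> chains (Suc p)" "(\<Sum>i<r. scalec (c i) (\<Omega> i)) + incl (\<Sum>j<\<rho>. s (c (r + j)) (\<omega> j)) = total (Suc p) w"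
      unfolding L by (auto simp only: cyc_bounds_def)
    have "shift (\<Sum>i<r. scalec (c i) (\<Omega> i)) = shift (total (Suc p) w)"
      unfolding w(2)[symmetric] shift_lin shift_incl by simp
    note c = indep[OF w(1) this]
    have "(\<Sum>i<r. scalec (c i) (\<Omega> i)) = 0"
      using c by (intro sum.neutral ballI) (simp add: scalec_def fun_eq_iff)
    then have w0: "total (Suc p) w = incl (\<Sum>j<\<rho>. s (c (r + j)) (\<omega> j))" using w(2) by (simp only: add_0)
    then have "shift (total (Suc p) w) = 0" by (simp only: shift_incl)
    then obtain w' where "w' \<in> chains (Suc p)" "shift w' = 0" "total (Suc p) w' = total (Suc p) w" using red[OF w(1)] by blast
    then have "(\<Sum>j<\<rho>. s (c (r + j)) (\<omega> j)) \<in> bounds p" using w0 by (intro bound_columns01) auto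
    then have "\<forall>j<\<rho>. c (r + j) = 0" by (rule \<omega>(3))
    then show "c i = 0" using c i by (cases "i < r") (auto dest!: spec[of _ "i - r"])
  qed
qed

text \<open>Cyclic homology vanishes in degrees \<open>p\<close> of the wrong parity, so the connecting maps vanish and the periodicity
  operator fits in short exact sequences.\<close>

theorem cyclic_homology_free:
  assumes zero: "\<And>n. n mod 2 \<noteq> d \<Longrightarrow> cycles n \<subseteq> bounds n"
    and free: "\<And>n. n mod 2 = d \<Longrightarrow> free_homology s (cycles n) (bounds n) \<rho>"
  shows "free_homology scalec (cyc_cycles p) (cyc_bounds p) (if p mod 2 = d then \<rho> * (p div 2 + 1) else 0)"
proof (cases "p mod 2 = d")
  case False
  then show ?thesis using cyclic_homology_0[OF zero] by (simp add: free_homology_0)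
next
  case True
  have "free_homology scalec (cyc_cycles p) (cyc_bounds p) (\<rho> * (p div 2 + 1))"
    using True
  proof (induction p rule: less_induct)
    case (less p)
    obtain \<omega> where \<omega>: "homology_basis s (cycles p) (bounds p) \<rho> \<omega>"
      using free[OF less.prems] by (auto simp: free_homology_def)
    have red: "\<exists>w'\<in>chains (Suc p). shift w' = 0 \<and> total (Suc p) w' = total (Suc p) w"
      if w: "w \<in> chains (Suc p)" and S: "shift (total (Suc p) w) = 0" for w
    proof (cases p)
      case 0
      then show ?thesis using w shift_small[of w "Suc p"] by auto
    next
      case (Suc k)
      have "shift w \<in> cyc_cycles k"
        using w S shift_chains[of w k] shift_total[of k w] by (simp add: cyc_cycles_def Suc)
      moreover have "k mod 2 \<noteq> d" using less.prems Suc by presburger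
      ultimately have "shift w \<in> cyc_bounds k" using cyclic_homology_0[OF zero] by blast
      then obtain v where v: "v \<in> chains (Suc k)" "shift w = total (Suc k) v" by (auto simp: cyc_bounds_def)
      let ?u = "total (Suc (Suc p)) (up v)"
      have uv: "up v \<in> chains (Suc (Suc p))" using up_chains[OF v(1)] by (simp add: Suc)
      have "shift ?u = total (Suc k) v"
        using shift_total[of "Suc k" "up v"] by (simp add: Suc shift_up)
      then have "shift (w - ?u) = 0" using v by (simp add: shift_lin)
      moreover have "total (Suc p) (w - ?u) = total (Suc p) w"
        unfolding total_diff total_total[OF uv] by simp
      moreover have "w - ?u \<in> chains (Suc p)" using w uv by (intro chains_diff total_chains)
      ultimately show ?thesis by blast
    qed
    show ?case
    proof (cases "p < 2")
      case True
      have "homology_basis scalec (cyc_cycles p) (cyc_bounds p) (0 + \<rho>) (\<lambda>i. if i < 0 then 0 else incl (\<omega> (i - 0)))"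
      proof (rule extend_basis[OF \<omega>])
        fix x assume "x \<in> cyc_cycles p"
        then have "shift (x - (\<Sum>i<(0 :: nat). scalec (0 :: 'k) 0) - total (Suc p) 0) = 0"
          using shift_small[of x p] True by (simp only: total_zero lessThan_0 sum.empty diff_zero cyc_cycles_def mem_Collect_eq)
        then show "\<exists>c. \<exists>w\<in>chains (Suc p). shift (x - (\<Sum>i<(0 :: nat). scalec (c i) 0) - total (Suc p) w) = 0"
          using chains_0 by auto
      qed (auto intro: red)
      moreover have "\<rho> * (p div 2 + 1) = 0 + \<rho>" using True by simp
      ultimately show ?thesis unfolding free_homology_def by metis
    next
      case False
      then obtain m where p: "p = m + 2" by (metis add.commute le_Suc_ex not_less)
      let ?r = "\<rho> * (m div 2 + 1)"
      have "free_homology scalec (cyc_cycles m) (cyc_bounds m) ?r"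
        using less.prems by (intro less.IH) (auto simp: p)
      then obtain \<Omega>' where \<Omega>': "\<And>i. i < ?r \<Longrightarrow> \<Omega>' i \<in> cyc_cycles m"
        "\<And>x. x \<in> cyc_cycles m \<Longrightarrow> \<exists>c. x - (\<Sum>i<?r. scalec (c i) (\<Omega>' i)) \<in> cyc_bounds m"
        "\<And>c. (\<Sum>i<?r. scalec (c i) (\<Omega>' i)) \<in> cyc_bounds m \<Longrightarrow> \<forall>i<?r. c i = 0"
        unfolding free_homology_def homology_basis_def by blast
      have "Suc m mod 2 \<noteq> d" using less.prems p by presburger
      then have "\<exists>x\<in>cyc_cycles p. shift x = y" if "y \<in> cyc_cycles m" for y
        using cycle_lift[OF that] zero by (simp add: p)
      then have "\<forall>i. \<exists>x. i < ?r \<longrightarrow> x \<in> cyc_cycles p \<and> shift x = \<Omega>' i" using \<Omega>'(1) by blast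
      then obtain \<Omega> where \<Omega>: "\<And>i. i < ?r \<Longrightarrow> \<Omega> i \<in> cyc_cycles p" "\<And>i. i < ?r \<Longrightarrow> shift (\<Omega> i) = \<Omega>' i"
        by metis
      have S: "shift (\<Sum>i<?r. scalec (c i) (\<Omega> i)) = (\<Sum>i<?r. scalec (c i) (\<Omega>' i))" for c
        unfolding shift_sum by (intro sum.cong refl) (simp add: \<Omega>)
      have "homology_basis scalec (cyc_cycles p) (cyc_bounds p) (?r + \<rho>) (\<lambda>i. if i < ?r then \<Omega> i else incl (\<omega> (i - ?r)))"
      proof (rule extend_basis[OF \<omega> \<Omega>(1)])
        fix x assume "x \<in> cyc_cycles p"
        then have "shift x \<in> cyc_cycles m" by (auto simp only: p intro: shift_cycles)
        then obtain c where "shift x - (\<Sum>i<?r. scalec (c i) (\<Omega>' i)) \<in> cyc_bounds m" using \<Omega>'(2) by blast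
        then obtain w where w: "w \<in> chains (Suc m)" "shift x - (\<Sum>i<?r. scalec (c i) (\<Omega>' i)) = total (Suc m) w"
          by (auto simp: cyc_bounds_def)
        have "shift (total (Suc p) (up w)) = total (Suc m) w"
          using shift_total[of "Suc m" "up w"] by (simp add: p shift_up)
        then have "shift (x - (\<Sum>i<?r. scalec (c i) (\<Omega> i)) - total (Suc p) (up w)) = 0"
          unfolding shift_lin S w(2) by simp
        moreover have "up w \<in> chains (Suc p)" using up_chains[OF w(1)] by (simp add: p)
        ultimately show "\<exists>c. \<exists>w\<in>chains (Suc p). shift (x - (\<Sum>i<?r. scalec (c i) (\<Omega> i)) - total (Suc p) w) = 0"
          by blast
      next
        fix c w i assume w: "w \<in> chains (Suc p)" and eq: "shift (\<Sum>i<?r. scalec (c i) (\<Omega> i)) = shift (total (Suc p) w)" and i: "i < ?r"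
        have "shift (total (Suc p) w) = total (Suc m) (shift w)" using shift_total[of "Suc m" w] by (simp add: p)
        moreover have "shift w \<in> chains (Suc m)" using shift_chains[of w "Suc m"] w by (simp add: p)
        ultimately have "(\<Sum>i<?r. scalec (c i) (\<Omega>' i)) \<in> cyc_bounds m"
          using eq unfolding S by (auto simp: cyc_bounds_def)
        then show "c i = 0" using \<Omega>'(3) i by blast
      qed (auto intro: red)
      moreover have "\<rho> * (p div 2 + 1) = ?r + \<rho>" by (simp add: p)
      ultimately show ?thesis unfolding free_homology_def by metis
    qed
  qed
  then show ?thesis using True by simp
qed

theorem cyclic_homology_iso:
  assumes "\<And>n. n mod 2 \<noteq> d \<Longrightarrow> cycles n \<subseteq> bounds n"
    and "\<And>n. n mod 2 = d \<Longrightarrow> free_homology s (cycles n) (bounds n) \<rho>"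
  shows "quotient_module scalec (cyc_cycles p) (cyc_bounds p) \<cong>\<^sub>k
    free_module (if p mod 2 = d then \<rho> * (p div 2 + 1) else 0)"
  by (rule free_homology_iso[OF cyclic_homology_free[OF assms] module_scalec])
    (assumption | erule (1) cyc_cycles_add cyc_bounds_add | erule cyc_cycles_scale cyc_bounds_scale | rule cyc_bounds_cycles cyc_bounds_0)+

end


section \<open>The bicomplex of a modular triple\<close>

definition smult_fun :: "'k::comm_ring_1 \<Rightarrow> ('w \<Rightarrow> 'k) \<Rightarrow> 'w \<Rightarrow> 'k" where
  "smult_fun r x = (\<lambda>w. r * x w)"

lemma module_smult_fun: "module (smult_fun :: 'k::comm_ring_1 \<Rightarrow> ('w \<Rightarrow> 'k) \<Rightarrow> 'w \<Rightarrow> 'k)"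
  by unfold_locales (auto simp: smult_fun_def fun_eq_iff algebra_simps)

lemma module_hom_smult_funI:
  assumes "\<And>x y. f (x + y) = f x + f y" "\<And>r x. f (smult_fun r x) = smult_fun r (f x)"
  shows "module_hom smult_fun smult_fun f"
  by (intro module_hom.intro module_hom_axioms.intro module_smult_fun assms)

context modular_triple
begin

lemma face_scale: "face H \<alpha> \<beta> n i (smult_fun r x) = smult_fun r (face H \<alpha> \<beta> n i x)"
  by (rule ext) (simp add: face_def linear_ext_def smult_fun_def sum_distrib_left mult.assoc)

lemma face_add: "face H \<alpha> \<beta> n i (x + y) = face H \<alpha> \<beta> n i x + face H \<alpha> \<beta> n i y"
  by (rule ext) (simp add: face_def linear_ext_def algebra_simps sum.distrib)

lemma b'_scale: "b' n (smult_fun r x) = smult_fun r (b' n x)"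
  by (rule ext) (simp add: b'_op_def face_scale, simp add: smult_fun_def sum_distrib_left mult.left_commute)

lemma tau_scale: "\<tau> n (smult_fun r x) = smult_fun r (\<tau> n x)"
  by (rule ext) (simp add: tau_def cyc_def linear_ext_def smult_fun_def sum_distrib_left ac_simps)

lemma tau_pow_scale: "(\<tau> n ^^ i) (smult_fun r x) = smult_fun r ((\<tau> n ^^ i) x)"
  by (induction i) (simp_all add: tau_scale)

lemma tau_pow_add: "(\<tau> n ^^ i) (x + y) = (\<tau> n ^^ i) x + (\<tau> n ^^ i) y"
proof (induction i)
  case (Suc i)
  show ?case unfolding funpow.simps o_apply Suc tau_add ..
qed simp

lemma norm_C: "x \<in> C n \<Longrightarrow> norm_op H \<pi> \<alpha> \<beta> n x \<in> C n"
proof -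
  assume x: "x \<in> C n"
  then have *: "(\<tau> n ^^ i) x \<in> C n" for i by (induction i) (auto intro: tau_C)
  have "finite I \<Longrightarrow> (\<Sum>i\<in>I. (\<tau> n ^^ i) x) \<in> C n" for I
  proof (induction I rule: finite_induct)
    case empty
    show ?case unfolding sum.empty by (rule C_0)
  next
    case (insert i I)
    show ?case unfolding sum.insert[OF insert(1,2)] by (rule C_add[OF * insert(3)])
  qed
  then show ?thesis by (simp only: norm_op_def finite_atMost)
qed

lemma b'_exact:
  assumes x: "x \<in> C n" and c: "n = 0 \<or> b' n x = 0"
  shows "\<exists>y\<in>C (Suc n). b' (Suc n) y = x"
proof (cases n)
  case 0
  then show ?thesis using x b'_append_one_0[of x] append_one_C[of 0 x] by auto
next
  case (Suc m)
  have append_one_0: "append_one m 0 = 0" by (simp add: append_one_def tmap_def linear_ext_def fun_eq_iff)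
  have "b' (Suc n) (append_one n x) = append_one m (b' n x) + smult_fun ((-1) ^ n) x"
    using b'_append_one_Suc[of x m] x by (simp only: Suc smult_fun_def)
  also have "\<dots> = smult_fun ((-1) ^ n) x" using c Suc by (auto simp: append_one_0)
  finally have eq: "b' (Suc n) (append_one n x) = smult_fun ((-1) ^ n) x" .
  have "b' (Suc n) (smult_fun ((-1) ^ n) (append_one n x)) = smult_fun ((-1) ^ n) (b' (Suc n) (append_one n x))"
    by (rule b'_scale)
  also have "\<dots> = x"
    unfolding eq by (rule ext) (simp add: smult_fun_def mult.assoc[symmetric] power_mult_distrib[symmetric])
  finally have "b' (Suc n) (smult_fun ((-1) ^ n) (append_one n x)) = x" .
  moreover have "smult_fun ((-1) ^ n) (append_one n x) \<in> C (Suc n)"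
    using append_one_C[of n x] by (auto simp: smult_fun_def vecs_def)
  ultimately show ?thesis by blast
qed

sublocale bicomplex: connes_bicomplex smult_fun C b b' \<tau> "norm_op H \<pi> \<alpha> \<beta>"
proof (intro connes_bicomplex.intro module_smult_fun connes_bicomplex_axioms.intro)
  fix n r and x y :: "'b list \<Rightarrow> 'k"
  show "0 \<in> C n" by (rule C_0)
  show "x \<in> C n \<Longrightarrow> y \<in> C n \<Longrightarrow> x + y \<in> C n" by (rule C_add)
  show "x \<in> C n \<Longrightarrow> smult_fun r x \<in> C n" by (auto simp: smult_fun_def vecs_def)
  show "module_hom smult_fun smult_fun (b n)"
    by (rule module_hom_smult_funI; rule ext; simp only: b_op_def face_add face_scale)
      (simp_all add: smult_fun_def algebra_simps sum.distrib sum_distrib_left)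
  show "module_hom smult_fun smult_fun (b' n)"
    by (rule module_hom_smult_funI; rule ext; simp only: b'_op_def face_add face_scale)
      (simp_all add: smult_fun_def algebra_simps sum.distrib sum_distrib_left)
  show "module_hom smult_fun smult_fun (\<tau> n)"
    by (rule module_hom_smult_funI) (rule tau_add tau_scale)+
  show "module_hom smult_fun smult_fun (norm_op H \<pi> \<alpha> \<beta> n)"
    by (rule module_hom_smult_funI; rule ext; simp only: norm_op_def tau_pow_add tau_pow_scale sum.distrib)
      (simp_all add: smult_fun_def sum_fun_apply sum_distrib_left)
  show "x \<in> C (Suc n) \<Longrightarrow> b (Suc n) x \<in> C n" by (rule b_C)
  show "x \<in> C (Suc n) \<Longrightarrow> b' (Suc n) x \<in> C n" by (rule b'_C)
  show "x \<in> C n \<Longrightarrow> \<tau> n x \<in> C n" by (rule tau_C)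
  show "x \<in> C n \<Longrightarrow> norm_op H \<pi> \<alpha> \<beta> n x \<in> C n" by (rule norm_C)
  show "b (Suc n) (b (Suc (Suc n)) x) = 0" by (rule b_b)
  show "b' (Suc n) (b' (Suc (Suc n)) x) = 0" by (rule b'_b')
  show "x \<in> C (Suc n) \<Longrightarrow> b (Suc n) (\<tau> (Suc n) x) = b (Suc n) x - b' (Suc n) x + \<tau> n (b' (Suc n) x)" by (rule b_tau)
  show "x \<in> C (Suc n) \<Longrightarrow> b' (Suc n) (norm_op H \<pi> \<alpha> \<beta> (Suc n) x) = norm_op H \<pi> \<alpha> \<beta> n (b (Suc n) x)" by (rule b'_norm)
  show "x \<in> C n \<Longrightarrow> \<tau> n (norm_op H \<pi> \<alpha> \<beta> n x) = norm_op H \<pi> \<alpha> \<beta> n x" by (rule norm_tau)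
  show "x \<in> C n \<Longrightarrow> norm_op H \<pi> \<alpha> \<beta> n (\<tau> n x) = norm_op H \<pi> \<alpha> \<beta> n x" by (rule norm_tau)
  show "x \<in> C n \<Longrightarrow> n = 0 \<or> b' n x = 0 \<Longrightarrow> \<exists>y\<in>C (Suc n). b' (Suc n) y = x" by (rule b'_exact)
qed

theorem HC_iso:
  assumes "\<And>n. n mod 2 \<noteq> d \<Longrightarrow> bicomplex.cycles n \<subseteq> bicomplex.bounds n"
    and "\<And>n. n mod 2 = d \<Longrightarrow> free_homology smult_fun (bicomplex.cycles n) (bicomplex.bounds n) \<rho>"
  shows "HC H \<pi> \<alpha> \<beta> p \<cong>\<^sub>k free_module (if p mod 2 = d then \<rho> * (p div 2 + 1) else 0)"
proof -
  have ch: "bicomplex.chains = tot_chains H"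
    by (simp add: fun_eq_iff bicomplex.chains_def tot_chains_def)
  have tot: "bicomplex.total = tot_diff H \<pi> \<alpha> \<beta>"
    by (intro ext) (simp add: bicomplex.total_def tot_diff_def vertical_def horizontal_def)
  have sc: "bicomplex.scalec = (\<lambda>r x c w. r * x c w)"
    by (simp add: fun_eq_iff bicomplex.scalec_def smult_fun_def)
  have "HC H \<pi> \<alpha> \<beta> p = quotient_module bicomplex.scalec (bicomplex.cyc_cycles p) (bicomplex.cyc_bounds p)"
    by (simp add: HC_def bicomplex.cyc_cycles_def bicomplex.cyc_bounds_def ch tot sc)
  then show ?thesis using bicomplex.cyclic_homology_iso[OF assms] by simp
qed

end


section \<open>The Taft algebra\<close>

locale taft_algebra =
  fixes n :: nat and q :: "'k::comm_ring_1"
  assumes n: "n \<ge> 2" and q1: "q ^ n = 1" and taft_is_hopf: "is_hopf_algebra (taft n q)"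
begin

sublocale hopf_algebra "taft n q"
  by (rule hopf_algebra.intro) (rule taft_is_hopf)

text \<open>Indices are computed with integers: \<open>ix k\<close> is the representative of \<open>k\<close> modulo \<open>n\<close> and \<open>qpow k\<close> is \<open>q\<^sup>k\<close>.\<close>

definition ix :: "int \<Rightarrow> nat" where "ix k = nat (k mod int n)"
definition qpow :: "int \<Rightarrow> 'k" where "qpow k = q ^ ix k"

lemma ix_less [simp]: "ix k < n"
  using n by (simp add: ix_def nat_less_iff)

lemma int_ix: "int (ix k) = k mod int n"
  using n by (simp add: ix_def)

lemma ix_int [simp]: "i < n \<Longrightarrow> ix (int i) = i"
  by (simp add: ix_def)

lemma ix_eq_iff: "ix a = ix b \<longleftrightarrow> a mod int n = b mod int n"
  using int_ix by (metis ix_def)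

lemma ix_ix [simp]: "ix (int (ix a)) = ix a" "ix (int (ix a) + b) = ix (a + b)" "ix (b + int (ix a)) = ix (b + a)"
   "ix (int (ix a) - b) = ix (a - b)" "ix (b - int (ix a)) = ix (b - a)"
   "ix (int (ix a) * b) = ix (a * b)" "ix (b * int (ix a)) = ix (b * a)" "ix (- int (ix a)) = ix (- a)"
  by (simp_all add: ix_eq_iff int_ix mod_simps)

lemma ix_neg [simp]: "ix (- int (ix a) + b) = ix (- a + b)" "ix (- int (ix a) - b) = ix (- a - b)"
  using ix_ix(2)[of "- int (ix a)" b] ix_ix(4)[of "- int (ix a)" b] by simp_all

lemma ix_of_nat: "ix (int m) = m mod n"
  by (simp add: ix_def zmod_int[symmetric])

lemma q_pow_mod: "q ^ (m mod n) = q ^ m"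
proof -
  have "q ^ m = q ^ (n * (m div n) + m mod n)" by simp
  also have "\<dots> = q ^ (m mod n)" unfolding power_add power_mult q1 by simp
  finally show ?thesis by simp
qed

lemma qpow_of_nat: "qpow (int m) = q ^ m"
  by (simp add: qpow_def ix_of_nat q_pow_mod)

lemma qpow_cong: "ix a = ix b \<Longrightarrow> qpow a = qpow b"
  by (simp add: qpow_def)

lemma qpow_add: "qpow (a + b) = qpow a * qpow b"
proof -
  have "qpow a * qpow b = q ^ (ix a + ix b)" by (simp add: qpow_def power_add)
  also have "\<dots> = qpow (int (ix a + ix b))" by (rule qpow_of_nat[symmetric])
  also have "\<dots> = qpow (a + b)" by (rule qpow_cong) simp
  finally show ?thesis by simp
qed

lemma qpow_0 [simp]: "qpow 0 = 1"
  by (simp add: qpow_def ix_def)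

lemma qpow_ix [simp]: "qpow (int (ix a)) = qpow a" "qpow (int (ix a) * b) = qpow (a * b)" "qpow (b * int (ix a)) = qpow (b * a)"
  by (auto intro!: qpow_cong)

lemma qpow_1 [simp]: "qpow 1 = q"
  using qpow_of_nat[of 1] by simp

lemma qpow_pow: "qpow a ^ m = qpow (a * int m)"
  by (induction m) (simp_all add: qpow_add[symmetric] algebra_simps)

lemma qpow_mult_1: "qpow a = 1 \<Longrightarrow> qpow (a * b) = 1"
  using qpow_pow[of a "ix b"] by simp

lemma qpow_minus_1: "qpow a = 1 \<Longrightarrow> qpow (- a) = 1"
  using qpow_mult_1[of a "- 1"] by simp

lemma taft_simps: "Basis (taft n q) = taft_paths n" "Counit (taft n q) = bvec (0, 0)"
    "Antipode (taft n q) = taft_antipode n q" "Comult (taft n q) = taft_comult n q"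
  by (simp_all add: taft_def)

lemma B_iff [simp]: "(i, l) \<in> Basis (taft n q) \<longleftrightarrow> i < n \<and> l < n"
  by (simp add: taft_simps taft_paths_def)

lemma eps_path: "Counit (taft n q) (i, l) = of_bool (i = 0 \<and> l = 0)"
  by (simp add: taft_simps bvec_def)

lemma mul_path:
  assumes "j < n" "m < n"
  shows "mul (i, l) (j, m) g = (if i = ix (int j + int m) \<and> l + m < n then g (j, l + m) else 0)"
proof -
  have "i = ix (int j + int m) \<longleftrightarrow> i = (j + m) mod n" using ix_of_nat[of "j + m"] by simp
  moreover have "mul (i, l) (j, m) g = functional B g (if i = (j + m) mod n \<and> l + m < n then bvec (j, l + m) else (\<lambda>_. 0))"
    by (simp add: mul_def taft_def taft_mult_def)
  moreover have "functional B g (bvec (j, l + m)) = g (j, l + m)" if "l + m < n"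
    using that assms by (intro functional_bvec finite_B) simp
  ultimately show ?thesis by (simp add: functional_def)
qed

lemma one_path: "one g = (\<Sum>i<n. g (i, 0))"
proof -
  have "one g = (\<Sum>i<n. functional (taft_paths n) g (bvec (i, 0)))"
    unfolding one_def by (simp add: taft_def functional_def sum_fun_apply sum_distrib_right) (rule sum.swap)
  also have "\<dots> = (\<Sum>i<n. g (i, 0))"
    using finite_B n by (intro sum.cong refl functional_bvec) (auto simp: taft_simps taft_paths_def)
  finally show ?thesis .
qed


text \<open>On the basis of paths the antipode is a signed permutation up to powers of \<open>q\<close>: it sends \<open>a\<close> to \<open>anti_coeff a\<close> times the path \<open>neg a\<close>.\<close>

definition neg :: "nat \<times> nat \<Rightarrow> nat \<times> nat" where "neg = (\<lambda>(i, l). (ix (- int i - int l), l))"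
definition anti_coeff :: "nat \<times> nat \<Rightarrow> 'k" where "anti_coeff = (\<lambda>(i, l). (-1) ^ l * qpow (int i * int l + int (\<Sum>{..l})))"

lemma bilinear_bvec_scaled:
  assumes "finite X" "a \<in> X" "c \<in> X"
  shows "bilinear_ext X f (\<lambda>u. s * bvec a u) (\<lambda>u. t * bvec c u) = (\<lambda>u. s * t * f a c u :: 'k)"
proof
  fix u
  have "bilinear_ext X f (\<lambda>u. s * bvec a u) (\<lambda>u. t * bvec c u) u =
      functional X (\<lambda>x. functional X (\<lambda>y. f x y u) (\<lambda>u. t * bvec c u)) (\<lambda>u. s * bvec a u)"
    by (simp add: bilinear_ext_def functional_def sum_distrib_left mult.assoc)
  then show "bilinear_ext X f (\<lambda>u. s * bvec a u) (\<lambda>u. t * bvec c u) u = s * t * f a c u"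
    using assms by (simp add: functional_of_scaled functional_bvec mult.assoc)
qed

lemma antipode_path:
  "i < n \<Longrightarrow> l < n \<Longrightarrow> taft_antipode n q (i, l) = (\<lambda>u. anti_coeff (i, l) * bvec (neg (i, l)) u)"
proof (induction l)
  case 0
  have "ix (- int i) = (n - i) mod n"
    using 0 ix_of_nat[of "n - i"] by (auto simp: of_nat_diff ix_eq_iff[of "- int i" "int n - int i", symmetric] ix_def mod_simps)
  then show ?case by (simp add: neg_def anti_coeff_def)
next
  case (Suc l)
  have edge: "taft_antipode_edge n q k = (\<lambda>u. - (q ^ (k + 1)) * bvec (ix (- int k - 1), 1) u)" if "k < n" for k
  proof -
    have "ix (- int k - 1) = ix (int (2 * n - k - 1))"
      using that by (simp add: ix_eq_iff of_nat_diff mod_eq_dvd_iff)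
    then show ?thesis by (simp add: taft_antipode_edge_def ix_of_nat)
  qed
  show ?case
  proof (cases l)
    case 0
    then show ?thesis using Suc.prems edge[of i] by (simp add: neg_def anti_coeff_def qpow_of_nat[symmetric] qpow_add algebra_simps)
  next
    case (Suc l')
    let ?k = "(i + l) mod n"
    have k: "?k = ix (int i + int l)" using ix_of_nat[of "i + l"] by simp
    have "taft_antipode n q (i, Suc l) = bilinear_ext (taft_paths n) (taft_mult n)
       (\<lambda>u. anti_coeff (i, l) * bvec (neg (i, l)) u) (\<lambda>u. - (q ^ (?k + 1)) * bvec (ix (- int ?k - 1), 1) u)"
      using Suc.IH Suc.prems Suc edge[of ?k] by simp
    also have "\<dots> = (\<lambda>u. anti_coeff (i, l) * (- (q ^ (?k + 1))) * taft_mult n (neg (i, l)) (ix (- int ?k - 1), 1) u)"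
      using Suc.prems n finite_B by (intro bilinear_bvec_scaled) (auto simp: taft_simps taft_paths_def neg_def)
    also have "(taft_mult n (neg (i, l)) (ix (- int ?k - 1), 1) :: _ \<Rightarrow> 'k) = bvec (neg (i, Suc l))"
    proof -
      have "(ix (- int ?k - 1) + 1) mod n = ix (- int i - int l)"
        using ix_of_nat[of "ix (- int ?k - 1) + 1"] by (simp add: k algebra_simps)
      moreover have "ix (- int ?k - 1) = ix (- int i - int (Suc l))"
        unfolding k ix_neg by (simp add: algebra_simps)
      ultimately show ?thesis using Suc.prems by (simp add: taft_mult_def neg_def)
    qed
    also have "anti_coeff (i, l) * (- (q ^ (?k + 1))) = anti_coeff (i, Suc l)"
    proof -
      have "q ^ (?k + 1) = qpow (int i + int l + 1)"
        unfolding qpow_of_nat[symmetric] by (rule qpow_cong) (simp add: k ac_simps)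
      then have "anti_coeff (i, l) * (- (q ^ (?k + 1))) = (-1) ^ Suc l * (qpow (int i * int l + int (\<Sum>{..l})) * qpow (int i + int l + 1))"
        by (simp add: anti_coeff_def)
      then show ?thesis unfolding qpow_add[symmetric] by (simp add: anti_coeff_def algebra_simps)
    qed
    finally show ?thesis .
  qed
qed

lemma neg_B: "a \<in> B \<Longrightarrow> neg a \<in> B"
  by (cases a) (auto simp: neg_def)

lemma anti_path: "a \<in> B \<Longrightarrow> anti a g = anti_coeff a * g (neg a)"
proof -
  assume a: "a \<in> B"
  then have "Antipode (taft n q) a = (\<lambda>u. anti_coeff a * bvec (neg a) u)"
    by (cases a) (simp add: taft_simps(3) antipode_path)
  then show ?thesis using neg_B[OF a] finite_B by (simp add: anti_def functional_of_scaled functional_bvec)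
qed

lemma neg_neg: "a \<in> B \<Longrightarrow> neg (neg a) = a"
  by (cases a) (auto simp: neg_def algebra_simps)

lemma anti_anti_path: "anti a (\<lambda>p. anti p g) = q ^ snd a * g a" if "a \<in> B"
proof -
  obtain i l where a: "a = (i, l)" by (cases a)
  have "int (\<Sum>{..l}) + int (\<Sum>{..l}) = int l * int l + int l"
    by (induction l) (auto simp: algebra_simps)
  then have *: "int i * int l + int (\<Sum>{..l}) + ((- int i - int l) * int l + int (\<Sum>{..l})) = int l"
    by (simp add: algebra_simps)
  have sq: "(-1) ^ l * (-1) ^ l = (1 :: 'k)" by (simp add: power_mult_distrib[symmetric])
  have "qpow (int (ix (- int i - int l)) * int l + int (\<Sum>{..l})) = qpow ((- int i - int l) * int l + int (\<Sum>{..l}))"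
    unfolding qpow_add qpow_ix ..
  then have "anti_coeff a * anti_coeff (neg a) = ((-1) ^ l * (-1) ^ l) * (qpow (int i * int l + int (\<Sum>{..l})) * qpow ((- int i - int l) * int l + int (\<Sum>{..l})))"
    by (simp only: anti_coeff_def a neg_def prod.case mult.assoc mult.left_commute)
  then have "anti_coeff a * anti_coeff (neg a) = qpow (int l)"
    unfolding sq qpow_add[symmetric] * by simp
  then show ?thesis using that neg_B[OF that] neg_neg[OF that] by (simp add: anti_path a qpow_of_nat mult.assoc[symmetric])
qed

definition pairs where "pairs i = {(j, k). j < n \<and> k < n \<and> (j + k) mod n = i}"

lemma finite_pairs: "finite (pairs i)"
  by (rule finite_subset[of _ "{..<n} \<times> {..<n}"]) (auto simp: pairs_def)

lemma pairs_ix: "i < n \<Longrightarrow> (j, k) \<in> pairs i \<longleftrightarrow> j < n \<and> k = ix (int i - int j)"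
  and pairs_ix': "i < n \<Longrightarrow> (j, k) \<in> pairs i \<longleftrightarrow> k < n \<and> j = ix (int i - int k)"
proof -
  assume i: "i < n"
  have *: "(j + k) mod n = i \<longleftrightarrow> ix (int j + int k) = ix (int i)" for j k
    using i ix_of_nat[of "j + k"] by simp
  have 1: "ix (int j + int k) = ix (int i) \<longleftrightarrow> ix (int k) = ix (int i - int j)" for j k
    by (auto simp: ix_eq_iff mod_eq_dvd_iff algebra_simps)
  show "(j, k) \<in> pairs i \<longleftrightarrow> j < n \<and> k = ix (int i - int j)"
    unfolding pairs_def using * 1[of j k] by auto
  show "(j, k) \<in> pairs i \<longleftrightarrow> k < n \<and> j = ix (int i - int k)"
    unfolding pairs_def using * 1[of k j] by (auto simp: add.commute)
qed

lemma functional_sum_vec: "functional X g (\<Sum>i\<in>I. f i) = (\<Sum>i\<in>I. functional X g (f i))"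
  unfolding functional_def sum_fun_apply sum_distrib_right by (rule sum.swap)

lemma comul_vertex: "i < n \<Longrightarrow> comul (i, 0) g = (\<Sum>(j, k)\<in>pairs i. g (j, 0) (k, 0))"
proof -
  assume "i < n"
  have "comul (i, 0) g = (\<Sum>p\<in>pairs i. functional (B \<times> B) (\<lambda>(x, y). g x y) (tensor_vec (bvec (fst p, 0)) (bvec (snd p, 0))))"
    unfolding comul_def taft_simps(4) taft_comult.simps taft_comult_vertex_def pairs_def[symmetric]
    by (simp only: case_prod_unfold functional_sum_vec)
  also have "\<dots> = (\<Sum>p\<in>pairs i. g (fst p, 0) (snd p, 0))"
    using n finite_B by (intro sum.cong refl) (auto simp: functional_tensor_vec functional_bvec pairs_def)
  finally show ?thesis by (simp add: case_prod_unfold)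
qed

lemma comul_edge:
  "i < n \<Longrightarrow> comul (i, 1) g = (\<Sum>(j, k)\<in>pairs i. g (j, 0) (k, 1) + q ^ k * g (j, 1) (k, 0))"
proof -
  assume "i < n"
  have "comul (i, 1) g = (\<Sum>p\<in>pairs i. functional (B \<times> B) (\<lambda>(x, y). g x y)
      (\<lambda>u. tensor_vec (bvec (fst p, 0)) (bvec (snd p, 1)) u + q ^ snd p * tensor_vec (bvec (fst p, 1)) (bvec (snd p, 0)) u))"
    unfolding comul_def taft_simps(4) One_nat_def taft_comult.simps taft_comult_edge_def pairs_def[symmetric] plus_fun_def
    by (simp only: case_prod_unfold functional_sum_vec One_nat_def)
  also have "\<dots> = (\<Sum>p\<in>pairs i. g (fst p, 0) (snd p, 1) + q ^ snd p * g (fst p, 1) (snd p, 0))"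
  proof (intro sum.cong refl)
    fix p assume "p \<in> pairs i"
    then have *: "(fst p, 0) \<in> B" "(fst p, 1) \<in> B" "(snd p, 0) \<in> B" "(snd p, 1) \<in> B" using n by (auto simp: pairs_def)
    have add: "functional X h (\<lambda>u. f u + f' u) = functional X h f + functional X h f'" for X :: "('x) set" and h f f' :: "'x \<Rightarrow> 'k"
      by (simp add: functional_def algebra_simps sum.distrib)
    show "functional (B \<times> B) (\<lambda>(x, y). g x y)
      (\<lambda>u. tensor_vec (bvec (fst p, 0)) (bvec (snd p, 1)) u + q ^ snd p * tensor_vec (bvec (fst p, 1)) (bvec (snd p, 0)) u)
      = g (fst p, 0) (snd p, 1) + q ^ snd p * g (fst p, 1) (snd p, 0)"
      unfolding add functional_of_scaled using * finite_B by (simp add: functional_tensor_vec functional_bvec)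
  qed
  finally show ?thesis by (simp add: case_prod_unfold)
qed

lemma path_Suc:
  assumes "i < n" "Suc l < n"
  shows "mul (ix (int i + int l), 1) (i, l) g = g (i, Suc l)"
  using assms by (simp add: mul_path)

lemma comul_path_Suc:
  assumes "i < n" "Suc l < n"
  shows "comul (i, Suc l) g = comul (ix (int i + int l), 1) (\<lambda>x y. comul (i, l) (\<lambda>x' y'. mul x x' (\<lambda>p. mul y y' (\<lambda>r. g p r))))"
proof -
  have "comul (i, Suc l) g = mul (ix (int i + int l), 1) (i, l) (\<lambda>c. comul c g)"
    using assms by (simp add: path_Suc)
  then show ?thesis using assms n by (simp add: comul_mul_hom)
qed

definition sft :: "int \<Rightarrow> nat \<times> nat \<Rightarrow> nat \<times> nat" where "sft k = (\<lambda>(i, l). (ix (int i + k), l))"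

lemma sft_B: "a \<in> B \<Longrightarrow> sft k a \<in> B"
  by (cases a) (auto simp: sft_def)

lemma sft_sft: "sft k (sft m a) = sft (k + m) a"
  by (cases a) (simp add: sft_def algebra_simps)

lemma sft_0: "a \<in> B \<Longrightarrow> sft 0 a = a"
  by (cases a) (simp add: sft_def)

lemma snd_sft [simp]: "snd (sft k a) = snd a"
  by (cases a) (simp add: sft_def)

lemma sft_cong: "ix k = ix m \<Longrightarrow> sft k a = sft m a"
  by (cases a) (auto simp: sft_def ix_eq_iff mod_eq_dvd_iff)

lemma sft_mul:
  assumes "a \<in> B" "b \<in> B"
  shows "mul (sft k a) (sft k b) g = mul a b (\<lambda>c. g (sft k c))"
proof -
  obtain i l j m where ab: "a = (i, l)" "b = (j, m)" by (cases a; cases b)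
  have "ix (int i + k) = ix (int j + k + int m) \<longleftrightarrow> ix (int i) = ix (int j + int m)"
    by (auto simp: ix_eq_iff mod_eq_dvd_iff algebra_simps)
  then show ?thesis using assms by (auto simp: ab sft_def mul_path cong del: mul_cong)
qed


text \<open>Every path is a product of arrows, so identities that are multiplicative need to be checked on vertices and arrows.\<close>

lemma path_induct [consumes 1, case_names vertex edge step]:
  assumes "a \<in> B"
    and "\<And>i. i < n \<Longrightarrow> P (i, 0)" and "\<And>i. i < n \<Longrightarrow> P (i, 1)"
    and "\<And>i l. i < n \<Longrightarrow> Suc l < n \<Longrightarrow> P (ix (int i + int l), 1) \<Longrightarrow> P (i, l) \<Longrightarrow> P (i, Suc l)"
  shows "P a"
proof -
  obtain i l where a: "a = (i, l)" by (cases a)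
  have "i < n \<Longrightarrow> l < n \<Longrightarrow> P (i, l)" by (induction l) (use assms(2-) in auto)
  then show ?thesis using assms(1) by (simp add: a)
qed

lemma mul_char:
  assumes "u < n" "a \<in> B" "b \<in> B"
  shows "mul a b (taft_char u) = taft_char u a * taft_char u b"
  using assms by (cases a; cases b) (auto simp: taft_char_def bvec_def mul_path)

lemma char_vertex [simp]: "taft_char u (j, l) = (of_bool (j = u \<and> l = 0) :: 'k)"
  by (simp add: taft_char_def bvec_def)

lemma pairs_delta_left:
  assumes "i < n" "u < n"
  shows "(\<Sum>(j, k)\<in>pairs i. of_bool (j = u) * F j k) = (F u (ix (int i - int u)) :: 'k)"
proof -
  have "(\<Sum>(j, k)\<in>pairs i. of_bool (j = u) * F j k) = (\<Sum>p\<in>pairs i. if p = (u, ix (int i - int u)) then F u (ix (int i - int u)) else 0)"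
    using assms by (intro sum.cong refl) (auto simp: pairs_ix of_bool_def split: if_splits)
  then show ?thesis using assms finite_pairs by (simp add: sum.delta pairs_ix)
qed

lemma pairs_delta_right:
  assumes "i < n" "u < n"
  shows "(\<Sum>(j, k)\<in>pairs i. of_bool (k = u) * F j k) = (F (ix (int i - int u)) u :: 'k)"
proof -
  have "(\<Sum>(j, k)\<in>pairs i. of_bool (k = u) * F j k) = (\<Sum>p\<in>pairs i. if p = (ix (int i - int u), u) then F (ix (int i - int u)) u else 0)"
    using assms by (intro sum.cong refl) (auto simp: pairs_ix' of_bool_def split: if_splits)
  then show ?thesis using assms finite_pairs by (simp add: sum.delta pairs_ix')
qed

text \<open>The character of the vertex \<open>e\<^sub>u\<close> acts on the algebra from both sides: from the left by translation of
  indices, from the right by the same translation and a power of \<open>q\<close>.\<close>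

lemma translate_left:
  assumes "a \<in> B" "u < n"
  shows "comul a (\<lambda>x y. taft_char u x * g y) = g (sft (- int u) a)"
  using assms(1)
proof (induction a arbitrary: g rule: path_induct)
  case (vertex i)
  have "comul (i, 0) (\<lambda>x y. taft_char u x * g y) = (\<Sum>(j, k)\<in>pairs i. of_bool (j = u) * g (k, 0))"
    using vertex by (simp add: comul_vertex)
  then show ?case using vertex assms by (simp add: pairs_delta_left sft_def)
next
  case (edge i)
  have "comul (i, 1) (\<lambda>x y. taft_char u x * g y) = (\<Sum>(j, k)\<in>pairs i. of_bool (j = u) * g (k, 1))"
    using edge by (simp add: comul_edge)
  then show ?case using edge assms by (simp add: pairs_delta_left sft_def)
next
  case (step i l)
  let ?e = "(ix (int i + int l), 1)" and ?s = "sft (- int u)"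
  have B: "?e \<in> B" "(i, l) \<in> B" using step n by auto
  have "comul (i, Suc l) (\<lambda>x y. taft_char u x * g y) =
    comul ?e (\<lambda>x y. taft_char u x * comul (i, l) (\<lambda>x' y'. taft_char u x' * mul y y' g))"
    unfolding comul_path_Suc[OF step(1,2)] comul_scale[symmetric]
  proof (intro comul_cong)
    fix x y x' y' assume "x \<in> B" "x' \<in> B"
    have "mul x x' (\<lambda>p. mul y y' (\<lambda>r. taft_char u p * g r)) = mul x x' (\<lambda>p. mul y y' g * taft_char u p)"
      by (rule mul_cong) (subst mul_scale, rule mult.commute)
    also have "\<dots> = mul y y' g * (taft_char u x * taft_char u x')"
      using assms \<open>x \<in> B\<close> \<open>x' \<in> B\<close> by (simp only: mul_scale mul_char)
    finally show "mul x x' (\<lambda>p. mul y y' (\<lambda>r. taft_char u p * g r)) = taft_char u x * (taft_char u x' * mul y y' g)"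
      by (simp only: ac_simps)
  qed
  also have "\<dots> = mul (?s ?e) (?s (i, l)) g" by (simp only: step.IH)
  also have "\<dots> = g (?s (i, Suc l))" using path_Suc[OF step(1,2)] B by (simp only: sft_mul)
  finally show ?case .
qed

lemma translate_right:
  assumes "a \<in> B" "u < n"
  shows "comul a (\<lambda>x y. taft_char u y * g x) = q ^ (u * snd a) * g (sft (- int u) a)"
  using assms(1)
proof (induction a arbitrary: g rule: path_induct)
  case (vertex i)
  have "comul (i, 0) (\<lambda>x y. taft_char u y * g x) = (\<Sum>(j, k)\<in>pairs i. of_bool (k = u) * g (j, 0))"
    using vertex by (simp add: comul_vertex)
  then show ?case using vertex assms by (simp add: pairs_delta_right sft_def)
next
  case (edge i)
  have "comul (i, 1) (\<lambda>x y. taft_char u y * g x) = (\<Sum>(j, k)\<in>pairs i. of_bool (k = u) * (q ^ u * g (j, 1)))"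
    unfolding comul_edge[OF edge] by (intro sum.cong refl) auto
  also have "\<dots> = q ^ u * g (ix (int i - int u), 1)" by (rule pairs_delta_right[OF edge assms(2)])
  finally show ?case by (simp add: sft_def)
next
  case (step i l)
  let ?e = "(ix (int i + int l), 1)" and ?s = "sft (- int u)"
  have B: "?e \<in> B" "(i, l) \<in> B" using step n by auto
  have "comul (i, Suc l) (\<lambda>x y. taft_char u y * g x) =
    comul ?e (\<lambda>x y. taft_char u y * comul (i, l) (\<lambda>x' y'. taft_char u y' * mul x x' g))"
    unfolding comul_path_Suc[OF step(1,2)] comul_scale[symmetric]
  proof (intro comul_cong)
    fix x y x' y' assume "y \<in> B" "y' \<in> B"
    have "mul x x' (\<lambda>p. mul y y' (\<lambda>r. taft_char u r * g p)) = mul x x' (\<lambda>p. (taft_char u y * taft_char u y') * g p)"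
    proof (rule mul_cong)
      fix p
      have "mul y y' (\<lambda>r. taft_char u r * g p) = mul y y' (\<lambda>r. g p * taft_char u r)"
        by (rule mul_cong) (rule mult.commute)
      also have "\<dots> = g p * mul y y' (taft_char u)" by (rule mul_scale)
      finally show "mul y y' (\<lambda>r. taft_char u r * g p) = (taft_char u y * taft_char u y') * g p"
        using assms \<open>y \<in> B\<close> \<open>y' \<in> B\<close> by (simp only: mul_char mult.commute)
    qed
    then show "mul x x' (\<lambda>p. mul y y' (\<lambda>r. taft_char u r * g p)) = taft_char u y * (taft_char u y' * mul x x' g)"
      by (simp only: mul_scale mult.assoc)
  qed
  also have "\<dots> = q ^ u * (q ^ (u * l) * mul (?s ?e) (?s (i, l)) g)"
    using step.IH(1)[of "\<lambda>x. q ^ (u * l) * mul x (?s (i, l)) g"] by (simp only: step.IH(2) snd_conv mult_1_right)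
  also have "\<dots> = q ^ (u * Suc l) * g (?s (i, Suc l))"
    using path_Suc[OF step(1,2)] B by (simp only: sft_mul) (simp add: power_add mult.assoc)
  finally show ?case by simp
qed

text \<open>The coproduct is homogeneous for the grading by length; here \<open>F\<close> is any function of the total length.\<close>

lemma comul_length:
  assumes "a \<in> B"
  shows "comul a (\<lambda>x y. F (snd x + snd y) * g x y) = F (snd a) * comul a g"
  using assms
proof (induction a arbitrary: F g rule: path_induct)
  case (vertex i)
  then show ?case by (simp add: comul_vertex sum_distrib_left case_prod_unfold)
next
  case (edge i)
  then show ?case unfolding comul_edge[OF edge] by (simp add: sum_distrib_left case_prod_unfold algebra_simps)
next
  case (step i l)
  let ?e = "(ix (int i + int l), 1)"
  have mul: "mul x y (\<lambda>p. G (snd p) * h p) = G (snd x + snd y) * mul x y h" if "x \<in> B" "y \<in> B" for x y G h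
    using that by (cases x; cases y) (simp add: mul_path cong del: mul_cong)
  have "comul (i, Suc l) (\<lambda>x y. F (snd x + snd y) * g x y) =
    comul ?e (\<lambda>x y. comul (i, l) (\<lambda>x' y'. F (snd x + snd y + (snd x' + snd y')) * mul x x' (\<lambda>p. mul y y' (\<lambda>r. g p r))))"
    unfolding comul_path_Suc[OF step(1,2)]
  proof (intro comul_cong)
    fix x y x' y' assume B: "x \<in> B" "y \<in> B" "x' \<in> B" "y' \<in> B"
    have "mul x x' (\<lambda>p. mul y y' (\<lambda>r. F (snd p + snd r) * g p r)) = mul x x' (\<lambda>p. F (snd p + (snd y + snd y')) * mul y y' (g p))"
      by (rule mul_cong) (rule mul[OF B(2,4)])
    also have "\<dots> = F (snd x + snd x' + (snd y + snd y')) * mul x x' (\<lambda>p. mul y y' (\<lambda>r. g p r))"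
      by (rule mul[OF B(1,3), of "\<lambda>m. F (m + (snd y + snd y'))"])
    finally show "mul x x' (\<lambda>p. mul y y' (\<lambda>r. F (snd p + snd r) * g p r)) =
      F (snd x + snd y + (snd x' + snd y')) * mul x x' (\<lambda>p. mul y y' (\<lambda>r. g p r))" by (simp only: ac_simps)
  qed
  also have "\<dots> = comul ?e (\<lambda>x y. F (snd x + snd y + l) * comul (i, l) (\<lambda>x' y'. mul x x' (\<lambda>p. mul y y' (\<lambda>r. g p r))))"
  proof (rule comul_cong)
    fix x y
    show "comul (i, l) (\<lambda>x' y'. F (snd x + snd y + (snd x' + snd y')) * mul x x' (\<lambda>p. mul y y' (\<lambda>r. g p r))) =
      F (snd x + snd y + l) * comul (i, l) (\<lambda>x' y'. mul x x' (\<lambda>p. mul y y' (\<lambda>r. g p r)))"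
      using step.IH(2)[of "\<lambda>m. F (snd x + snd y + m)"] by simp
  qed
  also have "\<dots> = F (1 + l) * comul (i, Suc l) g"
    using step.IH(1)[of "\<lambda>m. F (m + l)"] by (simp only: snd_conv comul_path_Suc[OF step(1,2)])
  finally show ?case by simp
qed

text \<open>Translations are convolutions with characters, so coassociativity lets them act on either part of a coproduct.\<close>

lemma comul_sft_left:
  assumes "a \<in> B"
  shows "comul a (\<lambda>x c. G (sft k x) c) = comul (sft k a) G"
proof -
  let ?u = "ix (- k)"
  have sft: "sft (- int ?u) x = sft k x" for x
    by (rule sft_cong) simp
  have "comul (sft k a) G = comul a (\<lambda>m z. taft_char ?u m * comul z G)"
    unfolding translate_left[OF assms ix_less] sft ..
  also have "\<dots> = comul a (\<lambda>x c. comul x (\<lambda>m z. taft_char ?u m * G z c))"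
    unfolding comul_scale[symmetric] by (rule coassoc[OF assms, symmetric])
  also have "\<dots> = comul a (\<lambda>x c. G (sft k x) c)"
    by (rule comul_cong) (simp only: translate_left[OF _ ix_less] sft)
  finally show ?thesis by simp
qed

lemma comul_sft_right:
  assumes "a \<in> B"
  shows "comul a (\<lambda>x c. G x (sft k c)) = comul a (\<lambda>x c. qpow (- k * int (snd x)) * G (sft k x) c)"
proof -
  let ?u = "ix (- k)"
  have sft: "sft (- int ?u) x = sft k x" for x
    by (rule sft_cong) simp
  have "comul a (\<lambda>x c. G x (sft k c)) = comul a (\<lambda>x z. comul z (\<lambda>m c. taft_char ?u m * G x c))"
    by (rule comul_cong) (simp only: translate_left[OF _ ix_less] sft)
  also have "\<dots> = comul a (\<lambda>z c. comul z (\<lambda>x m. taft_char ?u m * G x c))"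
    by (rule coassoc[OF assms, symmetric])
  also have "\<dots> = comul a (\<lambda>x c. qpow (- k * int (snd x)) * G (sft k x) c)"
  proof (rule comul_cong)
    fix x c assume "x \<in> B"
    have "q ^ (?u * snd x) = qpow (- k * int (snd x))"
      unfolding qpow_of_nat[symmetric] by simp
    then show "comul x (\<lambda>x m. taft_char ?u m * G x c) = qpow (- k * int (snd x)) * G (sft k x) c"
      using translate_right[OF \<open>x \<in> B\<close> ix_less] by (simp only: sft)
  qed
  finally show ?thesis .
qed

text \<open>Moving the translation from the second part to the first costs a power of \<open>q\<close>, and this cancels the change of the
  coefficient of the antipode.\<close>

lemma sft_anti:
  assumes "a \<in> B"
  shows "comul a (\<lambda>x c. anti x (\<lambda>p. g (sft k p) (sft k c))) = comul a (\<lambda>x c. anti x (\<lambda>p. g p c))"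
  unfolding comul_sft_right[OF assms, of "\<lambda>x c. anti x (\<lambda>p. g (sft k p) c)"]
proof (rule comul_cong)
  fix x c assume x: "x \<in> B"
  obtain i l where xi: "x = (i, l)" by (cases x)
  have "anti_coeff (sft k x) = qpow (k * int l) * anti_coeff x"
    by (simp add: xi anti_coeff_def sft_def qpow_add[symmetric] mult.left_commute[of _ "(-1) ^ l"]) (simp add: algebra_simps qpow_add)
  moreover have "sft k (neg (sft k x)) = neg x" by (simp add: xi sft_def neg_def algebra_simps)
  moreover have "qpow (- k * int l) * qpow (k * int l) = 1" unfolding qpow_add[symmetric] by simp
  ultimately show "qpow (- k * int (snd x)) * anti (sft k x) (\<lambda>p. g (sft k p) c) = anti x (\<lambda>p. g p c)"
    using x sft_B[OF x] by (simp add: anti_path xi mult.assoc[symmetric])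
qed


lemma functional_grouplike: "functional B g (taft_grouplike n q j) = (\<Sum>l<n. q ^ (j * l) * g (l, 0))"
  unfolding taft_grouplike_def functional_sum_vec functional_of_scaled
  using n finite_B by (intro sum.cong refl) (simp add: functional_bvec)

lemma grouplike_comul:
  "functional B (\<lambda>p. comul p g) (taft_grouplike n q j) =
   functional B (\<lambda>x. functional B (\<lambda>y. g x y) (taft_grouplike n q j)) (taft_grouplike n q j)"
proof -
  let ?S = "{..<n} \<times> {..<n}" and ?f = "\<lambda>p. q ^ (j * (fst p + snd p)) * g (fst p, 0) (snd p, 0)"
  have P: "pairs l = {p \<in> ?S. (fst p + snd p) mod n = l}" for l by (auto simp: pairs_def)
  have "functional B (\<lambda>p. comul p g) (taft_grouplike n q j) = (\<Sum>l<n. \<Sum>p\<in>pairs l. ?f p)"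
    unfolding functional_grouplike
  proof (rule sum.cong[OF refl])
    fix l assume l: "l \<in> {..<n}"
    have "q ^ (j * l) = q ^ (j * (fst p + snd p))" if "p \<in> pairs l" for p
    proof -
      have "(j * l) mod n = (j * (fst p + snd p)) mod n" using that by (auto simp: pairs_def mod_mult_right_eq)
      then show ?thesis by (metis q_pow_mod)
    qed
    then show "q ^ (j * l) * comul (l, 0) g = (\<Sum>p\<in>pairs l. ?f p)"
      using l by (simp add: comul_vertex case_prod_unfold sum_distrib_left)
  qed
  also have "\<dots> = sum ?f ?S"
    unfolding P using n by (intro sum.group) auto
  also have "\<dots> = (\<Sum>a<n. \<Sum>b<n. ?f (a, b))" by (simp add: sum.cartesian_product case_prod_unfold)
  also have "\<dots> = functional B (\<lambda>x. functional B (\<lambda>y. g x y) (taft_grouplike n q j)) (taft_grouplike n q j)"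
    unfolding functional_grouplike sum_distrib_left by (simp add: distrib_left power_add mult.assoc)
  finally show ?thesis .
qed

lemma grouplike_mul_right:
  assumes "c \<in> B"
  shows "functional B (\<lambda>p. mul c p h) (taft_grouplike n q j) = q ^ (j * fst c) * h c"
proof -
  obtain d m where c: "c = (d, m)" by (cases c)
  have "functional B (\<lambda>p. mul c p h) (taft_grouplike n q j) = (\<Sum>l<n. if l = d then q ^ (j * d) * h (d, m) else 0)"
    unfolding functional_grouplike using assms n by (intro sum.cong refl) (auto simp: c mul_path cong del: mul_cong)
  then show ?thesis using assms by (simp add: c)
qed

lemma grouplike_mul_left:
  assumes "c \<in> B"
  shows "functional B (\<lambda>p. mul p c h) (taft_grouplike n q j) = q ^ (j * (fst c + snd c)) * h c"
proof -
  obtain d m where c: "c = (d, m)" by (cases c)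
  have "functional B (\<lambda>p. mul p c h) (taft_grouplike n q j) =
      (\<Sum>l<n. if l = ix (int d + int m) then q ^ (j * (d + m)) * h (d, m) else 0)"
    unfolding functional_grouplike
  proof (rule sum.cong[OF refl])
    fix l assume "l \<in> {..<n}"
    have "q ^ (j * ix (int d + int m)) = q ^ (j * (d + m))"
      unfolding qpow_of_nat[symmetric] by simp
    then show "q ^ (j * l) * mul (l, 0) c h = (if l = ix (int d + int m) then q ^ (j * (d + m)) * h (d, m) else 0)"
      using assms by (simp add: c mul_path cong del: mul_cong)
  qed
  then show ?thesis by (simp add: c)
qed

lemma grouplike_shift:
  assumes "qpow (int j * k) = 1"
  shows "functional B (\<lambda>p. g (sft k p)) (taft_grouplike n q j) = functional B g (taft_grouplike n q j)"
proof -
  have "(\<Sum>l<n. q ^ (j * l) * g (sft k (l, 0))) = (\<Sum>l<n. q ^ (j * l) * g (l, 0))"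
  proof (rule sum.reindex_bij_witness[of _ "\<lambda>l. ix (int l - k)" "\<lambda>l. ix (int l + k)"])
    fix l assume "l \<in> {..<n}"
    have "q ^ (j * ix (int l + k)) = qpow (int j * int l) * qpow (int j * k)"
      unfolding qpow_of_nat[symmetric] by (simp add: qpow_add[symmetric] algebra_simps)
    then show "q ^ (j * ix (int l + k)) * g (ix (int l + k), 0) = q ^ (j * l) * g (sft k (l, 0))"
      using assms by (simp add: sft_def qpow_of_nat[symmetric])
  qed auto
  then show ?thesis by (simp only: functional_grouplike)
qed

lemma functional_char_grouplike:
  "u < n \<Longrightarrow> functional B (taft_char u) (taft_grouplike n q j) = q ^ (j * u)"
  unfolding functional_grouplike by (simp add: of_bool_def if_distrib[of "\<lambda>x. _ * x"] cong: if_cong)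

lemma one_char: "u < n \<Longrightarrow> one (taft_char u) = 1"
  unfolding one_path by (simp add: of_bool_def)

lemma grouplike_commute:
  assumes "c \<in> B" "s \<in> B"
  shows "functional B (\<lambda>p. mul p s (\<lambda>t. mul c t g)) (taft_grouplike n q j) =
    qpow (- int j * int (snd c)) * mul c s (\<lambda>r. functional B (\<lambda>p. mul p r g) (taft_grouplike n q j))"
proof -
  obtain d m i t where ct: "c = (d, m)" "s = (i, t)" by (cases c; cases s)
  have "functional B (\<lambda>p. mul p s (\<lambda>t. mul c t g)) (taft_grouplike n q j) =
      functional B (\<lambda>p. mul c p (\<lambda>r. mul r s g)) (taft_grouplike n q j)"
    using assms by (intro functional_cong) (simp add: mul_assoc)
  also have "\<dots> = q ^ (j * d) * mul c s g" using assms by (simp add: grouplike_mul_right ct)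
  also have "\<dots> = qpow (- int j * int m) * mul c s (\<lambda>r. q ^ (j * (fst r + snd r)) * g r)"
  proof -
    have "qpow (int j * int d) = qpow (- int j * int m) * qpow (int j * (int i + int (m + t)))" if "d = ix (int i + int t)"
      unfolding that qpow_add[symmetric] qpow_ix by (simp add: algebra_simps)
    then show ?thesis using assms by (simp add: ct mul_path qpow_of_nat[symmetric] mult.assoc cong del: mul_cong)
  qed
  also have "mul c s (\<lambda>r. q ^ (j * (fst r + snd r)) * g r) = mul c s (\<lambda>r. functional B (\<lambda>p. mul p r g) (taft_grouplike n q j))"
    by (intro mul_cong) (simp add: grouplike_mul_left)
  finally show ?thesis by (simp add: ct cong del: mul_cong)
qed

text \<open>Apply the antipode to \<open>x\<^sup>(\<^sup>1\<^sup>) S(x\<^sup>(\<^sup>2\<^sup>)) = \<epsilon>(x)\<close> and use that \<open>S\<^sup>2\<close> multiplies a path by \<open>q\<close> to the power of its length.\<close>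

lemma antipode_r_square: "comul w (\<lambda>x c. q ^ snd c * anti x (\<lambda>a. mul c a h)) = eps w * one h" if "w \<in> B"
proof -
  have "comul w (\<lambda>x c. anti c (\<lambda>p. mul x p (\<lambda>m. anti m h))) = comul w (\<lambda>x c. q ^ snd c * anti x (\<lambda>a. mul c a h))"
  proof (rule comul_cong)
    fix x c assume xc: "x \<in> B" "c \<in> B"
    have "anti c (\<lambda>p. mul x p (\<lambda>m. anti m h)) = anti c (\<lambda>p. anti x (\<lambda>a. anti p (\<lambda>b. mul b a h)))"
      using xc by (intro anti_cong) (simp add: anti_mul_rev)
    also have "\<dots> = anti x (\<lambda>a. anti c (\<lambda>p. anti p (\<lambda>b. mul b a h)))" by (rule anti_anti)
    also have "\<dots> = anti x (\<lambda>a. q ^ snd c * mul c a h)" using xc by (intro anti_cong) (simp add: anti_anti_path)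
    finally show "anti c (\<lambda>p. mul x p (\<lambda>m. anti m h)) = q ^ snd c * anti x (\<lambda>a. mul c a h)" by (simp only: anti_scale)
  qed
  then show ?thesis using that by (simp add: antipode_r anti_one)
qed

text \<open>\<open>\<alpha>\<^sub>u * S\<^sub>\<pi> * \<alpha>\<^sub>v\<close> sends the path \<open>a\<close> to \<open>tw_coeff j u v a\<close> times the path \<open>tw_perm u v a\<close>.\<close>

definition tw_coeff where
  "tw_coeff j u v a = q ^ (v * snd a) * anti_coeff (sft (- int u - int v) a) * qpow (- int j * int (fst (sft (- int u - int v) a)))"

lemma twisted_antipode_bvec:
  assumes "y \<in> B"
  shows "twisted_antipode (taft n q) (taft_grouplike n q j) (bvec y) c = anti_coeff y * qpow (- int j * int (fst y)) * bvec (neg y) c"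
proof -
  obtain i l where y: "y = (i, l)" by (cases y)
  have "twisted_antipode (taft n q) (taft_grouplike n q j) (bvec y) c =
      functional B (bvec c) (twisted_antipode (taft n q) (taft_grouplike n q j) (bvec y))"
    by (rule functional_at[symmetric, OF finite_B twisted_antipode_vecs])
  also have "\<dots> = functional B (\<lambda>p. anti y (\<lambda>s. mul p s (bvec c))) (taft_grouplike n q j)"
    using assms finite_B by (simp add: twisted_antipode_def functional_hmult functional_hantipode functional_bvec)
  also have "\<dots> = anti_coeff y * functional B (\<lambda>p. mul p (neg y) (bvec c)) (taft_grouplike n q j)"
    using assms by (simp add: anti_path functional_scale)
  also have "\<dots> = anti_coeff y * (q ^ (j * (fst (neg y) + l)) * bvec c (neg y))"
    using neg_B[OF assms] by (simp add: grouplike_mul_left y neg_def)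
  also have "q ^ (j * (fst (neg y) + l)) = qpow (- int j * int i)"
    unfolding qpow_of_nat[symmetric] y neg_def by (simp add: distrib_left qpow_add) (simp add: qpow_add[symmetric] algebra_simps)
  also have "bvec c (neg y) = (bvec (neg y) c :: 'k)" by (auto simp: bvec_def)
  finally show ?thesis by (simp add: y mult.assoc)
qed

definition tw_perm where "tw_perm u v a = neg (sft (- int u - int v) a)"

lemma twisted_conv_kernel:
  assumes "a \<in> B" "u < n" "v < n"
  shows "(\<Sum>x\<in>B. \<Sum>y\<in>B. \<Sum>z\<in>B. comult3 (taft n q) a x y z * taft_char u x *
      twisted_antipode (taft n q) (taft_grouplike n q j) (bvec y) c * taft_char v z) =
    tw_coeff j u v a * bvec (tw_perm u v a) c"
proof -
  let ?h = "\<lambda>y. twisted_antipode (taft n q) (taft_grouplike n q j) (bvec y) c"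
  have "comul a (\<lambda>x w. taft_char u x * comul w (\<lambda>y z. taft_char v z * ?h y)) =
     (\<Sum>x\<in>B. \<Sum>w\<in>B. \<Sum>y\<in>B. \<Sum>z\<in>B. Comult (taft n q) a (x, w) * Comult (taft n q) w (y, z) * taft_char u x * ?h y * taft_char v z)"
    unfolding comul_def functional_Times sum_distrib_left by (simp only: ac_simps)
  also have "\<dots> = (\<Sum>x\<in>B. \<Sum>y\<in>B. \<Sum>z\<in>B. comult3 (taft n q) a x y z * taft_char u x * ?h y * taft_char v z)"
    unfolding comult3_def sum_distrib_right
    by (rule sum.cong[OF refl], subst sum.swap, rule sum.cong[OF refl], rule sum.swap)
  finally have "(\<Sum>x\<in>B. \<Sum>y\<in>B. \<Sum>z\<in>B. comult3 (taft n q) a x y z * taft_char u x * ?h y * taft_char v z) =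
     comul (sft (- int u) a) (\<lambda>y z. taft_char v z * ?h y)"
    unfolding translate_left[OF assms(1,2)] by simp
  also have "\<dots> = q ^ (v * snd a) * ?h (sft (- int v) (sft (- int u) a))"
    using translate_right[OF sft_B[OF assms(1)] assms(3)] by simp
  also have "sft (- int v) (sft (- int u) a) = sft (- int u - int v) a"
    by (simp add: sft_sft algebra_simps)
  finally show ?thesis
    unfolding twisted_antipode_bvec[OF sft_B[OF assms(1)]] by (simp add: tw_coeff_def tw_perm_def mult.assoc)
qed

lemma tw_perm_perm: "a \<in> B \<Longrightarrow> tw_perm u v (tw_perm u v a) = a" and tw_perm_B: "a \<in> B \<Longrightarrow> tw_perm u v a \<in> B"
  by (cases a; simp add: tw_perm_def sft_def neg_def algebra_simps)+

lemma tw_coeff_perm: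
  assumes "a \<in> B"
  shows "tw_coeff j u v a * tw_coeff j u v (tw_perm u v a) =
    qpow (int (snd a) * (int v - int u + 1 + int j) + int j * (int u + int v))"
proof -
  obtain i l where a: "a = (i, l)" by (cases a)
  let ?c = "int i - int u - int v" and ?d = "- int i - int l" and ?S = "int (\<Sum>{..l})"
  have S: "?S + ?S = int l * int l + int l" by (induction l) (auto simp: algebra_simps)
  have sq: "(-1) ^ l * (-1) ^ l = (1 :: 'k)" by (simp add: power_mult_distrib[symmetric])
  have cancel: "(-1) ^ l * x * ((-1) ^ l * y) = x * y" for x y :: 'k
  proof -
    have "(-1) ^ l * x * ((-1) ^ l * y) = ((-1) ^ l * (-1) ^ l) * (x * y)" by (simp only: ac_simps)
    then show ?thesis by (simp only: sq mult_1_left)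
  qed
  have coeff: "tw_coeff j u v (k, l) = (-1) ^ l * qpow (int v * int l + (c * int l + ?S) + (- int j * c))"
    if "ix (int k - int u - int v) = ix c" for k c
  proof -
    have 1: "sft (- int u - int v) (k, l) = (ix c, l)" using that by (simp add: sft_def algebra_simps)
    have 2: "qpow (int (ix c) * int l + ?S) = qpow (c * int l + ?S)" unfolding qpow_add qpow_ix ..
    have 3: "qpow (- int j * int (ix c)) = qpow (- int j * c)" by (rule qpow_ix)
    show ?thesis unfolding tw_coeff_def 1 anti_coeff_def prod.case fst_conv snd_conv 2 3 qpow_add qpow_of_nat[symmetric]
      by (simp add: ac_simps)
  qed
  have p: "tw_perm u v a = (ix (- (int i - int u - int v) - int l), l)"
    by (simp add: a tw_perm_def sft_def neg_def algebra_simps)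
  have "tw_coeff j u v a * tw_coeff j u v (tw_perm u v a) =
     ((-1) ^ l * qpow (int v * int l + (?c * int l + ?S) + (- int j * ?c))) * ((-1) ^ l * qpow (int v * int l + (?d * int l + ?S) + (- int j * ?d)))"
    unfolding p unfolding a by (intro arg_cong2[of _ _ _ _ "(*)"] coeff) (simp_all add: algebra_simps)
  also have "\<dots> = qpow (int v * int l + (?c * int l + ?S) + (- int j * ?c) + (int v * int l + (?d * int l + ?S) + (- int j * ?d)))"
    unfolding cancel by (rule qpow_add[symmetric])
  also have "int v * int l + (?c * int l + ?S) + (- int j * ?c) + (int v * int l + (?d * int l + ?S) + (- int j * ?d)) =
      int l * (int v - int u + 1 + int j) + int j * (int u + int v)"
    using S by (simp add: algebra_simps)
  finally show ?thesis by (simp add: a)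
qed

text \<open>The square of \<open>\<alpha>\<^sub>u * S\<^sub>\<pi> * \<alpha>\<^sub>v\<close> is diagonal in the basis of paths.  Its entry at an arrow gives the last condition.\<close>

lemma CM_iff:
  assumes "u < n" "v < n"
  shows "CM (taft n q) (taft_grouplike n q j) (taft_char u) (taft_char v) \<longleftrightarrow>
    qpow (int j * int u) = 1 \<and> qpow (int j * int v) = 1 \<and> qpow (int v - int u + 1 + int j) = 1"
proof -
  let ?c = "tw_coeff j u v" and ?p = "tw_perm u v"
  let ?T = "twisted_conv (taft n q) (taft_grouplike n q j) (taft_char u) (taft_char v)"
  have T: "?T x c = (\<Sum>a\<in>B. x a * (?c a * bvec (?p a) c))" for x c
    unfolding twisted_conv_def linear_ext_def using assms by (intro sum.cong refl) (simp only: twisted_conv_kernel)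
  have TT: "?T (?T x) c = x c * (?c c * ?c (?p c))" if "x \<in> vecs B" for x c
  proof -
    have "?T (?T x) c = (\<Sum>a\<in>B. x a * ?c a * (\<Sum>b\<in>B. bvec (?p a) b * (?c b * bvec (?p b) c)))"
      unfolding T[of "?T x"] unfolding T sum_distrib_left sum_distrib_right
      by (subst sum.swap) (simp only: ac_simps)
    also have "\<dots> = (\<Sum>a\<in>B. x a * ?c a * (?c (?p a) * bvec a c))"
    proof (intro sum.cong refl arg_cong[of _ _ "(*) _"])
      fix a assume a: "a \<in> B"
      show "(\<Sum>b\<in>B. bvec (?p a) b * (?c b * bvec (?p b) c)) = ?c (?p a) * bvec a c"
        using functional_bvec[OF finite_B tw_perm_B[OF a], of "\<lambda>b. ?c b * bvec (?p b) c" u v] a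
        by (simp add: functional_def tw_perm_perm)
    qed
    also have "\<dots> = functional B (\<lambda>a. (?c a * ?c (?p a)) * bvec a c) x" by (simp add: functional_def ac_simps)
    also have "\<dots> = functional B (\<lambda>a. (?c c * ?c (?p c)) * bvec c a) x"
      by (rule functional_cong) (auto simp: bvec_def)
    also have "\<dots> = x c * (?c c * ?c (?p c))"
      unfolding functional_scale functional_at[OF finite_B that] by (rule mult.commute)
    finally show ?thesis .
  qed
  have coeff: "?c a * ?c (?p a) = qpow (int (snd a) * (int v - int u + 1 + int j) + int j * (int u + int v))" if "a \<in> B" for a
    by (rule tw_coeff_perm[OF that])
  have chars: "functional B (taft_char u) (taft_grouplike n q j) = qpow (int j * int u)"
     "functional B (taft_char v) (taft_grouplike n q j) = qpow (int j * int v)"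
    using assms by (simp_all add: functional_char_grouplike qpow_of_nat[symmetric])
  show ?thesis
  proof
    assume CM: "CM (taft n q) (taft_grouplike n q j) (taft_char u) (taft_char v)"
    then have uv: "qpow (int j * int u) = 1" "qpow (int j * int v) = 1" by (simp_all add: CM_def chars)
    have a: "(0, 1) \<in> B" using n by simp
    have bv: "(bvec (0, 1) :: _ \<Rightarrow> 'k) \<in> vecs B" by (rule bvec_vecs[OF a])
    then have "?T (?T (bvec (0, 1))) = bvec (0, 1)" using CM unfolding CM_def by blast
    then have "?T (?T (bvec (0, 1))) (0, 1) = 1" by (simp add: bvec_def)
    then have "?c (0, 1) * ?c (?p (0, 1)) = 1" unfolding TT[OF bv] by (simp add: bvec_def)
    then have "qpow (int v - int u + 1 + int j) * (qpow (int j * int u) * qpow (int j * int v)) = 1"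
      unfolding coeff[OF a] qpow_add[symmetric] by (simp add: algebra_simps)
    then show "qpow (int j * int u) = 1 \<and> qpow (int j * int v) = 1 \<and> qpow (int v - int u + 1 + int j) = 1" using uv by simp
  next
    assume *: "qpow (int j * int u) = 1 \<and> qpow (int j * int v) = 1 \<and> qpow (int v - int u + 1 + int j) = 1"
    have "?T (?T x) = x" if x: "x \<in> vecs B" for x
    proof
      fix c
      show "?T (?T x) c = x c"
      proof (cases "c \<in> B")
        case True
        have "qpow (int (snd c) * (int v - int u + 1 + int j)) = 1" "qpow (int j * (int u + int v)) = 1"
          using * qpow_mult_1[of "int v - int u + 1 + int j" "int (snd c)"] by (simp_all add: mult.commute distrib_left qpow_add)
        then show ?thesis unfolding TT[OF x] coeff[OF True] qpow_add by simp
      next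
        case False
        then have "x c = 0" using x unfolding vecs_def by blast
        then show ?thesis unfolding TT[OF x] by simp
      qed
    qed
    then show "CM (taft n q) (taft_grouplike n q j) (taft_char u) (taft_char v)" using * by (simp add: CM_def chars)
  qed
qed

end

locale taft_triple = taft_algebra n q for n and q :: "'k::comm_ring_1" +
  fixes j u v :: nat
  assumes u: "u < n" and v: "v < n"
    and ju: "qpow (int j * int u) = 1" and jv: "qpow (int j * int v) = 1"
    and uv: "ix (int u - int v) = ix (int j + 1)"
begin

text \<open>All factors are expressed through the path \<open>w\<close> that is \<open>z\<close> translated by \<open>-v\<close>.  The powers of \<open>q\<close> from moving the
  translation and from moving \<open>\<pi>\<close> past a path combine, by \<open>u - v = j + 1\<close>, to a function of the total length and the power
  that turns the sum into \<open>\<epsilon>(w)\<close>.\<close>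

lemma twist_identity:
  assumes z: "z \<in> B"
  shows "functional B (\<lambda>p. comul (sft (- int u) z) (\<lambda>x c. anti x (\<lambda>s. mul p s (\<lambda>t. mul (sft (int u - int v) c) t g)))) (taft_grouplike n q j)
     = taft_char v z * functional B g (taft_grouplike n q j)"
proof -
  let ?\<pi> = "taft_grouplike n q j" and ?s = "int u - int v"
  let ?K = "\<lambda>r. functional B (\<lambda>p. mul p r g) ?\<pi>" and ?w = "sft (- int v) z"
  have w: "?w \<in> B" and sz: "sft (- int u) z \<in> B" using sft_B[OF z] by auto
  have ww: "sft ?s (sft (- int u) z) = ?w" by (simp add: sft_sft)
  have "functional B (\<lambda>p. comul (sft (- int u) z) (\<lambda>x c. anti x (\<lambda>s. mul p s (\<lambda>t. mul (sft ?s c) t g)))) ?\<pi> =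
      comul (sft (- int u) z) (\<lambda>x c. anti x (\<lambda>s. functional B (\<lambda>p. mul p s (\<lambda>t. mul (sft ?s c) t g)) ?\<pi>))"
    by (simp only: comul_functional[symmetric] anti_functional[symmetric])
  also have "\<dots> = comul (sft (- int u) z) (\<lambda>x c. qpow (- ?s * int (snd x)) * anti (sft ?s x) (\<lambda>s. functional B (\<lambda>p. mul p s (\<lambda>t. mul c t g)) ?\<pi>))"
    by (rule comul_sft_right[OF sz])
  also have "\<dots> = comul ?w (\<lambda>x c. qpow (- ?s * int (snd x)) * anti x (\<lambda>s. functional B (\<lambda>p. mul p s (\<lambda>t. mul c t g)) ?\<pi>))"
    using comul_sft_left[OF sz, of "\<lambda>x c. qpow (- ?s * int (snd x)) * anti x (\<lambda>s. functional B (\<lambda>p. mul p s (\<lambda>t. mul c t g)) ?\<pi>)" ?s]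
    by (simp only: snd_sft ww)
  also have "\<dots> = comul ?w (\<lambda>x c. qpow (- ?s * int (snd x + snd c)) * (q ^ snd c * anti x (\<lambda>a. mul c a ?K)))"
  proof (rule comul_cong)
    fix x c assume xc: "x \<in> B" "c \<in> B"
    have "anti x (\<lambda>s. functional B (\<lambda>p. mul p s (\<lambda>t. mul c t g)) ?\<pi>) = anti x (\<lambda>s. qpow (- int j * int (snd c)) * mul c s ?K)"
      using xc by (intro anti_cong) (rule grouplike_commute)
    moreover have "qpow (- ?s * int (snd x)) * qpow (- int j * int (snd c)) = qpow (- ?s * int (snd x + snd c)) * q ^ snd c"
    proof -
      have "ix (?s - int j) = ix 1"
        using uv by (simp add: ix_eq_iff mod_eq_dvd_iff algebra_simps)
      then have "qpow ((?s - int j) * int (snd c)) = qpow (1 * int (snd c))"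
        using qpow_ix(2)[of "?s - int j" "int (snd c)"] qpow_ix(2)[of 1 "int (snd c)"] by simp
      then have "q ^ snd c = qpow ((?s - int j) * int (snd c))" by (simp add: qpow_of_nat)
      then show ?thesis unfolding qpow_add[symmetric] by (simp add: qpow_add[symmetric] algebra_simps)
    qed
    ultimately show "qpow (- ?s * int (snd x)) * anti x (\<lambda>s. functional B (\<lambda>p. mul p s (\<lambda>t. mul c t g)) ?\<pi>) =
      qpow (- ?s * int (snd x + snd c)) * (q ^ snd c * anti x (\<lambda>a. mul c a ?K))"
      unfolding anti_scale by (simp only: mult.assoc[symmetric])
  qed
  also have "\<dots> = qpow (- ?s * int (snd ?w)) * (eps ?w * one ?K)"
    using comul_length[OF w, of "\<lambda>m. qpow (- ?s * int m)" "\<lambda>x c. q ^ snd c * anti x (\<lambda>a. mul c a ?K)"] antipode_r_square[OF w, of ?K]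
    by (simp only:)
  also have "one ?K = functional B g ?\<pi>"
    unfolding one_functional by (rule functional_cong) (simp add: one_mul_right)
  also have "qpow (- ?s * int (snd ?w)) * (eps ?w * functional B g ?\<pi>) = taft_char v z * functional B g ?\<pi>"
  proof -
    obtain i l where zi: "z = (i, l)" by (cases z)
    have "ix (int i - int v) = 0 \<longleftrightarrow> i = v"
    proof
      assume "ix (int i - int v) = 0"
      then have "ix (int v + int (ix (int i - int v))) = ix (int v)" by simp
      then show "i = v" using z v by (simp add: zi)
    qed (simp add: ix_def)
    then show ?thesis by (simp add: zi sft_def eps_path)
  qed
  finally show ?thesis .
qed

sublocale modular_triple "taft n q" "taft_grouplike n q j" "taft_char u" "taft_char v" "sft (- int u)" "sft (int u - int v)"
proof
  show "functional B (\<lambda>p. comul p g) (taft_grouplike n q j) =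
    functional B (\<lambda>x. functional B (\<lambda>y. g x y) (taft_grouplike n q j)) (taft_grouplike n q j)" for g
    by (rule grouplike_comul)
  show "functional B eps (taft_grouplike n q j) = 1"
    unfolding functional_grouplike using n
    by (simp add: eps_path of_bool_def if_distrib[of "\<lambda>x. _ * x"] cong: if_cong)
  show "mul a b (taft_char u) = taft_char u a * taft_char u b" if "a \<in> B" "b \<in> B" for a b
    using u that by (rule mul_char)
  show "mul a b (taft_char v) = taft_char v a * taft_char v b" if "a \<in> B" "b \<in> B" for a b
    using v that by (rule mul_char)
  show "one (taft_char u) = 1" using u by (rule one_char)
  show "functional B (taft_char v) (taft_grouplike n q j) = 1"
    using v jv by (simp add: functional_char_grouplike qpow_of_nat[symmetric])
  show "bij_betw (sft (- int u)) B B"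
    by (rule bij_betw_byWitness[of _ "sft (int u)"]) (auto simp: sft_sft sft_0 sft_B simp del: B_iff split_paired_All)
  show "comul a (\<lambda>x y. taft_char u x * g y) = g (sft (- int u) a)" if "a \<in> B" for a g
    using that u by (rule translate_left)
  show "comul a (\<lambda>x c. anti x (\<lambda>p. g (sft (- int u) p) (sft (- int u) c))) = comul a (\<lambda>x c. anti x (\<lambda>p. g p c))"
      and "comul a (\<lambda>x c. anti x (\<lambda>p. g (sft (int u - int v) p) (sft (int u - int v) c))) = comul a (\<lambda>x c. anti x (\<lambda>p. g p c))"
      if "a \<in> B" for a g
    using that by (rule sft_anti)+
  show "functional B (\<lambda>p. g (sft (- int u) p)) (taft_grouplike n q j) = functional B g (taft_grouplike n q j)" for g
    using qpow_minus_1[OF ju] by (intro grouplike_shift) simp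
  show "functional B (\<lambda>p. g (sft (int u - int v) p)) (taft_grouplike n q j) = functional B g (taft_grouplike n q j)" for g
  proof (rule grouplike_shift)
    have "qpow (int j * (int u - int v)) = qpow (int j * int u) * qpow (- (int j * int v))"
      unfolding qpow_add[symmetric] by (simp add: algebra_simps)
    then show "qpow (int j * (int u - int v)) = 1" using ju qpow_minus_1[OF jv] by simp
  qed
  show "sft (int u - int v) a \<in> B" if "a \<in> B" for a using that by (rule sft_B)
  show "mul (sft (int u - int v) a) (sft (int u - int v) b) g = mul a b (\<lambda>c. g (sft (int u - int v) c))"
    if "a \<in> B" "b \<in> B" for a b g using that by (rule sft_mul)
  show "functional B (\<lambda>p. comul (sft (- int u) z) (\<lambda>x c. anti x (\<lambda>s. mul p s (\<lambda>t. mul (sft (int u - int v) c) t g)))) (taft_grouplike n q j)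
     = taft_char v z * functional B g (taft_grouplike n q j)" if "z \<in> B" for z g
    using that by (rule twist_identity)
qed

end


section \<open>Hochschild homology\<close>

text \<open>A basis is lifted along a map that is bijective on homology.\<close>

lemma free_homology_transfer:
  fixes s :: "'k::comm_ring_1 \<Rightarrow> 'm::ab_group_add \<Rightarrow> 'm" and s' :: "'k \<Rightarrow> 'l::ab_group_add \<Rightarrow> 'l"
  assumes free: "free_homology s' Z' Bd' r" and hom: "module_hom s s' P"
    and PZ: "\<And>x. x \<in> Z \<Longrightarrow> P x \<in> Z'" and PB: "\<And>x. x \<in> Bd \<Longrightarrow> P x \<in> Bd'"
    and refl: "\<And>x. x \<in> Z \<Longrightarrow> P x \<in> Bd' \<Longrightarrow> x \<in> Bd" and onto: "\<And>y. y \<in> Z' \<Longrightarrow> \<exists>x\<in>Z. P x - y \<in> Bd'"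
    and Z: "\<And>x y. x \<in> Z \<Longrightarrow> y \<in> Z \<Longrightarrow> x - y \<in> Z" "\<And>a x. x \<in> Z \<Longrightarrow> s a x \<in> Z"
    and Bd: "\<And>x y. x \<in> Bd' \<Longrightarrow> y \<in> Bd' \<Longrightarrow> x - y \<in> Bd'" "\<And>a x. x \<in> Bd' \<Longrightarrow> s' a x \<in> Bd'" "0 \<in> Bd'"
  shows "free_homology s Z Bd r"
proof -
  interpret module_hom s s' P by (rule hom)
  have Bd_add: "x + y \<in> Bd'" if "x \<in> Bd'" "y \<in> Bd'" for x y
    using Bd(1)[OF that(1) Bd(1)[OF Bd(3) that(2)]] by simp
  obtain \<omega>' where \<omega>': "\<And>i. i < r \<Longrightarrow> \<omega>' i \<in> Z'" "\<And>x. x \<in> Z' \<Longrightarrow> \<exists>c. x - (\<Sum>i<r. s' (c i) (\<omega>' i)) \<in> Bd'"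
     "\<And>c. (\<Sum>i<r. s' (c i) (\<omega>' i)) \<in> Bd' \<Longrightarrow> \<forall>i<r. c i = 0"
    using free unfolding free_homology_def homology_basis_def by blast
  have "\<forall>i. \<exists>x. i < r \<longrightarrow> x \<in> Z \<and> P x - \<omega>' i \<in> Bd'" using onto \<omega>'(1) by blast
  then obtain \<omega> where \<omega>: "\<And>i. i < r \<Longrightarrow> \<omega> i \<in> Z" "\<And>i. i < r \<Longrightarrow> P (\<omega> i) - \<omega>' i \<in> Bd'" by metis
  have diff: "P (\<Sum>i<r. s (c i) (\<omega> i)) - (\<Sum>i<r. s' (c i) (\<omega>' i)) \<in> Bd'" for c
  proof -
    have "finite I \<Longrightarrow> I \<subseteq> {..<r} \<Longrightarrow> (\<Sum>i\<in>I. s' (c i) (P (\<omega> i) - \<omega>' i)) \<in> Bd'" for I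
      by (induction I rule: finite_induct) (auto intro!: Bd Bd_add \<omega>)
    then have "(\<Sum>i<r. s' (c i) (P (\<omega> i) - \<omega>' i)) \<in> Bd'" by simp
    then show ?thesis by (simp add: sum scale m2.scale_right_diff_distrib sum_subtractf)
  qed
  show ?thesis
    unfolding free_homology_def homology_basis_def
  proof (intro exI[of _ \<omega>] conjI allI impI ballI)
    show "\<omega> i \<in> Z" if "i < r" for i using that by (rule \<omega>)
  next
    fix x assume x: "x \<in> Z"
    then obtain c where c: "P x - (\<Sum>i<r. s' (c i) (\<omega>' i)) \<in> Bd'" using \<omega>'(2)[OF PZ] by blast
    have "finite I \<Longrightarrow> I \<subseteq> {..<r} \<Longrightarrow> x - (\<Sum>i\<in>I. s (c i) (\<omega> i)) \<in> Z" for I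
    proof (induction I rule: finite_induct)
      case (insert i I)
      then have h1: "x - (\<Sum>i\<in>I. s (c i) (\<omega> i)) \<in> Z" and h2: "\<omega> i \<in> Z" using \<omega>(1) by auto
      have "(x - (\<Sum>i\<in>I. s (c i) (\<omega> i))) - s (c i) (\<omega> i) \<in> Z" by (rule Z(1)[OF h1 Z(2)[OF h2]])
      then show ?case using insert by (simp add: algebra_simps)
    qed (use x in simp)
    then have "x - (\<Sum>i<r. s (c i) (\<omega> i)) \<in> Z" by simp
    moreover have "P (x - (\<Sum>i<r. s (c i) (\<omega> i))) \<in> Bd'"
      using Bd(1)[OF c diff[of c]] by (simp add: module_hom.diff[OF hom])
    ultimately show "\<exists>c. x - (\<Sum>i<r. s (c i) (\<omega> i)) \<in> Bd" using refl by blast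
  next
    fix c i assume "(\<Sum>i<r. s (c i) (\<omega> i)) \<in> Bd" and i: "i < r"
    then have "P (\<Sum>i<r. s (c i) (\<omega> i)) - (P (\<Sum>i<r. s (c i) (\<omega> i)) - (\<Sum>i<r. s' (c i) (\<omega>' i))) \<in> Bd'"
      by (intro Bd(1) PB diff)
    then show "c i = 0" using \<omega>'(3)[of c] i by simp
  qed
qed

context taft_triple
begin

text \<open>The vertex \<open>e\<^sub>v\<close>, the arrow \<open>a\<^sub>v\<close>, its end point and the longest path starting there.\<close>

abbreviation e where "e \<equiv> (v, 0 :: nat)"
abbreviation a1 where "a1 \<equiv> (v, 1 :: nat)"
abbreviation e' where "e' \<equiv> (ix (int v + 1), 0 :: nat)"
abbreviation longest where "longest \<equiv> (ix (int v + 1), n - 1)"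

text \<open>Operations on the last tensor factor, first as transposes and then as linear maps: appending a path, right
  multiplication by a path, the projection to last factors of positive length starting at \<open>e\<^sub>v\<close>, the removal of the first
  arrow \<open>a\<^sub>v\<close> from such last factors, and the coefficient of the longest path in the last factor.\<close>

definition appd where "appd a \<phi> w = \<phi> (w @ [a])" for \<phi> :: "(nat \<times> nat) list \<Rightarrow> 'k"
definition rmultd where "rmultd a \<phi> w = mul (last w) a (\<lambda>c. \<phi> (butlast w @ [c]))" for \<phi> :: "(nat \<times> nat) list \<Rightarrow> 'k"
definition posd where "posd \<phi> w = of_bool (fst (last w) = v \<and> snd (last w) > 0) * \<phi> w" for \<phi> :: "(nat \<times> nat) list \<Rightarrow> 'k"
definition cutd where "cutd \<phi> w = of_bool (fst (last w) = v \<and> snd (last w) > 0) * \<phi> (butlast w @ [(ix (int v + 1), snd (last w) - 1)])"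
  for \<phi> :: "(nat \<times> nat) list \<Rightarrow> 'k"
definition sliced where "sliced \<phi> w = of_bool (last w = longest) * \<phi> (butlast w)" for \<phi> :: "(nat \<times> nat) list \<Rightarrow> 'k"

definition app where "app N a = tmap N (appd a)"
definition rmult where "rmult N a = tmap N (rmultd a)"
definition pos where "pos N = tmap N posd"
definition cut where "cut N = tmap N cutd"
definition slice where "slice N = tmap N sliced"

lemma longest_B: "longest \<in> B" "e \<in> B" "e' \<in> B" "a1 \<in> B"
  using n v by auto

lemma Cons_W: "w \<in> W (Suc N) \<Longrightarrow> \<exists>w' i l. w = w' @ [(i, l)] \<and> w' \<in> W N \<and> i < n \<and> l < n"
  by (cases w rule: rev_cases) (auto simp: W_iff)

lemma locals:
  shows app_local: "a \<in> B \<Longrightarrow> local_map N (Suc N) (appd a)"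
    and rmult_local: "local_map (Suc N) (Suc N) (rmultd a)"
    and pos_local: "local_map (Suc N) (Suc N) posd"
    and cut_local: "local_map (Suc N) (Suc N) cutd"
    and longest_local: "local_map (Suc N) N sliced"
proof -
  show "local_map N (Suc N) (appd a)" if "a \<in> B"
    by (rule local_mapI) (use that in \<open>auto simp: appd_def W_iff\<close>)
  show "local_map (Suc N) (Suc N) (rmultd a)"
  proof (rule local_mapI)
    fix \<phi> \<psi> :: "(nat \<times> nat) list \<Rightarrow> 'k" and w assume "w \<in> W (Suc N)" and *: "\<And>u. u \<in> W (Suc N) \<Longrightarrow> \<phi> u = \<psi> u"
    then show "rmultd a \<phi> w = rmultd a \<psi> w" using Cons_W[of w N]
      by (auto simp: rmultd_def W_iff intro!: mul_cong *)
  qed (simp add: rmultd_def mul_functional)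
  show "local_map (Suc N) (Suc N) posd"
    by (rule local_mapI) (auto simp: posd_def functional_scale)
  show "local_map (Suc N) (Suc N) cutd"
  proof (rule local_mapI)
    fix \<phi> \<psi> :: "(nat \<times> nat) list \<Rightarrow> 'k" and w assume "w \<in> W (Suc N)" and *: "\<And>u. u \<in> W (Suc N) \<Longrightarrow> \<phi> u = \<psi> u"
    then show "cutd \<phi> w = cutd \<psi> w" using Cons_W[of w N]
      by (auto simp: cutd_def W_iff intro!: *)
  qed (simp add: cutd_def functional_scale)
  show "local_map (Suc N) N sliced"
  proof (rule local_mapI)
    fix \<phi> \<psi> :: "(nat \<times> nat) list \<Rightarrow> 'k" and w assume "w \<in> W (Suc N)" and *: "\<And>u. u \<in> W N \<Longrightarrow> \<phi> u = \<psi> u"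
    then show "sliced \<phi> w = sliced \<psi> w" using Cons_W[of w N]
      by (auto simp: sliced_def W_iff intro!: *)
  qed (simp add: sliced_def functional_scale)
qed

lemma app_C: "a \<in> B \<Longrightarrow> app N a x \<in> C (Suc N)" and rmult_C: "rmult (Suc N) a x \<in> C (Suc N)"
  and pos_C: "pos (Suc N) x \<in> C (Suc N)" and cut_C: "cut (Suc N) x \<in> C (Suc N)" and slice_C: "slice (Suc N) x \<in> C N"
  unfolding app_def rmult_def pos_def cut_def slice_def
  by (rule tmap_vecs, erule app_local) (rule tmap_vecs locals)+

lemma tmap_hom: "module_hom smult_fun smult_fun (tmap m P)"
  by (rule module_hom_smult_funI) (auto simp: tmap_def linear_ext_def smult_fun_def fun_eq_iff algebra_simps sum.distrib sum_distrib_left)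

lemma tmap_plus: "tmap m P x + tmap m Q x = tmap m (\<lambda>\<phi> w. P \<phi> w + Q \<phi> w) x"
  by (rule ext) (simp add: tmap_def linear_ext_def algebra_simps sum.distrib)

lemma tmap_minus: "tmap m P x - tmap m Q x = tmap m (\<lambda>\<phi> w. P \<phi> w - Q \<phi> w) x"
  by (rule ext) (simp add: tmap_def linear_ext_def algebra_simps sum_subtractf)

lemma tmap_smult: "smult_fun c (tmap m P x) = tmap m (\<lambda>\<phi> w. c * P \<phi> w) x"
  by (rule ext) (simp add: tmap_def linear_ext_def smult_fun_def sum_distrib_left mult.left_commute)

text \<open>The last two faces of \<open>z \<otimes> e\<^sub>v\<close>: multiplication with \<open>e\<^sub>v\<close> keeps the last factors that start at \<open>e\<^sub>v\<close>, while
  \<open>\<alpha>\<^sub>v(e\<^sub>v) = 1\<close> returns \<open>z\<close>.  The term with last factor \<open>e\<^sub>v\<close> itself belongs to the last face of \<open>b z\<close>.\<close>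

lemma b_app_e:
  assumes "z \<in> C (Suc N)"
  shows "b (Suc (Suc N)) (app (Suc N) e z) = app N e (b (Suc N) z) + smult_fun ((-1) ^ Suc N) (pos (Suc N) z - z)"
proof -
  have "b (Suc (Suc N)) (app (Suc N) e z) = tmap (Suc N) (\<lambda>\<phi>. appd e (db (Suc (Suc N)) \<phi>)) z"
    unfolding app_def b_op_eq[OF zero_less_Suc] by (rule tmap_tmap[OF app_local[OF longest_B(2)]])
  also have "\<dots> = tmap (Suc N) (\<lambda>\<phi> w. db (Suc N) (appd e \<phi>) w + (-1) ^ Suc N * (posd \<phi> w - \<phi> w)) z"
  proof (rule tmap_cong)
    fix \<phi> :: "(nat \<times> nat) list \<Rightarrow> 'k" and w assume w: "w \<in> W (Suc N)"
    then obtain w' i l where w': "w = w' @ [(i, l)]" "i < n" "l < n" using Cons_W by blast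
    have mul: "mul (i, l) e (\<lambda>c. \<phi> (w' @ [c])) = taft_char v (i, l) * \<phi> (w' @ [e]) + posd \<phi> w"
      using v w'(2,3) by (auto simp: mul_path posd_def w'(1) cong del: mul_cong)
    have "appd e (db (Suc (Suc N)) \<phi>) w = dbp (Suc (Suc N)) \<phi> (w @ [e]) + (-1) ^ Suc (Suc N) * \<phi> w"
      by (simp add: appd_def db_Suc last_face_def)
    also have "\<dots> = dbp (Suc N) (appd e \<phi>) w + (-1) ^ Suc N * mul (i, l) e (\<lambda>c. \<phi> (w' @ [c])) + (-1) ^ Suc (Suc N) * \<phi> w"
      using w by (subst dbp_snoc) (auto simp: W_iff w' appd_def[abs_def] cong del: mul_cong)
    also have "\<dots> = db (Suc N) (appd e \<phi>) w + (-1) ^ Suc N * (posd \<phi> w - \<phi> w)"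
      unfolding mul by (simp add: db_Suc last_face_def w' appd_def[abs_def] algebra_simps)
    finally show "appd e (db (Suc (Suc N)) \<phi>) w = \<dots>" .
  qed
  also have "\<dots> = app N e (b (Suc N) z) + smult_fun ((-1) ^ Suc N) (pos (Suc N) z - tmap (Suc N) (\<lambda>\<phi>. \<phi>) z)"
    unfolding app_def b_op_eq[OF zero_less_Suc] pos_def tmap_tmap[OF db_local] tmap_minus tmap_smult tmap_plus ..
  finally show ?thesis using assms by (simp only: tmap_id)
qed

text \<open>A product with the longest path is zero unless the other factor is the end point of that path, and this end point is
  \<open>e\<^sub>v\<close> because \<open>v + 1 + (n - 1) = v\<close> modulo \<open>n\<close>.  So this product behaves like the character \<open>\<alpha>\<^sub>v\<close>.\<close>

lemma b'_app_longest: "b' (Suc (Suc N)) (app (Suc N) longest z) = app N longest (b (Suc N) z)"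
proof -
  have "b' (Suc (Suc N)) (app (Suc N) longest z) = tmap (Suc N) (\<lambda>\<phi>. appd longest (dbp (Suc (Suc N)) \<phi>)) z"
    unfolding app_def b'_op_eq[OF zero_less_Suc] by (rule tmap_tmap[OF app_local[OF longest_B(1)]])
  also have "\<dots> = tmap (Suc N) (\<lambda>\<phi>. db (Suc N) (appd longest \<phi>)) z"
  proof (rule tmap_cong)
    fix \<phi> :: "(nat \<times> nat) list \<Rightarrow> 'k" and w assume w: "w \<in> W (Suc N)"
    then obtain w' i l where w': "w = w' @ [(i, l)]" "i < n" "l < n" using Cons_W by blast
    have "ix (int v + 1 + int (n - 1)) = v"
    proof -
      have "ix (int v + 1 + int (n - 1)) = ix (int v)" using n by (simp add: ix_eq_iff of_nat_diff)
      then show ?thesis using v by simp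
    qed
    then have "mul (i, l) longest (\<lambda>c. \<phi> (w' @ [c])) = taft_char v (i, l) * \<phi> (w' @ [longest])"
      using n w'(2,3) by (auto simp: mul_path cong del: mul_cong)
    then show "appd longest (dbp (Suc (Suc N)) \<phi>) w = db (Suc N) (appd longest \<phi>) w"
      using w by (simp add: appd_def dbp_snoc W_iff) (simp add: w' db_Suc last_face_def appd_def[abs_def] algebra_simps cong del: mul_cong)
  qed
  also have "\<dots> = app N longest (b (Suc N) z)"
    unfolding app_def b_op_eq[OF zero_less_Suc] by (rule tmap_tmap[OF db_local, symmetric])
  finally show ?thesis .
qed

lemma b'_app_0: "z \<in> C 0 \<Longrightarrow> a \<in> B \<Longrightarrow> b' (Suc 0) (app 0 a z) = smult_fun (taft_char u a) z"
  and b_app_0: "z \<in> C 0 \<Longrightarrow> a \<in> B \<Longrightarrow> b (Suc 0) (app 0 a z) = smult_fun (taft_char u a - taft_char v a) z"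
proof -
  assume z: "z \<in> C 0" and a: "a \<in> B"
  have "b' (Suc 0) (app 0 a z) = tmap 0 (\<lambda>\<phi> w. taft_char u a * \<phi> w) z"
    unfolding app_def b'_op_eq[OF zero_less_Suc] tmap_tmap[OF app_local[OF a]]
    by (rule tmap_cong) (auto simp: W_iff appd_def dbp_1)
  then show "b' (Suc 0) (app 0 a z) = smult_fun (taft_char u a) z"
    using z by (simp add: tmap_smult[symmetric] tmap_id)
  have "b (Suc 0) (app 0 a z) = tmap 0 (\<lambda>\<phi> w. (taft_char u a - taft_char v a) * \<phi> w) z"
    unfolding app_def b_op_eq[OF zero_less_Suc] tmap_tmap[OF app_local[OF a]]
    by (rule tmap_cong) (auto simp: W_iff appd_def dbp_1 db_Suc last_face_def algebra_simps)
  then show "b (Suc 0) (app 0 a z) = smult_fun (taft_char u a - taft_char v a) z"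
    using z by (simp add: tmap_smult[symmetric] tmap_id)
qed

lemma b'_rmult:
  assumes "a \<in> B"
  shows "b' (Suc (Suc N)) (rmult (Suc (Suc N)) a y) = rmult (Suc N) a (b' (Suc (Suc N)) y)"
proof -
  have "b' (Suc (Suc N)) (rmult (Suc (Suc N)) a y) = tmap (Suc (Suc N)) (\<lambda>\<phi>. rmultd a (dbp (Suc (Suc N)) \<phi>)) y"
    unfolding rmult_def b'_op_eq[OF zero_less_Suc] by (rule tmap_tmap[OF rmult_local])
  also have "\<dots> = tmap (Suc (Suc N)) (\<lambda>\<phi>. dbp (Suc (Suc N)) (rmultd a \<phi>)) y"
  proof (rule tmap_cong)
    fix \<phi> :: "(nat \<times> nat) list \<Rightarrow> 'k" and w assume w: "w \<in> W (Suc (Suc N))"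
    then obtain w' i l where w': "w = w' @ [(i, l)]" "w' \<in> W (Suc N)" "i < n" "l < n" using Cons_W by blast
    then show "rmultd a (dbp (Suc (Suc N)) \<phi>) w = dbp (Suc (Suc N)) (rmultd a \<phi>) w"
      using dbp_mul_last[of w' "Suc N" "(i, l)" a \<phi>] assms
      by (simp add: rmultd_def[abs_def] W_iff cong del: mul_cong)
  qed
  also have "\<dots> = rmult (Suc N) a (b' (Suc (Suc N)) y)"
    unfolding rmult_def b'_op_eq[OF zero_less_Suc] by (rule tmap_tmap[OF dbp_local, symmetric])
  finally show ?thesis .
qed

lemma b_rmult_a1: "b (Suc N) (rmult (Suc N) a1 y) = b' (Suc N) (rmult (Suc N) a1 y)"
proof -
  have "tmap (Suc N) (\<lambda>\<phi>. rmultd a1 (db (Suc N) \<phi>)) y = tmap (Suc N) (\<lambda>\<phi>. rmultd a1 (dbp (Suc N) \<phi>)) y"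
  proof (rule tmap_cong)
    fix \<phi> :: "(nat \<times> nat) list \<Rightarrow> 'k" and w assume "w \<in> W (Suc N)"
    then obtain w' i l where w': "w = w' @ [(i, l)]" "i < n" "l < n" using Cons_W by blast
    then show "rmultd a1 (db (Suc N) \<phi>) w = rmultd a1 (dbp (Suc N) \<phi>) w"
      using v n by (simp add: rmultd_def mul_path db_Suc last_face_def cong del: mul_cong)
  qed
  then show ?thesis
    unfolding rmult_def b_op_eq[OF zero_less_Suc] b'_op_eq[OF zero_less_Suc] tmap_tmap[OF rmult_local] .
qed

text \<open>A path starting at the end point of \<open>a\<^sub>v\<close> either survives multiplication by \<open>a\<^sub>v\<close> or is the longest one.\<close>

lemma rmult_e'_split:
  "rmult (Suc N) e' z = cut (Suc N) (rmult (Suc N) a1 z) + app N longest (slice (Suc N) z)"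
  unfolding rmult_def cut_def app_def slice_def tmap_tmap[OF rmult_local] tmap_tmap[OF longest_local] tmap_plus
proof (rule tmap_cong)
  fix \<phi> :: "(nat \<times> nat) list \<Rightarrow> 'k" and w assume "w \<in> W (Suc N)"
  then obtain w' i l where w': "w = w' @ [(i, l)]" "i < n" "l < n" using Cons_W by blast
  then show "rmultd e' \<phi> w = rmultd a1 (cutd \<phi>) w + sliced (appd longest \<phi>) w"
    using v n by (auto simp: rmultd_def cutd_def sliced_def appd_def mul_path cong del: mul_cong)
qed

lemma rmult_cut: "rmult (Suc N) a1 (cut (Suc N) z) = pos (Suc N) z"
  and cut_pos: "cut (Suc N) (pos (Suc N) z) = cut (Suc N) z"
  and rmult_e'_cut: "rmult (Suc N) e' (cut (Suc N) z) = cut (Suc N) z"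
  unfolding rmult_def cut_def pos_def tmap_tmap[OF cut_local] tmap_tmap[OF pos_local]
proof -
  have *: "cutd (rmultd a1 \<phi>) w = posd \<phi> w \<and> posd (cutd \<phi>) w = cutd \<phi> w \<and> cutd (rmultd e' \<phi>) w = cutd \<phi> w" if W: "w \<in> W (Suc N)"
    for \<phi> :: "(nat \<times> nat) list \<Rightarrow> 'k" and w
  proof -
    obtain w' i l where w': "w = w' @ [(i, l)]" "i < n" "l < n" using Cons_W[OF W] by blast
    then show ?thesis using v n by (auto simp: rmultd_def cutd_def posd_def mul_path cong del: mul_cong)
  qed
  show "tmap (Suc N) (\<lambda>\<phi>. cutd (rmultd a1 \<phi>)) z = tmap (Suc N) posd z"
    "tmap (Suc N) (\<lambda>\<phi>. posd (cutd \<phi>)) z = tmap (Suc N) cutd z"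
    "tmap (Suc N) (\<lambda>\<phi>. cutd (rmultd e' \<phi>)) z = tmap (Suc N) cutd z"
    by (rule tmap_cong, use * in blast)+
qed

lemma rmult_app_longest: "rmult (Suc N) a1 (app N longest x) = 0"
  and rmult_e'_app_longest: "rmult (Suc N) e' (app N longest x) = app N longest x"
  unfolding rmult_def app_def tmap_tmap[OF app_local[OF longest_B(1)]]
  using v n by (auto intro!: tmap_zero tmap_cong simp: appd_def rmultd_def mul_path cong del: mul_cong)

lemma slice_app_longest: "x \<in> C N \<Longrightarrow> slice (Suc N) (app N longest x) = x"
proof -
  assume x: "x \<in> C N"
  have "slice (Suc N) (app N longest x) = tmap N (\<lambda>\<phi>. \<phi>) x"
    unfolding slice_def app_def tmap_tmap[OF app_local[OF longest_B(1)]]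
    by (rule tmap_cong) (simp add: appd_def sliced_def)
  then show ?thesis using x by (simp add: tmap_id)
qed

text \<open>A product has positive length and starts at \<open>e\<^sub>v\<close> if its right factor is such a path; if the right factor is
  \<open>e\<^sub>v\<close> itself, the contribution of the product is cancelled by the last face.\<close>

lemma pos_b: "pos (Suc N) (b (Suc (Suc N)) X) = b' (Suc (Suc N)) (pos (Suc (Suc N)) X)"
  unfolding pos_def b_op_eq[OF zero_less_Suc] b'_op_eq[OF zero_less_Suc] tmap_tmap[OF db_local] tmap_tmap[OF pos_local]
proof (rule tmap_cong)
  fix \<phi> :: "(nat \<times> nat) list \<Rightarrow> 'k" and w assume "w \<in> W (Suc (Suc N))"
  then obtain w1 i l where w1: "w = w1 @ [(i, l)]" "w1 \<in> W (Suc N)" "i < n" "l < n" using Cons_W by blast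
  obtain w' k m where w': "w1 = w' @ [(k, m)]" "k < n" "m < n" using Cons_W[OF w1(2)] by blast
  have l: "length w1 = Suc N" using w1 by (simp add: W_iff)
  let ?P = "of_bool (i = v \<and> l > 0) :: 'k"
  have "db (Suc (Suc N)) (posd \<phi>) w = dbp (Suc N) (\<lambda>u. posd \<phi> (u @ [(i, l)])) w1 +
      (-1) ^ Suc N * mul (k, m) (i, l) (\<lambda>z. posd \<phi> (w' @ [z])) + (-1) ^ Suc (Suc N) * (posd \<phi> w1 * taft_char v (i, l))"
    unfolding w1(1) db_Suc by (subst dbp_snoc[OF l]) (simp_all add: w' last_face_def butlast_append cong del: mul_cong)
  also have "(\<lambda>u. posd \<phi> (u @ [(i, l)])) = (\<lambda>u. \<phi> (u @ [(i, l)]) * ?P)"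
    by (rule ext) (simp add: posd_def mult.commute)
  also have "(-1) ^ Suc N * mul (k, m) (i, l) (\<lambda>z. posd \<phi> (w' @ [z])) + (-1) ^ Suc (Suc N) * (posd \<phi> w1 * taft_char v (i, l)) =
      ?P * ((-1) ^ Suc N * mul (k, m) (i, l) (\<lambda>z. \<phi> (w' @ [z])))"
    using w1 w' v by (cases l) (auto simp: mul_path posd_def cong del: mul_cong)
  then have "dbp (Suc N) (\<lambda>u. \<phi> (u @ [(i, l)]) * ?P) w1 + (-1) ^ Suc N * mul (k, m) (i, l) (\<lambda>z. posd \<phi> (w' @ [z])) +
      (-1) ^ Suc (Suc N) * (posd \<phi> w1 * taft_char v (i, l)) =
    ?P * (dbp (Suc N) (\<lambda>u. \<phi> (u @ [(i, l)])) w1 + (-1) ^ Suc N * mul (k, m) (i, l) (\<lambda>z. \<phi> (w' @ [z])))"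
    unfolding dbp_scale add.assoc by (simp only: distrib_left mult.commute)
  also have "\<dots> = posd (dbp (Suc (Suc N)) \<phi>) w"
    unfolding w1(1) posd_def dbp_snoc[OF l zero_less_Suc] by (simp add: w' cong del: mul_cong)
  finally show "db (Suc (Suc N)) (posd \<phi>) w = posd (dbp (Suc (Suc N)) \<phi>) w" .
qed


abbreviation HZ where "HZ \<equiv> bicomplex.cycles"
abbreviation HB where "HB \<equiv> bicomplex.bounds"

lemma homs: "module_hom smult_fun smult_fun (app N a)" "module_hom smult_fun smult_fun (rmult N a)"
    "module_hom smult_fun smult_fun (pos N)" "module_hom smult_fun smult_fun (cut N)" "module_hom smult_fun smult_fun (slice N)"
  unfolding app_def rmult_def pos_def cut_def slice_def by (rule tmap_hom)+

lemmas hom_rules = homs[THEN module_hom.add] homs[THEN module_hom.diff] homs[THEN module_hom.zero] homs[THEN module_hom.neg]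

lemma b_diff: "b m (x - y) = b m x - b m y" and b'_diff: "b' m (x - y) = b' m x - b' m y"
  and b_zero: "b m 0 = 0" and b'_zero: "b' m 0 = 0"
  and b'_neg: "b' m (- x) = - b' m x" and b_neg: "b m (- x) = - b m x"
  by (rule bicomplex.b_lin bicomplex.b'_lin)+

lemma boundsI: "x \<in> C (Suc N) \<Longrightarrow> b (Suc N) x \<in> HB N"
  by (simp add: bicomplex.bounds_def)

lemma bounds_diff: "x \<in> HB N \<Longrightarrow> y \<in> HB N \<Longrightarrow> x - y \<in> HB N"
  unfolding bicomplex.bounds_def by (auto simp only: b_diff[symmetric] intro!: imageI bicomplex.C_diff)

lemma bounds_scale: "x \<in> HB N \<Longrightarrow> smult_fun c x \<in> HB N"
  unfolding bicomplex.bounds_def by (auto simp only: bicomplex.b_lin[symmetric] intro!: imageI bicomplex.C_scale)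

lemma bounds_0: "0 \<in> HB N"
  using boundsI[OF bicomplex.C_0, of N] by (simp only: b_zero)

lemma cycles_diff: "x \<in> HZ N \<Longrightarrow> y \<in> HZ N \<Longrightarrow> x - y \<in> HZ N"
  by (auto simp: bicomplex.cycles_def b_diff intro: bicomplex.C_diff)

lemma cycles_scale: "x \<in> HZ N \<Longrightarrow> smult_fun c x \<in> HZ N"
  by (auto simp: bicomplex.cycles_def bicomplex.b_lin module.scale_zero_right[OF module_smult_fun] intro: bicomplex.C_scale)

text \<open>A cycle is homologous to its part \<open>z\<^sup>+\<close>, which is a right multiple of \<open>a\<^sub>v\<close>; on such multiples \<open>b = b'\<close>.\<close>

lemma cycle_pos:
  assumes "z \<in> HZ (Suc N)"
  shows "z - pos (Suc N) z \<in> HB (Suc N)" and "b' (Suc N) (pos (Suc N) z) = 0" and "b (Suc N) (pos (Suc N) z) = 0"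
proof -
  have z: "z \<in> C (Suc N)" "b (Suc N) z = 0" using assms by (auto simp: bicomplex.cycles_def)
  have eq: "b (Suc (Suc N)) (app (Suc N) e z) = smult_fun ((-1) ^ Suc N) (pos (Suc N) z - z)"
    unfolding b_app_e[OF z(1)] z(2) hom_rules by simp
  have "smult_fun ((-1) ^ N) (smult_fun ((-1) ^ Suc N) (pos (Suc N) z - z)) \<in> HB (Suc N)"
    unfolding eq[symmetric] by (intro bounds_scale boundsI app_C longest_B)
  moreover have "smult_fun ((-1) ^ N) (smult_fun ((-1) ^ Suc N) x) = - x" for x :: "(nat \<times> nat) list \<Rightarrow> 'k"
  proof -
    have "(-1) ^ N * (-1) ^ N = (1 :: 'k)" unfolding power_mult_distrib[symmetric] by simp
    then show ?thesis by (simp add: smult_fun_def fun_eq_iff mult.assoc[symmetric])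
  qed
  ultimately show HB: "z - pos (Suc N) z \<in> HB (Suc N)" by simp
  then have "b (Suc N) (z - pos (Suc N) z) = 0" unfolding bicomplex.bounds_def by (metis (no_types, lifting) b_b imageE)
  then show "b (Suc N) (pos (Suc N) z) = 0" using z unfolding b_diff by simp
  then show "b' (Suc N) (pos (Suc N) z) = 0" unfolding rmult_cut[symmetric] b_rmult_a1 .
qed

lemma bound_if_cut:
  assumes "z \<in> HZ (Suc N)" "Y \<in> C (Suc (Suc N))" "pos (Suc N) z = rmult (Suc N) a1 (b' (Suc (Suc N)) Y)"
  shows "z \<in> HB (Suc N)"
proof -
  have "pos (Suc N) z = b (Suc (Suc N)) (rmult (Suc (Suc N)) a1 Y)"
    unfolding assms(3) b_rmult_a1 b'_rmult[OF longest_B(4)] ..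
  then have "pos (Suc N) z \<in> HB (Suc N)" using boundsI[OF rmult_C] by simp
  then have "(z - pos (Suc N) z) - (0 - pos (Suc N) z) \<in> HB (Suc N)"
    by (intro bounds_diff cycle_pos(1)[OF assms(1)] bounds_0)
  then show ?thesis by simp
qed

text \<open>On cycles, this is the \<open>w\<close> with \<open>b' y = w \<otimes> longest\<close>, where \<open>y\<close> is \<open>z\<close> without its arrow \<open>a\<^sub>v\<close>.\<close>

definition period where "period M z = slice (Suc M) (b' (Suc (Suc M)) (cut (Suc (Suc M)) z))"

lemma period_hom: "module_hom smult_fun smult_fun (period M)"
  using module_hom_compose[OF module_hom_compose[OF homs(4) bicomplex.b'_hom] homs(5)]
  by (simp add: period_def[abs_def] o_def)

lemma period_C: "period M z \<in> C M"
  unfolding period_def by (rule slice_C)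

lemma app_longest_inj: "x \<in> C N \<Longrightarrow> app N longest x = 0 \<Longrightarrow> x = 0"
  using slice_app_longest[of x N] by (simp add: hom_rules)

text \<open>\<open>b' y\<close> has last factors starting at the end point of \<open>a\<^sub>v\<close> because \<open>y\<close> does, and is killed by \<open>a\<^sub>v\<close> because
  \<open>(b' y) a\<^sub>v = b' (z\<^sup>+) = 0\<close>.\<close>

lemma b'_cut_cycle:
  assumes "z \<in> HZ (Suc (Suc M))"
  shows "b' (Suc (Suc M)) (cut (Suc (Suc M)) z) = app M longest (period M z)"
proof -
  let ?y = "cut (Suc (Suc M)) z"
  have "b' (Suc (Suc M)) ?y = rmult (Suc M) e' (b' (Suc (Suc M)) ?y)"
    unfolding b'_rmult[OF longest_B(3), symmetric] rmult_e'_cut ..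
  also have "\<dots> = cut (Suc M) (rmult (Suc M) a1 (b' (Suc (Suc M)) ?y)) + app M longest (period M z)"
    unfolding rmult_e'_split period_def ..
  also have "rmult (Suc M) a1 (b' (Suc (Suc M)) ?y) = b' (Suc (Suc M)) (pos (Suc (Suc M)) z)"
    unfolding b'_rmult[OF longest_B(4), symmetric] rmult_cut ..
  finally show ?thesis unfolding cycle_pos(2)[OF assms] hom_rules by simp
qed

text \<open>\<open>0 = b' (b' y) = (b w) \<otimes> longest\<close>.\<close>

lemma period_cycle:
  assumes "z \<in> HZ (Suc (Suc M))" shows "period M z \<in> HZ M"
proof (cases M)
  case 0
  then show ?thesis using period_C[of M z] by (simp add: bicomplex.cycles_def)
next
  case (Suc K)
  have "0 = app K longest (b M (period M z))"
    unfolding Suc b'_app_longest[symmetric] unfolding Suc[symmetric] b'_cut_cycle[OF assms, symmetric]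
    by (simp only: Suc b'_b')
  then have "b M (period M z) = 0" using app_longest_inj[OF b_C, of K "period M z"] Suc by simp
  then show ?thesis using period_C[of M z] by (simp add: bicomplex.cycles_def)
qed

text \<open>If \<open>w = b x\<close>, then \<open>y - x \<otimes> longest\<close> is a \<open>b'\<close>-cycle, hence \<open>b' Y\<close> for some \<open>Y\<close>, and right multiplication by \<open>a\<^sub>v\<close>
  kills \<open>x \<otimes> longest\<close>, so \<open>z\<^sup>+ = b (Y a\<^sub>v)\<close>.\<close>

lemma period_reflects:
  assumes z: "z \<in> HZ (Suc (Suc M))" and "period M z \<in> HB M" shows "z \<in> HB (Suc (Suc M))"
proof -
  obtain x where x: "x \<in> C (Suc M)" "period M z = b (Suc M) x" using assms(2) by (auto simp: bicomplex.bounds_def)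
  let ?y = "cut (Suc (Suc M)) z" and ?a = "app (Suc M) longest x"
  have "b' (Suc (Suc M)) (?y - ?a) = 0"
    unfolding b'_diff b'_cut_cycle[OF z] b'_app_longest x(2) by simp
  then obtain Y where Y: "Y \<in> C (Suc (Suc (Suc M)))" "b' (Suc (Suc (Suc M))) Y = ?y - ?a"
    using b'_exact[of "?y - ?a" "Suc (Suc M)"] bicomplex.C_diff[OF cut_C app_C[OF longest_B(1)]] by auto
  show ?thesis
    by (rule bound_if_cut[OF z Y(1)]) (simp add: Y(2) hom_rules rmult_cut rmult_app_longest del: One_nat_def)
qed

text \<open>Given a cycle \<open>w\<close>, exactness of \<open>b'\<close> solves \<open>b' y = w \<otimes> longest\<close>, and \<open>y a\<^sub>v\<close> is a preimage of \<open>w\<close> modulo boundaries.\<close>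

lemma period_onto:
  assumes w: "w \<in> HZ M" shows "\<exists>z\<in>HZ (Suc (Suc M)). period M z - w \<in> HB M"
proof -
  have wC: "w \<in> C M" using w by (simp add: bicomplex.cycles_def)
  have "b' (Suc M) (app M longest w) = 0"
  proof (cases M)
    case 0
    then show ?thesis using b'_app_0[of w longest] wC n longest_B(1) by (simp add: smult_fun_def zero_fun_def)
  next
    case (Suc K)
    then have "b (Suc K) w = 0" using w by (simp add: bicomplex.cycles_def)
    then show ?thesis unfolding Suc b'_app_longest by (simp only: hom_rules)
  qed
  then obtain y where y: "y \<in> C (Suc (Suc M))" "b' (Suc (Suc M)) y = app M longest w"
    using b'_exact[of "app M longest w" "Suc M"] app_C[OF longest_B(1)] by auto
  let ?z = "rmult (Suc (Suc M)) a1 y"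
  have z: "?z \<in> HZ (Suc (Suc M))"
  proof -
    have "b (Suc (Suc M)) ?z = 0" unfolding b_rmult_a1 b'_rmult[OF longest_B(4)] y(2) rmult_app_longest ..
    then show ?thesis using rmult_C by (simp add: bicomplex.cycles_def)
  qed
  have cut: "cut (Suc (Suc M)) ?z = rmult (Suc (Suc M)) e' y - app (Suc M) longest (slice (Suc (Suc M)) y)"
    unfolding rmult_e'_split by simp
  have "period M ?z = w - b (Suc M) (slice (Suc (Suc M)) y)"
    unfolding period_def cut b'_diff b'_rmult[OF longest_B(3)] y(2) rmult_e'_app_longest b'_app_longest hom_rules
      slice_app_longest[OF wC] slice_app_longest[OF b_C] ..
  then have "period M ?z - w = 0 - b (Suc M) (slice (Suc (Suc M)) y)" by simp
  also have "\<dots> \<in> HB M" by (intro bounds_diff bounds_0 boundsI slice_C)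
  finally show ?thesis using z by blast
qed

lemma cut_b:
  "cut (Suc N) (b (Suc (Suc N)) X) = b' (Suc (Suc N)) (cut (Suc (Suc N)) X)
     - app N longest (slice (Suc N) (b' (Suc (Suc N)) (cut (Suc (Suc N)) X)))"
proof -
  let ?Y = "cut (Suc (Suc N)) X"
  have "cut (Suc N) (b (Suc (Suc N)) X) = cut (Suc N) (b' (Suc (Suc N)) (pos (Suc (Suc N)) X))"
    unfolding pos_b[symmetric] cut_pos ..
  also have "\<dots> = cut (Suc N) (rmult (Suc N) a1 (b' (Suc (Suc N)) ?Y))"
    unfolding rmult_cut[symmetric] b'_rmult[OF longest_B(4)] ..
  also have "\<dots> = rmult (Suc N) e' (b' (Suc (Suc N)) ?Y) - app N longest (slice (Suc N) (b' (Suc (Suc N)) ?Y))"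
    unfolding rmult_e'_split by simp
  also have "rmult (Suc N) e' (b' (Suc (Suc N)) ?Y) = b' (Suc (Suc N)) ?Y"
    unfolding b'_rmult[OF longest_B(3), symmetric] rmult_e'_cut ..
  finally show ?thesis .
qed

lemma period_bounds:
  assumes "x \<in> HB (Suc (Suc M))" shows "period M x \<in> HB M"
proof -
  obtain X where x: "x = b (Suc (Suc (Suc M))) X" using assms by (auto simp: bicomplex.bounds_def)
  let ?w = "slice (Suc (Suc M)) (b' (Suc (Suc (Suc M))) (cut (Suc (Suc (Suc M))) X))"
  have "period M x = 0 - b (Suc M) ?w"
    unfolding period_def x cut_b b'_diff b'_b' b'_app_longest hom_rules slice_app_longest[OF b_C] ..
  also have "\<dots> \<in> HB M" by (intro bounds_diff bounds_0 boundsI slice_C)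
  finally show ?thesis .
qed

theorem hochschild_periodic:
  assumes "free_homology smult_fun (HZ M) (HB M) r"
  shows "free_homology smult_fun (HZ (Suc (Suc M))) (HB (Suc (Suc M))) r"
  by (rule free_homology_transfer[OF assms period_hom]) (fact period_cycle period_bounds period_reflects period_onto cycles_diff cycles_scale
      bounds_diff bounds_scale bounds_0)+

lemma sum_lessThan_1: "(\<Sum>i<1. f i) = f 0" for f :: "nat \<Rightarrow> (nat \<times> nat) list \<Rightarrow> 'k"
  unfolding One_nat_def sum.lessThan_Suc by simp

lemma C_0_iff: "x \<in> C 0 \<longleftrightarrow> x = smult_fun (x []) (bvec [])"
proof
  assume "x \<in> C 0"
  then have "x w = 0" if "w \<noteq> []" for w using that by (auto simp: vecs_def W_iff)
  then show "x = smult_fun (x []) (bvec [])" by (auto simp: smult_fun_def bvec_def fun_eq_iff)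
next
  assume *: "x = smult_fun (x []) (bvec [])"
  show "x \<in> C 0" by (subst *) (auto simp: vecs_def W_iff smult_fun_def bvec_def)
qed

lemma nil_C: "bvec [] \<in> C 0"
  by (simp add: vecs_def W_iff bvec_def)

lemma nil_cycle: "bvec [] \<in> HZ 0"
  using nil_C by (simp add: bicomplex.cycles_def)

lemma b_1: assumes "u = v" shows "b (Suc 0) x = 0"
  unfolding b_op_eq[OF zero_less_Suc]
proof (rule tmap_zero)
  fix \<phi> :: "(nat \<times> nat) list \<Rightarrow> 'k" and w assume "w \<in> W (Suc 0)"
  then obtain a where "w = [a]" by (auto simp: W_iff length_Suc_conv)
  then have "db (Suc 0) \<phi> w = (taft_char u a - taft_char v a) * \<phi> []"
    by (simp add: db_Suc dbp_1 last_face_def algebra_simps)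
  then show "db (Suc 0) \<phi> w = 0" unfolding assms by simp
qed

lemma hochschild_0: "free_homology smult_fun (HZ 0) (HB 0) (of_bool (u = v))"
proof (cases "u = v")
  case True
  have "HB 0 = (\<lambda>_. 0) ` C (Suc 0)" unfolding bicomplex.bounds_def using b_1[OF True] by (intro image_cong) auto
  then have "HB 0 = {0}" using bicomplex.C_0 by auto
  have "homology_basis smult_fun (HZ 0) (HB 0) 1 (\<lambda>_. bvec [])"
    unfolding homology_basis_def sum_lessThan_1 \<open>HB 0 = {0}\<close>
  proof (intro conjI allI impI ballI)
    show "bvec [] \<in> HZ 0" by (rule nil_cycle)
  next
    fix x assume "x \<in> HZ 0"
    then have "x = smult_fun (x []) (bvec [])" unfolding bicomplex.cycles_def using C_0_iff by blast
    then have "x - smult_fun (x []) (bvec []) = 0" by (rule right_minus_eq[THEN iffD2])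
    then show "\<exists>c :: nat \<Rightarrow> 'k. x - smult_fun (c 0) (bvec []) \<in> {0}" by (intro exI[of _ "\<lambda>_. x []"]) blast
  next
    fix c :: "nat \<Rightarrow> 'k" and i :: nat assume "smult_fun (c 0) (bvec []) \<in> {0 :: (nat \<times> nat) list \<Rightarrow> 'k}" and i: "i < 1"
    then have "smult_fun (c 0) (bvec [] :: (nat \<times> nat) list \<Rightarrow> 'k) [] = 0" by simp
    then show "c i = 0" using i by (simp add: smult_fun_def bvec_def)
  qed
  then show ?thesis using True unfolding free_homology_def by auto
next
  case False
  have "HZ 0 \<subseteq> HB 0"
  proof
    fix x assume "x \<in> HZ 0"
    then have x: "x \<in> C 0" by (simp add: bicomplex.cycles_def)
    \<comment> \<open>\<open>b(e\<^sub>u) = \<alpha>\<^sub>u(e\<^sub>u) - \<alpha>\<^sub>v(e\<^sub>u) = 1\<close>\<close>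
    have "b (Suc 0) (app 0 (u, 0) x) = x"
      using b_app_0[OF x, of "(u, 0)"] False u n by (simp add: smult_fun_def)
    then show "x \<in> HB 0" using boundsI[OF app_C, of "(u, 0)" 0 x] u n by simp
  qed
  then show ?thesis using False by (simp add: free_homology_0)
qed

text \<open>In degree 1 removing the arrow leaves a combination of the vertex at the end of \<open>a\<^sub>v\<close> and longer paths, and \<open>\<theta>\<close> applies
  \<open>\<alpha>\<^sub>u\<close> to it.  This is the obstruction for a 1-cycle to be a boundary.\<close>

definition \<theta> where "\<theta> z = b' (Suc 0) (cut (Suc 0) z) []"

lemma theta_zero: "z \<in> HZ (Suc 0) \<Longrightarrow> \<theta> z = 0 \<Longrightarrow> z \<in> HB (Suc 0)"
proof -
  assume z: "z \<in> HZ (Suc 0)" and "\<theta> z = 0"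
  moreover have "b' (Suc 0) (cut (Suc 0) z) = smult_fun (\<theta> z) (bvec [])"
    unfolding \<theta>_def using C_0_iff b'_C by blast
  ultimately have "b' (Suc 0) (cut (Suc 0) z) = 0" by (simp add: smult_fun_def zero_fun_def)
  then obtain Y where "Y \<in> C (Suc (Suc 0))" "b' (Suc (Suc 0)) Y = cut (Suc 0) z"
    using b'_exact[OF cut_C] by blast
  then show ?thesis using bound_if_cut[OF z, of Y] by (simp add: rmult_cut del: One_nat_def)
qed

lemma theta_lin: "\<theta> (x - smult_fun c y) = \<theta> x - c * \<theta> y"
  unfolding \<theta>_def hom_rules b'_diff homs(4)[THEN module_hom.scale] bicomplex.b'_lin by (simp add: smult_fun_def)

lemma theta_bounds: "x \<in> HB (Suc 0) \<Longrightarrow> \<theta> x = 0"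
proof -
  assume "x \<in> HB (Suc 0)"
  then obtain X where x: "x = b (Suc (Suc 0)) X" by (auto simp: bicomplex.bounds_def)
  let ?w = "slice (Suc 0) (b' (Suc (Suc 0)) (cut (Suc (Suc 0)) X))"
  have "b' (Suc 0) (app 0 longest ?w) = 0"
    using b'_app_0[OF slice_C longest_B(1)] n by (simp add: smult_fun_def zero_fun_def)
  then show ?thesis unfolding \<theta>_def x cut_b b'_diff b'_b' by simp
qed

lemma theta_eq: "\<theta> z = tmap (Suc 0) (\<lambda>\<phi>. cutd (dbp (Suc 0) \<phi>)) z []"
  unfolding \<theta>_def cut_def b'_op_eq[OF zero_less_Suc] tmap_tmap[OF cut_local] ..

lemma hochschild_1: "free_homology smult_fun (HZ (Suc 0)) (HB (Suc 0)) (of_bool (u = ix (int v + 1)))"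
proof (cases "u = ix (int v + 1)")
  case True
  let ?\<omega> = "app 0 a1 (bvec [])"
  have "b (Suc 0) ?\<omega> = 0"
    using b_app_0[OF nil_C longest_B(4)] by (simp add: smult_fun_def zero_fun_def)
  then have \<omega>: "?\<omega> \<in> HZ (Suc 0)" using app_C[OF longest_B(4), of 0] by (simp add: bicomplex.cycles_def)
  have "\<theta> ?\<omega> = tmap 0 (\<lambda>\<phi>. appd a1 (cutd (dbp (Suc 0) \<phi>))) (bvec []) []"
    unfolding theta_eq app_def tmap_tmap[OF app_local[OF longest_B(4)]] ..
  also have "\<dots> = tmap 0 (\<lambda>\<phi>. \<phi>) (bvec []) []"
    by (rule fun_cong[OF tmap_cong]) (use True[symmetric] n v in \<open>auto simp: appd_def cutd_def W_iff dbp_1\<close>)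
  also have "\<dots> = 1" unfolding tmap_id[OF nil_C] by (simp add: bvec_def)
  finally have 1: "\<theta> ?\<omega> = 1" .
  have "homology_basis smult_fun (HZ (Suc 0)) (HB (Suc 0)) 1 (\<lambda>_. ?\<omega>)"
    unfolding homology_basis_def sum_lessThan_1
  proof (intro conjI allI impI ballI)
    fix x assume x: "x \<in> HZ (Suc 0)"
    have "x - smult_fun (\<theta> x) ?\<omega> \<in> HB (Suc 0)"
      by (intro theta_zero cycles_diff cycles_scale x \<omega>) (simp only: theta_lin 1, simp)
    then show "\<exists>c :: nat \<Rightarrow> 'k. x - smult_fun (c 0) ?\<omega> \<in> HB (Suc 0)"
      by (intro exI[of _ "\<lambda>_. \<theta> x"])
  next
    fix c :: "nat \<Rightarrow> 'k" and i :: nat assume c: "smult_fun (c 0) ?\<omega> \<in> HB (Suc 0)" and i: "i < 1"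
    have "\<theta> (0 - smult_fun (c 0) ?\<omega>) = 0"
      by (intro theta_bounds bounds_diff bounds_0 c)
    moreover have "\<theta> 0 = 0" by (rule theta_bounds[OF bounds_0])
    ultimately show "c i = 0" using i by (simp only: theta_lin 1) simp
  qed (rule \<omega>)
  then show ?thesis using True unfolding free_homology_def by auto
next
  case False
  have "\<theta> z = 0" for z
  proof -
    have "tmap (Suc 0) (\<lambda>\<phi>. cutd (dbp (Suc 0) \<phi>)) z = 0"
    proof (rule tmap_zero)
      fix \<phi> :: "(nat \<times> nat) list \<Rightarrow> 'k" and w assume "w \<in> W (Suc 0)"
      then obtain a where "w = [a]" by (auto simp: W_iff length_Suc_conv)
      then show "cutd (dbp (Suc 0) \<phi>) w = 0" using False n v by (auto simp: cutd_def dbp_1)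
    qed
    then show ?thesis unfolding theta_eq by simp
  qed
  then have "HZ (Suc 0) \<subseteq> HB (Suc 0)" using theta_zero by blast
  then show ?thesis using False by (simp add: free_homology_0)
qed

theorem hochschild:
  "free_homology smult_fun (HZ m) (HB m) (of_bool (if even m then u = v else u = ix (int v + 1)))"
proof (induction m rule: less_induct)
  case (less m)
  consider "m = 0" | "m = Suc 0" | M where "m = Suc (Suc M)" by (metis not0_implies_Suc)
  then show ?case
  proof cases
    case 3
    then show ?thesis using hochschild_periodic[OF less[of M]] by simp
  qed (use hochschild_0 hochschild_1 in simp_all)
qed


section \<open>Cyclic homology of the Taft algebra\<close>

theorem cyclic_homology_taft:
  "HC (taft n q) (taft_grouplike n q j) (taft_char u) (taft_char v) p \<cong>\<^sub>k
     free_module (if u = v \<and> even p \<or> u = ix (int v + 1) \<and> odd p then p div 2 + 1 else 0)"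
proof -
  have excl: "\<not> (u = v \<and> u = ix (int v + 1))"
  proof
    assume "u = v \<and> u = ix (int v + 1)"
    then have "ix (int v + 1) = ix (int v)" using v by simp
    then have "int n dvd 1" by (simp add: ix_eq_iff mod_eq_dvd_iff)
    then show False using n by simp
  qed
  define d \<rho> where "d = (of_bool (u \<noteq> v) :: nat)" and "\<rho> = (of_bool (u = v \<or> u = ix (int v + 1)) :: nat)"
  have "HZ m \<subseteq> HB m" if "m mod 2 \<noteq> d" for m
  proof -
    have eq: "of_bool (if even m then u = v else u = ix (int v + 1)) = (0 :: nat)"
      using that excl by (auto simp: d_def even_iff_mod_2_eq_zero)
    show ?thesis using hochschild[of m] unfolding eq free_homology_0 .
  qed
  moreover have "free_homology smult_fun (HZ m) (HB m) \<rho>" if "m mod 2 = d" for m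
  proof -
    have eq: "of_bool (if even m then u = v else u = ix (int v + 1)) = \<rho>"
      using that excl by (auto simp: d_def \<rho>_def even_iff_mod_2_eq_zero)
    show ?thesis using hochschild[of m] unfolding eq .
  qed
  ultimately have "HC (taft n q) (taft_grouplike n q j) (taft_char u) (taft_char v) p \<cong>\<^sub>k
      free_module (if p mod 2 = d then \<rho> * (p div 2 + 1) else 0)"
    by (rule HC_iso)
  moreover have "(if p mod 2 = d then \<rho> * (p div 2 + 1) else 0) =
      (if u = v \<and> even p \<or> u = ix (int v + 1) \<and> odd p then p div 2 + 1 else 0)"
    using excl by (cases "u = v"; cases "even p") (auto simp: d_def \<rho>_def even_iff_mod_2_eq_zero)
  ultimately show ?thesis by simp
qed

end

theorem proposition4p12:
  fixes n :: nat and q :: "'k::comm_ring_1"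
  assumes "n \<ge> 2"
    and "q ^ n = 1" and "\<And>m. 0 < m \<Longrightarrow> m < n \<Longrightarrow> q ^ m \<noteq> 1"
    and "is_hopf_algebra (taft n q)"
  defines "\<Lambda> \<equiv> taft n q"
    and "\<epsilon> \<equiv> Counit (taft n q)"
  shows
    "taft_char 0 = \<epsilon> \<and> taft_grouplike n q 0 = Unit \<Lambda> \<and>
     CM \<Lambda> (taft_grouplike n q (n - 1)) \<epsilon> \<epsilon> \<and>
     (\<forall>p. HC \<Lambda> (taft_grouplike n q (n - 1)) \<epsilon> \<epsilon> p
            \<cong>\<^sub>k free_module (if even p then p div 2 + 1 else 0)) \<and>
     (\<forall>u<n. CM \<Lambda> (Unit \<Lambda>) (taft_char u) (taft_char ((u + n - 1) mod n)) \<and>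
        (\<forall>p. HC \<Lambda> (Unit \<Lambda>) (taft_char u) (taft_char ((u + n - 1) mod n)) p
               \<cong>\<^sub>k free_module (if even p then 0 else (p + 1) div 2))) \<and>
     (\<forall>i<n. \<forall>u<n. \<forall>v<n.
        CM \<Lambda> (taft_grouplike n q i) (taft_char u) (taft_char v) \<longrightarrow>
        (i, u, v) \<noteq> (n - 1, 0, 0) \<longrightarrow>
        (i, v) \<noteq> (0, (u + n - 1) mod n) \<longrightarrow>
        (\<forall>p. HC \<Lambda> (taft_grouplike n q i) (taft_char u) (taft_char v) p
               \<cong>\<^sub>k free_module 0))"
proof -
  interpret taft_algebra n q using assms(1,2,4) by (rule taft_algebra.intro)
  have ix_0: "ix k = 0 \<longleftrightarrow> int n dvd k" for k
    using ix_eq_iff[of k 0] n by (simp add: ix_def dvd_eq_mod_eq_0)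
  have "qpow k = 1 \<longleftrightarrow> ix k = 0" for k
    using assms(3)[of "ix k"] by (auto simp: qpow_def)
  then have qpow_1: "qpow k = 1 \<longleftrightarrow> int n dvd k" for k by (simp add: ix_0)
  have CM: "CM \<Lambda> (taft_grouplike n q j) (taft_char u) (taft_char v) \<longleftrightarrow>
      int n dvd int j * int u \<and> int n dvd int j * int v \<and> int n dvd int v - int u + 1 + int j"
    if "u < n" "v < n" for j u v
    unfolding \<Lambda>_def CM_iff[OF that] qpow_1 ..
  have HC: "HC \<Lambda> (taft_grouplike n q j) (taft_char u) (taft_char v) p \<cong>\<^sub>k
     free_module (if u = v \<and> even p \<or> u = ix (int v + 1) \<and> odd p then p div 2 + 1 else 0)"
    if "CM \<Lambda> (taft_grouplike n q j) (taft_char u) (taft_char v)" "u < n" "v < n" for j u v p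
  proof -
    have c: "int n dvd int j * int u" "int n dvd int j * int v" "int n dvd int v - int u + 1 + int j"
      using that CM by auto
    have "int n dvd (int j + 1) - (int u - int v)" using c(3) by (simp add: algebra_simps)
    then have "ix (int u - int v) = ix (int j + 1)"
      unfolding ix_eq_iff mod_eq_dvd_iff using dvd_diff_commute by blast
    then interpret taft_triple n q j u v
      using that c by unfold_locales (simp_all add: qpow_1)
    show ?thesis unfolding \<Lambda>_def by (rule cyclic_homology_taft)
  qed
  have pred: "(u + n - 1) mod n = ix (int u - 1)" for u
  proof -
    have "(u + n - 1) mod n = ix (int (u + n - 1))" by (simp only: ix_of_nat)
    also have "\<dots> = ix (int u - 1)" using n by (simp add: ix_eq_iff of_nat_diff mod_eq_dvd_iff)
    finally show ?thesis .
  qed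
  have unit: "taft_grouplike n q 0 = Unit \<Lambda>"
    by (simp add: taft_grouplike_def \<Lambda>_def taft_def)
  have counit: "taft_char 0 = \<epsilon>"
    by (simp add: taft_char_def \<epsilon>_def taft_def)
  have 1: "CM \<Lambda> (taft_grouplike n q (n - 1)) \<epsilon> \<epsilon>"
    using CM[of 0 0 "n - 1"] n by (simp add: counit of_nat_diff)
  have ne: "ix 1 \<noteq> 0" using n by (simp add: ix_0)
  have 2: "HC \<Lambda> (taft_grouplike n q (n - 1)) \<epsilon> \<epsilon> p \<cong>\<^sub>k free_module (if even p then p div 2 + 1 else 0)" for p
    using HC[of "n - 1" 0 0 p] 1 n ne by (simp add: counit)
  have 3: "CM \<Lambda> (Unit \<Lambda>) (taft_char u) (taft_char ((u + n - 1) mod n))" if "u < n" for u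
  proof -
    have "ix (int (ix (int u - 1))) = ix (int u - 1)" by simp
    then have "int n dvd int (ix (int u - 1)) - (int u - 1)" unfolding ix_eq_iff mod_eq_dvd_iff .
    then have "int n dvd int (ix (int u - 1)) - int u + 1" by (simp only: diff_diff_eq2 diff_add_eq)
    then show ?thesis using CM[of u "ix (int u - 1)" 0] that unfolding pred by (simp add: unit)
  qed
  have 4: "HC \<Lambda> (Unit \<Lambda>) (taft_char u) (taft_char ((u + n - 1) mod n)) p
      \<cong>\<^sub>k free_module (if even p then 0 else (p + 1) div 2)" if "u < n" for u p
  proof -
    have "u \<noteq> ix (int u - 1)"
    proof
      assume "u = ix (int u - 1)"
      then have "ix (int u) = ix (int u - 1)" using that by simp
      then show False using n by (simp add: ix_eq_iff mod_eq_dvd_iff)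
    qed
    moreover have "u = ix (int (ix (int u - 1)) + 1)" using that by simp
    moreover have "odd p \<Longrightarrow> p div 2 + 1 = (p + 1) div 2" by presburger
    moreover have "HC \<Lambda> (Unit \<Lambda>) (taft_char u) (taft_char (ix (int u - 1))) p \<cong>\<^sub>k
     free_module (if u = ix (int u - 1) \<and> even p \<or> u = ix (int (ix (int u - 1)) + 1) \<and> odd p then p div 2 + 1 else 0)"
      using HC[of 0 u "ix (int u - 1)" p] 3[OF that] that unfolding unit pred by simp
    ultimately show ?thesis unfolding pred by (cases "even p") simp_all
  qed
  have 5: "HC \<Lambda> (taft_grouplike n q i) (taft_char u) (taft_char v) p \<cong>\<^sub>k free_module 0"
    if lt: "i < n" "u < n" "v < n" and cm: "CM \<Lambda> (taft_grouplike n q i) (taft_char u) (taft_char v)"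
      and ne1: "(i, u, v) \<noteq> (n - 1, 0, 0)" and ne2: "(i, v) \<noteq> (0, (u + n - 1) mod n)" for i u v p
  proof -
    have c: "int n dvd int i * int u" "int n dvd int v - int u + 1 + int i"
      using cm CM[OF lt(2,3)] by auto
    have "u \<noteq> v"
    proof
      assume uv: "u = v"
      have "int n dvd int (Suc i)" using c(2) uv by (simp add: add.commute)
      then have "n dvd Suc i" by (simp only: int_dvd_int_iff)
      then have i: "i = n - 1" using lt(1) dvd_imp_le[of n "Suc i"] by simp
      have "int n dvd int (Suc i) * int u - int i * int u"
        by (rule dvd_diff[OF dvd_mult2[OF \<open>int n dvd int (Suc i)\<close>] c(1)])
      then have "n dvd u" by (simp add: algebra_simps)
      then have "u = 0" using lt(2) by (auto dest: dvd_imp_le)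
      then show False using ne1 i uv by simp
    qed
    moreover have "u \<noteq> ix (int v + 1)"
    proof
      assume uv: "u = ix (int v + 1)"
      have "ix (int u) = ix (int v + 1)" using uv by simp
      then have d: "int n dvd int u - (int v + 1)" unfolding ix_eq_iff mod_eq_dvd_iff .
      have "int n dvd (int v - int u + 1 + int i) + (int u - (int v + 1))" using c(2) d by (rule dvd_add)
      then have "n dvd i" by simp
      then have "i = 0" using lt(1) by (auto dest: dvd_imp_le)
      moreover have "v = ix (int u - 1)" using lt(3) unfolding uv by simp
      ultimately show False using ne2 unfolding pred by simp
    qed
    ultimately show ?thesis using HC[OF cm lt(2,3), of p] by simp
  qed
  show ?thesis
    by (intro conjI allI impI counit unit 1 2) (erule 3, erule 4, erule (5) 5)
qed


end
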